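(* Let $\mathcal H=(T^*Q,S^*,X_H,\Delta)$ be an unconstrained Hamiltonian impact system with $\dim Q=n$, and let $\omega$ be the standard symplectic form on $T^*Q$. Then the volume form $\omega^n$ is hybrid-invariant, i.e. $\omega^n\in\mathscr A_{\mathcal H}$.
   Context: $Q$ is a smooth $n$-dimensional manifold with Riemannian metric $g$, $L(q,\dot q)=\frac12g_q(\dot q,\dot q)-V(q)$ a natural Lagrangian, $\mathbb FL(v)=g(v,\cdot)$, and $H:T^*Q\to\mathbb R$ the Legendre transform of $L$: $H(q,p)=p(\dot q)-L(q,\dot q)$, $p=\mathbb FL(\dot q)$. $\omega=dq^i\wedge dp_i$ and $X_H$ is defined by $i_{X_H}\omega=dH$. $S\subset Q$ is an embedded codimension 1 submanifold, (locally) the zero level set of a smooth $h:Q\to\mathbb R$ with $dh\neq0$ on $S$. With $P(\nabla h)(q,p)=\langle p,\nabla h(q)\rangle$ ($\nabla h$ the $g$-gradient), $S^*=\{(q,p)\in T^*Q:h(q)=0,\ P(\nabla h)(q,p)<0\}$. The impact map $\Delta:S^*\to T^*Q$ is the identity on the base and acts on momenta as the nontrivial solution of the corner conditions $p^+=p^-+\varepsilon\,dh$, $H^+=H^-$; explicitly $p^+=p^--2\frac{P(\nabla h)}{g(\nabla h,\nabla h)}dh$. Such a 4-tuple is an unconstrained Hamiltonian impact system. Hybrid flow of $(M,S',X,\Delta)$: it follows the flow of $X$ away from $S'$, and whenever a trajectory reaches $S'$ at time $t$ the state is reinitialized by $\lim_{s\to t^+}\varphi^{\mathcal H}(s,x)=\Delta(\lim_{s\to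 t^-}\varphi^{\mathcal H}(s,x))$. A differential form $\alpha$ on $M$ is hybrid-invariant if $(\varphi_t^{\mathcal H})^*\alpha=\alpha$ for all times $t$ and at all points $x\notin S'$ with $\varphi_t^{\mathcal H}(x)\notin S'$ where $\varphi_t^{\mathcal H}$ is defined and smooth near $x$; $\mathscr A_{\mathcal H}$ is the set of hybrid-invariant forms. *)

theory Defs
  imports "HOL-Analysis.Analysis" "HOL-Combinatorics.Permutations"
begin

section \<open>Smooth functions on open subsets of Euclidean spaces\<close>

text \<open>Both notions are meant for open \<open>S\<close> only.\<close>

primrec Ck_on :: "nat \<Rightarrow> 'd set \<Rightarrow> ('d::euclidean_space \<Rightarrow> 'e::real_normed_vector) \<Rightarrow> bool" where
  "Ck_on 0 S f \<longleftrightarrow> continuous_on S f"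
| "Ck_on (Suc k) S f \<longleftrightarrow>
     (\<forall>x\<in>S. f differentiable (at x)) \<and>
     (\<forall>u. Ck_on k S (\<lambda>x. frechet_derivative f (at x) u))"

definition smooth_on :: "'d set \<Rightarrow> ('d::euclidean_space \<Rightarrow> 'e::real_normed_vector) \<Rightarrow> bool" where
  "smooth_on S f \<longleftrightarrow> (\<forall>k. Ck_on k S f)"

section \<open>Smooth manifolds\<close>

text \<open>
  A manifold is given by an atlas, which determines the underlying set (the union of the chart
  domains) and the topology. A chart is a pair of its domain and its coordinate function; values
  of the coordinate function outside the domain are never used.
\<close>

type_synonym ('a, 'e) chart = "'a set \<times> ('a \<Rightarrow> 'e)"
type_synonym ('a, 'e) atlas = "('a, 'e) chart set"

definition points :: "('a, 'e) atlas \<Rightarrow> 'a set" where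
  "points A = (\<Union>c\<in>A. fst c)"

definition chart_inv :: "('a, 'e) chart \<Rightarrow> 'e \<Rightarrow> 'a" where
  "chart_inv c = inv_into (fst c) (snd c)"

definition transition :: "('a, 'e) chart \<Rightarrow> ('a, 'e) chart \<Rightarrow> 'e \<Rightarrow> 'e" where
  "transition c c' = snd c' \<circ> chart_inv c"

definition chart_at :: "('a, 'e) atlas \<Rightarrow> 'a \<Rightarrow> ('a, 'e) chart" where
  "chart_at A x = (SOME c. c \<in> A \<and> x \<in> fst c)"

definition smooth_atlas :: "('a, 'e::euclidean_space) atlas \<Rightarrow> bool" where
  "smooth_atlas A \<longleftrightarrow>
     (\<forall>c\<in>A. inj_on (snd c) (fst c)) \<and>
     (\<forall>c\<in>A. \<forall>c'\<in>A. open (snd c ` (fst c \<inter> fst c')) \<and>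
                  smooth_on (snd c ` (fst c \<inter> fst c')) (transition c c'))"

definition atlas_topology :: "('a, 'e::euclidean_space) atlas \<Rightarrow> 'a topology" where
  "atlas_topology A =
     topology (\<lambda>W. W \<subseteq> points A \<and> (\<forall>c\<in>A. open (snd c ` (fst c \<inter> W))))"

lemma openin_atlas_topology:
  assumes "smooth_atlas A"
  shows "openin (atlas_topology A) W \<longleftrightarrow>
           W \<subseteq> points A \<and> (\<forall>c\<in>A. open (snd c ` (fst c \<inter> W)))"
proof -
  have inj: "inj_on (snd c) (fst c)" if "c \<in> A" for c
    using assms that by (auto simp: smooth_atlas_def)
  have "istopology (\<lambda>W. W \<subseteq> points A \<and> (\<forall>c\<in>A. open (snd c ` (fst c \<inter> W))))"
    unfolding istopology_def
  proof (intro conjI allI impI ballI)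
    fix U V c
    assume U: "U \<subseteq> points A \<and> (\<forall>c\<in>A. open (snd c ` (fst c \<inter> U)))"
      and V: "V \<subseteq> points A \<and> (\<forall>c\<in>A. open (snd c ` (fst c \<inter> V)))"
    show "U \<inter> V \<subseteq> points A"
      using U by blast
    assume c: "c \<in> A"
    have "snd c ` (fst c \<inter> (U \<inter> V)) = snd c ` (fst c \<inter> U) \<inter> snd c ` (fst c \<inter> V)"
      using inj[OF c] by (fastforce simp: inj_on_def)
    then show "open (snd c ` (fst c \<inter> (U \<inter> V)))"
      using U V c by auto
  next
    fix K c
    assume K: "\<forall>W\<in>K. W \<subseteq> points A \<and> (\<forall>c\<in>A. open (snd c ` (fst c \<inter> W)))"
    show "\<Union> K \<subseteq> points A"
      using K by blast
    assume c: "c \<in> A"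
    have "snd c ` (fst c \<inter> \<Union> K) = (\<Union>W\<in>K. snd c ` (fst c \<inter> W))"
      by blast
    then show "open (snd c ` (fst c \<inter> \<Union> K))"
      using K c by auto
  qed
  then show ?thesis
    by (simp add: atlas_topology_def topology_inverse')
qed

definition smooth_manifold :: "('a, 'e::euclidean_space) atlas \<Rightarrow> bool" where
  "smooth_manifold A \<longleftrightarrow>
     smooth_atlas A \<and> Hausdorff_space (atlas_topology A) \<and> second_countable (atlas_topology A)"

definition smooth_fun ::
  "('a, 'e::euclidean_space) atlas \<Rightarrow> ('a \<Rightarrow> real) \<Rightarrow> bool" where
  "smooth_fun A f \<longleftrightarrow> (\<forall>c\<in>A. smooth_on (snd c ` fst c) (f \<circ> chart_inv c))"

definition smooth_map_on ::
  "('a, 'd::euclidean_space) atlas \<Rightarrow> ('b, 'e::euclidean_space) atlas \<Rightarrow> 'a set \<Rightarrow> ('a \<Rightarrow> 'b) \<Rightarrow> bool"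
where
  "smooth_map_on A B W F \<longleftrightarrow>
     (\<forall>x\<in>W. \<exists>c\<in>A. \<exists>c'\<in>B. \<exists>U. openin (atlas_topology A) U \<and> x \<in> U \<and> U \<subseteq> W \<inter> fst c \<and>
        F ` U \<subseteq> fst c' \<and> smooth_on (snd c ` U) (snd c' \<circ> F \<circ> chart_inv c))"

section \<open>Tangent and cotangent vectors\<close>

text \<open>
  A tangent vector at \<open>x\<close> is represented by its components in all charts around \<open>x\<close>, which
  transform with the Jacobians of the transition maps; this is a choice-free form of the
  equivalence classes of pairs (chart, component vector). A cotangent vector is a linear
  functional on the tangent space. Both are extended by zero to be determined by their
  meaningful values.
\<close>

type_synonym ('a, 'e) tvec = "('a, 'e) chart \<Rightarrow> 'e"

definition tangent_space :: "('a, 'e::euclidean_space) atlas \<Rightarrow> 'a \<Rightarrow> ('a, 'e) tvec set" where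
  "tangent_space A x =
     {v. (\<forall>c\<in>A. \<forall>c'\<in>A. x \<in> fst c \<and> x \<in> fst c' \<longrightarrow>
            v c' = frechet_derivative (transition c c') (at (snd c x)) (v c)) \<and>
         (\<forall>c. \<not> (c \<in> A \<and> x \<in> fst c) \<longrightarrow> v c = 0)}"

definition lincomb ::
  "real \<Rightarrow> ('a, 'e::real_vector) tvec \<Rightarrow> real \<Rightarrow> ('a, 'e) tvec \<Rightarrow> ('a, 'e) tvec" where
  "lincomb a v b w = (\<lambda>c. a *\<^sub>R v c + b *\<^sub>R w c)"

definition coord_vec ::
  "('a, 'e::euclidean_space) atlas \<Rightarrow> ('a, 'e) chart \<Rightarrow> 'a \<Rightarrow> 'e \<Rightarrow> ('a, 'e) tvec" where
  \<comment> \<open>the tangent vector at \<open>x\<close> with components \<open>u\<close> in the chart \<open>c\<close>\<close>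
  "coord_vec A c x u =
     (\<lambda>c'. if c' \<in> A \<and> x \<in> fst c'
           then frechet_derivative (transition c c') (at (snd c x)) u else 0)"

definition cotangent_space ::
  "('a, 'e::euclidean_space) atlas \<Rightarrow> 'a \<Rightarrow> (('a, 'e) tvec \<Rightarrow> real) set" where
  "cotangent_space A x =
     {p. (\<forall>v\<in>tangent_space A x. \<forall>w\<in>tangent_space A x. \<forall>a b.
            p (lincomb a v b w) = a * p v + b * p w) \<and>
         (\<forall>v. v \<notin> tangent_space A x \<longrightarrow> p v = 0)}"

definition differential ::
  "('a, 'e::euclidean_space) atlas \<Rightarrow> ('a \<Rightarrow> real) \<Rightarrow> 'a \<Rightarrow> ('a, 'e) tvec \<Rightarrow> real" where
  "differential A f x =
     (let c = chart_at A x
      in (\<lambda>v. if v \<in> tangent_space A x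
             then frechet_derivative (f \<circ> chart_inv c) (at (snd c x)) (v c) else 0))"

definition tangent_map ::
  "('a, 'd::euclidean_space) atlas \<Rightarrow> ('b, 'e::euclidean_space) atlas \<Rightarrow> ('a \<Rightarrow> 'b) \<Rightarrow>
   'a \<Rightarrow> ('a, 'd) tvec \<Rightarrow> ('b, 'e) tvec" where
  "tangent_map A B F x v =
     (let c = chart_at A x
      in (\<lambda>c'. if c' \<in> B \<and> F x \<in> fst c'
              then frechet_derivative (snd c' \<circ> F \<circ> chart_inv c) (at (snd c x)) (v c) else 0))"

section \<open>Differential forms\<close>

text \<open>
  A \<open>k\<close>-form at a point is a function of a sequence of tangent vectors that only depends on
  the first \<open>k\<close> of them.
\<close>

type_synonym ('a, 'e) dform = "'a \<Rightarrow> (nat \<Rightarrow> ('a, 'e) tvec) \<Rightarrow> real"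

definition differential_form ::
  "('a, 'e::euclidean_space) atlas \<Rightarrow> nat \<Rightarrow> ('a, 'e) dform \<Rightarrow> bool" where
  "differential_form A k \<alpha> \<longleftrightarrow>
     (\<forall>x\<in>points A.
        (\<forall>v v'. (\<forall>i<k. v i = v' i) \<longrightarrow> \<alpha> x v = \<alpha> x v') \<and>
        (\<forall>v. (\<forall>i. v i \<in> tangent_space A x) \<longrightarrow>
           (\<forall>i<k. \<forall>u\<in>tangent_space A x. \<forall>w\<in>tangent_space A x. \<forall>a b.
              \<alpha> x (v(i := lincomb a u b w)) = a * \<alpha> x (v(i := u)) + b * \<alpha> x (v(i := w))) \<and>
           (\<forall>i<k. \<forall>j<k. i \<noteq> j \<and> v i = v j \<longrightarrow> \<alpha> x v = 0))) \<and>
     (\<forall>c\<in>A. \<forall>u. smooth_on (snd c ` fst c)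
        (\<lambda>y. \<alpha> (chart_inv c y) (\<lambda>i. coord_vec A c (chart_inv c y) (u i))))"

definition pullback ::
  "('a, 'd::euclidean_space) atlas \<Rightarrow> ('b, 'e::euclidean_space) atlas \<Rightarrow> ('a \<Rightarrow> 'b) \<Rightarrow>
   ('b, 'e) dform \<Rightarrow> ('a, 'd) dform" where
  "pullback A B F \<alpha> x v = \<alpha> (F x) (\<lambda>i. tangent_map A B F x (v i))"

text \<open>The normalisation of the wedge product is the one with \<open>(\<alpha> \<and> \<beta>)(v, w) = \<alpha>(v) \<beta>(w) - \<alpha>(w) \<beta>(v)\<close> for
  one-forms.\<close>

definition wedge ::
  "nat \<Rightarrow> nat \<Rightarrow> ((nat \<Rightarrow> 'v) \<Rightarrow> real) \<Rightarrow> ((nat \<Rightarrow> 'v) \<Rightarrow> real) \<Rightarrow> (nat \<Rightarrow> 'v) \<Rightarrow> real" where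
  "wedge k l \<alpha> \<beta> v =
     (\<Sum>\<sigma> | \<sigma> permutes {..<k + l}.
        of_int (sign \<sigma>) * \<alpha> (\<lambda>i. v (\<sigma> i)) * \<beta> (\<lambda>i. v (\<sigma> (k + i)))) / (fact k * fact l)"

primrec wedge_power ::
  "nat \<Rightarrow> ((nat \<Rightarrow> 'v) \<Rightarrow> real) \<Rightarrow> nat \<Rightarrow> (nat \<Rightarrow> 'v) \<Rightarrow> real" where
  "wedge_power k \<alpha> 0 = (\<lambda>v. 1)"
| "wedge_power k \<alpha> (Suc m) = wedge k (k * m) \<alpha> (wedge_power k \<alpha> m)"

section \<open>The cotangent bundle\<close>

type_synonym ('q, 'e) covec = "('q, 'e) tvec \<Rightarrow> real"
type_synonym ('q, 'e) phase = "'q \<times> ('q, 'e) covec"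

definition cotangent_chart ::
  "('q, real^'n) atlas \<Rightarrow> ('q, real^'n) chart \<Rightarrow>
   (('q, real^'n) phase, (real^'n) \<times> (real^'n)) chart" where
  \<comment> \<open>the canonical coordinates \<open>(q\<^sup>i, p\<^sub>i)\<close>, where \<open>p\<^sub>i\<close> is the value of \<open>p\<close> on the \<open>i\<close>-th coordinate vector\<close>
  "cotangent_chart A c =
     ({(q, p). q \<in> fst c \<and> p \<in> cotangent_space A q},
      \<lambda>(q, p). (snd c q, \<chi> i. p (coord_vec A c q (axis i 1))))"

definition cotangent_atlas ::
  "('q, real^'n) atlas \<Rightarrow> (('q, real^'n) phase, (real^'n) \<times> (real^'n)) atlas" where
  "cotangent_atlas A = cotangent_chart A ` A"

definition symplectic_form ::
  "('q, real^'n) atlas \<Rightarrow> (('q, real^'n) phase, (real^'n) \<times> (real^'n)) dform" where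
  \<comment> \<open>\<open>\<Sum>\<^sub>i dq\<^sup>i \<and> dp\<^sub>i\<close>, in any canonical chart around the point\<close>
  "symplectic_form A x =
     (let C = chart_at (cotangent_atlas A) x
      in (\<lambda>v. \<Sum>i\<in>UNIV. wedge 1 1 (\<lambda>u. fst (u 0 C) $ i) (\<lambda>u. snd (u 0 C) $ i) v))"

definition hamiltonian_vector_field ::
  "('q, real^'n) atlas \<Rightarrow> (('q, real^'n) phase \<Rightarrow> real) \<Rightarrow>
   ('q, real^'n) phase \<Rightarrow> (('q, real^'n) phase, (real^'n) \<times> (real^'n)) tvec" where
  "hamiltonian_vector_field A H x =
     (THE u. u \<in> tangent_space (cotangent_atlas A) x \<and>
        (\<forall>v\<in>tangent_space (cotangent_atlas A) x.
           symplectic_form A x (case_nat u (\<lambda>_. v)) = differential (cotangent_atlas A) H x v))"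

section \<open>Natural mechanical systems\<close>

type_synonym ('q, 'e) metric = "'q \<Rightarrow> ('q, 'e) tvec \<Rightarrow> ('q, 'e) tvec \<Rightarrow> real"

definition riemannian_metric ::
  "('q, 'e::euclidean_space) atlas \<Rightarrow> ('q, 'e) metric \<Rightarrow> bool" where
  "riemannian_metric A g \<longleftrightarrow>
     (\<forall>q\<in>points A. \<forall>u\<in>tangent_space A q. \<forall>v\<in>tangent_space A q.
        g q u v = g q v u \<and>
        (\<forall>w\<in>tangent_space A q. \<forall>a b. g q (lincomb a u b v) w = a * g q u w + b * g q v w) \<and>
        (u \<noteq> (\<lambda>_. 0) \<longrightarrow> g q u u > 0)) \<and>
     (\<forall>c\<in>A. \<forall>u w. smooth_on (snd c ` fst c)
        (\<lambda>y. g (chart_inv c y) (coord_vec A c (chart_inv c y) u) (coord_vec A c (chart_inv c y) w)))"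

definition natural_lagrangian ::
  "('q, 'e) metric \<Rightarrow> ('q \<Rightarrow> real) \<Rightarrow> 'q \<Rightarrow> ('q, 'e) tvec \<Rightarrow> real" where
  "natural_lagrangian g V q v = g q v v / 2 - V q"

definition fiber_derivative ::
  "('q, 'e::euclidean_space) atlas \<Rightarrow> ('q, 'e) metric \<Rightarrow> 'q \<Rightarrow> ('q, 'e) tvec \<Rightarrow> ('q, 'e) covec" where
  "fiber_derivative A g q v = (\<lambda>w. if w \<in> tangent_space A q then g q v w else 0)"

definition hamiltonian ::
  "('q, 'e::euclidean_space) atlas \<Rightarrow> ('q, 'e) metric \<Rightarrow> ('q \<Rightarrow> real) \<Rightarrow> ('q, 'e) phase \<Rightarrow> real" where
  "hamiltonian A g V = (\<lambda>(q, p).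
     let v = (THE v. v \<in> tangent_space A q \<and> fiber_derivative A g q v = p)
     in p v - natural_lagrangian g V q v)"

definition gradient ::
  "('q, 'e::euclidean_space) atlas \<Rightarrow> ('q, 'e) metric \<Rightarrow> ('q \<Rightarrow> real) \<Rightarrow> 'q \<Rightarrow> ('q, 'e) tvec" where
  "gradient A g f q =
     (THE u. u \<in> tangent_space A q \<and> (\<forall>w\<in>tangent_space A q. g q u w = differential A f q w))"

section \<open>Hybrid systems and their flows\<close>

record ('a, 'e) hybrid_system =
  state_atlas :: "('a, 'e) atlas"
  guard :: "'a set"
  vfield :: "'a \<Rightarrow> ('a, 'e) tvec"
  reset :: "'a \<Rightarrow> 'a"

text \<open>
  Trajectories are left-continuous: at an impact time the value is the pre-impact state, and the
  limit from the right is its image under the reset. Only finitely many impacts may occur in a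
  compact time interval, so the hybrid flow is not continued past a Zeno time. Away from the
  guard the limit conditions ensure that the curve stays in the chart domain near \<open>s\<close>, so that
  the derivative in the chart is meaningful.
\<close>

definition hybrid_trajectory ::
  "('a, 'e::euclidean_space) hybrid_system \<Rightarrow> real \<Rightarrow> (real \<Rightarrow> 'a) \<Rightarrow> bool" where
  "hybrid_trajectory \<H> t \<gamma> \<longleftrightarrow>
     0 \<le> t \<and>
     (\<forall>s\<in>{0..t}. \<gamma> s \<in> points (state_atlas \<H>)) \<and>
     finite {s\<in>{0..t}. \<gamma> s \<in> guard \<H>} \<and>
     (\<forall>s\<in>{0<..t}. limitin (atlas_topology (state_atlas \<H>)) \<gamma> (\<gamma> s) (at_left s)) \<and>
     (\<forall>s\<in>{0..<t}. limitin (atlas_topology (state_atlas \<H>)) \<gamma>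
        (if \<gamma> s \<in> guard \<H> then reset \<H> (\<gamma> s) else \<gamma> s) (at_right s)) \<and>
     (\<forall>s\<in>{0..t}. \<gamma> s \<notin> guard \<H> \<longrightarrow>
        (\<forall>c\<in>state_atlas \<H>. \<gamma> s \<in> fst c \<longrightarrow>
           (snd c \<circ> \<gamma> has_vector_derivative vfield \<H> (\<gamma> s) c) (at s within {0..t})))"

definition flow_defined ::
  "('a, 'e::euclidean_space) hybrid_system \<Rightarrow> real \<Rightarrow> 'a \<Rightarrow> bool" where
  "flow_defined \<H> t x \<longleftrightarrow> (\<exists>\<gamma>. hybrid_trajectory \<H> t \<gamma> \<and> \<gamma> 0 = x)"

definition hybrid_flow ::
  "('a, 'e::euclidean_space) hybrid_system \<Rightarrow> real \<Rightarrow> 'a \<Rightarrow> 'a" where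
  "hybrid_flow \<H> t x = (THE y. \<exists>\<gamma>. hybrid_trajectory \<H> t \<gamma> \<and> \<gamma> 0 = x \<and> \<gamma> t = y)"

definition flow_smooth_near ::
  "('a, 'e::euclidean_space) hybrid_system \<Rightarrow> real \<Rightarrow> 'a \<Rightarrow> bool" where
  "flow_smooth_near \<H> t x \<longleftrightarrow>
     (\<exists>W. openin (atlas_topology (state_atlas \<H>)) W \<and> x \<in> W \<and> (\<forall>y\<in>W. flow_defined \<H> t y) \<and>
        smooth_map_on (state_atlas \<H>) (state_atlas \<H>) W (hybrid_flow \<H> t))"

text \<open>A state in the image of the reset may also be reached along \<open>vfield\<close> without an impact, so
  trajectories are not determined backwards in time and the hybrid flow is only a semiflow.\<close>

definition hybrid_invariant ::
  "('a, 'e::euclidean_space) hybrid_system \<Rightarrow> ('a, 'e) dform \<Rightarrow> bool" where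
  "hybrid_invariant \<H> \<alpha> \<longleftrightarrow>
     (\<forall>t\<ge>0. \<forall>x\<in>points (state_atlas \<H>).
        x \<notin> guard \<H> \<and> flow_smooth_near \<H> t x \<and> hybrid_flow \<H> t x \<notin> guard \<H> \<longrightarrow>
        (\<forall>v. (\<forall>i. v i \<in> tangent_space (state_atlas \<H>) x) \<longrightarrow>
           pullback (state_atlas \<H>) (state_atlas \<H>) (hybrid_flow \<H> t) \<alpha> x v = \<alpha> x v))"

definition hybrid_invariant_forms ::
  "('a, 'e::euclidean_space) hybrid_system \<Rightarrow> nat \<Rightarrow> ('a, 'e) dform set" where
  "hybrid_invariant_forms \<H> k =
     {\<alpha>. differential_form (state_atlas \<H>) k \<alpha> \<and> hybrid_invariant \<H> \<alpha>}"

section \<open>Unconstrained Hamiltonian impact systems\<close>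

definition impact_guard ::
  "('q, real^'n) atlas \<Rightarrow> ('q, real^'n) metric \<Rightarrow> ('q \<Rightarrow> real) \<Rightarrow> ('q, real^'n) phase set" where
  "impact_guard A g h =
     {(q, p) \<in> points (cotangent_atlas A). h q = 0 \<and> p (gradient A g h q) < 0}"

definition impact_map ::
  "('q, real^'n) atlas \<Rightarrow> ('q, real^'n) metric \<Rightarrow> ('q \<Rightarrow> real) \<Rightarrow>
   ('q, real^'n) phase \<Rightarrow> ('q, real^'n) phase" where
  "impact_map A g h = (\<lambda>(q, p).
     let n = gradient A g h q
     in (q, \<lambda>v. p v - 2 * (p n / g q n n) * differential A h q v))"

definition hamiltonian_impact_system ::
  "('q, real^'n) atlas \<Rightarrow> ('q, real^'n) metric \<Rightarrow> ('q \<Rightarrow> real) \<Rightarrow> ('q \<Rightarrow> real) \<Rightarrow>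
   (('q, real^'n) phase, (real^'n) \<times> (real^'n)) hybrid_system" where
  "hamiltonian_impact_system A g V h =
     \<lparr>state_atlas = cotangent_atlas A,
      guard = impact_guard A g h,
      vfield = hamiltonian_vector_field A (hamiltonian A g V),
      reset = impact_map A g h\<rparr>"

end

(* The invariance of omega^n follows from that of omega. In canonical charts the action
   S(y) = integral of L along the hybrid trajectory from y satisfies the first variation formula
   dS = p_t dq_t - p_0 dq_0 near every initial state whose trajectory does not graze, i.e. never meets
   h = 0 with P(grad h) = 0. An impact adds no boundary term: the momentum jump is a multiple of dh,
   which vanishes on displacements of the impact point, and energy is conserved, which disposes of the
   variation of the impact time. Only Lipschitz dependence on the initial state is needed for this.
   Where the flow is smooth, the symmetry of the second derivative of S turns the formula into
   d(p_t dq_t) = d(p_0 dq_0), that is, the flow preserves omega.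

   Smoothness of the flow near x does not exclude grazing at x, but non-grazing states are dense: a
   one-dimensional pigeonhole argument of Sard type makes the states grazing before the next impact
   avoidable, and the Baire category theorem combines the countably many stages. By continuity of the
   derivative of the flow, omega is preserved at x as well. *)

theory Submission
  imports Defs
begin

section \<open>Calculus of \<open>C\<^sup>k\<close> functions\<close>

text \<open>Smoothness is assumed only for the time-t map on a neighbourhood of the initial state.
  Nothing is assumed about intermediate times or about the impact time as a function of the initial
  state, so the flow cannot be differentiated stage by stage. The variation formula is therefore
  kept as an inequality between two trajectories, with an error quadratic in their initial distance.
  Such inequalities compose over short time windows and survive changes of canonical chart, since
  \<open>p dq\<close> is chart independent up to a quadratic error; derivatives of the flow enter
  only at the final time. The same estimates carry backward uniqueness: the map from initial states
  to states at a later time is locally injective at non-grazing states, hence open by invariance of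
  domain. This transports the avoidability of a graze from a time just before it back to the initial
  states. Uniqueness of trajectories is obtained on the way, from non-grazing initial states; at the
  others the flow is controlled only through its assumed smoothness.\<close>

lemma has_derivative_frechet:
  "f differentiable (at x) \<Longrightarrow> (f has_derivative frechet_derivative f (at x)) (at x)"
  by (simp add: frechet_derivative_works)

lemma frechet_derivative_eqI:
  "(f has_derivative f') (at x) \<Longrightarrow> frechet_derivative f (at x) = f'"
  using frechet_derivative_at by metis

text \<open>Derivatives at a point of an open set depend only on nearby values, so the recursion in
  \<open>Ck_on\<close> never looks outside \<open>S\<close>.\<close>

lemma Ck_on_cong:
  assumes "open S" "\<And>x. x \<in> S \<Longrightarrow> f x = g x" "Ck_on k S f"
  shows "Ck_on k S g"
  using assms(2,3)
proof (induction k arbitrary: f g)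
  case 0
  then show ?case by (simp cong: continuous_on_cong)
next
  case (Suc k)
  have der: "(g has_derivative frechet_derivative f (at x)) (at x)" if "x \<in> S" for x
    using has_derivative_frechet[of f x] has_derivative_transform_within_open[of f _ x UNIV S g]
      Suc.prems that assms(1) by auto
  have "Ck_on k S (\<lambda>x. frechet_derivative g (at x) u)" for u
  proof (rule Suc.IH)
    show "Ck_on k S (\<lambda>x. frechet_derivative f (at x) u)" using Suc.prems by simp
    fix x assume "x \<in> S"
    from frechet_derivative_eqI[OF der[OF this]]
    show "frechet_derivative f (at x) u = frechet_derivative g (at x) u" by simp
  qed
  with der show ?case by (auto simp: differentiable_def)
qed

text \<open>Lets the derivative be supplied in any convenient form \<open>f'\<close>. The inductive
  closure rules below use it to avoid computing \<open>frechet_derivative\<close>.\<close>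

lemma Ck_on_SucI:
  assumes "open S" "\<And>x. x \<in> S \<Longrightarrow> (f has_derivative f' x) (at x)"
    "\<And>u. Ck_on k S (\<lambda>x. f' x u)"
  shows "Ck_on (Suc k) S f"
proof -
  have "Ck_on k S (\<lambda>x. frechet_derivative f (at x) u)" for u
    by (rule Ck_on_cong[OF assms(1) _ assms(3)[of u]])
       (simp add: frechet_derivative_eqI[OF assms(2)])
  with assms(2) show ?thesis by (auto simp: differentiable_def)
qed

lemma Ck_on_SucD:
  assumes "Ck_on (Suc k) S f"
  shows "\<And>x. x \<in> S \<Longrightarrow> (f has_derivative frechet_derivative f (at x)) (at x)"
    and "\<And>u. Ck_on k S (\<lambda>x. frechet_derivative f (at x) u)"
  using assms by (auto intro: has_derivative_frechet)

lemma Ck_on_continuous: "Ck_on k S f \<Longrightarrow> continuous_on S f"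
proof (cases k)
  case (Suc l)
  assume "Ck_on k S f"
  then show ?thesis using Suc
    by (metis Ck_on.simps(2) continuous_at_imp_continuous_on differentiable_imp_continuous_within)
qed simp

lemma Ck_on_pred: "Ck_on (Suc k) S f \<Longrightarrow> Ck_on k S f"
proof (induction k arbitrary: f)
  case 0
  then show ?case using Ck_on_continuous[of "Suc 0" S f] by simp
next
  case (Suc k)
  then show ?case by (metis Ck_on.simps(2))
qed

lemma Ck_on_le: "Ck_on k S f \<Longrightarrow> l \<le> k \<Longrightarrow> Ck_on l S f"
  by (induction k) (auto simp: le_Suc_eq dest: Ck_on_pred simp del: Ck_on.simps)

lemma Ck_on_subset: "Ck_on k S f \<Longrightarrow> T \<subseteq> S \<Longrightarrow> Ck_on k T f"
  by (induction k arbitrary: f) (auto intro: continuous_on_subset)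

lemma Ck_on_const [simp]: "Ck_on k S (\<lambda>x. c)"
  by (induction k arbitrary: c) auto

lemma Ck_on_linear:
  assumes "bounded_linear L" "open S" "Ck_on k S f"
  shows "Ck_on k S (\<lambda>x. L (f x))"
  using assms(3)
proof (induction k arbitrary: f)
  case 0
  then show ?case by (simp add: bounded_linear.continuous_on[OF assms(1)])
next
  case (Suc k)
  show ?case
    by (rule Ck_on_SucI[OF assms(2)
          bounded_linear.has_derivative[OF assms(1) Ck_on_SucD(1)[OF Suc.prems]]
          Suc.IH[OF Ck_on_SucD(2)[OF Suc.prems]]])
qed

lemma Ck_on_ident: "open S \<Longrightarrow> Ck_on k S (\<lambda>x. x)"
proof (cases k)
  case (Suc l)
  assume "open S"
  then show ?thesis unfolding Suc by (intro Ck_on_SucI[where f' = "\<lambda>x u. u"]) auto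
qed simp

lemma Ck_on_add:
  assumes "open S" "Ck_on k S f" "Ck_on k S g"
  shows "Ck_on k S (\<lambda>x. f x + g x)"
  using assms(2,3)
proof (induction k arbitrary: f g)
  case 0
  then show ?case by (simp add: continuous_on_add)
next
  case (Suc k)
  show ?case
    by (rule Ck_on_SucI[OF assms(1)
          has_derivative_add[OF Ck_on_SucD(1)[OF Suc.prems(1)] Ck_on_SucD(1)[OF Suc.prems(2)]]
          Suc.IH[OF Ck_on_SucD(2)[OF Suc.prems(1)] Ck_on_SucD(2)[OF Suc.prems(2)]]])
qed

lemma Ck_on_sum:
  assumes "open S" "\<And>i. i \<in> I \<Longrightarrow> Ck_on k S (f i)"
  shows "Ck_on k S (\<lambda>x. \<Sum>i\<in>I. f i x)"
  using assms(2)
  by (induction I rule: infinite_finite_induct) (auto intro: Ck_on_add[OF assms(1)])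

lemma Ck_on_bilinear:
  assumes "bounded_bilinear B" "open S" "Ck_on k S f" "Ck_on k S g"
  shows "Ck_on k S (\<lambda>x. B (f x) (g x))"
  using assms(3,4)
proof (induction k arbitrary: f g)
  case 0
  then show ?case by (simp add: bounded_bilinear.continuous_on[OF assms(1)])
next
  case (Suc k)
  show ?case
    by (rule Ck_on_SucI[OF assms(2)
          bounded_bilinear.FDERIV[OF assms(1) Ck_on_SucD(1)[OF Suc.prems(1)] Ck_on_SucD(1)[OF Suc.prems(2)]]
          Ck_on_add[OF assms(2) Suc.IH[OF Ck_on_pred[OF Suc.prems(1)] Ck_on_SucD(2)[OF Suc.prems(2)]]
            Suc.IH[OF Ck_on_SucD(2)[OF Suc.prems(1)] Ck_on_pred[OF Suc.prems(2)]]]])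
qed

lemmas Ck_on_mult = Ck_on_bilinear[OF bounded_bilinear_mult]
  and Ck_on_scaleR = Ck_on_bilinear[OF bounded_bilinear_scaleR]
  and Ck_on_inner = Ck_on_bilinear[OF bounded_bilinear_inner]

lemma Ck_on_minus: "open S \<Longrightarrow> Ck_on k S f \<Longrightarrow> Ck_on k S (\<lambda>x. - f x)"
  using Ck_on_linear[OF bounded_linear_minus[OF bounded_linear_ident]] .

lemma Ck_on_diff: "open S \<Longrightarrow> Ck_on k S f \<Longrightarrow> Ck_on k S g \<Longrightarrow> Ck_on k S (\<lambda>x. f x - g x)"
  using Ck_on_add[OF _ _ Ck_on_minus, of S k f g] by simp

lemma Ck_on_prod:
  fixes f :: "'i \<Rightarrow> 'd::euclidean_space \<Rightarrow> real"
  assumes "open S" "\<And>i. i \<in> I \<Longrightarrow> Ck_on k S (f i)"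
  shows "Ck_on k S (\<lambda>x. \<Prod>i\<in>I. f i x)"
  using assms(2)
  by (induction I rule: infinite_finite_induct) (auto intro: Ck_on_mult[OF assms(1)])

text \<open>The derivative of \<open>1 / f\<close> contains \<open>1 / f\<close> again, but one
  order lower, where the induction hypothesis covers it.\<close>

lemma Ck_on_inverse:
  fixes f :: "'d::euclidean_space \<Rightarrow> real"
  assumes "open S" "Ck_on k S f" "\<And>x. x \<in> S \<Longrightarrow> f x \<noteq> 0"
  shows "Ck_on k S (\<lambda>x. inverse (f x))"
  using assms(2)
proof (induction k)
  case 0
  then show ?case using assms(3) by (simp add: continuous_on_inverse)
next
  case (Suc k)
  show ?case
  proof (rule Ck_on_SucI[OF assms(1) Deriv.has_derivative_inverse[OF assms(3) Ck_on_SucD(1)[OF Suc.prems]]])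
    have "Ck_on k S (\<lambda>x. inverse (f x))"
      using Suc.IH Ck_on_pred[OF Suc.prems] .
    then show "Ck_on k S (\<lambda>x. - (inverse (f x) * frechet_derivative f (at x) u * inverse (f x)))" for u
      by (intro Ck_on_minus Ck_on_mult assms(1) Ck_on_SucD(2)[OF Suc.prems])
  qed auto
qed

lemma Ck_on_divide:
  fixes f g :: "'d::euclidean_space \<Rightarrow> real"
  assumes "open S" "Ck_on k S f" "Ck_on k S g" "\<And>x. x \<in> S \<Longrightarrow> g x \<noteq> 0"
  shows "Ck_on k S (\<lambda>x. f x / g x)"
  using Ck_on_mult[OF assms(1,2) Ck_on_inverse[OF assms(1,3,4)]] by (simp add: divide_inverse)

lemma linear_basis_sum:
  fixes L :: "'a::euclidean_space \<Rightarrow> 'b::real_vector"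
  assumes "linear L"
  shows "L w = (\<Sum>b\<in>Basis. (w \<bullet> b) *\<^sub>R L b)"
  by (subst euclidean_representation[symmetric, of w])
     (simp only: linear_sum[OF assms] linear_cmul[OF assms])

text \<open>By the chain rule the derivative is that of \<open>f\<close> in a direction that varies
  with \<open>x\<close>, whereas \<open>Ck_on\<close> speaks of fixed directions. Expanding the
  direction over \<open>Basis\<close> leaves scalar functions times derivatives in fixed
  directions.\<close>

lemma Ck_on_compose:
  fixes g :: "'d::euclidean_space \<Rightarrow> 'e::euclidean_space" and f :: "'e \<Rightarrow> 'f::real_normed_vector"
  assumes "open S" "Ck_on k S g" "Ck_on k T f" "g ` S \<subseteq> T"
  shows "Ck_on k S (\<lambda>x. f (g x))"
  using assms(2,3)
proof (induction k arbitrary: f)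
  case 0
  then show ?case using continuous_on_compose2[of T f S g] assms(4) by auto
next
  case (Suc k)
  let ?g' = "\<lambda>x. frechet_derivative g (at x)" and ?f' = "\<lambda>x. frechet_derivative f (at x)"
  have lin: "linear (?f' (g x))" if "x \<in> S" for x
    using Ck_on_SucD(1)[OF Suc.prems(2)] assms(4) that has_derivative_linear by blast
  show ?case
  proof (rule Ck_on_SucI[OF assms(1)])
    fix x assume x: "x \<in> S"
    show "((\<lambda>x. f (g x)) has_derivative (\<lambda>u. \<Sum>b\<in>Basis. (?g' x u \<bullet> b) *\<^sub>R ?f' (g x) b)) (at x)"
    proof -
      have "(\<lambda>u. \<Sum>b\<in>Basis. (?g' x u \<bullet> b) *\<^sub>R ?f' (g x) b) = (\<lambda>u. ?f' (g x) (?g' x u))"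
        by (rule ext) (rule linear_basis_sum[OF lin[OF x], symmetric])
      then show ?thesis
        using has_derivative_compose[OF Ck_on_SucD(1)[OF Suc.prems(1) x] Ck_on_SucD(1)[OF Suc.prems(2)]]
          assms(4) x by auto
    qed
  next
    fix u
    show "Ck_on k S (\<lambda>x. \<Sum>b\<in>Basis. (?g' x u \<bullet> b) *\<^sub>R ?f' (g x) b)"
      by (intro Ck_on_sum Ck_on_scaleR Ck_on_inner assms(1) Ck_on_const
            Ck_on_SucD(2)[OF Suc.prems(1)] Suc.IH Ck_on_SucD(2)[OF Suc.prems(2)] Ck_on_pred[OF Suc.prems(1)])
  qed
qed

lemma Ck_on_Pair:
  assumes "open S" "Ck_on k S f" "Ck_on k S g"
  shows "Ck_on k S (\<lambda>x. (f x, g x))"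
  using Ck_on_add[OF assms(1)
      Ck_on_linear[OF bounded_linear_Pair[OF bounded_linear_ident bounded_linear_zero] assms(1,2)]
      Ck_on_linear[OF bounded_linear_Pair[OF bounded_linear_zero bounded_linear_ident] assms(1,3)]]
  by simp

lemmas Ck_on_fst = Ck_on_linear[OF bounded_linear_fst]
  and Ck_on_snd = Ck_on_linear[OF bounded_linear_snd]
  and Ck_on_nth = Ck_on_linear[OF bounded_linear_vec_nth]

lemma Ck_on_vec:
  fixes f :: "'n::finite \<Rightarrow> 'd::euclidean_space \<Rightarrow> real"
  assumes "open S" "\<And>i. Ck_on k S (f i)"
  shows "Ck_on k S (\<lambda>x. \<chi> i. f i x)"
proof -
  have "(\<lambda>x. \<chi> i. f i x) = (\<lambda>x. \<Sum>i\<in>UNIV. f i x *\<^sub>R axis i 1)"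
    by (simp add: fun_eq_iff vec_eq_iff axis_def if_distrib[where f = "\<lambda>x. _ * x"] cong: if_cong)
  then show ?thesis
    using Ck_on_sum[OF assms(1) Ck_on_scaleR[OF assms(1,2) Ck_on_const]] by simp
qed

lemma Ck_on_det:
  fixes M :: "'d::euclidean_space \<Rightarrow> real^'n^'n"
  assumes "open S" "\<And>i j. Ck_on k S (\<lambda>x. M x $ i $ j)"
  shows "Ck_on k S (\<lambda>x. det (M x))"
  unfolding det_def by (intro Ck_on_sum Ck_on_mult Ck_on_prod Ck_on_const assms)

lemma matrix_inv_cancel:
  fixes M :: "real^'n^'n"
  assumes "invertible M"
  shows "M ** matrix_inv M = mat 1" "matrix_inv M ** M = mat 1"
  using someI_ex[OF assms[unfolded invertible_def]] by (auto simp: matrix_inv_def)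

text \<open>Cramer's rule writes each entry as a quotient of determinants, which are polynomials in
  the entries of \<open>M\<close>.\<close>

lemma Ck_on_matrix_inv:
  fixes M :: "'d::euclidean_space \<Rightarrow> real^'n^'n"
  assumes S: "open S" and M: "\<And>i j. Ck_on k S (\<lambda>x. M x $ i $ j)"
    and inv: "\<And>x. x \<in> S \<Longrightarrow> invertible (M x)"
  shows "Ck_on k S (\<lambda>x. matrix_inv (M x) $ i $ j)"
proof (rule Ck_on_cong[OF S])
  fix x assume x: "x \<in> S"
  let ?c = "matrix_inv (M x) *v axis j 1"
  have "M x *v ?c = axis j 1"
    using matrix_inv_cancel(1)[OF inv[OF x]] by (simp add: matrix_vector_mul_assoc)
  then have "?c = (\<chi> k. det (\<chi> i l. if l = k then axis j 1 $ i else M x $ i $ l) / det (M x))"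
    using cramer[of "M x"] inv[OF x] by (simp add: invertible_det_nz)
  moreover have "?c $ i = matrix_inv (M x) $ i $ j"
    by (simp add: matrix_vector_mult_basis column_def)
  ultimately show "det (\<chi> i' l. if l = i then axis j 1 $ i' else M x $ i' $ l) / det (M x)
      = matrix_inv (M x) $ i $ j" by simp
next
  have "Ck_on k S (\<lambda>x. det (\<chi> i' l. if l = i then axis j 1 $ i' else M x $ i' $ l))"
  proof (rule Ck_on_det[OF S])
    fix i' l show "Ck_on k S (\<lambda>x. (\<chi> i' l. if l = i then axis j 1 $ i' else M x $ i' $ l) $ i' $ l)"
      by (cases "l = i") (simp_all add: M)
  qed
  then show "Ck_on k S (\<lambda>x. det (\<chi> i' l. if l = i then axis j 1 $ i' else M x $ i' $ l) / det (M x))"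
    by (rule Ck_on_divide[OF S _ Ck_on_det[OF S M]]) (use inv in \<open>auto simp: invertible_det_nz\<close>)
qed

lemma smooth_on_Ck: "smooth_on S f \<Longrightarrow> Ck_on k S f"
  by (simp add: smooth_on_def)

lemma smooth_on_has_derivative:
  "smooth_on S f \<Longrightarrow> x \<in> S \<Longrightarrow> (f has_derivative frechet_derivative f (at x)) (at x)"
  using Ck_on_SucD(1)[OF smooth_on_Ck] by blast

lemma smooth_on_deriv: "smooth_on S f \<Longrightarrow> smooth_on S (\<lambda>x. frechet_derivative f (at x) u)"
  unfolding smooth_on_def using Ck_on_SucD(2) by blast

section \<open>Symmetry of second derivatives and Taylor estimates\<close>

text \<open>By the mean value theorem in direction \<open>u\<close>, the second difference is
  \<open>t\<close> times a difference of values of \<open>f' _ u\<close>, and the linear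
  approximation of these at \<open>x\<close> leaves \<open>t * D v\<close>. The second difference is
  symmetric in \<open>u\<close> and \<open>v\<close>, while \<open>D\<close> belongs to
  \<open>u\<close>; this forces the symmetry of second derivatives.\<close>

lemma mixed_difference_estimate:
  fixes f :: "'a::real_normed_vector \<Rightarrow> real"
  assumes U: "open U" "x \<in> U" and f': "\<And>y. y \<in> U \<Longrightarrow> (f has_derivative f' y) (at y)"
    and D: "((\<lambda>y. f' y u) has_derivative D) (at x)" and e: "e > 0"
  shows "\<exists>d>0. \<forall>t. 0 < t \<and> t < d \<longrightarrow>
    \<bar>f (x + t *\<^sub>R u + t *\<^sub>R v) - f (x + t *\<^sub>R u) - f (x + t *\<^sub>R v) + f x - t * t * D v\<bar> \<le> e * (t * t)"
proof -
  \<comment> \<open>\<open>t * M\<close> bounds the sum of the distances from \<open>x\<close> of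
    the two points at which \<open>f'\<close> is compared; the summand 1 makes \<open>M\<close>
    positive.\<close>
  define M where "M = 2 * norm u + norm v + 1"
  have M: "M > 0" unfolding M_def by (smt (verit) norm_ge_zero)
  obtain r where r: "r > 0" "\<And>y. norm (y - x) < r \<Longrightarrow> y \<in> U"
    using openE[OF U] by (metis mem_ball dist_norm norm_minus_commute subsetD)
  have "\<exists>d>0. \<forall>y. norm (y - x) < d \<longrightarrow> norm (f' y u - f' x u - D (y - x)) \<le> (e / M) * norm (y - x)"
    using D[unfolded has_derivative_at_alt] e M by (meson divide_pos_pos)
  then obtain d where d: "d > 0"
    "\<And>y. norm (y - x) < d \<Longrightarrow> \<bar>f' y u - f' x u - D (y - x)\<bar> \<le> (e / M) * norm (y - x)" by auto
  have lin: "linear D" using D has_derivative_linear by blast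
  show ?thesis
  proof (intro exI[of _ "min r d / M"] conjI allI impI)
    show "min r d / M > 0" using r d M by simp
    fix t assume t: "0 < t \<and> t < min r d / M"
    then have tM: "t * M < r" "t * M < d" using M by (auto simp: field_simps)
    have n1: "norm (s *\<^sub>R u + t *\<^sub>R v) \<le> t * (norm u + norm v)" "norm (s *\<^sub>R u) \<le> t * norm u"
      if "0 \<le> s" "s \<le> t" for s
      using that t mult_right_mono[of s t "norm u"] norm_triangle_ineq[of "s *\<^sub>R u" "t *\<^sub>R v"]
      by (auto simp: algebra_simps)
    have n2: "norm (s *\<^sub>R u + t *\<^sub>R v) < r" "norm (s *\<^sub>R u + t *\<^sub>R v) < d" "norm (s *\<^sub>R u) < r" "norm (s *\<^sub>R u) < d"
      if "0 \<le> s" "s \<le> t" for s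
    proof -
      have "t * (norm u + norm v) \<le> t * M" "t * norm u \<le> t * M"
        unfolding M_def using t by (auto intro!: mult_left_mono simp: add_nonneg_nonneg)
      then show "norm (s *\<^sub>R u + t *\<^sub>R v) < r" "norm (s *\<^sub>R u + t *\<^sub>R v) < d" "norm (s *\<^sub>R u) < r" "norm (s *\<^sub>R u) < d"
        using n1[OF that] tM by linarith+
    qed
    have der: "((\<lambda>s. f (x + (s *\<^sub>R u + c))) has_real_derivative f' (x + (s *\<^sub>R u + c)) u) (at s)"
      if "x + (s *\<^sub>R u + c) \<in> U" for s c
    proof -
      have "((\<lambda>s. x + (s *\<^sub>R u + c)) has_derivative (\<lambda>h. h *\<^sub>R u)) (at s)"
        by (auto intro!: derivative_eq_intros)
      from has_derivative_compose[OF this f'[OF that]]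
      have "((\<lambda>s. f (x + (s *\<^sub>R u + c))) has_derivative (\<lambda>h. f' (x + (s *\<^sub>R u + c)) (h *\<^sub>R u))) (at s)" .
      moreover have "f' (x + (s *\<^sub>R u + c)) (h *\<^sub>R u) = f' (x + (s *\<^sub>R u + c)) u * h" for h
        using linear_cmul[OF has_derivative_linear[OF f'[OF that]]] by simp
      ultimately show ?thesis by (simp add: has_field_derivative_def)
    qed
    let ?g = "\<lambda>s. f (x + (s *\<^sub>R u + t *\<^sub>R v)) - f (x + (s *\<^sub>R u + 0))"
    have "\<exists>z>0. z < t \<and> ?g t - ?g 0 = (t - 0) * (f' (x + (z *\<^sub>R u + t *\<^sub>R v)) u - f' (x + (z *\<^sub>R u + 0)) u)"
      using t n2 by (intro MVT2 DERIV_diff der) (auto intro!: r(2))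
    then obtain z where z: "0 < z" "z < t"
      "?g t - ?g 0 = t * (f' (x + (z *\<^sub>R u + t *\<^sub>R v)) u - f' (x + z *\<^sub>R u) u)" by auto
    let ?A = "f' (x + (z *\<^sub>R u + t *\<^sub>R v)) u" and ?B = "f' (x + z *\<^sub>R u) u"
    have a: "\<bar>?A - f' x u - D (z *\<^sub>R u + t *\<^sub>R v)\<bar> \<le> (e / M) * norm (z *\<^sub>R u + t *\<^sub>R v)"
      using d(2)[of "x + (z *\<^sub>R u + t *\<^sub>R v)"] n2[of z] z by simp
    have b: "\<bar>?B - f' x u - D (z *\<^sub>R u)\<bar> \<le> (e / M) * norm (z *\<^sub>R u)"
      using d(2)[of "x + z *\<^sub>R u"] n2[of z] z by simp
    have "D (z *\<^sub>R u + t *\<^sub>R v) = D (z *\<^sub>R u) + t * D v"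
      using lin by (simp add: linear_add linear_cmul)
    then have "\<bar>?A - ?B - t * D v\<bar> \<le> (e / M) * (norm (z *\<^sub>R u + t *\<^sub>R v) + norm (z *\<^sub>R u))"
      using a b by (simp only: distrib_left)
    also have "\<dots> \<le> (e / M) * (t * M)"
    proof (rule mult_left_mono)
      have "norm (z *\<^sub>R u + t *\<^sub>R v) + norm (z *\<^sub>R u) \<le> t * (norm u + norm v) + t * norm u"
        using n1[of z] z by linarith
      also have "\<dots> \<le> t * M" unfolding M_def using t by (simp add: algebra_simps)
      finally show "norm (z *\<^sub>R u + t *\<^sub>R v) + norm (z *\<^sub>R u) \<le> t * M" .
      show "0 \<le> e / M" using e M by simp
    qed
    also have "\<dots> = e * t" using M by simp
    finally have "t * \<bar>?A - ?B - t * D v\<bar> \<le> t * (e * t)" using t by (intro mult_left_mono) auto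
    then have "\<bar>t * (?A - ?B - t * D v)\<bar> \<le> e * (t * t)" using t by (simp add: abs_mult mult_ac)
    then have "\<bar>?g t - ?g 0 - t * t * D v\<bar> \<le> e * (t * t)"
      unfolding z(3) by (simp add: algebra_simps)
    then show "\<bar>f (x + t *\<^sub>R u + t *\<^sub>R v) - f (x + t *\<^sub>R u) - f (x + t *\<^sub>R v) + f x - t * t * D v\<bar> \<le> e * (t * t)"
      by (simp add: add.assoc)
  qed
qed

lemma symmetric_second_derivative:
  fixes f :: "'a::real_normed_vector \<Rightarrow> real"
  assumes U: "open U" "x \<in> U" and f': "\<And>y. y \<in> U \<Longrightarrow> (f has_derivative f' y) (at y)"
    and D: "\<And>u. ((\<lambda>y. f' y u) has_derivative D u) (at x)"
  shows "D u v = D v u"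
proof -
  have "\<bar>D u v - D v u\<bar> \<le> 2 * e" if e: "e > 0" for e
  proof -
    obtain d1 d2 where d: "d1 > 0" "d2 > 0"
      "\<And>t. 0 < t \<Longrightarrow> t < d1 \<Longrightarrow> \<bar>f (x + t *\<^sub>R u + t *\<^sub>R v) - f (x + t *\<^sub>R u) - f (x + t *\<^sub>R v) + f x - t * t * D u v\<bar> \<le> e * (t * t)"
      "\<And>t. 0 < t \<Longrightarrow> t < d2 \<Longrightarrow> \<bar>f (x + t *\<^sub>R v + t *\<^sub>R u) - f (x + t *\<^sub>R v) - f (x + t *\<^sub>R u) + f x - t * t * D v u\<bar> \<le> e * (t * t)"
      using mixed_difference_estimate[OF U f' D[of u] e, of v] mixed_difference_estimate[OF U f' D[of v] e, of u]
      by blast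
    define t where "t = min d1 d2 / 2"
    have t: "0 < t" "t < d1" "t < d2" using d unfolding t_def by auto
    have "x + t *\<^sub>R v + t *\<^sub>R u = x + t *\<^sub>R u + t *\<^sub>R v" by simp
    then have "\<bar>t * t * D u v - t * t * D v u\<bar> \<le> 2 * (e * (t * t))"
      using d(3)[OF t(1,2)] d(4)[OF t(1,3)] unfolding \<open>x + t *\<^sub>R v + t *\<^sub>R u = x + t *\<^sub>R u + t *\<^sub>R v\<close> by linarith
    then have "t * t * \<bar>D u v - D v u\<bar> \<le> t * t * (2 * e)"
      by (simp add: abs_mult right_diff_distrib[symmetric] mult_ac)
    then show ?thesis using t by (simp add: mult_le_cancel_left)
  qed
  \<comment> \<open>With \<open>e\<close> a quarter of the difference, the difference is at most
    half of itself.\<close>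
  from this[of "\<bar>D u v - D v u\<bar> / 4"] show ?thesis by (cases "D u v = D v u") auto
qed

lemma smooth_on_symmetric:
  fixes f :: "'d::euclidean_space \<Rightarrow> 'e::euclidean_space"
  assumes S: "open S" "x \<in> S" and f: "Ck_on 2 S f"
  shows "frechet_derivative (\<lambda>y. frechet_derivative f (at y) u) (at x) v
       = frechet_derivative (\<lambda>y. frechet_derivative f (at y) v) (at x) u"
proof (rule euclidean_eqI)
  fix b :: 'e assume "b \<in> Basis"
  have f2: "Ck_on (Suc (Suc 0)) S f" using f by (simp add: numeral_2_eq_2)
  note d1 = Ck_on_SucD(1)[OF f2] and d2 = Ck_on_SucD(1)[OF Ck_on_SucD(2)[OF f2] S(2)]
  show "frechet_derivative (\<lambda>y. frechet_derivative f (at y) u) (at x) v \<bullet> b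
       = frechet_derivative (\<lambda>y. frechet_derivative f (at y) v) (at x) u \<bullet> b"
    by (rule symmetric_second_derivative[OF S, of "\<lambda>y. f y \<bullet> b" "\<lambda>y u. frechet_derivative f (at y) u \<bullet> b"
        "\<lambda>u v. frechet_derivative (\<lambda>y. frechet_derivative f (at y) u) (at x) v \<bullet> b"])
       (auto intro!: has_derivative_inner_left d1 d2)
qed

section \<open>Uniform first and second order estimates on compact sets\<close>

lemma Ck1_local_bound:
  fixes f :: "'d::euclidean_space \<Rightarrow> 'e::real_normed_vector"
  assumes S: "compact S" "S \<subseteq> T" and f: "Ck_on 1 T f"
  shows "\<exists>B>0. \<forall>x\<in>S. \<forall>u. norm (frechet_derivative f (at x) u) \<le> B * norm u"
proof -
  have f1: "Ck_on (Suc 0) T f" using f by simp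
  \<comment> \<open>Continuity of the derivative is known direction by direction, so it is bounded
    on each basis vector; linearity combines these bounds.\<close>
  have "\<exists>C. \<forall>x\<in>S. norm (frechet_derivative f (at x) b) \<le> C" for b
    using compact_imp_bounded[OF compact_continuous_image[OF continuous_on_subset[OF _ S(2)] S(1)], of "\<lambda>x. frechet_derivative f (at x) b"]
      Ck_on_SucD(2)[OF f1] by (auto simp: bounded_iff)
  then obtain C where C: "\<And>b x. x \<in> S \<Longrightarrow> norm (frechet_derivative f (at x) b) \<le> C b" by metis
  show ?thesis
  proof (intro exI[of _ "(\<Sum>b\<in>Basis. \<bar>C b\<bar>) + 1"] conjI ballI allI)
    show "0 < (\<Sum>b\<in>Basis. \<bar>C b\<bar>) + 1" by (smt (verit) sum_nonneg abs_ge_zero)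
    fix x u assume x: "x \<in> S"
    have lin: "linear (frechet_derivative f (at x))"
      using Ck_on_SucD(1)[OF f1] x S(2) has_derivative_linear by blast
    have "norm (frechet_derivative f (at x) u) \<le> (\<Sum>b\<in>Basis. norm ((u \<bullet> b) *\<^sub>R frechet_derivative f (at x) b))"
      by (subst linear_basis_sum[OF lin]) (rule norm_sum)
    also have "\<dots> \<le> (\<Sum>b\<in>Basis. \<bar>C b\<bar> * norm u)"
    proof (rule sum_mono)
      fix b :: 'd assume b: "b \<in> Basis"
      have "\<bar>u \<bullet> b\<bar> * norm (frechet_derivative f (at x) b) \<le> norm u * \<bar>C b\<bar>"
        by (rule mult_mono) (use Basis_le_norm[OF b, of u] C[OF x, of b] in auto)
      then show "norm ((u \<bullet> b) *\<^sub>R frechet_derivative f (at x) b) \<le> \<bar>C b\<bar> * norm u"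
        by (simp add: mult_ac)
    qed
    also have "\<dots> \<le> ((\<Sum>b\<in>Basis. \<bar>C b\<bar>) + 1) * norm u"
      by (simp only: sum_distrib_right[symmetric] distrib_right) simp
    finally show "norm (frechet_derivative f (at x) u) \<le> ((\<Sum>b\<in>Basis. \<bar>C b\<bar>) + 1) * norm u" .
  qed
qed

lemma Ck1_lipschitz:
  fixes f :: "'d::euclidean_space \<Rightarrow> 'e::real_normed_vector"
  assumes S: "compact S" "convex S" "S \<subseteq> T" and f: "Ck_on 1 T f"
  shows "\<exists>B>0. \<forall>x\<in>S. \<forall>y\<in>S. norm (f y - f x) \<le> B * norm (y - x)"
proof -
  have f1: "Ck_on (Suc 0) T f" using f by simp
  obtain B where B: "B > 0" "\<And>x u. x \<in> S \<Longrightarrow> norm (frechet_derivative f (at x) u) \<le> B * norm u"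
    using Ck1_local_bound[OF S(1,3) f] by blast
  have "norm (f y - f x) \<le> B * norm (y - x)" if "x \<in> S" "y \<in> S" for x y
    by (rule differentiable_bound[OF S(2) has_derivative_at_withinI[OF Ck_on_SucD(1)[OF f1]] onorm_le])
       (use B S(3) that in auto)
  with B(1) show ?thesis by blast
qed

text \<open>The derivative is Lipschitz on \<open>S\<close>, again by bounds on basis vectors. The
  mean value inequality on the segment from \<open>x\<close> to \<open>y\<close>, applied to
  \<open>f\<close> minus its linearisation at \<open>x\<close>, gives the square.\<close>

lemma Ck2_taylor:
  fixes f :: "'d::euclidean_space \<Rightarrow> 'e::real_normed_vector"
  assumes S: "compact S" "convex S" "S \<subseteq> T" "open T" and f: "Ck_on 2 T f"
  shows "\<exists>B>0. \<forall>x\<in>S. \<forall>y\<in>S. norm (f y - f x - frechet_derivative f (at x) (y - x)) \<le> B * (norm (y - x))\<^sup>2"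
proof -
  have f2: "Ck_on (Suc (Suc 0)) T f" using f by (simp add: numeral_2_eq_2)
  have "\<exists>C>0. \<forall>x\<in>S. \<forall>y\<in>S. norm (frechet_derivative f (at y) b - frechet_derivative f (at x) b) \<le> C * norm (y - x)" for b
    using Ck1_lipschitz[OF S(1-3)] Ck_on_SucD(2)[OF f2] by (metis One_nat_def)
  then obtain C where C: "\<And>b. C b > 0" "\<And>b x y. x \<in> S \<Longrightarrow> y \<in> S \<Longrightarrow>
     norm (frechet_derivative f (at y) b - frechet_derivative f (at x) b) \<le> C b * norm (y - x)" by metis
  define B where "B = (\<Sum>b\<in>Basis. C b) + 1"
  have B: "B > 0" unfolding B_def by (smt (verit) sum_nonneg C(1))
  have key: "norm (frechet_derivative f (at y) u - frechet_derivative f (at x) u) \<le> B * norm (y - x) * norm u"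
    if xy: "x \<in> S" "y \<in> S" for x y u
  proof -
    have lin: "linear (frechet_derivative f (at z))" if "z \<in> S" for z
      using Ck_on_SucD(1)[OF f2] that S(3) has_derivative_linear by blast
    have "frechet_derivative f (at y) u - frechet_derivative f (at x) u
       = (\<Sum>b\<in>Basis. (u \<bullet> b) *\<^sub>R (frechet_derivative f (at y) b - frechet_derivative f (at x) b))"
      using linear_basis_sum[OF lin[OF xy(1)], of u] linear_basis_sum[OF lin[OF xy(2)], of u]
      by (simp add: scaleR_diff_right sum_subtractf)
    also have "norm \<dots> \<le> (\<Sum>b\<in>Basis. C b * (norm (y - x) * norm u))"
    proof (rule order_trans[OF norm_sum sum_mono])
      fix b :: 'd assume b: "b \<in> Basis"
      have "\<bar>u \<bullet> b\<bar> * norm (frechet_derivative f (at y) b - frechet_derivative f (at x) b) \<le> norm u * (C b * norm (y - x))"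
        by (rule mult_mono) (use Basis_le_norm[OF b, of u] C(2)[OF xy, of b] in auto)
      then show "norm ((u \<bullet> b) *\<^sub>R (frechet_derivative f (at y) b - frechet_derivative f (at x) b)) \<le> C b * (norm (y - x) * norm u)"
        by (simp add: mult_ac)
    qed
    also have "\<dots> \<le> B * (norm (y - x) * norm u)"
      unfolding B_def by (simp only: sum_distrib_right[symmetric] distrib_right) simp
    finally show ?thesis by (simp add: mult.assoc)
  qed
  have "norm (f y - f x - frechet_derivative f (at x) (y - x)) \<le> B * (norm (y - x))\<^sup>2"
    if xy: "x \<in> S" "y \<in> S" for x y
  proof -
    have sub: "closed_segment x y \<subseteq> S" using S(2) xy by (simp add: closed_segment_subset)
    let ?g = "\<lambda>z. f z - frechet_derivative f (at x) z"
    have lx: "bounded_linear (frechet_derivative f (at x))"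
      using Ck_on_SucD(1)[OF f2] xy S(3) has_derivative_bounded_linear by blast
    have dz: "norm (z - x) \<le> norm (y - x)" if z: "z \<in> closed_segment x y" for z
    proof -
      obtain a where a: "0 \<le> a" "a \<le> 1" "z = (1 - a) *\<^sub>R x + a *\<^sub>R y" using z by (auto simp: in_segment)
      then have "z - x = a *\<^sub>R (y - x)" by (simp add: algebra_simps)
      then show ?thesis using a by (simp add: mult_left_le_one_le)
    qed
    have gd: "(?g has_derivative (\<lambda>u. frechet_derivative f (at z) u - frechet_derivative f (at x) u)) (at z within closed_segment x y)"
      if z: "z \<in> closed_segment x y" for z
      by (rule has_derivative_at_withinI[OF has_derivative_diff[OF Ck_on_SucD(1)[OF f2] bounded_linear_imp_has_derivative[OF lx]]])
         (use z sub S(3) in auto)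
    have "norm (frechet_derivative f (at z) u - frechet_derivative f (at x) u) \<le> B * norm (y - x) * norm u"
      if z: "z \<in> closed_segment x y" for z u
    proof -
      have "norm (frechet_derivative f (at z) u - frechet_derivative f (at x) u) \<le> B * norm (z - x) * norm u"
        using key xy z sub by blast
      also have "\<dots> \<le> B * norm (y - x) * norm u"
        using dz[OF z] B by (intro mult_right_mono mult_left_mono) auto
      finally show ?thesis .
    qed
    then have "norm (?g y - ?g x) \<le> (B * norm (y - x)) * norm (y - x)"
      by (intro differentiable_bound[OF convex_closed_segment gd onorm_le]) auto
    then show ?thesis
      unfolding linear_diff[OF bounded_linear.linear[OF lx]] by (simp add: power2_eq_square algebra_simps)
  qed
  with B show ?thesis by blast
qed

section \<open>Multilinearity and naturality of wedge powers\<close>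

text \<open>The multilinearity part of \<open>differential_form\<close> at one point, with arguments
  from \<open>T\<close> because forms are constrained on tangent vectors only. Kept apart from
  alternation, it passes through \<open>wedge\<close> by induction.\<close>

definition multilinear_on ::
  "('a, 'e::real_vector) tvec set \<Rightarrow> nat \<Rightarrow> ((nat \<Rightarrow> ('a, 'e) tvec) \<Rightarrow> real) \<Rightarrow> bool" where
  "multilinear_on T k \<alpha> \<longleftrightarrow>
     (\<forall>v v'. (\<forall>i<k. v i = v' i) \<longrightarrow> \<alpha> v = \<alpha> v') \<and>
     (\<forall>v. (\<forall>i. v i \<in> T) \<longrightarrow> (\<forall>i<k. \<forall>u\<in>T. \<forall>w\<in>T. \<forall>a b.
        \<alpha> (v(i := lincomb a u b w)) = a * \<alpha> (v(i := u)) + b * \<alpha> (v(i := w))))"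

lemma multilinear_onD1: "multilinear_on T k \<alpha> \<Longrightarrow> (\<And>i. i < k \<Longrightarrow> v i = v' i) \<Longrightarrow> \<alpha> v = \<alpha> v'"
  unfolding multilinear_on_def by blast

lemma multilinear_onD2:
  "multilinear_on T k \<alpha> \<Longrightarrow> (\<And>i. v i \<in> T) \<Longrightarrow> i < k \<Longrightarrow> u \<in> T \<Longrightarrow> w \<in> T \<Longrightarrow>
    \<alpha> (v(i := lincomb a u b w)) = a * \<alpha> (v(i := u)) + b * \<alpha> (v(i := w))"
  unfolding multilinear_on_def by blast

text \<open>In the summand of a permutation \<open>\<sigma>\<close>, slot \<open>i\<close> is read
  exactly once, at the position that \<open>\<sigma>\<close> maps to \<open>i\<close>. That position
  belongs to either \<alpha> or \<beta>, and the other factor is constant.\<close>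

lemma wedge_multilinear:
  assumes \<alpha>: "multilinear_on T k \<alpha>" and \<beta>: "multilinear_on T l \<beta>"
  shows "multilinear_on T (k + l) (wedge k l \<alpha> \<beta>)"
  unfolding multilinear_on_def
proof (intro conjI allI impI ballI)
  fix v v' :: "nat \<Rightarrow> ('a, 'b) tvec" assume eq: "\<forall>i<k + l. v i = v' i"
  have "of_int (sign \<sigma>) * \<alpha> (\<lambda>i. v (\<sigma> i)) * \<beta> (\<lambda>i. v (\<sigma> (k + i)))
      = of_int (sign \<sigma>) * \<alpha> (\<lambda>i. v' (\<sigma> i)) * \<beta> (\<lambda>i. v' (\<sigma> (k + i)))" if \<sigma>: "\<sigma> permutes {..<k + l}" for \<sigma>
  proof -
    have "\<sigma> i < k + l" if "i < k + l" for i using permutes_in_image[OF \<sigma>, of i] that by simp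
    then have "\<alpha> (\<lambda>i. v (\<sigma> i)) = \<alpha> (\<lambda>i. v' (\<sigma> i))" "\<beta> (\<lambda>i. v (\<sigma> (k + i))) = \<beta> (\<lambda>i. v' (\<sigma> (k + i)))"
      using eq by (auto intro!: multilinear_onD1[OF \<alpha>] multilinear_onD1[OF \<beta>])
    then show ?thesis by simp
  qed
  then show "wedge k l \<alpha> \<beta> v = wedge k l \<alpha> \<beta> v'"
    unfolding wedge_def by (intro arg_cong[where f = "\<lambda>s. s / _"] sum.cong) auto
next
  fix v :: "nat \<Rightarrow> ('a, 'b) tvec" and i u w and a b :: real
  assume v: "\<forall>i. v i \<in> T" and i: "i < k + l" and u: "u \<in> T" and w: "w \<in> T"
  let ?t = "\<lambda>x \<sigma>. of_int (sign \<sigma>) * \<alpha> (\<lambda>j. (v(i := x)) (\<sigma> j)) * \<beta> (\<lambda>j. (v(i := x)) (\<sigma> (k + j)))"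
  have "?t (lincomb a u b w) \<sigma> = a * ?t u \<sigma> + b * ?t w \<sigma>" if \<sigma>: "\<sigma> permutes {..<k + l}" for \<sigma>
  proof -
    obtain j where j: "\<sigma> j = i" "j < k + l"
      using permutes_image[OF \<sigma>] i by (metis imageE lessThan_iff)
    have inj: "\<sigma> j' = i \<longleftrightarrow> j' = j" for j'
      using permutes_inj[OF \<sigma>] j(1) by (auto dest: injD)
    show ?thesis
    proof (cases "j < k")
      case True
      have "(\<lambda>j. (v(i := x)) (\<sigma> j)) = (\<lambda>j. v (\<sigma> j))(j := x)" for x
        using inj by (auto simp: fun_eq_iff)
      moreover have "\<beta> (\<lambda>j. (v(i := x)) (\<sigma> (k + j))) = \<beta> (\<lambda>j. v (\<sigma> (k + j)))" for x
        using True inj by (intro multilinear_onD1[OF \<beta>]) auto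
      ultimately show ?thesis
        using multilinear_onD2[OF \<alpha> _ True u w, of "\<lambda>j. v (\<sigma> j)" a b] v by (simp add: algebra_simps)
    next
      case False
      then obtain m where m: "j = k + m" "m < l" using j by (metis add_diff_inverse_nat nat_add_left_cancel_less)
      have "(\<lambda>j. (v(i := x)) (\<sigma> (k + j))) = (\<lambda>j. v (\<sigma> (k + j)))(m := x)" for x
        using inj m by (auto simp: fun_eq_iff)
      moreover have "\<alpha> (\<lambda>j. (v(i := x)) (\<sigma> j)) = \<alpha> (\<lambda>j. v (\<sigma> j))" for x
        using False inj by (intro multilinear_onD1[OF \<alpha>]) auto
      ultimately show ?thesis
        using multilinear_onD2[OF \<beta> _ m(2) u w, of "\<lambda>j. v (\<sigma> (k + j))" a b] v by (simp add: algebra_simps)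
    qed
  qed
  then have "(\<Sum>\<sigma> | \<sigma> permutes {..<k + l}. ?t (lincomb a u b w) \<sigma>)
      = (\<Sum>\<sigma> | \<sigma> permutes {..<k + l}. a * ?t u \<sigma> + b * ?t w \<sigma>)"
    by (intro sum.cong) auto
  then show "wedge k l \<alpha> \<beta> (v(i := lincomb a u b w))
      = a * wedge k l \<alpha> \<beta> (v(i := u)) + b * wedge k l \<alpha> \<beta> (v(i := w))"
    unfolding wedge_def by (simp only: sum.distrib sum_distrib_left[symmetric] add_divide_distrib times_divide_eq_right)
qed

text \<open>Alternation is produced by the sum over permutations: composing with the transposition
  of \<open>i\<close> and \<open>j\<close> permutes the summands, leaves the arguments unchanged and
  reverses every sign.\<close>

lemma wedge_alternating:
  assumes ij: "i < k + l" "j < k + l" "i \<noteq> j" and v: "v i = v j"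
  shows "wedge k l \<alpha> \<beta> v = 0"
proof -
  let ?\<tau> = "Transposition.transpose i j" and ?P = "{\<sigma>. \<sigma> permutes {..<k + l}}"
  let ?t = "\<lambda>\<sigma>. of_int (sign \<sigma>) * \<alpha> (\<lambda>i. v (\<sigma> i)) * \<beta> (\<lambda>i. v (\<sigma> (k + i)))"
  have \<tau>: "?\<tau> permutes {..<k + l}" using ij by (auto intro: permutes_swap_id)
  have v\<tau>: "v (?\<tau> m) = v m" for m using v by (simp add: Transposition.transpose_def)
  have \<tau>\<tau>: "?\<tau> \<circ> (?\<tau> \<circ> \<sigma>) = \<sigma>" for \<sigma> :: "nat \<Rightarrow> nat" by (simp add: fun_eq_iff)
  have "sum ?t ?P = (\<Sum>\<sigma>\<in>?P. ?t (?\<tau> \<circ> \<sigma>))"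
    by (rule sum.reindex_bij_witness[of _ "\<lambda>\<sigma>. ?\<tau> \<circ> \<sigma>" "\<lambda>\<sigma>. ?\<tau> \<circ> \<sigma>"])
       (simp_all add: \<tau>\<tau> permutes_compose[OF _ \<tau>])
  also have "\<dots> = (\<Sum>\<sigma>\<in>?P. - ?t \<sigma>)"
  proof (rule sum.cong)
    fix \<sigma> assume "\<sigma> \<in> ?P"
    then have "permutation \<sigma>" using permutes_imp_permutation[of "{..<k + l}"] by blast
    then have "sign (?\<tau> \<circ> \<sigma>) = - sign \<sigma>"
      using ij by (simp add: sign_compose permutation_swap_id sign_swap_id)
    then show "?t (?\<tau> \<circ> \<sigma>) = - ?t \<sigma>" by (simp add: v\<tau>)
  qed simp
  finally have "sum ?t ?P = 0" by (simp add: sum_negf)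
  then show ?thesis unfolding wedge_def by simp
qed

lemma wedge_power_multilinear:
  "multilinear_on T k \<alpha> \<Longrightarrow> multilinear_on T (k * m) (wedge_power k \<alpha> m)"
proof (induction m)
  case 0
  then show ?case by (simp add: multilinear_on_def)
next
  case (Suc m)
  then show ?case using wedge_multilinear[of T k \<alpha> "k * m"] by simp
qed

text \<open>The hypotheses range over all index maps \<open>f\<close> because \<open>wedge\<close>
  evaluates its factors on permuted and shifted sequences. In this form equality passes through
  iterated wedges, and the two sequences may live in different spaces, as for a pullback or for
  coordinates.\<close>

lemma wedge_cong:
  assumes "\<And>f. \<alpha> (\<lambda>i. v (f i)) = \<alpha>' (\<lambda>i. v' (f i))" "\<And>f. \<beta> (\<lambda>i. v (f i)) = \<beta>' (\<lambda>i. v' (f i))"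
  shows "wedge k l \<alpha> \<beta> v = wedge k l \<alpha>' \<beta>' v'"
  unfolding wedge_def by (simp add: assms)

lemma wedge_power_cong:
  assumes "\<And>f. \<alpha> (\<lambda>i. v (f i)) = \<alpha>' (\<lambda>i. v' (f i))"
  shows "wedge_power k \<alpha> m v = wedge_power k \<alpha>' m v'"
proof -
  have "\<forall>f. wedge_power k \<alpha> m (\<lambda>i. v (f i)) = wedge_power k \<alpha>' m (\<lambda>i. v' (f i))"
  proof (induction m)
    case (Suc m)
    then show ?case using assms by (auto intro!: wedge_cong)
  qed simp
  from spec[OF this, of "\<lambda>i. i"] show ?thesis by simp
qed

lemma permutes_two: "{\<sigma>. \<sigma> permutes {..<2::nat}} = {id, Transposition.transpose 0 1}"
proof -
  have "{..<2::nat} = insert 0 {1}" by auto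
  then show ?thesis
    using permutes_doubleton_iff[of _ "0::nat" 1] by auto
qed

lemma wedge_one_one:
  "wedge 1 1 (\<lambda>u. a (u 0)) (\<lambda>u. b (u 0)) v = a (v 0) * b (v 1) - a (v 1) * b (v 0)"
proof -
  have "id \<noteq> Transposition.transpose 0 (1::nat)" by (metis id_apply transpose_apply_first zero_neq_one)
  moreover have "(1::nat) + 1 = 2" by simp
  ultimately show ?thesis
    unfolding wedge_def \<open>(1::nat) + 1 = 2\<close> permutes_two by (simp add: sign_swap_id)
qed

section \<open>Charts and tangent vectors\<close>

context
  fixes A :: "('a, 'e::euclidean_space) atlas"
  assumes A: "smooth_atlas A"
begin

lemma chart_inv_left: "c \<in> A \<Longrightarrow> q \<in> fst c \<Longrightarrow> chart_inv c (snd c q) = q"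
  using A unfolding smooth_atlas_def chart_inv_def by (auto intro: inv_into_f_f)

lemma chart_inv_right: "x \<in> snd c ` fst c \<Longrightarrow> snd c (chart_inv c x) = x"
  unfolding chart_inv_def by (rule f_inv_into_f)

lemma chart_inv_mem: "x \<in> snd c ` fst c \<Longrightarrow> chart_inv c x \<in> fst c"
  unfolding chart_inv_def by (rule inv_into_into)

lemma open_chart_image: "c \<in> A \<Longrightarrow> open (snd c ` fst c)"
  using A unfolding smooth_atlas_def by (metis inf.idem)

lemma open_overlap: "c \<in> A \<Longrightarrow> c' \<in> A \<Longrightarrow> open (snd c ` (fst c \<inter> fst c'))"
  using A unfolding smooth_atlas_def by blast

lemma transition_smooth: "c \<in> A \<Longrightarrow> c' \<in> A \<Longrightarrow> smooth_on (snd c ` (fst c \<inter> fst c')) (transition c c')"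
  using A unfolding smooth_atlas_def by blast

lemma transition_apply: "c \<in> A \<Longrightarrow> q \<in> fst c \<Longrightarrow> transition c c' (snd c q) = snd c' q"
  by (simp add: transition_def chart_inv_left)

lemma transition_has_derivative:
  "c \<in> A \<Longrightarrow> c' \<in> A \<Longrightarrow> q \<in> fst c \<Longrightarrow> q \<in> fst c' \<Longrightarrow>
   (transition c c' has_derivative frechet_derivative (transition c c') (at (snd c q))) (at (snd c q))"
  using smooth_on_has_derivative[OF transition_smooth] by blast

lemma transition_linear:
  "c \<in> A \<Longrightarrow> c' \<in> A \<Longrightarrow> q \<in> fst c \<Longrightarrow> q \<in> fst c' \<Longrightarrow>
   linear (frechet_derivative (transition c c') (at (snd c q)))"
  using transition_has_derivative has_derivative_linear by blast

lemma transition_chain: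
  assumes c: "c \<in> A" "c' \<in> A" "c'' \<in> A" and q: "q \<in> fst c" "q \<in> fst c'" "q \<in> fst c''"
  shows "frechet_derivative (transition c c'') (at (snd c q)) u
       = frechet_derivative (transition c' c'') (at (snd c' q))
           (frechet_derivative (transition c c') (at (snd c q)) u)"
proof -
  let ?S = "snd c ` (fst c \<inter> fst c')"
  have "((\<lambda>x. transition c' c'' (transition c c' x)) has_derivative
      (\<lambda>u. frechet_derivative (transition c' c'') (at (snd c' q))
           (frechet_derivative (transition c c') (at (snd c q)) u))) (at (snd c q))"
    by (rule has_derivative_compose[OF transition_has_derivative[OF c(1,2) q(1,2)]])
       (use transition_has_derivative[OF c(2,3) q(2,3)] transition_apply[OF c(1) q(1)] in simp)
  then have "(transition c c'' has_derivative
      (\<lambda>u. frechet_derivative (transition c' c'') (at (snd c' q))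
           (frechet_derivative (transition c c') (at (snd c q)) u))) (at (snd c q))"
    by (rule has_derivative_transform_within_open[OF _ open_overlap[OF c(1,2)]])
       (use c q in \<open>auto simp: transition_apply\<close>)
  from frechet_derivative_eqI[OF this] show ?thesis by simp
qed

lemma transition_self:
  assumes c: "c \<in> A" and q: "q \<in> fst c"
  shows "frechet_derivative (transition c c) (at (snd c q)) u = u"
proof -
  have "(transition c c has_derivative (\<lambda>u. u)) (at (snd c q))"
    by (rule has_derivative_transform_within_open[OF has_derivative_ident open_chart_image[OF c]])
       (use c q in \<open>auto simp: transition_apply\<close>)
  from frechet_derivative_eqI[OF this] show ?thesis by simp
qed

lemma coord_vec_in_tangent_space:
  assumes c: "c \<in> A" "q \<in> fst c"
  shows "coord_vec A c q u \<in> tangent_space A q"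
  unfolding tangent_space_def mem_Collect_eq
proof (intro conjI ballI allI impI)
  fix c' c'' assume c': "c' \<in> A" "c'' \<in> A" "q \<in> fst c' \<and> q \<in> fst c''"
  show "coord_vec A c q u c'' = frechet_derivative (transition c' c'') (at (snd c' q)) (coord_vec A c q u c')"
    using transition_chain[OF c(1) c'(1,2) c(2), of u] c' by (simp add: coord_vec_def)
qed (auto simp: coord_vec_def)

lemma coord_vec_component: "c \<in> A \<Longrightarrow> q \<in> fst c \<Longrightarrow> coord_vec A c q u c = u"
  by (simp add: coord_vec_def transition_self)

lemma tangent_space_component:
  "v \<in> tangent_space A q \<Longrightarrow> c \<in> A \<Longrightarrow> c' \<in> A \<Longrightarrow> q \<in> fst c \<Longrightarrow> q \<in> fst c' \<Longrightarrow>
   v c' = frechet_derivative (transition c c') (at (snd c q)) (v c)"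
  unfolding tangent_space_def by blast

lemma coord_vec_of_component:
  assumes v: "v \<in> tangent_space A q" and c: "c \<in> A" "q \<in> fst c"
  shows "coord_vec A c q (v c) = v"
proof
  fix c' show "coord_vec A c q (v c) c' = v c'"
  proof (cases "c' \<in> A \<and> q \<in> fst c'")
    case True
    then show ?thesis using tangent_space_component[OF v c(1) _ c(2), of c'] by (simp add: coord_vec_def)
  next
    case False
    then have "v c' = 0" using v unfolding tangent_space_def by blast
    then show ?thesis using False unfolding coord_vec_def by auto
  qed
qed

lemma coord_vec_lincomb:
  assumes "c \<in> A" "q \<in> fst c"
  shows "coord_vec A c q (a *\<^sub>R u + b *\<^sub>R w) = lincomb a (coord_vec A c q u) b (coord_vec A c q w)"
  unfolding coord_vec_def lincomb_def
  using transition_linear[OF assms(1)] assms(2) by (auto simp: fun_eq_iff linear_add linear_cmul)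

lemma lincomb_in_tangent_space:
  assumes "q \<in> points A" "u \<in> tangent_space A q" "w \<in> tangent_space A q"
  shows "lincomb a u b w \<in> tangent_space A q"
proof -
  obtain c where c: "c \<in> A" "q \<in> fst c" using assms(1) by (auto simp: points_def)
  have "lincomb a u b w = coord_vec A c q (a *\<^sub>R u c + b *\<^sub>R w c)"
    using coord_vec_lincomb[OF c] coord_vec_of_component[OF assms(2) c] coord_vec_of_component[OF assms(3) c] by simp
  then show ?thesis using coord_vec_in_tangent_space[OF c] by simp
qed

lemma chart_at_props: "q \<in> points A \<Longrightarrow> chart_at A q \<in> A \<and> q \<in> fst (chart_at A q)"
  unfolding chart_at_def points_def by (rule someI_ex) blast

lemma smooth_fun_has_derivative:
  assumes "smooth_fun A f" "c \<in> A" "q \<in> fst c"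
  shows "(f \<circ> chart_inv c has_derivative frechet_derivative (f \<circ> chart_inv c) (at (snd c q))) (at (snd c q))"
  using assms smooth_on_has_derivative unfolding smooth_fun_def by blast

text \<open>\<open>differential\<close> computes in the chart picked by \<open>chart_at\<close>; the
  chain rule makes every other chart around the point give the same value.\<close>

lemma differential_in_chart:
  assumes f: "smooth_fun A f" and c: "c \<in> A" "q \<in> fst c" and v: "v \<in> tangent_space A q"
  shows "differential A f q v = frechet_derivative (f \<circ> chart_inv c) (at (snd c q)) (v c)"
proof -
  define d where "d = chart_at A q"
  have d: "d \<in> A" "q \<in> fst d" using chart_at_props c unfolding d_def points_def by blast+
  have "((\<lambda>x. (f \<circ> chart_inv d) (transition c d x)) has_derivative
      (\<lambda>u. frechet_derivative (f \<circ> chart_inv d) (at (snd d q)) (frechet_derivative (transition c d) (at (snd c q)) u))) (at (snd c q))"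
    by (rule has_derivative_compose[OF transition_has_derivative[OF c(1) d(1) c(2) d(2)]])
       (use smooth_fun_has_derivative[OF f d] in \<open>unfold transition_apply[OF c]\<close>)
  then have "(f \<circ> chart_inv c has_derivative
      (\<lambda>u. frechet_derivative (f \<circ> chart_inv d) (at (snd d q)) (frechet_derivative (transition c d) (at (snd c q)) u))) (at (snd c q))"
    by (rule has_derivative_transform_within_open[OF _ open_overlap[OF c(1) d(1)]])
       (use c d in \<open>auto simp: transition_apply chart_inv_left\<close>)
  from frechet_derivative_eqI[OF this] tangent_space_component[OF v c(1) d(1) c(2) d(2)] v
  show ?thesis unfolding differential_def d_def[symmetric] Let_def by simp
qed

section \<open>The atlas topology and convergence in charts\<close>

lemma openin_chart_preimage:
  assumes c: "c \<in> A" and W: "open W"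
  shows "openin (atlas_topology A) {q \<in> fst c. snd c q \<in> W}"
  unfolding openin_atlas_topology[OF A]
proof (intro conjI ballI)
  show "{q \<in> fst c. snd c q \<in> W} \<subseteq> points A" using c by (auto simp: points_def)
  fix d assume d: "d \<in> A"
  let ?S = "snd d ` (fst d \<inter> fst c)"
  have "snd d ` (fst d \<inter> {q \<in> fst c. snd c q \<in> W}) = ?S \<inter> transition d c -` W"
    using d by (auto simp: transition_apply)
  moreover have "open (?S \<inter> transition d c -` W)"
    using continuous_open_preimage[OF Ck_on_continuous[OF smooth_on_Ck[OF transition_smooth[OF d c]]] open_overlap[OF d c] W]
    by blast
  ultimately show "open (snd d ` (fst d \<inter> {q \<in> fst c. snd c q \<in> W}))" by simp
qed

lemma openin_chart_domain: "c \<in> A \<Longrightarrow> openin (atlas_topology A) (fst c)"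
  using openin_chart_preimage[of c UNIV] by simp

lemma open_chart_image_of_openin:
  "openin (atlas_topology A) U \<Longrightarrow> c \<in> A \<Longrightarrow> open (snd c ` (fst c \<inter> U))"
  unfolding openin_atlas_topology[OF A] by blast

lemma topspace_atlas: "topspace (atlas_topology A) = points A"
proof -
  have "fst c \<subseteq> topspace (atlas_topology A)" if "c \<in> A" for c
    using openin_subset[OF openin_chart_domain[OF that]] .
  then have "points A \<subseteq> topspace (atlas_topology A)" by (auto simp: points_def)
  moreover have "topspace (atlas_topology A) \<subseteq> points A"
    using openin_topspace openin_atlas_topology[OF A] by blast
  ultimately show ?thesis by blast
qed

lemma limitin_chartD:
  assumes l: "limitin (atlas_topology A) \<gamma> z F" and c: "c \<in> A" "z \<in> fst c"
  shows "\<forall>\<^sub>F s in F. \<gamma> s \<in> fst c" "((\<lambda>s. snd c (\<gamma> s)) \<longlongrightarrow> snd c z) F"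
proof -
  show "\<forall>\<^sub>F s in F. \<gamma> s \<in> fst c"
    using l openin_chart_domain[OF c(1)] c(2) unfolding limitin_def by blast
  show "((\<lambda>s. snd c (\<gamma> s)) \<longlongrightarrow> snd c z) F"
  proof (rule topological_tendstoI)
    fix S assume S: "open S" "snd c z \<in> S"
    have "\<forall>\<^sub>F s in F. \<gamma> s \<in> {q \<in> fst c. snd c q \<in> S}"
      using l openin_chart_preimage[OF c(1) S(1)] c(2) S(2) unfolding limitin_def by blast
    then show "\<forall>\<^sub>F s in F. snd c (\<gamma> s) \<in> S" by eventually_elim simp
  qed
qed

text \<open>Turns convergence of coordinates back into convergence on the manifold. Membership in
  the domain is a separate hypothesis because chart values outside the domain are arbitrary.\<close>

lemma limitin_chartI:
  assumes c: "c \<in> A" "z \<in> fst c" and ev: "\<forall>\<^sub>F s in F. \<gamma> s \<in> fst c"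
    and l: "((\<lambda>s. snd c (\<gamma> s)) \<longlongrightarrow> snd c z) F"
  shows "limitin (atlas_topology A) \<gamma> z F"
  unfolding limitin_def
proof (intro conjI allI impI)
  show "z \<in> topspace (atlas_topology A)" using c by (auto simp: topspace_atlas points_def)
  fix U assume U: "openin (atlas_topology A) U \<and> z \<in> U"
  have "\<forall>\<^sub>F s in F. snd c (\<gamma> s) \<in> snd c ` (fst c \<inter> U)"
    by (rule topological_tendstoD[OF l open_chart_image_of_openin[OF _ c(1)]]) (use U c in auto)
  with ev show "\<forall>\<^sub>F s in F. \<gamma> s \<in> U"
  proof eventually_elim
    case (elim s)
    then obtain q where "q \<in> fst c \<inter> U" "snd c (\<gamma> s) = snd c q" by auto
    then show ?case using chart_inv_left[OF c(1), of q] chart_inv_left[OF c(1) elim(1)] by simp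
  qed
qed

end

text \<open>\<open>tangent_map\<close> uses a chosen chart at \<open>x\<close>. This computes it in
  the charts in which smoothness of a map happens to be known, by the chain rule through both
  transitions.\<close>

lemma tangent_map_in_chart:
  fixes A :: "('a, 'e::euclidean_space) atlas" and B :: "('b, 'f::euclidean_space) atlas"
  assumes A: "smooth_atlas A" and B: "smooth_atlas B" and c: "c \<in> A" and d: "d \<in> B"
    and U: "openin (atlas_topology A) U" "x \<in> U" "U \<subseteq> fst c" and F: "F ` U \<subseteq> fst d"
    and f: "(snd d \<circ> F \<circ> chart_inv c has_derivative f') (at (snd c x))"
    and v: "v \<in> tangent_space A x"
  shows "tangent_map A B F x v = coord_vec B d (F x) (f' (v c))"
proof
  fix d'
  define c' where "c' = chart_at A x"
  have c': "c' \<in> A" "x \<in> fst c'" using chart_at_props[OF A, of x] U c unfolding c'_def points_def by blast+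
  have xc: "x \<in> fst c" using U by blast
  have Fx: "F x \<in> fst d" using U F by blast
  show "tangent_map A B F x v d' = coord_vec B d (F x) (f' (v c)) d'"
  proof (cases "d' \<in> B \<and> F x \<in> fst d'")
    case True
    let ?T = "\<lambda>y. transition d d' ((snd d \<circ> F \<circ> chart_inv c) (transition c' c y))"
    let ?T' = "\<lambda>u. frechet_derivative (transition d d') (at (snd d (F x))) (f' (frechet_derivative (transition c' c) (at (snd c' x)) u))"
    have "((\<lambda>y. (snd d \<circ> F \<circ> chart_inv c) (transition c' c y)) has_derivative
        (\<lambda>u. f' (frechet_derivative (transition c' c) (at (snd c' x)) u))) (at (snd c' x))"
      by (rule has_derivative_compose[OF transition_has_derivative[OF A c'(1) c c'(2) xc]])
         (use f in \<open>unfold transition_apply[OF A c']\<close>)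
    then have "(?T has_derivative ?T') (at (snd c' x))"
      by (rule has_derivative_compose)
         (use d True Fx xc c c' in \<open>simp add: transition_apply[OF A] chart_inv_left[OF A] transition_has_derivative[OF B]\<close>)
    then have "(snd d' \<circ> F \<circ> chart_inv c' has_derivative ?T') (at (snd c' x))"
      by (rule has_derivative_transform_within_open[OF _ open_chart_image_of_openin[OF A U(1) c'(1)]])
         (use d True Fx xc c c' U F in \<open>auto simp: transition_apply[OF A] chart_inv_left[OF A] transition_apply[OF B] image_subset_iff subset_iff\<close>)
    from frechet_derivative_eqI[OF this] tangent_space_component[OF A v c'(1) c c'(2) xc] True
    show ?thesis unfolding tangent_map_def c'_def[symmetric] Let_def coord_vec_def by simp
  next
    case False
    then show ?thesis unfolding tangent_map_def coord_vec_def Let_def by auto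
  qed
qed

section \<open>Canonical coordinates on the cotangent bundle\<close>

text \<open>Inverse to \<open>momentum\<close> in the chart \<open>c\<close>; the value zero off the
  tangent space is what \<open>cotangent_space\<close> demands.\<close>

definition covec :: "('q, real^'n) atlas \<Rightarrow> ('q, real^'n) chart \<Rightarrow> 'q \<Rightarrow> real^'n \<Rightarrow> ('q, real^'n) covec" where
  "covec A c q a = (\<lambda>v. if v \<in> tangent_space A q then a \<bullet> v c else 0)"

definition momentum :: "('q, real^'n) atlas \<Rightarrow> ('q, real^'n) chart \<Rightarrow> 'q \<Rightarrow> ('q, real^'n) covec \<Rightarrow> real^'n" where
  "momentum A c q p = (\<chi> i. p (coord_vec A c q (axis i 1)))"

text \<open>The constant form that \<open>symplectic_form\<close> becomes in every canonical chart,
  written with dot products.\<close>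

definition omega0 :: "(real^'n) \<times> (real^'n) \<Rightarrow> (real^'n) \<times> (real^'n) \<Rightarrow> real" where
  "omega0 z w = fst z \<bullet> snd w - fst w \<bullet> snd z"

lemma real_linear_axis_sum:
  fixes L :: "real^'n \<Rightarrow> real"
  assumes "linear L"
  shows "(\<chi> i. L (axis i 1)) \<bullet> u = L u"
proof -
  have "L u = L (\<Sum>i\<in>UNIV. u $ i *\<^sub>R axis i 1)"
    using basis_expansion[of u] by (simp add: scalar_mult_eq_scaleR)
  also have "\<dots> = (\<Sum>i\<in>UNIV. u $ i * L (axis i 1))"
    by (simp only: linear_sum[OF assms] linear_cmul[OF assms] real_scaleR_def)
  finally show ?thesis by (simp add: inner_vec_def mult.commute)
qed

lemma inner_vec_eqI:
  fixes x y :: "real^'n"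
  shows "(\<And>u. x \<bullet> u = y \<bullet> u) \<Longrightarrow> x = y"
  by (metis inner_commute vector_eq_ldot)

lemma cotangent_chart_domain: "fst (cotangent_chart A c) = {(q, p). q \<in> fst c \<and> p \<in> cotangent_space A q}"
  by (simp add: cotangent_chart_def)

lemma cotangent_chart_apply: "snd (cotangent_chart A c) (q, p) = (snd c q, momentum A c q p)"
  by (simp add: cotangent_chart_def momentum_def)

lemma points_cotangent: "(q, p) \<in> points (cotangent_atlas A) \<longleftrightarrow> q \<in> points A \<and> p \<in> cotangent_space A q"
  by (auto simp: points_def cotangent_atlas_def cotangent_chart_domain)

lemma lincomb_apply: "lincomb a v b w c = a *\<^sub>R v c + b *\<^sub>R w c"
  by (simp add: lincomb_def)

lemma cotangent_space_lincomb:
  "p \<in> cotangent_space A q \<Longrightarrow> v \<in> tangent_space A q \<Longrightarrow> w \<in> tangent_space A q \<Longrightarrow>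
   p (lincomb a v b w) = a * p v + b * p w"
  unfolding cotangent_space_def by blast

context
  fixes A :: "('q, real^'n) atlas"
  assumes A: "smooth_atlas A"
begin

lemma covec_in_cotangent_space:
  assumes "c \<in> A" "q \<in> fst c"
  shows "covec A c q a \<in> cotangent_space A q"
proof -
  have q: "q \<in> points A" using assms by (auto simp: points_def)
  show ?thesis
    unfolding cotangent_space_def covec_def
    using lincomb_in_tangent_space[OF A q] by (auto simp: lincomb_apply inner_add_right)
qed

lemma momentum_covec:
  assumes "c \<in> A" "q \<in> fst c"
  shows "momentum A c q (covec A c q a) = a"
  using coord_vec_in_tangent_space[OF A assms] coord_vec_component[OF A assms]
  by (simp add: momentum_def covec_def inner_axis)

lemma cotangent_apply:
  assumes c: "c \<in> A" "q \<in> fst c" and p: "p \<in> cotangent_space A q" and v: "v \<in> tangent_space A q"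
  shows "p v = momentum A c q p \<bullet> v c"
proof -
  have "linear (\<lambda>u. p (coord_vec A c q u))"
  proof (rule linearI)
    fix x y r
    show "p (coord_vec A c q (x + y)) = p (coord_vec A c q x) + p (coord_vec A c q y)"
      using coord_vec_lincomb[OF A c, of 1 x 1 y] cotangent_space_lincomb[OF p] coord_vec_in_tangent_space[OF A c] by simp
    show "p (coord_vec A c q (r *\<^sub>R x)) = r *\<^sub>R p (coord_vec A c q x)"
      using coord_vec_lincomb[OF A c, of r x 0 x] cotangent_space_lincomb[OF p] coord_vec_in_tangent_space[OF A c] by simp
  qed
  from real_linear_axis_sum[OF this, of "v c"] show ?thesis
    by (simp add: momentum_def coord_vec_of_component[OF A v c])
qed

lemma covec_momentum:
  assumes c: "c \<in> A" "q \<in> fst c" and p: "p \<in> cotangent_space A q"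
  shows "covec A c q (momentum A c q p) = p"
  using cotangent_apply[OF c p] p unfolding covec_def cotangent_space_def fun_eq_iff by auto

text \<open>Two readings of the transposed tangent map. The first makes the pairing of momentum with
  an infinitesimal displacement independent of the chart; the second is the explicit coordinate
  change, which involves the derivative of the reverse transition.\<close>

lemma momentum_transform:
  assumes c: "c \<in> A" "q \<in> fst c" "c' \<in> A" "q \<in> fst c'" and p: "p \<in> cotangent_space A q"
  shows "momentum A c' q p \<bullet> frechet_derivative (transition c c') (at (snd c q)) u = momentum A c q p \<bullet> u"
    and "momentum A c' q p = (\<chi> i. momentum A c q p \<bullet> frechet_derivative (transition c' c) (at (snd c' q)) (axis i 1))"
proof -
  have eq: "coord_vec A c q u c' = frechet_derivative (transition c c') (at (snd c q)) u"
    if "c' \<in> A" "q \<in> fst c'" for c c' u using that by (simp add: coord_vec_def)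
  show "momentum A c' q p \<bullet> frechet_derivative (transition c c') (at (snd c q)) u = momentum A c q p \<bullet> u"
    using cotangent_apply[OF c(1,2) p coord_vec_in_tangent_space[OF A c(1,2)], of u]
      cotangent_apply[OF c(3,4) p coord_vec_in_tangent_space[OF A c(1,2)], of u]
      coord_vec_component[OF A c(1,2)] eq[OF c(3,4)] by simp
  show "momentum A c' q p = (\<chi> i. momentum A c q p \<bullet> frechet_derivative (transition c' c) (at (snd c' q)) (axis i 1))"
    unfolding vec_eq_iff
    using cotangent_apply[OF c(1,2) p coord_vec_in_tangent_space[OF A c(3,4)]] eq[OF c(1,2)]
    by (simp add: momentum_def[of A c'])
qed

lemma cotangent_chart_inj:
  assumes c: "c \<in> A"
  shows "inj_on (snd (cotangent_chart A c)) (fst (cotangent_chart A c))"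
proof (rule inj_onI)
  fix z w assume zw: "z \<in> fst (cotangent_chart A c)" "w \<in> fst (cotangent_chart A c)"
    "snd (cotangent_chart A c) z = snd (cotangent_chart A c) w"
  obtain q p r s where z: "z = (q, p)" and w: "w = (r, s)" by (metis surj_pair)
  have q: "q \<in> fst c" "p \<in> cotangent_space A q" "r \<in> fst c" "s \<in> cotangent_space A r"
    and eq: "snd c q = snd c r" "momentum A c q p = momentum A c r s"
    using zw unfolding z w cotangent_chart_domain cotangent_chart_apply by auto
  have "q = r" using chart_inv_left[OF A c] q eq by metis
  moreover have "p = s"
    using covec_momentum[OF c q(1,2)] covec_momentum[OF c q(3,4)] eq(2) calculation by metis
  ultimately show "z = w" using z w by simp
qed

lemma cotangent_chart_preimage:
  assumes c: "c \<in> A" and x: "x \<in> snd c ` fst c"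
  shows "(chart_inv c x, covec A c (chart_inv c x) a) \<in> fst (cotangent_chart A c)"
    and "snd (cotangent_chart A c) (chart_inv c x, covec A c (chart_inv c x) a) = (x, a)"
    and "chart_inv (cotangent_chart A c) (x, a) = (chart_inv c x, covec A c (chart_inv c x) a)"
proof -
  note q = chart_inv_mem[OF A x] and xx = chart_inv_right[OF A x]
  show m: "(chart_inv c x, covec A c (chart_inv c x) a) \<in> fst (cotangent_chart A c)"
    using covec_in_cotangent_space[OF c q] q by (simp add: cotangent_chart_domain)
  show e: "snd (cotangent_chart A c) (chart_inv c x, covec A c (chart_inv c x) a) = (x, a)"
    using momentum_covec[OF c q] xx by (simp add: cotangent_chart_apply)
  show "chart_inv (cotangent_chart A c) (x, a) = (chart_inv c x, covec A c (chart_inv c x) a)"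
    unfolding chart_inv_def[of "cotangent_chart A c"] e[symmetric]
    by (rule inv_into_f_f[OF cotangent_chart_inj[OF c] m])
qed

lemma cotangent_chart_image_inter:
  assumes c: "c \<in> A" and U: "U \<subseteq> fst c"
  shows "snd (cotangent_chart A c) ` {(q, p) \<in> fst (cotangent_chart A c). q \<in> U} = (snd c ` U) \<times> UNIV"
proof (intro set_eqI iffI)
  fix z assume "z \<in> snd (cotangent_chart A c) ` {(q, p) \<in> fst (cotangent_chart A c). q \<in> U}"
  then show "z \<in> (snd c ` U) \<times> UNIV" by (auto simp: cotangent_chart_apply)
next
  fix z assume "z \<in> (snd c ` U) \<times> (UNIV :: (real^'n) set)"
  then obtain q a where q: "q \<in> U" "z = (snd c q, a)" by auto
  have x: "snd c q \<in> snd c ` fst c" using q U by auto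
  have "chart_inv c (snd c q) = q" using chart_inv_left[OF A c] q U by blast
  then show "z \<in> snd (cotangent_chart A c) ` {(q, p) \<in> fst (cotangent_chart A c). q \<in> U}"
    using cotangent_chart_preimage(1,2)[OF c x, of a] q by force
qed

lemma cotangent_chart_image:
  assumes "c \<in> A"
  shows "snd (cotangent_chart A c) ` fst (cotangent_chart A c) = (snd c ` fst c) \<times> UNIV"
proof -
  have "{(q, p) \<in> fst (cotangent_chart A c). q \<in> fst c} = fst (cotangent_chart A c)"
    by (auto simp: cotangent_chart_domain)
  then show ?thesis using cotangent_chart_image_inter[OF assms order_refl] by simp
qed

lemma cotangent_chart_overlap:
  assumes "c \<in> A" "c' \<in> A"
  shows "snd (cotangent_chart A c) ` (fst (cotangent_chart A c) \<inter> fst (cotangent_chart A c'))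
       = (snd c ` (fst c \<inter> fst c')) \<times> UNIV"
proof -
  have "fst (cotangent_chart A c) \<inter> fst (cotangent_chart A c')
      = {(q, p) \<in> fst (cotangent_chart A c). q \<in> fst c \<inter> fst c'}"
    by (auto simp: cotangent_chart_domain)
  then show ?thesis using cotangent_chart_image_inter[OF assms(1), of "fst c \<inter> fst c'"] by simp
qed

lemma cotangent_transition:
  assumes c: "c \<in> A" "c' \<in> A" and x: "x \<in> snd c ` (fst c \<inter> fst c')"
  shows "transition (cotangent_chart A c) (cotangent_chart A c') (x, a)
     = (transition c c' x, \<chi> i. a \<bullet> frechet_derivative (transition c' c) (at (transition c c' x)) (axis i 1))"
proof -
  obtain q where q: "q \<in> fst c" "q \<in> fst c'" "x = snd c q" using x by auto
  have q': "chart_inv c x = q" using chart_inv_left[OF A c(1) q(1)] q by simp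
  have xx: "x \<in> snd c ` fst c" using x by auto
  have cs: "covec A c q a \<in> cotangent_space A q" using covec_in_cotangent_space c q by simp
  show ?thesis
    unfolding transition_def[of "cotangent_chart A c"] comp_def cotangent_chart_preimage(3)[OF c(1) xx] q'
      cotangent_chart_apply momentum_transform(2)[OF c(1) q(1) c(2) q(2) cs] momentum_covec[OF c(1) q(1)]
    using transition_apply[OF A c(1) q(1)] q by simp
qed

lemma smooth_cotangent_atlas: "smooth_atlas (cotangent_atlas A)"
  unfolding smooth_atlas_def
proof (intro conjI ballI)
  fix C assume "C \<in> cotangent_atlas A"
  then show "inj_on (snd C) (fst C)" using cotangent_chart_inj by (auto simp: cotangent_atlas_def)
next
  fix C C' assume "C \<in> cotangent_atlas A" "C' \<in> cotangent_atlas A"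
  then obtain c c' where c: "c \<in> A" "c' \<in> A" and C: "C = cotangent_chart A c" "C' = cotangent_chart A c'"
    by (auto simp: cotangent_atlas_def)
  let ?S = "snd c ` (fst c \<inter> fst c')" and ?T = "snd c' ` (fst c' \<inter> fst c)"
  have S: "open (?S \<times> (UNIV :: (real^'n) set))" by (intro open_Times open_overlap[OF A c] open_UNIV)
  show "open (snd C ` (fst C \<inter> fst C'))" unfolding C cotangent_chart_overlap[OF c] by (rule S)
  have "Ck_on k (?S \<times> UNIV) (transition C C')" for k
  proof (rule Ck_on_cong[OF S])
    fix z assume "z \<in> ?S \<times> (UNIV :: (real^'n) set)"
    then show "(transition c c' (fst z), \<chi> i. snd z \<bullet> frechet_derivative (transition c' c) (at (transition c c' (fst z))) (axis i 1))
        = transition C C' z"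
      using cotangent_transition[OF c, of "fst z" "snd z"] unfolding C by auto
  next
    have \<psi>: "Ck_on k (?S \<times> (UNIV :: (real^'n) set)) (\<lambda>z. transition c c' (fst z))"
      by (rule Ck_on_compose[OF S Ck_on_fst[OF S Ck_on_ident[OF S]] smooth_on_Ck[OF transition_smooth[OF A c]]]) auto
    have "Ck_on k (?S \<times> (UNIV :: (real^'n) set)) (\<lambda>z. frechet_derivative (transition c' c) (at (transition c c' (fst z))) (axis i 1))" for i
      by (rule Ck_on_compose[OF S \<psi> smooth_on_Ck[OF smooth_on_deriv[OF transition_smooth[OF A c(2,1)]]]])
         (auto simp: transition_apply[OF A c(1)])
    then show "Ck_on k (?S \<times> UNIV) (\<lambda>z. (transition c c' (fst z), \<chi> i. snd z \<bullet> frechet_derivative (transition c' c) (at (transition c c' (fst z))) (axis i 1)))"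
      by (intro Ck_on_Pair S \<psi> Ck_on_vec Ck_on_inner Ck_on_snd Ck_on_ident)
  qed
  then show "smooth_on (snd C ` (fst C \<inter> fst C')) (transition C C')"
    unfolding C cotangent_chart_overlap[OF c] smooth_on_def by blast
qed

text \<open>The derivative acts on positions by \<open>P\<close> and on momenta by the transpose of
  \<open>X\<close>, the inverse of \<open>P\<close>, plus a term from the second derivative
  \<open>H\<close> of the reverse transition. The first two preserve the pairing, and the last one
  contributes a symmetric form, which cancels in \<open>omega0\<close>.\<close>

lemma cotangent_transition_symplectic:
  assumes C: "C \<in> cotangent_atlas A" "C' \<in> cotangent_atlas A" and z: "z \<in> fst C" "z \<in> fst C'"
  shows "omega0 (frechet_derivative (transition C C') (at (snd C z)) v) (frechet_derivative (transition C C') (at (snd C z)) w)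
       = omega0 v w"
proof -
  obtain c c' where c: "c \<in> A" "c' \<in> A" and C': "C = cotangent_chart A c" "C' = cotangent_chart A c'"
    using C by (auto simp: cotangent_atlas_def)
  obtain q p where zqp: "z = (q, p)" by (metis surj_pair)
  have q: "q \<in> fst c" "q \<in> fst c'" and p: "p \<in> cotangent_space A q"
    using z unfolding C' zqp cotangent_chart_domain by auto
  define x a where "x = snd c q" and "a = momentum A c q p"
  define \<psi> \<chi>' where "\<psi> = transition c c'" and "\<chi>' = transition c' c"
  define y where "y = snd c' q"
  let ?S = "snd c ` (fst c \<inter> fst c')" and ?T = "snd c' ` (fst c' \<inter> fst c)"
  have y: "\<psi> x = y" unfolding \<psi>_def x_def y_def by (rule transition_apply[OF A c(1) q(1)])
  have yT: "y \<in> ?T" using q by (auto simp: y_def)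
  have oT: "open ?T" by (rule open_overlap[OF A c(2,1)])
  have T2: "Ck_on 2 ?T \<chi>'" unfolding \<chi>'_def by (rule smooth_on_Ck[OF transition_smooth[OF A c(2,1)]])
  define P X where "P = frechet_derivative \<psi> (at x)" and "X = frechet_derivative \<chi>' (at y)"
  define H where "H u = frechet_derivative (\<lambda>y. frechet_derivative \<chi>' (at y) u) (at y)" for u
  have H: "((\<lambda>y. frechet_derivative \<chi>' (at y) u) has_derivative H u) (at y)" for u
    unfolding H_def \<chi>'_def
    by (rule smooth_on_has_derivative[OF smooth_on_deriv[OF transition_smooth[OF A c(2,1)]] yT])
  have Hs: "H u v = H v u" for u v unfolding H_def by (rule smooth_on_symmetric[OF oT yT T2])
  have Hl: "linear (H u)" for u using H has_derivative_linear by blast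
  have P: "(\<psi> has_derivative P) (at x)"
    unfolding P_def \<psi>_def x_def by (rule transition_has_derivative[OF A c q])
  have Xl: "linear X" unfolding X_def \<chi>'_def y_def by (rule transition_linear[OF A c(2,1) q(2,1)])
  have XP: "X (P u) = u" for u
    unfolding X_def P_def \<chi>'_def \<psi>_def x_def y_def
    using transition_chain[OF A c(1,2,1) q q(1), of u] transition_self[OF A c(1) q(1)] by simp
  define D where "D u = (P (fst u), \<chi> i. a \<bullet> H (axis i 1) (P (fst u)) + snd u \<bullet> X (axis i 1))" for u
  have "((\<lambda>z. (\<psi> (fst z), \<chi> i. snd z \<bullet> frechet_derivative \<chi>' (at (\<psi> (fst z))) (axis i 1))) has_derivative D) (at (x, a))"
  proof -
    have Pf: "((\<lambda>z. \<psi> (fst z)) has_derivative (\<lambda>u. P (fst u))) (at (x, a))"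
      by (rule has_derivative_compose[OF has_derivative_fst[OF has_derivative_ident]]) (simp add: P)
    have "((\<lambda>z. frechet_derivative \<chi>' (at (\<psi> (fst z))) e) has_derivative (\<lambda>u. H e (P (fst u)))) (at (x, a))" for e
      by (rule has_derivative_compose[OF Pf]) (simp add: y H)
    from has_derivative_inner[OF has_derivative_snd[OF has_derivative_ident] this]
    have "((\<lambda>z. snd z \<bullet> frechet_derivative \<chi>' (at (\<psi> (fst z))) e) has_derivative
        (\<lambda>u. a \<bullet> H e (P (fst u)) + snd u \<bullet> X e)) (at (x, a))" for e
      by (simp add: X_def y)
    then show ?thesis unfolding D_def[abs_def]
      by (intro has_derivative_Pair Pf) (subst has_derivative_componentwise_within, auto simp: Basis_vec_def inner_axis)
  qed
  then have "(transition C C' has_derivative D) (at (x, a))"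
  proof (rule has_derivative_transform_within_open)
    show "open (?S \<times> (UNIV :: (real^'n) set))" by (intro open_Times open_overlap[OF A c] open_UNIV)
    show "(x, a) \<in> ?S \<times> UNIV" using q by (auto simp: x_def)
    fix z assume "z \<in> ?S \<times> (UNIV :: (real^'n) set)"
    then show "(\<psi> (fst z), \<chi> i. snd z \<bullet> frechet_derivative \<chi>' (at (\<psi> (fst z))) (axis i 1)) = transition C C' z"
      using cotangent_transition[OF c, of "fst z" "snd z"] unfolding C' \<psi>_def \<chi>'_def by auto
  qed
  moreover have "snd C z = (x, a)" unfolding C' zqp cotangent_chart_apply x_def a_def ..
  ultimately have D: "frechet_derivative (transition C C') (at (snd C z)) = D"
    using frechet_derivative_eqI by simp
  \<comment> \<open>The last summand is symmetric in \<open>v\<close> and \<open>w\<close> by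
    \<open>Hs\<close>, so it drops out on antisymmetrising.\<close>
  have key: "P (fst v) \<bullet> snd (D w) = fst v \<bullet> snd w + a \<bullet> H (P (fst w)) (P (fst v))" for v w
  proof -
    have "linear (\<lambda>u. a \<bullet> H (P (fst w)) u + snd w \<bullet> X u)"
      using Hl[of "P (fst w)"] Xl
      by (intro linearI) (auto simp: linear_add linear_cmul inner_add_right algebra_simps)
    from real_linear_axis_sum[OF this, of "P (fst v)"]
    show ?thesis by (simp add: D_def Hs[of "axis _ 1"] XP inner_commute)
  qed
  have fD: "fst (D u) = P (fst u)" for u by (simp add: D_def)
  show ?thesis
    unfolding omega0_def D fD key using Hs[of "P (fst w)" "P (fst v)"] by simp
qed

section \<open>The symplectic form, its powers, and the topology of the cotangent bundle\<close>

lemma symplectic_form_in_chart: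
  assumes C: "C \<in> cotangent_atlas A" "z \<in> fst C"
    and v: "v 0 \<in> tangent_space (cotangent_atlas A) z" "v 1 \<in> tangent_space (cotangent_atlas A) z"
  shows "symplectic_form A z v = omega0 (v 0 C) (v 1 C)"
proof -
  define C' where "C' = chart_at (cotangent_atlas A) z"
  have C': "C' \<in> cotangent_atlas A" "z \<in> fst C'"
    using chart_at_props[OF smooth_cotangent_atlas, of z] C unfolding C'_def points_def by blast+
  have "symplectic_form A z v = omega0 (v 0 C') (v 1 C')"
    unfolding symplectic_form_def C'_def[symmetric] Let_def
      wedge_one_one[of "\<lambda>w. fst (w C') $ _" "\<lambda>w. snd (w C') $ _"]
    by (simp add: omega0_def inner_vec_def sum_subtractf)
  also have "\<dots> = omega0 (v 0 C) (v 1 C)"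
    unfolding tangent_space_component[OF smooth_cotangent_atlas v(1) C(1) C'(1) C(2) C'(2)]
      tangent_space_component[OF smooth_cotangent_atlas v(2) C(1) C'(1) C(2) C'(2)]
    by (rule cotangent_transition_symplectic[OF C(1) C'(1) C(2) C'(2)])
  finally show ?thesis .
qed

lemma symplectic_form_multilinear:
  assumes "z \<in> points (cotangent_atlas A)"
  shows "multilinear_on (tangent_space (cotangent_atlas A) z) 2 (symplectic_form A z)"
proof -
  define C where "C = chart_at (cotangent_atlas A) z"
  have eq: "symplectic_form A z = (\<lambda>v. omega0 (v 0 C) (v 1 C))"
    unfolding symplectic_form_def C_def[symmetric] Let_def
      wedge_one_one[of "\<lambda>w. fst (w C) $ _" "\<lambda>w. snd (w C) $ _"]
    by (simp add: omega0_def inner_vec_def sum_subtractf)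
  show ?thesis unfolding multilinear_on_def eq
    by (auto simp: omega0_def lincomb_def less_2_cases_iff inner_add_left inner_add_right algebra_simps)
qed

lemma differential_form_symplectic_power:
  "differential_form (cotangent_atlas A) (2 * CARD('n)) (\<lambda>z. wedge_power 2 (symplectic_form A z) CARD('n))"
  unfolding differential_form_def
proof (intro conjI ballI allI impI)
  let ?B = "cotangent_atlas A"
  \<comment> \<open>Writing the exponent as a successor exposes the outermost wedge, to which
    \<open>wedge_alternating\<close> applies.\<close>
  obtain m where m: "CARD('n) = Suc m" using zero_less_card_finite by (metis gr0_conv_Suc)
  fix z assume z: "z \<in> points ?B"
  note ml = wedge_power_multilinear[OF symplectic_form_multilinear[OF z], of "CARD('n)"]
  show "wedge_power 2 (symplectic_form A z) CARD('n) v = wedge_power 2 (symplectic_form A z) CARD('n) v'"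
    if "\<forall>i<2 * CARD('n). v i = v' i" for v v'
    using multilinear_onD1[OF ml] that by blast
  show "wedge_power 2 (symplectic_form A z) CARD('n) (v(i := lincomb a u b w))
      = a * wedge_power 2 (symplectic_form A z) CARD('n) (v(i := u)) + b * wedge_power 2 (symplectic_form A z) CARD('n) (v(i := w))"
    if "\<forall>i. v i \<in> tangent_space ?B z" "i < 2 * CARD('n)" "u \<in> tangent_space ?B z" "w \<in> tangent_space ?B z" for v i u w a b
    using multilinear_onD2[OF ml _ that(2-4)] that(1) by blast
  show "wedge_power 2 (symplectic_form A z) CARD('n) v = 0"
    if "i < 2 * CARD('n)" "j < 2 * CARD('n)" "i \<noteq> j \<and> v i = v j" for v i j
    using wedge_alternating[of i 2 "2 * m" j v] that by (simp add: m)
next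
  let ?B = "cotangent_atlas A"
  fix C u assume C: "C \<in> ?B"
  let ?f = "\<lambda>y. wedge_power 2 (symplectic_form A (chart_inv C y)) CARD('n) (\<lambda>i. coord_vec ?B C (chart_inv C y) (u i))"
  \<comment> \<open>In a canonical chart the power has constant coefficients, so smoothness is that
    of a constant.\<close>
  have "Ck_on k (snd C ` fst C) ?f" for k
  proof (rule Ck_on_cong[OF open_chart_image[OF smooth_cotangent_atlas C] _ Ck_on_const])
    fix y assume "y \<in> snd C ` fst C"
    then have z: "chart_inv C y \<in> fst C" by (rule chart_inv_mem[OF smooth_cotangent_atlas])
    show "wedge_power 2 (\<lambda>v. omega0 (v 0) (v 1)) CARD('n) u = ?f y"
      by (rule wedge_power_cong, subst symplectic_form_in_chart[OF C z])
         (use C z in \<open>simp_all add: coord_vec_in_tangent_space[OF smooth_cotangent_atlas] coord_vec_component[OF smooth_cotangent_atlas]\<close>)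
  qed
  then show "smooth_on (snd C ` fst C) ?f" by (simp add: smooth_on_def)
qed

lemma openin_cotangent_preimage:
  assumes U: "openin (atlas_topology A) U"
  shows "openin (atlas_topology (cotangent_atlas A)) {z \<in> points (cotangent_atlas A). fst z \<in> U}"
  unfolding openin_atlas_topology[OF smooth_cotangent_atlas]
proof (intro conjI ballI)
  fix C assume "C \<in> cotangent_atlas A"
  then obtain c where c: "c \<in> A" and C: "C = cotangent_chart A c" by (auto simp: cotangent_atlas_def)
  have "fst C \<inter> {z \<in> points (cotangent_atlas A). fst z \<in> U} = {(q, p) \<in> fst (cotangent_chart A c). q \<in> fst c \<inter> U}"
    using c unfolding C by (auto simp: cotangent_chart_domain points_cotangent) (auto simp: points_def)
  then have "snd C ` (fst C \<inter> {z \<in> points (cotangent_atlas A). fst z \<in> U}) = (snd c ` (fst c \<inter> U)) \<times> UNIV"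
    using cotangent_chart_image_inter[OF c, of "fst c \<inter> U"] C by simp
  then show "open (snd C ` (fst C \<inter> {z \<in> points (cotangent_atlas A). fst z \<in> U}))"
    using open_Times[OF open_chart_image_of_openin[OF A U c] open_UNIV] by simp
qed auto

text \<open>States over different base points are separated in the base, and states over the same
  base point share a canonical chart. Uniqueness of limits later identifies a trajectory with the
  limit of its coordinate curve.\<close>

lemma Hausdorff_cotangent:
  assumes hd: "Hausdorff_space (atlas_topology A)"
  shows "Hausdorff_space (atlas_topology (cotangent_atlas A))"
  unfolding Hausdorff_space_def
proof (intro allI impI)
  let ?B = "cotangent_atlas A"
  fix z w assume zw: "z \<in> topspace (atlas_topology ?B) \<and> w \<in> topspace (atlas_topology ?B) \<and> z \<noteq> w"
  then have zp: "z \<in> points ?B" and wp: "w \<in> points ?B" by (auto simp: topspace_atlas[OF smooth_cotangent_atlas])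
  have q: "fst z \<in> points A" "fst w \<in> points A"
    using zp wp points_cotangent[of "fst z" "snd z" A] points_cotangent[of "fst w" "snd w" A] by auto
  show "\<exists>U V. openin (atlas_topology ?B) U \<and> openin (atlas_topology ?B) V \<and> z \<in> U \<and> w \<in> V \<and> disjnt U V"
  proof (cases "fst z = fst w")
    case False
    then obtain U V where UV: "openin (atlas_topology A) U" "openin (atlas_topology A) V" "fst z \<in> U" "fst w \<in> V" "disjnt U V"
      using hd q unfolding Hausdorff_space_def topspace_atlas[OF A] by blast
    show ?thesis
      by (rule exI[of _ "{z \<in> points ?B. fst z \<in> U}"], rule exI[of _ "{z \<in> points ?B. fst z \<in> V}"])
         (use openin_cotangent_preimage[OF UV(1)] openin_cotangent_preimage[OF UV(2)] UV zp wp in \<open>auto simp: disjnt_def\<close>)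
  next
    case True
    obtain C where C: "C \<in> ?B" "z \<in> fst C" using zp by (auto simp: points_def)
    then obtain c where c: "c \<in> A" "C = cotangent_chart A c" by (auto simp: cotangent_atlas_def)
    have wC: "w \<in> fst C"
      using C(2) True wp points_cotangent[of "fst w" "snd w" A] unfolding c cotangent_chart_domain by (cases z; cases w) auto
    have "snd C z \<noteq> snd C w"
      using inj_onD[OF cotangent_chart_inj[OF c(1)], of z w] C(2) wC zw unfolding c by blast
    then obtain U V where UV: "open U" "open V" "snd C z \<in> U" "snd C w \<in> V" "U \<inter> V = {}"
      using hausdorff[of "snd C z" "snd C w"] by auto
    show ?thesis
      by (rule exI[of _ "{z \<in> fst C. snd C z \<in> U}"], rule exI[of _ "{z \<in> fst C. snd C z \<in> V}"])
         (use openin_chart_preimage[OF smooth_cotangent_atlas C(1) UV(1)] openin_chart_preimage[OF smooth_cotangent_atlas C(1) UV(2)]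
            UV C wC in \<open>auto simp: disjnt_def\<close>)
  qed
qed

end

section \<open>Mechanical systems in canonical coordinates\<close>

lemma linear_coeff_inner:
  fixes L :: "(real^'n) \<Rightarrow> real"
  assumes "\<And>x y. L (x + y) = L x + L y" "\<And>r x. L (r *\<^sub>R x) = r * L x"
  shows "(\<chi> i. L (axis i 1)) \<bullet> u = L u"
  by (rule real_linear_axis_sum) (rule linearI, simp_all add: assms)

definition metric_matrix :: "('q, real^'n) atlas \<Rightarrow> ('q, real^'n) metric \<Rightarrow> ('q, real^'n) chart \<Rightarrow> real^'n \<Rightarrow> real^'n^'n" where
  "metric_matrix A g c x = (\<chi> i j. g (chart_inv c x) (coord_vec A c (chart_inv c x) (axis i 1)) (coord_vec A c (chart_inv c x) (axis j 1)))"

text \<open>The dual metric on covectors. It raises indices, so \<open>cometric *v dvec\<close> is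
  the coordinate expression of a gradient.\<close>

definition cometric :: "('q, real^'n) atlas \<Rightarrow> ('q, real^'n) metric \<Rightarrow> ('q, real^'n) chart \<Rightarrow> real^'n \<Rightarrow> real^'n^'n" where
  "cometric A g c x = matrix_inv (metric_matrix A g c x)"

definition dvec :: "('q, real^'n) chart \<Rightarrow> ('q \<Rightarrow> real) \<Rightarrow> real^'n \<Rightarrow> real^'n" where
  "dvec c f x = (\<chi> i. frechet_derivative (f \<circ> chart_inv c) (at x) (axis i 1))"

definition ham_chart :: "('q, real^'n) atlas \<Rightarrow> ('q, real^'n) metric \<Rightarrow> ('q \<Rightarrow> real) \<Rightarrow> ('q, real^'n) chart \<Rightarrow> (real^'n) \<times> (real^'n) \<Rightarrow> real" where
  "ham_chart A g V c z = (snd z \<bullet> (cometric A g c (fst z) *v snd z)) / 2 + V (chart_inv c (fst z))"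

text \<open>The right-hand side of Hamilton's equations.\<close>

definition symplectic_gradient :: "((real^'n) \<times> (real^'n) \<Rightarrow> real) \<Rightarrow> (real^'n) \<times> (real^'n) \<Rightarrow> (real^'n) \<times> (real^'n)" where
  "symplectic_gradient H z = (\<chi> i. frechet_derivative H (at z) (0, axis i 1), \<chi> i. - frechet_derivative H (at z) (axis i 1, 0))"

text \<open>The impact map in canonical coordinates: since \<open>cometric *v dvec c h\<close> is
  the gradient of \<open>h\<close>, the numerator is \<open>P(grad h)\<close> and the denominator
  \<open>g(grad h, grad h)\<close>.\<close>

definition refl_chart :: "('q, real^'n) atlas \<Rightarrow> ('q, real^'n) metric \<Rightarrow> ('q \<Rightarrow> real) \<Rightarrow> ('q, real^'n) chart \<Rightarrow> (real^'n) \<times> (real^'n) \<Rightarrow> (real^'n) \<times> (real^'n)" where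
  "refl_chart A g h c z = (fst z, snd z -
     (2 * (snd z \<bullet> (cometric A g c (fst z) *v dvec c h (fst z))
         / (dvec c h (fst z) \<bullet> (cometric A g c (fst z) *v dvec c h (fst z))))) *\<^sub>R dvec c h (fst z))"

lemma omega0_symplectic_gradient:
  assumes "linear (frechet_derivative H (at z))"
  shows "omega0 (symplectic_gradient H z) v = frechet_derivative H (at z) v"
proof -
  let ?D = "frechet_derivative H (at z)"
  have "(\<chi> i. ?D (0, axis i 1)) \<bullet> snd v = ?D (0, snd v)"
  proof (rule linear_coeff_inner)
    show "?D (0, x + y) = ?D (0, x) + ?D (0, y)" for x y
      using linear_add[OF assms, of "(0, x)" "(0, y)"] by simp
    show "?D (0, r *\<^sub>R x) = r * ?D (0, x)" for r x
      using linear_cmul[OF assms, of r "(0, x)"] by simp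
  qed
  moreover have "(\<chi> i. ?D (axis i 1, 0)) \<bullet> fst v = ?D (fst v, 0)"
  proof (rule linear_coeff_inner)
    show "?D (x + y, 0) = ?D (x, 0) + ?D (y, 0)" for x y
      using linear_add[OF assms, of "(x, 0)" "(y, 0)"] by simp
    show "?D (r *\<^sub>R x, 0) = r * ?D (x, 0)" for r x
      using linear_cmul[OF assms, of r "(x, 0)"] by simp
  qed
  moreover have "?D v = ?D (fst v, 0) + ?D (0, snd v)"
    using linear_add[OF assms, of "(fst v, 0)" "(0, snd v)"] by simp
  moreover have "fst v \<bullet> (\<chi> i. - ?D (axis i 1, 0)) = - ((\<chi> i. ?D (axis i 1, 0)) \<bullet> fst v)"
    by (simp add: inner_vec_def sum_negf mult.commute)
  ultimately show ?thesis by (simp add: omega0_def symplectic_gradient_def)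
qed

lemma omega0_nondegenerate:
  assumes "\<And>v. omega0 u v = omega0 w v"
  shows "u = w"
proof (rule prod_eqI)
  show "fst u = fst w"
    using assms[of "(0, _)"] by (intro inner_vec_eqI) (simp add: omega0_def)
  show "snd u = snd w"
    using assms[of "(_, 0)"] by (intro inner_vec_eqI) (simp add: omega0_def inner_commute)
qed

locale mechanical_system =
  fixes A :: "('q, real^'n) atlas" and g :: "('q, real^'n) metric" and V h :: "'q \<Rightarrow> real"
  assumes A: "smooth_atlas A" and g: "riemannian_metric A g"
    and V: "smooth_fun A V" and h: "smooth_fun A h"
    and regular: "\<And>q. q \<in> points A \<Longrightarrow> h q = 0 \<Longrightarrow> differential A h q \<noteq> (\<lambda>_. 0)"
begin

lemma metric_sym: "q \<in> points A \<Longrightarrow> u \<in> tangent_space A q \<Longrightarrow> v \<in> tangent_space A q \<Longrightarrow> g q u v = g q v u"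
  using g unfolding riemannian_metric_def by blast

lemma metric_lincomb: "q \<in> points A \<Longrightarrow> u \<in> tangent_space A q \<Longrightarrow> v \<in> tangent_space A q \<Longrightarrow> w \<in> tangent_space A q \<Longrightarrow>
    g q (lincomb a u b v) w = a * g q u w + b * g q v w"
  using g unfolding riemannian_metric_def by blast

lemma metric_pos: "q \<in> points A \<Longrightarrow> u \<in> tangent_space A q \<Longrightarrow> u \<noteq> (\<lambda>_. 0) \<Longrightarrow> g q u u > 0"
  using g unfolding riemannian_metric_def by blast

context
  fixes c assumes c: "c \<in> A"
begin

lemma chart_point: "q \<in> fst c \<Longrightarrow> q \<in> points A"
  using c by (auto simp: points_def)

lemma metric_coord_linear:
  assumes q: "q \<in> fst c" and w: "w \<in> tangent_space A q"
  shows "(\<chi> i. g q (coord_vec A c q (axis i 1)) w) \<bullet> u = g q (coord_vec A c q u) w"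
proof (rule linear_coeff_inner)
  note T = coord_vec_in_tangent_space[OF A c q]
  show "g q (coord_vec A c q (x + y)) w = g q (coord_vec A c q x) w + g q (coord_vec A c q y) w" for x y
    using coord_vec_lincomb[OF A c q, of 1 x 1 y] metric_lincomb[OF chart_point[OF q] T T w, of 1 x 1 y] by simp
  show "g q (coord_vec A c q (r *\<^sub>R x)) w = r * g q (coord_vec A c q x) w" for r x
    using coord_vec_lincomb[OF A c q, of r x 0 x] metric_lincomb[OF chart_point[OF q] T T w, of r x 0 x] by simp
qed

lemma metric_in_chart:
  assumes q: "q \<in> fst c" and u: "u \<in> tangent_space A q" and w: "w \<in> tangent_space A q"
  shows "g q u w = u c \<bullet> (metric_matrix A g c (snd c q) *v w c)"
proof -
  note T = coord_vec_in_tangent_space[OF A c q] and qp = chart_point[OF q]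
  have 1: "g q u w = u c \<bullet> (\<chi> i. g q (coord_vec A c q (axis i 1)) w)"
    using metric_coord_linear[OF q w, of "u c"] coord_vec_of_component[OF A u c q] by (simp add: inner_commute)
  have "g q (coord_vec A c q (axis i 1)) w = (metric_matrix A g c (snd c q) *v w c) $ i" for i
  proof -
    have "g q (coord_vec A c q (axis i 1)) w = g q (coord_vec A c q (w c)) (coord_vec A c q (axis i 1))"
      using metric_sym[OF qp T w] coord_vec_of_component[OF A w c q] by simp
    also have "\<dots> = (\<chi> j. g q (coord_vec A c q (axis j 1)) (coord_vec A c q (axis i 1))) \<bullet> w c"
      using metric_coord_linear[OF q T] by simp
    also have "\<dots> = (metric_matrix A g c (snd c q) *v w c) $ i"
      using metric_sym[OF qp T T, of _ "axis i 1"] chart_inv_left[OF A c q]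
      by (simp add: metric_matrix_def matrix_vector_mult_def inner_vec_def)
    finally show ?thesis .
  qed
  then show ?thesis unfolding 1 by (metis (no_types, lifting) vec_lambda_unique)
qed

lemma metric_matrix_sym:
  assumes q: "q \<in> fst c"
  shows "u \<bullet> (metric_matrix A g c (snd c q) *v w) = w \<bullet> (metric_matrix A g c (snd c q) *v u)"
  using metric_in_chart[OF q coord_vec_in_tangent_space[OF A c q] coord_vec_in_tangent_space[OF A c q]]
    metric_sym[OF chart_point[OF q] coord_vec_in_tangent_space[OF A c q] coord_vec_in_tangent_space[OF A c q]]
    coord_vec_component[OF A c q] by metis

lemma metric_matrix_pos:
  assumes q: "q \<in> fst c" and u: "u \<noteq> 0"
  shows "u \<bullet> (metric_matrix A g c (snd c q) *v u) > 0"
proof -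
  have "coord_vec A c q u \<noteq> (\<lambda>_. 0)" using coord_vec_component[OF A c q, of u] u by metis
  from metric_pos[OF chart_point[OF q] coord_vec_in_tangent_space[OF A c q] this]
  show ?thesis
    using metric_in_chart[OF q coord_vec_in_tangent_space[OF A c q] coord_vec_in_tangent_space[OF A c q], of u u]
      coord_vec_component[OF A c q] by simp
qed

lemma metric_matrix_invertible:
  assumes q: "q \<in> fst c"
  shows "invertible (metric_matrix A g c (snd c q))"
proof -
  have "u = 0" if "metric_matrix A g c (snd c q) *v u = 0" for u
    using metric_matrix_pos[OF q, of u] that by force
  then show ?thesis
    using matrix_left_invertible_ker[of "metric_matrix A g c (snd c q)"] invertible_left_inverse by blast
qed

lemma cometric_cancel:
  assumes q: "q \<in> fst c"
  shows "metric_matrix A g c (snd c q) *v (cometric A g c (snd c q) *v a) = a"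
    and "cometric A g c (snd c q) *v (metric_matrix A g c (snd c q) *v a) = a"
  using matrix_inv_cancel[OF metric_matrix_invertible[OF q]]
  by (simp_all add: cometric_def matrix_vector_mul_assoc)

lemma cometric_sym:
  assumes q: "q \<in> fst c"
  shows "a \<bullet> (cometric A g c (snd c q) *v b) = b \<bullet> (cometric A g c (snd c q) *v a)"
  using metric_matrix_sym[OF q, of "cometric A g c (snd c q) *v a" "cometric A g c (snd c q) *v b"]
  by (simp add: cometric_cancel(1)[OF q] inner_commute)

lemma cometric_pos:
  assumes q: "q \<in> fst c" and "a \<noteq> 0"
  shows "a \<bullet> (cometric A g c (snd c q) *v a) > 0"
proof -
  have "cometric A g c (snd c q) *v a \<noteq> 0" using cometric_cancel(1)[OF q, of a] assms(2) by auto
  from metric_matrix_pos[OF q this] show ?thesis by (simp add: cometric_cancel(1)[OF q] inner_commute)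
qed

lemma dvec_inner:
  assumes f: "smooth_fun A f" and q: "q \<in> fst c"
  shows "dvec c f (snd c q) \<bullet> u = frechet_derivative (f \<circ> chart_inv c) (at (snd c q)) u"
  unfolding dvec_def
  by (rule real_linear_axis_sum[OF has_derivative_linear[OF smooth_fun_has_derivative[OF A f c q]]])

lemma differential_dvec:
  assumes f: "smooth_fun A f" and q: "q \<in> fst c" and v: "v \<in> tangent_space A q"
  shows "differential A f q v = dvec c f (snd c q) \<bullet> v c"
  using differential_in_chart[OF A f c q v] dvec_inner[OF f q] by simp

text \<open>Inverting the Legendre transform means solving \<open>?G *v v = ?a\<close>; positive
  definiteness gives the unique solution \<open>?K *v ?a\<close>. Then \<open>p v\<close> is twice
  the kinetic energy.\<close>

lemma hamiltonian_in_chart: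
  assumes z: "z \<in> fst (cotangent_chart A c)"
  shows "hamiltonian A g V z = ham_chart A g V c (snd (cotangent_chart A c) z)"
proof -
  obtain q p where zqp: "z = (q, p)" by (metis surj_pair)
  have q: "q \<in> fst c" and p: "p \<in> cotangent_space A q" using z by (auto simp: zqp cotangent_chart_domain)
  let ?a = "momentum A c q p" and ?G = "metric_matrix A g c (snd c q)" and ?K = "cometric A g c (snd c q)"
  note T = coord_vec_in_tangent_space[OF A c q]
  let ?v = "coord_vec A c q (?K *v ?a)"
  have v1: "fiber_derivative A g q ?v = p"
  proof
    fix w
    show "fiber_derivative A g q ?v w = p w"
    proof (cases "w \<in> tangent_space A q")
      case True
      have "g q ?v w = w c \<bullet> ?a"
        using metric_in_chart[OF q True T, of "?K *v ?a"] metric_sym[OF chart_point[OF q] T True, of "?K *v ?a"]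
          coord_vec_component[OF A c q] cometric_cancel(1)[OF q] by simp
      then show ?thesis
        using True cotangent_apply[OF A c q p True] by (simp add: fiber_derivative_def inner_commute)
    next
      case False
      then show ?thesis using p unfolding fiber_derivative_def cotangent_space_def by auto
    qed
  qed
  have "(THE v. v \<in> tangent_space A q \<and> fiber_derivative A g q v = p) = ?v"
  proof (rule the_equality)
    show "?v \<in> tangent_space A q \<and> fiber_derivative A g q ?v = p" using T v1 by simp
    fix v assume v: "v \<in> tangent_space A q \<and> fiber_derivative A g q v = p"
    then have vT: "v \<in> tangent_space A q" and eq: "fiber_derivative A g q v = p" by auto
    have "?G *v v c = ?a"
    proof (rule inner_vec_eqI)
      fix u
      have "p (coord_vec A c q u) = g q v (coord_vec A c q u)"
        using T eq[symmetric] by (simp add: fiber_derivative_def)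
      also have "\<dots> = u \<bullet> (?G *v v c)"
        using metric_in_chart[OF q T vT, of u] metric_sym[OF chart_point[OF q] vT T, of u] coord_vec_component[OF A c q] by simp
      finally show "(?G *v v c) \<bullet> u = ?a \<bullet> u"
        using cotangent_apply[OF A c q p T, of u] coord_vec_component[OF A c q] by (simp add: inner_commute)
    qed
    then have "v c = ?K *v ?a" using cometric_cancel(2)[OF q, of "v c"] by simp
    then show "v = ?v" using coord_vec_of_component[OF A vT c q] by simp
  qed
  moreover have "p ?v = ?a \<bullet> (?K *v ?a)" using cotangent_apply[OF A c q p T] coord_vec_component[OF A c q] by simp
  moreover have "g q ?v ?v = ?a \<bullet> (?K *v ?a)"
    using metric_in_chart[OF q T T, of "?K *v ?a" "?K *v ?a"] coord_vec_component[OF A c q] cometric_cancel(1)[OF q]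
    by (simp add: inner_commute)
  ultimately show ?thesis
    using chart_inv_left[OF A c q]
    by (simp add: zqp hamiltonian_def natural_lagrangian_def ham_chart_def cotangent_chart_apply Let_def)
qed

section \<open>Hamiltonian, guard functions and reflection in one canonical chart\<close>

abbreviation "\<Omega> \<equiv> (snd c ` fst c) \<times> (UNIV :: (real^'n) set)"

lemma open_\<Omega>: "open \<Omega>"
  by (intro open_Times open_UNIV open_chart_image[OF A c])

lemma Ck_\<Omega>_fst: "smooth_on (snd c ` fst c) f \<Longrightarrow> Ck_on k \<Omega> (\<lambda>z. f (fst z))"
  by (rule Ck_on_compose[OF open_\<Omega> Ck_on_fst[OF open_\<Omega> Ck_on_ident[OF open_\<Omega>]] smooth_on_Ck]) auto

lemma Ck_cometric: "Ck_on k \<Omega> (\<lambda>z. cometric A g c (fst z) $ i $ j)"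
  unfolding cometric_def
proof (rule Ck_on_matrix_inv[OF open_\<Omega>])
  fix i j
  have "smooth_on (snd c ` fst c) (\<lambda>y. g (chart_inv c y) (coord_vec A c (chart_inv c y) u) (coord_vec A c (chart_inv c y) w))" for u w
    using g c unfolding riemannian_metric_def by blast
  from Ck_\<Omega>_fst[OF this]
  show "Ck_on k \<Omega> (\<lambda>z. metric_matrix A g c (fst z) $ i $ j)" by (simp add: metric_matrix_def)
next
  fix z assume "z \<in> \<Omega>" then show "invertible (metric_matrix A g c (fst z))" using metric_matrix_invertible by auto
qed

lemma Ck_cometric_mult:
  assumes f: "Ck_on k \<Omega> f"
  shows "Ck_on k \<Omega> (\<lambda>z. cometric A g c (fst z) *v f z)"
  unfolding matrix_vector_mult_def
  by (intro Ck_on_vec Ck_on_sum Ck_on_mult Ck_cometric Ck_on_nth[OF open_\<Omega> f] open_\<Omega>)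

lemma Ck_smooth_fun: "smooth_fun A f \<Longrightarrow> Ck_on k \<Omega> (\<lambda>z. f (chart_inv c (fst z)))"
  using Ck_\<Omega>_fst[of "f \<circ> chart_inv c"] c unfolding smooth_fun_def by simp

lemma Ck_dvec:
  assumes "smooth_fun A f"
  shows "Ck_on k \<Omega> (\<lambda>z. dvec c f (fst z))"
  unfolding dvec_def
  by (intro Ck_on_vec[OF open_\<Omega>] Ck_\<Omega>_fst smooth_on_deriv) (use assms c in \<open>auto simp: smooth_fun_def comp_def\<close>)

lemma Ck_ham_chart: "Ck_on k \<Omega> (ham_chart A g V c)"
proof -
  have "Ck_on k \<Omega> (\<lambda>z. (snd z \<bullet> (cometric A g c (fst z) *v snd z)) * (1/2) + V (chart_inv c (fst z)))"
    by (intro Ck_on_add Ck_on_mult Ck_on_inner Ck_cometric_mult Ck_smooth_fun V Ck_on_const Ck_on_snd Ck_on_ident open_\<Omega>)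
  then show ?thesis by (simp add: ham_chart_def[abs_def])
qed

lemma ham_chart_has_derivative:
  "z \<in> \<Omega> \<Longrightarrow> (ham_chart A g V c has_derivative frechet_derivative (ham_chart A g V c) (at z)) (at z)"
  using Ck_on_SucD(1)[OF Ck_ham_chart] .

abbreviation "XH \<equiv> symplectic_gradient (ham_chart A g V c)"

lemma Ck_XH: "Ck_on k \<Omega> XH"
  unfolding symplectic_gradient_def[abs_def]
  by (intro Ck_on_Pair Ck_on_vec Ck_on_minus Ck_on_SucD(2)[OF Ck_ham_chart] open_\<Omega>)

lemma omega0_XH: "z \<in> \<Omega> \<Longrightarrow> omega0 (XH z) v = frechet_derivative (ham_chart A g V c) (at z) v"
  by (rule omega0_symplectic_gradient[OF has_derivative_linear[OF ham_chart_has_derivative]])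

lemma fst_XH:
  assumes "z \<in> \<Omega>"
  shows "fst (XH z) = cometric A g c (fst z) *v snd z"
proof (rule inner_vec_eqI)
  fix b
  obtain q where q: "q \<in> fst c" "fst z = snd c q" using assms by auto
  let ?K = "cometric A g c (fst z)"
  have "((\<lambda>a. ham_chart A g V c (fst z, a)) has_derivative (\<lambda>b. frechet_derivative (ham_chart A g V c) (at z) (0, b))) (at (snd z))"
    by (rule has_derivative_compose[of "\<lambda>a. (fst z, a)" "\<lambda>b. (0, b)"])
       (use ham_chart_has_derivative[OF assms] in \<open>auto intro!: derivative_eq_intros\<close>)
  moreover have "((\<lambda>a. ham_chart A g V c (fst z, a)) has_derivative (\<lambda>b. (snd z \<bullet> (?K *v b) + b \<bullet> (?K *v snd z)) / 2)) (at (snd z))"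
    unfolding ham_chart_def fst_conv snd_conv
    by (rule derivative_eq_intros bounded_linear_imp_has_derivative matrix_vector_mul_bounded_linear refl | simp)+
  ultimately have "frechet_derivative (ham_chart A g V c) (at z) (0, b) = (snd z \<bullet> (?K *v b) + b \<bullet> (?K *v snd z)) / 2"
    by (metis (no_types, lifting) has_derivative_unique)
  also have "\<dots> = b \<bullet> (?K *v snd z)" using cometric_sym[OF q(1), of "snd z" b] q by simp
  finally show "fst (XH z) \<bullet> b = (?K *v snd z) \<bullet> b"
    using omega0_XH[OF assms, of "(0, b)"] by (simp add: omega0_def inner_commute)
qed

lemma gradient_in_chart:
  assumes q: "q \<in> fst c"
  shows "gradient A g h q \<in> tangent_space A q"
    and "gradient A g h q c = cometric A g c (snd c q) *v dvec c h (snd c q)"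
proof -
  note T = coord_vec_in_tangent_space[OF A c q]
  let ?K = "cometric A g c (snd c q)" and ?d = "dvec c h (snd c q)" and ?G = "metric_matrix A g c (snd c q)"
  have "gradient A g h q = coord_vec A c q (?K *v ?d)"
    unfolding gradient_def
  proof (rule the_equality)
    have "g q (coord_vec A c q (?K *v ?d)) w = differential A h q w" if w: "w \<in> tangent_space A q" for w
      using metric_in_chart[OF q w T, of "?K *v ?d"] metric_sym[OF chart_point[OF q] T w, of "?K *v ?d"]
        coord_vec_component[OF A c q] cometric_cancel(1)[OF q] differential_dvec[OF h q w] by (simp add: inner_commute)
    then show "coord_vec A c q (?K *v ?d) \<in> tangent_space A q \<and> (\<forall>w\<in>tangent_space A q. g q (coord_vec A c q (?K *v ?d)) w = differential A h q w)"
      using T by simp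
    fix u assume u: "u \<in> tangent_space A q \<and> (\<forall>w\<in>tangent_space A q. g q u w = differential A h q w)"
    then have uT: "u \<in> tangent_space A q" by simp
    have "?G *v u c = ?d"
    proof (rule inner_vec_eqI)
      fix b
      have "g q u (coord_vec A c q b) = ?d \<bullet> b"
        using u T differential_dvec[OF h q T] coord_vec_component[OF A c q] by simp
      then show "(?G *v u c) \<bullet> b = ?d \<bullet> b"
        using metric_in_chart[OF q T uT, of b] metric_sym[OF chart_point[OF q] uT T, of b] coord_vec_component[OF A c q]
        by (simp add: inner_commute)
    qed
    then have "u c = ?K *v ?d" using cometric_cancel(2)[OF q, of "u c"] by simp
    then show "u = coord_vec A c q (?K *v ?d)" using coord_vec_of_component[OF A uT c q] by simp
  qed
  then show "gradient A g h q \<in> tangent_space A q" "gradient A g h q c = ?K *v ?d"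
    using T coord_vec_component[OF A c q] by simp_all
qed

definition hE :: "(real^'n) \<times> (real^'n) \<Rightarrow> real" where "hE z = h (chart_inv c (fst z))"
text \<open>\<open>P(grad h)\<close> in coordinates; \<open>nE\<close> below is the squared length
  of the gradient of \<open>h\<close>.\<close>

definition PE :: "(real^'n) \<times> (real^'n) \<Rightarrow> real" where
  "PE z = snd z \<bullet> (cometric A g c (fst z) *v dvec c h (fst z))"
definition nE :: "(real^'n) \<times> (real^'n) \<Rightarrow> real" where
  "nE z = dvec c h (fst z) \<bullet> (cometric A g c (fst z) *v dvec c h (fst z))"
text \<open>The Lagrangian on phase space: kinetic minus potential energy is
  \<open>H - 2 V\<close>.\<close>

definition LE :: "(real^'n) \<times> (real^'n) \<Rightarrow> real" where
  "LE z = ham_chart A g V c z - 2 * V (chart_inv c (fst z))"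

abbreviation "RE \<equiv> refl_chart A g h c"

lemma Ck_hE: "Ck_on k \<Omega> hE" unfolding hE_def[abs_def] by (rule Ck_smooth_fun[OF h])

lemma Ck_PE: "Ck_on k \<Omega> PE"
  unfolding PE_def[abs_def] by (intro Ck_on_inner Ck_cometric_mult Ck_dvec h Ck_on_snd Ck_on_ident open_\<Omega>)

lemma Ck_nE: "Ck_on k \<Omega> nE"
  unfolding nE_def[abs_def] by (intro Ck_on_inner Ck_cometric_mult Ck_dvec h open_\<Omega>)

lemma Ck_LE: "Ck_on k \<Omega> LE"
  unfolding LE_def[abs_def] by (intro Ck_on_diff Ck_on_mult Ck_on_const Ck_ham_chart Ck_smooth_fun V open_\<Omega>)

lemma open_nE: "open {z \<in> \<Omega>. nE z \<noteq> 0}"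
proof -
  have "open (\<Omega> \<inter> nE -` (- {0}))"
    by (rule continuous_open_preimage[OF Ck_on_continuous[OF Ck_nE] open_\<Omega>]) auto
  moreover have "\<Omega> \<inter> nE -` (- {0}) = {z \<in> \<Omega>. nE z \<noteq> 0}" by auto
  ultimately show ?thesis by simp
qed

lemma Ck_RE: "Ck_on k {z \<in> \<Omega>. nE z \<noteq> 0} RE"
proof -
  let ?S = "{z \<in> \<Omega>. nE z \<noteq> 0}"
  have sub: "?S \<subseteq> \<Omega>" by blast
  note S = open_nE and sb = Ck_on_subset[OF _ sub]
  have "Ck_on k ?S (\<lambda>z. (fst z, snd z - (2 * (PE z / nE z)) *\<^sub>R dvec c h (fst z)))"
    by (intro Ck_on_Pair Ck_on_diff Ck_on_scaleR Ck_on_mult Ck_on_const Ck_on_divide S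
        Ck_on_fst Ck_on_snd Ck_on_ident sb[OF Ck_PE] sb[OF Ck_nE] sb[OF Ck_dvec[OF h]]) auto
  then show ?thesis unfolding refl_chart_def[abs_def] PE_def nE_def .
qed

lemma hE_derivative:
  assumes "z \<in> \<Omega>"
  shows "frechet_derivative hE (at z) v = dvec c h (fst z) \<bullet> fst v"
proof -
  obtain q where q: "q \<in> fst c" "fst z = snd c q" using assms by auto
  have "((\<lambda>z. (h \<circ> chart_inv c) (fst z)) has_derivative (\<lambda>v. frechet_derivative (h \<circ> chart_inv c) (at (fst z)) (fst v))) (at z)"
    by (rule has_derivative_compose[OF has_derivative_fst[OF has_derivative_ident]])
       (simp only: q(2) smooth_fun_has_derivative[OF A h c q(1)])
  then have "frechet_derivative hE (at z) = (\<lambda>v. frechet_derivative (h \<circ> chart_inv c) (at (fst z)) (fst v))"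
    unfolding hE_def[abs_def] comp_def by (rule frechet_derivative_eqI)
  then show ?thesis using dvec_inner[OF h q(1), of "fst v"] q by simp
qed

text \<open>\<open>P(grad h)\<close> is the rate of change of \<open>h\<close> along
  \<open>X_H\<close>. Hence its sign gives the direction in which the level set is crossed, and its
  zeros on the level set are the tangencies.\<close>

lemma PE_eq:
  assumes "z \<in> \<Omega>"
  shows "PE z = frechet_derivative hE (at z) (XH z)"
proof -
  obtain q where q: "q \<in> fst c" "fst z = snd c q" using assms by auto
  show ?thesis using cometric_sym[OF q(1), of "snd z" "dvec c h (fst z)"] q
    by (simp add: hE_derivative[OF assms] fst_XH[OF assms] PE_def)
qed

lemma LE_eq: "z \<in> \<Omega> \<Longrightarrow> LE z = snd z \<bullet> fst (XH z) - ham_chart A g V c z"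
  by (simp add: LE_def fst_XH ham_chart_def)

lemma nE_pos:
  assumes z: "z \<in> \<Omega>" and "hE z = 0"
  shows "nE z > 0" "dvec c h (fst z) \<noteq> 0"
proof -
  obtain q where q: "q \<in> fst c" "fst z = snd c q" using z by auto
  have "h q = 0" using assms(2) chart_inv_left[OF A c q(1)] q by (simp add: hE_def)
  then obtain v where v: "differential A h q v \<noteq> 0" using regular[OF chart_point[OF q(1)]] by (auto simp: fun_eq_iff)
  then have "v \<in> tangent_space A q" unfolding differential_def Let_def by metis
  then show "dvec c h (fst z) \<noteq> 0" using v differential_dvec[OF h q(1)] q by force
  from cometric_pos[OF q(1) this] show "nE z > 0" using q by (simp add: nE_def)
qed

text \<open>\<open>RE\<close> reflects the momentum along \<open>dh\<close> in the cometric. A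
  reflection is an isometric involution, so kinetic energy is preserved and the component along
  \<open>dh\<close>, measured by \<open>PE\<close>, changes sign. The last item displays the
  momentum jump as a multiple of \<open>dh\<close>.\<close>

lemma RE_props:
  assumes z: "z \<in> \<Omega>" and "hE z = 0"
  shows "RE z \<in> \<Omega>" "fst (RE z) = fst z" "hE (RE z) = 0" "PE (RE z) = - PE z" "RE (RE z) = z"
    "ham_chart A g V c (RE z) = ham_chart A g V c z" "LE (RE z) = LE z"
    "snd (RE z) \<bullet> fst (XH (RE z)) = snd z \<bullet> fst (XH z)"
    "(snd (RE z) - snd z) \<bullet> \<xi> = (- 2 * PE z / nE z) * frechet_derivative hE (at z) (\<xi>, 0)"
proof -
  obtain q where q: "q \<in> fst c" "fst z = snd c q" using z by auto
  let ?d = "dvec c h (fst z)" and ?K = "cometric A g c (fst z)"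
  define l where "l = 2 * (PE z / nE z)"
  have n: "nE z \<noteq> 0" using nE_pos[OF assms] by simp
  have R: "RE z = (fst z, snd z - l *\<^sub>R ?d)" by (simp add: refl_chart_def l_def PE_def nE_def)
  show fR: "fst (RE z) = fst z" by (simp add: R)
  show RO: "RE z \<in> \<Omega>" using z by (auto simp: R)
  show "hE (RE z) = 0" using assms(2) by (simp add: hE_def fR)
  have nR: "nE (RE z) = nE z" by (simp add: nE_def fR)
  have "PE (RE z) = PE z - l * nE z" by (simp add: PE_def nE_def R inner_diff_left)
  then show PR: "PE (RE z) = - PE z" using n by (simp add: l_def)
  have RR: "RE (RE z) = (fst z, snd (RE z) - (2 * (PE (RE z) / nE (RE z))) *\<^sub>R ?d)"
    unfolding refl_chart_def[of A g h c "RE z"] fR PE_def[of "RE z"] nE_def[of "RE z"] by simp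
  show "RE (RE z) = z" unfolding RR PR nR by (simp add: R l_def prod_eq_iff)
  have K: "snd (RE z) \<bullet> (?K *v snd (RE z)) = snd z \<bullet> (?K *v snd z)"
  proof -
    have "snd (RE z) \<bullet> (?K *v snd (RE z)) = snd z \<bullet> (?K *v snd z) - l * (snd z \<bullet> (?K *v ?d)) - l * (?d \<bullet> (?K *v snd z)) + l * l * (?d \<bullet> (?K *v ?d))"
      by (simp add: R matrix_vector_mult_diff_distrib matrix_vector_mult_scaleR inner_diff_left inner_diff_right algebra_simps)
    also have "?d \<bullet> (?K *v snd z) = PE z" using cometric_sym[OF q(1), of "snd z" ?d] q by (simp add: PE_def)
    also have "snd z \<bullet> (?K *v ?d) = PE z" by (simp add: PE_def)
    also have "?d \<bullet> (?K *v ?d) = nE z" by (simp add: nE_def)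
    finally show ?thesis using n by (simp add: l_def)
  qed
  show H: "ham_chart A g V c (RE z) = ham_chart A g V c z" unfolding ham_chart_def fR K ..
  show "LE (RE z) = LE z" unfolding LE_def H fR ..
  show "snd (RE z) \<bullet> fst (XH (RE z)) = snd z \<bullet> fst (XH z)" unfolding fst_XH[OF z] fst_XH[OF RO] fR K ..
  show "(snd (RE z) - snd z) \<bullet> \<xi> = (- 2 * PE z / nE z) * frechet_derivative hE (at z) (\<xi>, 0)"
    by (simp add: hE_derivative[OF z] R l_def)
qed

end

section \<open>Coordinate expressions of the Hamiltonian vector field, the guard and the
  reset\<close>

lemma smooth_fun_hamiltonian: "smooth_fun (cotangent_atlas A) (hamiltonian A g V)"
  unfolding smooth_fun_def
proof
  fix C assume "C \<in> cotangent_atlas A"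
  then obtain c where c: "c \<in> A" and C: "C = cotangent_chart A c" by (auto simp: cotangent_atlas_def)
  have "Ck_on k (snd C ` fst C) (hamiltonian A g V \<circ> chart_inv C)" for k
    unfolding C cotangent_chart_image[OF A c]
  proof (rule Ck_on_cong[OF open_\<Omega>[OF c] _ Ck_ham_chart[OF c]])
    fix z assume "z \<in> (snd c ` fst c) \<times> (UNIV :: (real^'n) set)"
    then have x: "fst z \<in> snd c ` fst c" by auto
    show "ham_chart A g V c z = (hamiltonian A g V \<circ> chart_inv (cotangent_chart A c)) z"
      using hamiltonian_in_chart[OF c cotangent_chart_preimage(1)[OF A c x, of "snd z"]]
        cotangent_chart_preimage(2,3)[OF A c x, of "snd z"] by simp
  qed
  then show "smooth_on (snd C ` fst C) (hamiltonian A g V \<circ> chart_inv C)" by (simp add: smooth_on_def)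
qed

text \<open>Nondegeneracy of \<open>omega0\<close> makes the defining equation of the field uniquely
  solvable, and Hamilton's equations give the solution.\<close>

lemma vector_field_in_chart:
  assumes c: "c \<in> A" and z: "z \<in> fst (cotangent_chart A c)"
  shows "hamiltonian_vector_field A (hamiltonian A g V) z (cotangent_chart A c)
       = symplectic_gradient (ham_chart A g V c) (snd (cotangent_chart A c) z)"
proof -
  let ?B = "cotangent_atlas A" and ?C = "cotangent_chart A c"
  note B = smooth_cotangent_atlas[OF A]
  have C: "?C \<in> ?B" using c by (auto simp: cotangent_atlas_def)
  let ?X = "symplectic_gradient (ham_chart A g V c) (snd ?C z)"
  let ?u = "coord_vec ?B ?C z ?X"
  note T = coord_vec_in_tangent_space[OF B C z]
  have \<kappa>: "snd ?C z \<in> (snd c ` fst c) \<times> UNIV" using z cotangent_chart_image[OF A c] by blast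
  have eqH: "frechet_derivative (hamiltonian A g V \<circ> chart_inv ?C) (at (snd ?C z)) = frechet_derivative (ham_chart A g V c) (at (snd ?C z))"
  proof (rule frechet_derivative_eqI, rule has_derivative_transform_within_open[OF ham_chart_has_derivative[OF c \<kappa>] open_\<Omega>[OF c] \<kappa>])
    fix z assume "z \<in> (snd c ` fst c) \<times> (UNIV :: (real^'n) set)"
    then have x: "fst z \<in> snd c ` fst c" by auto
    show "ham_chart A g V c z = (hamiltonian A g V \<circ> chart_inv (cotangent_chart A c)) z"
      using hamiltonian_in_chart[OF c cotangent_chart_preimage(1)[OF A c x, of "snd z"]]
        cotangent_chart_preimage(2,3)[OF A c x, of "snd z"] by simp
  qed
  have dH: "differential ?B (hamiltonian A g V) z v = omega0 ?X (v ?C)" if "v \<in> tangent_space ?B z" for v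
    using differential_in_chart[OF B smooth_fun_hamiltonian C z that] omega0_XH[OF c \<kappa>] eqH by simp
  have sf: "symplectic_form A z (case_nat u (\<lambda>_. v)) = omega0 (u ?C) (v ?C)"
    if "u \<in> tangent_space ?B z" "v \<in> tangent_space ?B z" for u v
    using symplectic_form_in_chart[OF A C z, of "case_nat u (\<lambda>_. v)"] that by simp
  have "hamiltonian_vector_field A (hamiltonian A g V) z = ?u"
    unfolding hamiltonian_vector_field_def
  proof (rule the_equality)
    show "?u \<in> tangent_space ?B z \<and> (\<forall>v\<in>tangent_space ?B z. symplectic_form A z (case_nat ?u (\<lambda>_. v)) = differential ?B (hamiltonian A g V) z v)"
      using T sf[OF T] dH coord_vec_component[OF B C z] by simp
    fix u assume u: "u \<in> tangent_space ?B z \<and> (\<forall>v\<in>tangent_space ?B z. symplectic_form A z (case_nat u (\<lambda>_. v)) = differential ?B (hamiltonian A g V) z v)"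
    have "u ?C = ?X"
    proof (rule omega0_nondegenerate)
      fix v show "omega0 (u ?C) v = omega0 ?X v"
        using u T[of v] sf[OF _ T[of v], of u] dH[OF T[of v]] coord_vec_component[OF B C z, of v] by simp
    qed
    then show "u = ?u" using coord_vec_of_component[OF B _ C z, of u] u by simp
  qed
  then show ?thesis using coord_vec_component[OF B C z] by simp
qed

lemma guard_in_chart:
  assumes c: "c \<in> A" and z: "z \<in> fst (cotangent_chart A c)"
  shows "snd z (gradient A g h (fst z)) = PE c (snd (cotangent_chart A c) z)"
    and "h (fst z) = hE c (snd (cotangent_chart A c) z)"
proof -
  obtain q p where zqp: "z = (q, p)" by (metis surj_pair)
  have q: "q \<in> fst c" and p: "p \<in> cotangent_space A q" using z by (auto simp: zqp cotangent_chart_domain)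
  show "snd z (gradient A g h (fst z)) = PE c (snd (cotangent_chart A c) z)"
    using cotangent_apply[OF A c q p gradient_in_chart(1)[OF c q]] gradient_in_chart(2)[OF c q]
    by (simp add: zqp PE_def[OF c] cotangent_chart_apply)
  show "h (fst z) = hE c (snd (cotangent_chart A c) z)"
    using chart_inv_left[OF A c q] by (simp add: zqp hE_def[OF c] cotangent_chart_apply)
qed

lemma impact_map_in_chart:
  assumes c: "c \<in> A" and z: "z \<in> fst (cotangent_chart A c)"
  shows "impact_map A g h z \<in> fst (cotangent_chart A c)"
    and "snd (cotangent_chart A c) (impact_map A g h z) = refl_chart A g h c (snd (cotangent_chart A c) z)"
proof -
  obtain q p where zqp: "z = (q, p)" by (metis surj_pair)
  have q: "q \<in> fst c" and p: "p \<in> cotangent_space A q" using z by (auto simp: zqp cotangent_chart_domain)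
  let ?n = "gradient A g h q" and ?d = "dvec c h (snd c q)" and ?K = "cometric A g c (snd c q)" and ?a = "momentum A c q p"
  define l where "l = 2 * (p ?n / g q ?n ?n)"
  note nT = gradient_in_chart(1)[OF c q] and nc = gradient_in_chart(2)[OF c q]
  have pn: "p ?n = ?a \<bullet> (?K *v ?d)" using cotangent_apply[OF A c q p nT] nc by simp
  have gn: "g q ?n ?n = ?d \<bullet> (?K *v ?d)"
    using metric_in_chart[OF c q nT nT] nc cometric_cancel(1)[OF c q] by (simp add: inner_commute)
  have imp: "impact_map A g h z = (q, covec A c q (?a - l *\<^sub>R ?d))"
  proof -
    have "p v - l * differential A h q v = covec A c q (?a - l *\<^sub>R ?d) v" for v
    proof (cases "v \<in> tangent_space A q")
      case True
      then show ?thesis using cotangent_apply[OF A c q p True] differential_dvec[OF c h q True]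
        by (simp add: covec_def inner_diff_left)
    next
      case False
      then have "p v = 0" "differential A h q v = 0" using p by (auto simp: cotangent_space_def differential_def Let_def)
      then show ?thesis using False by (simp add: covec_def)
    qed
    then show ?thesis by (simp add: zqp impact_map_def Let_def l_def fun_eq_iff)
  qed
  show "impact_map A g h z \<in> fst (cotangent_chart A c)"
    unfolding imp cotangent_chart_domain using q covec_in_cotangent_space[OF A c q] by simp
  show "snd (cotangent_chart A c) (impact_map A g h z) = refl_chart A g h c (snd (cotangent_chart A c) z)"
    unfolding imp by (simp add: zqp cotangent_chart_apply momentum_covec[OF A c q] refl_chart_def l_def pn gn)
qed

end

section \<open>Integral curves\<close>

text \<open>The equation is required only in the interior, with continuity up to the ends: the ends
  may be impact times, where a hybrid trajectory has only one-sided limits.\<close>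

definition flowline :: "('d::real_normed_vector \<Rightarrow> 'd) \<Rightarrow> real \<Rightarrow> real \<Rightarrow> (real \<Rightarrow> 'd) \<Rightarrow> bool" where
  "flowline X a b \<zeta> \<longleftrightarrow> a \<le> b \<and> continuous_on {a..b} \<zeta> \<and>
     (\<forall>s\<in>{a<..<b}. (\<zeta> has_vector_derivative X (\<zeta> s)) (at s))"

lemma flowline_le: "flowline X a b \<zeta> \<Longrightarrow> a \<le> b"
  and flowline_cont: "flowline X a b \<zeta> \<Longrightarrow> continuous_on {a..b} \<zeta>"
  and flowline_deriv: "flowline X a b \<zeta> \<Longrightarrow> a < s \<Longrightarrow> s < b \<Longrightarrow> (\<zeta> has_vector_derivative X (\<zeta> s)) (at s)"
  by (auto simp: flowline_def)

lemma flowline_sub: "flowline X a b \<zeta> \<Longrightarrow> a \<le> a' \<Longrightarrow> a' \<le> b' \<Longrightarrow> b' \<le> b \<Longrightarrow> flowline X a' b' \<zeta>"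
  by (auto simp: flowline_def intro: continuous_on_subset)

lemma increment_bound:
  fixes f :: "real \<Rightarrow> 'd::real_inner"
  assumes "a \<le> b" "continuous_on {a..b} f"
    and "\<And>s. a < s \<Longrightarrow> s < b \<Longrightarrow> (f has_vector_derivative f' s) (at s)"
    and "\<And>s. a < s \<Longrightarrow> s < b \<Longrightarrow> norm (f' s) \<le> M"
  shows "norm (f b - f a) \<le> M * (b - a)"
proof (cases "a < b")
  case True
  have "\<exists>x\<in>{a<..<b}. norm (f b - f a) \<le> norm ((b - a) *\<^sub>R f' x)"
    by (rule mvt_general[OF True assms(2), of "\<lambda>x h. h *\<^sub>R f' x"])
       (use assms(3) in \<open>auto simp: has_vector_derivative_def\<close>)
  then obtain x where x: "a < x" "x < b" "norm (f b - f a) \<le> norm ((b - a) *\<^sub>R f' x)" by auto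
  have "norm ((b - a) *\<^sub>R f' x) \<le> M * (b - a)"
    using mult_left_mono[OF assms(4)[OF x(1,2)], of "b - a"] assms(1) by (simp add: mult.commute)
  with x(3) show ?thesis by linarith
qed (use assms(1) in auto)

lemma flowline_increment:
  fixes \<zeta> :: "real \<Rightarrow> 'd::real_inner"
  assumes "flowline X a b \<zeta>" "a \<le> r" "r \<le> s" "s \<le> b" "\<And>s. s \<in> {a..b} \<Longrightarrow> norm (X (\<zeta> s)) \<le> M"
  shows "norm (\<zeta> s - \<zeta> r) \<le> M * (s - r)"
  by (rule increment_bound[OF assms(3) flowline_cont[OF flowline_sub[OF assms(1-4)]]
        flowline_deriv[OF flowline_sub[OF assms(1-4)]]]) (use assms in auto)

text \<open>The squared distance \<open>f\<close> satisfies
  \<open>\<bar>f'\<bar> \<le> 2 * B * f\<close>, which bounds both its growth and its decay. The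
  bound backwards in time is the later source of injectivity.\<close>

lemma gronwall:
  fixes \<zeta> \<zeta>' :: "real \<Rightarrow> 'd::real_inner"
  assumes \<zeta>: "flowline X a b \<zeta>" "\<zeta> ` {a..b} \<subseteq> S" and \<zeta>': "flowline X a b \<zeta>'" "\<zeta>' ` {a..b} \<subseteq> S"
    and B: "B \<ge> 0" "\<And>z z'. z \<in> S \<Longrightarrow> z' \<in> S \<Longrightarrow> norm (X z' - X z) \<le> B * norm (z' - z)"
  shows "norm (\<zeta>' b - \<zeta> b) \<le> exp (B * (b - a)) * norm (\<zeta>' a - \<zeta> a)"
    and "norm (\<zeta>' a - \<zeta> a) \<le> exp (B * (b - a)) * norm (\<zeta>' b - \<zeta> b)"
proof -
  define f where "f s = (\<zeta>' s - \<zeta> s) \<bullet> (\<zeta>' s - \<zeta> s)" for s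
  define f' where "f' s = 2 * ((\<zeta>' s - \<zeta> s) \<bullet> (X (\<zeta>' s) - X (\<zeta> s)))" for s
  have ab: "a \<le> b" using flowline_le[OF \<zeta>(1)] .
  have f0: "f s \<ge> 0" for s unfolding f_def by simp
  have df: "(f has_real_derivative f' s) (at s)" if "a < s" "s < b" for s
  proof -
    have "((\<lambda>s. \<zeta>' s - \<zeta> s) has_derivative (\<lambda>h. h *\<^sub>R (X (\<zeta>' s) - X (\<zeta> s)))) (at s)"
      using has_vector_derivative_diff[OF flowline_deriv[OF \<zeta>'(1) that] flowline_deriv[OF \<zeta>(1) that]]
      by (simp add: has_vector_derivative_def)
    from has_derivative_inner[OF this this] show ?thesis
      unfolding f_def[abs_def] f'_def has_field_derivative_def
      by (rule has_derivative_eq_rhs) (auto simp: fun_eq_iff inner_commute algebra_simps)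
  qed
  have f'b: "\<bar>f' s\<bar> \<le> 2 * B * f s" if "a < s" "s < b" for s
  proof -
    have "\<bar>f' s\<bar> \<le> 2 * (norm (\<zeta>' s - \<zeta> s) * norm (X (\<zeta>' s) - X (\<zeta> s)))"
      unfolding f'_def using Cauchy_Schwarz_ineq2[of "\<zeta>' s - \<zeta> s" "X (\<zeta>' s) - X (\<zeta> s)"] by (simp add: abs_mult)
    also have "\<dots> \<le> 2 * (norm (\<zeta>' s - \<zeta> s) * (B * norm (\<zeta>' s - \<zeta> s)))"
      using that \<zeta>(2) \<zeta>'(2) by (intro mult_left_mono B(2)) auto
    finally show ?thesis unfolding f_def by (simp add: dot_square_norm power2_eq_square mult_ac)
  qed
  have cf: "continuous_on {a..b} f"
    unfolding f_def[abs_def] by (intro continuous_intros flowline_cont[OF \<zeta>(1)] flowline_cont[OF \<zeta>'(1)])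
  have "f b * exp (- (2 * B) * b) \<le> f a * exp (- (2 * B) * a)"
  proof (rule DERIV_nonpos_imp_decreasing_open[OF ab])
    fix s assume s: "a < s" "s < b"
    have "((\<lambda>s. f s * exp (- (2 * B) * s)) has_real_derivative (f' s * exp (- (2 * B) * s) + f s * (exp (- (2 * B) * s) * - (2 * B)))) (at s)"
      by (auto intro!: derivative_eq_intros df[OF s])
    moreover have "f' s * exp (- (2 * B) * s) + f s * (exp (- (2 * B) * s) * - (2 * B)) = (f' s - 2 * B * f s) * exp (- (2 * B) * s)"
      by (simp add: algebra_simps)
    moreover have "(f' s - 2 * B * f s) * exp (- (2 * B) * s) \<le> 0"
      using f'b[OF s] by (intro mult_nonpos_nonneg) auto
    ultimately show "\<exists>y. ((\<lambda>s. f s * exp (- (2 * B) * s)) has_real_derivative y) (at s) \<and> y \<le> 0" by metis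
  qed (intro continuous_intros cf)
  then have "(f b * exp (- (2 * B) * b)) * exp (2 * B * b) \<le> (f a * exp (- (2 * B) * a)) * exp (2 * B * b)"
    by (intro mult_right_mono) auto
  then have 1: "f b \<le> f a * exp (2 * B * (b - a))" by (simp add: exp_minus exp_diff right_diff_distrib field_simps)
  have "f a * exp ((2 * B) * a) \<le> f b * exp ((2 * B) * b)"
  proof (rule DERIV_nonneg_imp_increasing_open[OF ab])
    fix s assume s: "a < s" "s < b"
    have "((\<lambda>s. f s * exp ((2 * B) * s)) has_real_derivative (f' s * exp ((2 * B) * s) + f s * (exp ((2 * B) * s) * (2 * B)))) (at s)"
      by (auto intro!: derivative_eq_intros df[OF s])
    moreover have "f' s * exp ((2 * B) * s) + f s * (exp ((2 * B) * s) * (2 * B)) = (f' s + 2 * B * f s) * exp ((2 * B) * s)"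
      by (simp add: algebra_simps)
    moreover have "(f' s + 2 * B * f s) * exp ((2 * B) * s) \<ge> 0"
      using f'b[OF s] by (intro mult_nonneg_nonneg) auto
    ultimately show "\<exists>y. ((\<lambda>s. f s * exp ((2 * B) * s)) has_real_derivative y) (at s) \<and> y \<ge> 0" by metis
  qed (intro continuous_intros cf)
  then have 2: "f a \<le> f b * exp (2 * B * (b - a))" by (simp add: exp_diff right_diff_distrib field_simps)
  have e2: "exp (2 * B * (b - a)) = (exp (B * (b - a)))\<^sup>2" by (simp add: exp_double[symmetric] mult_ac)
  have fn: "f s = (norm (\<zeta>' s - \<zeta> s))\<^sup>2" for s unfolding f_def by (simp add: dot_square_norm)
  show "norm (\<zeta>' b - \<zeta> b) \<le> exp (B * (b - a)) * norm (\<zeta>' a - \<zeta> a)"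
    by (rule power2_le_imp_le) (use 1[unfolded e2 fn] in \<open>auto simp: power_mult_distrib mult.commute\<close>)
  show "norm (\<zeta>' a - \<zeta> a) \<le> exp (B * (b - a)) * norm (\<zeta>' b - \<zeta> b)"
    by (rule power2_le_imp_le) (use 2[unfolded e2 fn] in \<open>auto simp: power_mult_distrib mult.commute\<close>)
qed

text \<open>Strict differentiability: the single linear map at \<open>z0\<close> approximates the
  increment between any two nearby points. It serves to compare two flow lines that both pass beside
  \<open>z0\<close>.\<close>

lemma Ck1_strict_derivative:
  fixes f :: "'d::euclidean_space \<Rightarrow> 'e::real_normed_vector"
  assumes T: "open T" "z0 \<in> T" and f: "Ck_on 1 T f" and e: "e > 0"
  shows "\<exists>\<rho>>0. cball z0 \<rho> \<subseteq> T \<and> (\<forall>z\<in>cball z0 \<rho>. \<forall>z'\<in>cball z0 \<rho>.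
    norm (f z' - f z - frechet_derivative f (at z0) (z' - z)) \<le> e * norm (z' - z))"
proof -
  have f1: "Ck_on (Suc 0) T f" using f by simp
  \<comment> \<open>Each basis direction receives the share \<open>e / n\<close> of the
    error.\<close>
  define n where "n = real DIM('d) + 1"
  have n: "n > 0" unfolding n_def by simp
  have "\<exists>d>0. \<forall>z\<in>T. dist z z0 < d \<longrightarrow> dist (frechet_derivative f (at z) b) (frechet_derivative f (at z0) b) < e / n" for b
    using Ck_on_SucD(2)[OF f1, of b] T(2) e n unfolding Ck_on.simps(1) continuous_on_iff by simp
  then obtain d where d: "\<And>b. d b > 0"
    "\<And>b z. z \<in> T \<Longrightarrow> dist z z0 < d b \<Longrightarrow> norm (frechet_derivative f (at z) b - frechet_derivative f (at z0) b) < e / n"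
    unfolding dist_norm by metis
  obtain r where r: "r > 0" "cball z0 r \<subseteq> T" using T open_contains_cball by blast
  define \<rho> where "\<rho> = min r (Min (d ` Basis) / 2)"
  have m: "Min (d ` Basis) > 0" using d(1) by (subst Min_gr_iff) auto
  have \<rho>: "\<rho> > 0" using r m unfolding \<rho>_def by simp
  have sub: "cball z0 \<rho> \<subseteq> T" using r(2) unfolding \<rho>_def by auto
  have db: "dist z z0 < d b" if "z \<in> cball z0 \<rho>" "b \<in> Basis" for z b
  proof -
    have "dist z z0 \<le> Min (d ` Basis) / 2" using that(1) unfolding \<rho>_def by (auto simp: dist_commute)
    also have "\<dots> < Min (d ` Basis)" using m by simp
    also have "\<dots> \<le> d b" using that(2) by auto
    finally show ?thesis .
  qed
  have l0: "linear (frechet_derivative f (at z))" if "z \<in> T" for z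
    using Ck_on_SucD(1)[OF f1 that] has_derivative_linear by blast
  have bound: "norm (frechet_derivative f (at z) u - frechet_derivative f (at z0) u) \<le> e * norm u" if z: "z \<in> cball z0 \<rho>" for z u
  proof -
    have "frechet_derivative f (at z) u - frechet_derivative f (at z0) u
       = (\<Sum>b\<in>Basis. (u \<bullet> b) *\<^sub>R (frechet_derivative f (at z) b - frechet_derivative f (at z0) b))"
      using linear_basis_sum[OF l0[of z], of u] linear_basis_sum[OF l0[OF T(2)], of u] z sub
      by (simp add: scaleR_diff_right sum_subtractf subset_iff)
    also have "norm \<dots> \<le> (\<Sum>b\<in>(Basis::'d set). e / n * norm u)"
    proof (rule order_trans[OF norm_sum sum_mono])
      fix b :: 'd assume b: "b \<in> Basis"
      have "\<bar>u \<bullet> b\<bar> * norm (frechet_derivative f (at z) b - frechet_derivative f (at z0) b) \<le> norm u * (e / n)"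
        using Basis_le_norm[OF b, of u] d(2)[of z b] db[OF z b] z sub e by (intro mult_mono) auto
      then show "norm ((u \<bullet> b) *\<^sub>R (frechet_derivative f (at z) b - frechet_derivative f (at z0) b)) \<le> e / n * norm u"
        by (simp add: mult_ac)
    qed
    also have "\<dots> = (real DIM('d) / n) * (e * norm u)" by simp
    also have "\<dots> \<le> 1 * (e * norm u)" using n e unfolding n_def by (intro mult_right_mono) auto
    finally show ?thesis by simp
  qed
  have bl: "bounded_linear (frechet_derivative f (at z0))"
    using Ck_on_SucD(1)[OF f1 T(2)] has_derivative_bounded_linear by blast
  have "norm (f z' - f z - frechet_derivative f (at z0) (z' - z)) \<le> e * norm (z' - z)"
    if z: "z \<in> cball z0 \<rho>" "z' \<in> cball z0 \<rho>" for z z'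
  proof -
    let ?g = "\<lambda>z. f z - frechet_derivative f (at z0) z"
    have "norm (?g z' - ?g z) \<le> e * norm (z' - z)"
      by (rule differentiable_bound[OF convex_cball has_derivative_at_withinI[OF has_derivative_diff[OF Ck_on_SucD(1)[OF f1] bounded_linear_imp_has_derivative[OF bl]]] onorm_le])
         (use bound z sub in auto)
    then show ?thesis unfolding linear_diff[OF l0[OF T(2)]] by (simp add: algebra_simps)
  qed
  with \<rho> sub show ?thesis by blast
qed

section \<open>Local analysis in a canonical chart\<close>

text \<open>In canonical coordinates \<open>hf\<close>, \<open>P\<close>, \<open>Lg\<close>, \<open>Hm\<close> stand for \<open>h\<close>, \<open>P(\<nabla>h)\<close>, \<open>L\<close>, \<open>H\<close> and \<open>R\<close> for the
  impact map, so that \<open>p\<^sup>+ - p\<^sup>- = lam dh\<close>.\<close>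

locale impact_chart =
  fixes D :: "((real^'n) \<times> (real^'n)) set" and X :: "(real^'n) \<times> (real^'n) \<Rightarrow> (real^'n) \<times> (real^'n)"
    and hf P Lg Hm :: "(real^'n) \<times> (real^'n) \<Rightarrow> real"
    and R :: "(real^'n) \<times> (real^'n) \<Rightarrow> (real^'n) \<times> (real^'n)" and DR :: "((real^'n) \<times> (real^'n)) set"
    and lam :: "(real^'n) \<times> (real^'n) \<Rightarrow> real"
  assumes D: "open D" and CkX: "Ck_on 1 D X" and Ckh: "Ck_on 2 D hf" and CkP: "Ck_on 1 D P"
    and CkL: "Ck_on 1 D Lg" and CkH: "Ck_on 2 D Hm"
    and P_eq: "\<And>z. z \<in> D \<Longrightarrow> P z = frechet_derivative hf (at z) (X z)"
    and hf_vertical: "\<And>z b. z \<in> D \<Longrightarrow> frechet_derivative hf (at z) (0, b) = 0"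
    and omega: "\<And>z v. z \<in> D \<Longrightarrow> omega0 (X z) v = frechet_derivative Hm (at z) v"
    and Lg_eq: "\<And>z. z \<in> D \<Longrightarrow> Lg z = snd z \<bullet> fst (X z) - Hm z"
    and DR: "open DR" "DR \<subseteq> D" "\<And>z. z \<in> D \<Longrightarrow> hf z = 0 \<Longrightarrow> z \<in> DR" "Ck_on 1 DR R" "continuous_on DR lam"
    and R: "\<And>z. z \<in> D \<Longrightarrow> hf z = 0 \<Longrightarrow> R z \<in> D" "\<And>z. z \<in> D \<Longrightarrow> hf z = 0 \<Longrightarrow> fst (R z) = fst z"
      "\<And>z. z \<in> D \<Longrightarrow> hf z = 0 \<Longrightarrow> hf (R z) = 0" "\<And>z. z \<in> D \<Longrightarrow> hf z = 0 \<Longrightarrow> P (R z) = - P z"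
      "\<And>z. z \<in> D \<Longrightarrow> hf z = 0 \<Longrightarrow> R (R z) = z" "\<And>z. z \<in> D \<Longrightarrow> hf z = 0 \<Longrightarrow> Lg (R z) = Lg z"
      "\<And>z. z \<in> D \<Longrightarrow> hf z = 0 \<Longrightarrow> snd (R z) \<bullet> fst (X (R z)) = snd z \<bullet> fst (X z)"
      "\<And>z \<xi>. z \<in> D \<Longrightarrow> hf z = 0 \<Longrightarrow> (snd (R z) - snd z) \<bullet> \<xi> = lam z * frechet_derivative hf (at z) (\<xi>, 0)"
    and nondeg: "\<And>z. z \<in> D \<Longrightarrow> hf z = 0 \<Longrightarrow> \<exists>v. frechet_derivative hf (at z) v \<noteq> 0"
begin

text \<open>One constant for all local estimates on \<open>S\<close>. The last clause is the
  infinitesimal first variation formula: along two integral curves, the difference of the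
  Lagrangians is the time derivative of momentum times displacement, up to a quadratic
  error.\<close>

definition box :: "((real^'n) \<times> (real^'n)) set \<Rightarrow> real \<Rightarrow> bool" where
  "box S B \<longleftrightarrow> S \<subseteq> D \<and> B \<ge> 1 \<and> (\<forall>z\<in>S. norm z \<le> B \<and> norm (X z) \<le> B) \<and>
     (\<forall>z\<in>S. \<forall>z'\<in>S. norm (X z' - X z) \<le> B * norm (z' - z) \<and> \<bar>hf z' - hf z\<bar> \<le> B * norm (z' - z) \<and>
        \<bar>P z' - P z\<bar> \<le> B * norm (z' - z) \<and> \<bar>Lg z' - Lg z\<bar> \<le> B * norm (z' - z) \<and>
        \<bar>hf z' - hf z - frechet_derivative hf (at z) (z' - z)\<bar> \<le> B * (norm (z' - z))\<^sup>2 \<and>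
        \<bar>Lg z' - Lg z - snd (X z) \<bullet> (fst z' - fst z) - snd z \<bullet> (fst (X z') - fst (X z))\<bar> \<le> B * (norm (z' - z))\<^sup>2)"

lemma boxD:
  assumes "box S B"
  shows "S \<subseteq> D" "B \<ge> 1" "\<And>z. z \<in> S \<Longrightarrow> norm z \<le> B" "\<And>z. z \<in> S \<Longrightarrow> norm (X z) \<le> B"
    "\<And>z z'. z \<in> S \<Longrightarrow> z' \<in> S \<Longrightarrow> norm (X z' - X z) \<le> B * norm (z' - z)"
    "\<And>z z'. z \<in> S \<Longrightarrow> z' \<in> S \<Longrightarrow> \<bar>hf z' - hf z\<bar> \<le> B * norm (z' - z)"
    "\<And>z z'. z \<in> S \<Longrightarrow> z' \<in> S \<Longrightarrow> \<bar>P z' - P z\<bar> \<le> B * norm (z' - z)"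
    "\<And>z z'. z \<in> S \<Longrightarrow> z' \<in> S \<Longrightarrow> \<bar>Lg z' - Lg z\<bar> \<le> B * norm (z' - z)"
    "\<And>z z'. z \<in> S \<Longrightarrow> z' \<in> S \<Longrightarrow> \<bar>hf z' - hf z - frechet_derivative hf (at z) (z' - z)\<bar> \<le> B * (norm (z' - z))\<^sup>2"
    "\<And>z z'. z \<in> S \<Longrightarrow> z' \<in> S \<Longrightarrow> \<bar>Lg z' - Lg z - snd (X z) \<bullet> (fst z' - fst z) - snd z \<bullet> (fst (X z') - fst (X z))\<bar> \<le> B * (norm (z' - z))\<^sup>2"
  using assms unfolding box_def by blast+

lemma box_mono:
  assumes b: "box S B" and le: "B \<le> B'" "S' \<subseteq> S"
  shows "box S' B'"
proof -
  have m: "x \<le> B * y \<Longrightarrow> 0 \<le> y \<Longrightarrow> x \<le> B' * y" for x y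
    by (meson le(1) mult_right_mono order_trans)
  have 1: "norm z \<le> B'" "norm (X z) \<le> B'" if "z \<in> S" for z
    using boxD(3,4)[OF b that] le by auto
  show ?thesis
    unfolding box_def
    using boxD[OF b] le 1 by (auto intro!: m[OF boxD(5)[OF b]] m[OF boxD(6)[OF b]] m[OF boxD(7)[OF b]] m[OF boxD(8)[OF b]] m[OF boxD(9)[OF b]] m[OF boxD(10)[OF b]])
qed

lemma box_exists:
  assumes S: "compact S" "convex S" "S \<subseteq> D"
  shows "\<exists>B. box S B"
proof -
  obtain B1 where B1: "\<And>z. z \<in> S \<Longrightarrow> norm z \<le> B1" using compact_imp_bounded[OF S(1)] by (auto simp: bounded_iff)
  obtain B2 where B2: "\<And>z. z \<in> S \<Longrightarrow> norm (X z) \<le> B2"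
    using compact_imp_bounded[OF compact_continuous_image[OF continuous_on_subset[OF Ck_on_continuous[OF CkX] S(3)] S(1)]]
    by (auto simp: bounded_iff)
  obtain B3 where B3: "B3 > 0" "\<And>z z'. z \<in> S \<Longrightarrow> z' \<in> S \<Longrightarrow> norm (X z' - X z) \<le> B3 * norm (z' - z)"
    using Ck1_lipschitz[OF S CkX] by blast
  obtain B4 where B4: "B4 > 0" "\<And>z z'. z \<in> S \<Longrightarrow> z' \<in> S \<Longrightarrow> \<bar>hf z' - hf z\<bar> \<le> B4 * norm (z' - z)"
    using Ck1_lipschitz[OF S Ck_on_le[OF Ckh, of 1]] by auto
  obtain B5 where B5: "B5 > 0" "\<And>z z'. z \<in> S \<Longrightarrow> z' \<in> S \<Longrightarrow> \<bar>P z' - P z\<bar> \<le> B5 * norm (z' - z)"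
    using Ck1_lipschitz[OF S CkP] by auto
  obtain B6 where B6: "B6 > 0" "\<And>z z'. z \<in> S \<Longrightarrow> z' \<in> S \<Longrightarrow> \<bar>Lg z' - Lg z\<bar> \<le> B6 * norm (z' - z)"
    using Ck1_lipschitz[OF S CkL] by auto
  obtain B7 where B7: "B7 > 0" "\<And>z z'. z \<in> S \<Longrightarrow> z' \<in> S \<Longrightarrow> \<bar>hf z' - hf z - frechet_derivative hf (at z) (z' - z)\<bar> \<le> B7 * (norm (z' - z))\<^sup>2"
    using Ck2_taylor[OF S D Ckh] by auto
  obtain B8 where B8: "B8 > 0" "\<And>z z'. z \<in> S \<Longrightarrow> z' \<in> S \<Longrightarrow> \<bar>Hm z' - Hm z - frechet_derivative Hm (at z) (z' - z)\<bar> \<le> B8 * (norm (z' - z))\<^sup>2"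
    using Ck2_taylor[OF S D CkH] by auto
  \<comment> \<open>Inserting \<open>L = p \<bullet> q' - H\<close> and Hamilton's equations cancels
    all terms of first order. What remains is a product of two increments and the Taylor remainder
    of \<open>H\<close>.\<close>
  have B9: "\<bar>Lg z' - Lg z - snd (X z) \<bullet> (fst z' - fst z) - snd z \<bullet> (fst (X z') - fst (X z))\<bar> \<le> (B3 + B8) * (norm (z' - z))\<^sup>2"
    if z: "z \<in> S" "z' \<in> S" for z z'
  proof -
    let ?d = "z' - z"
    have zD: "z \<in> D" "z' \<in> D" using z S(3) by auto
    have "Lg z' - Lg z - snd (X z) \<bullet> (fst z' - fst z) - snd z \<bullet> (fst (X z') - fst (X z))
        = snd ?d \<bullet> (fst (X z') - fst (X z)) - (Hm z' - Hm z - frechet_derivative Hm (at z) ?d)"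
      unfolding Lg_eq[OF zD(1)] Lg_eq[OF zD(2)] omega[OF zD(1), symmetric] omega0_def
      by (simp add: inner_diff_left inner_diff_right inner_commute algebra_simps)
    moreover have "\<bar>snd ?d \<bullet> (fst (X z') - fst (X z))\<bar> \<le> norm ?d * (B3 * norm ?d)"
    proof -
      have "\<bar>snd ?d \<bullet> (fst (X z') - fst (X z))\<bar> \<le> norm (snd ?d) * norm (fst (X z' - X z))"
        using Cauchy_Schwarz_ineq2 by simp
      also have "\<dots> \<le> norm ?d * norm (X z' - X z)"
        by (intro mult_mono norm_fst_le norm_snd_le) (metis norm_snd_le prod.collapse, metis norm_fst_le prod.collapse, auto)
      also have "\<dots> \<le> norm ?d * (B3 * norm ?d)" using B3(2)[OF z] by (intro mult_left_mono) auto
      finally show ?thesis .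
    qed
    ultimately show ?thesis using B8(2)[OF z] by (simp add: power2_eq_square algebra_simps)
  qed
  define B where "B = 1 + \<bar>B1\<bar> + \<bar>B2\<bar> + B3 + B4 + B5 + B6 + B7 + B8"
  have le: "1 \<le> B" "B1 \<le> B" "B2 \<le> B" "B3 \<le> B" "B4 \<le> B" "B5 \<le> B" "B6 \<le> B" "B7 \<le> B" "B3 + B8 \<le> B"
    unfolding B_def using B3 B4 B5 B6 B7 B8 by linarith+
  have m: "x \<le> C * y \<Longrightarrow> C \<le> B \<Longrightarrow> 0 \<le> y \<Longrightarrow> x \<le> B * y" for x C y
    by (meson mult_right_mono order_trans)
  have "box S B" unfolding box_def
  proof (intro conjI ballI)
    fix z z' assume z: "z \<in> S" "z' \<in> S"
    show "norm (X z' - X z) \<le> B * norm (z' - z)" by (rule m[OF B3(2)[OF z] le(4)]) simp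
    show "\<bar>hf z' - hf z\<bar> \<le> B * norm (z' - z)" by (rule m[OF B4(2)[OF z] le(5)]) simp
    show "\<bar>P z' - P z\<bar> \<le> B * norm (z' - z)" by (rule m[OF B5(2)[OF z] le(6)]) simp
    show "\<bar>Lg z' - Lg z\<bar> \<le> B * norm (z' - z)" by (rule m[OF B6(2)[OF z] le(7)]) simp
    show "\<bar>hf z' - hf z - frechet_derivative hf (at z) (z' - z)\<bar> \<le> B * (norm (z' - z))\<^sup>2" by (rule m[OF B7(2)[OF z] le(8)]) simp
    show "\<bar>Lg z' - Lg z - snd (X z) \<bullet> (fst z' - fst z) - snd z \<bullet> (fst (X z') - fst (X z))\<bar> \<le> B * (norm (z' - z))\<^sup>2"
      by (rule m[OF B9[OF z] le(9)]) simp
    show "norm z \<le> B" "norm (X z) \<le> B" using B1[OF z(1)] B2[OF z(1)] le by auto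
  qed (use S(3) le in auto)
  then show ?thesis ..
qed

lemma hf_flowline_derivative:
  assumes \<zeta>: "flowline X a b \<zeta>" "\<zeta> ` {a..b} \<subseteq> D" and s: "a < s" "s < b"
  shows "((\<lambda>s. hf (\<zeta> s)) has_real_derivative P (\<zeta> s)) (at s)"
proof -
  have zD: "\<zeta> s \<in> D" using \<zeta>(2) s by auto
  have dh: "(hf has_derivative frechet_derivative hf (at (\<zeta> s))) (at (\<zeta> s))"
    using Ck_on_SucD(1)[of 1 D hf] Ckh zD by (simp add: numeral_2_eq_2)
  have "((\<lambda>s. hf (\<zeta> s)) has_derivative (\<lambda>t. frechet_derivative hf (at (\<zeta> s)) (t *\<^sub>R X (\<zeta> s)))) (at s)"
    by (rule has_derivative_compose[of \<zeta> "\<lambda>t. t *\<^sub>R X (\<zeta> s)" s UNIV hf "frechet_derivative hf (at (\<zeta> s))", OF _ dh]) (use flowline_deriv[OF \<zeta>(1) s] in \<open>simp add: has_vector_derivative_def\<close>)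
  then show ?thesis
    using linear_cmul[OF has_derivative_linear[OF dh]] P_eq[OF zD]
    by (simp add: has_field_derivative_def mult_commute_abs)
qed

lemma hf_flowline_cont:
  "flowline X a b \<zeta> \<Longrightarrow> \<zeta> ` {a..b} \<subseteq> D \<Longrightarrow> continuous_on {a..b} (\<lambda>s. hf (\<zeta> s))"
  using continuous_on_compose2[OF Ck_on_continuous[OF Ckh] flowline_cont] by blast

text \<open>Together with \<open>hf_decrease\<close> this is transversality in quantitative form: a
  one-sided bound on \<open>P\<close> is a rate at which the level set is left or
  approached.\<close>

lemma hf_increase:
  assumes \<zeta>: "flowline X a b \<zeta>" "\<zeta> ` {a..b} \<subseteq> D" and P: "\<And>s. s \<in> {a..b} \<Longrightarrow> P (\<zeta> s) \<ge> k"
    and s: "a \<le> r" "r \<le> s" "s \<le> b"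
  shows "hf (\<zeta> s) - hf (\<zeta> r) \<ge> k * (s - r)"
proof -
  have "hf (\<zeta> r) - k * r \<le> hf (\<zeta> s) - k * s"
  proof (rule DERIV_nonneg_imp_increasing_open[OF s(2)])
    fix x assume x: "r < x" "x < s"
    then have x': "a < x" "x < b" using s by auto
    have "((\<lambda>s. hf (\<zeta> s) - k * s) has_real_derivative (P (\<zeta> x) - k)) (at x)"
      by (auto intro!: derivative_eq_intros hf_flowline_derivative[OF \<zeta> x'])
    then show "\<exists>y. ((\<lambda>s. hf (\<zeta> s) - k * s) has_real_derivative y) (at x) \<and> y \<ge> 0"
      using P[of x] x' by (intro exI[of _ "P (\<zeta> x) - k"]) auto
  qed (intro continuous_intros continuous_on_subset[OF hf_flowline_cont[OF \<zeta>]], use s in auto)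
  then show ?thesis by (simp add: algebra_simps)
qed

lemma hf_decrease:
  assumes \<zeta>: "flowline X a b \<zeta>" "\<zeta> ` {a..b} \<subseteq> D" and P: "\<And>s. s \<in> {a..b} \<Longrightarrow> P (\<zeta> s) \<le> - k"
    and s: "a \<le> r" "r \<le> s" "s \<le> b"
  shows "hf (\<zeta> r) - hf (\<zeta> s) \<ge> k * (s - r)"
proof -
  have "hf (\<zeta> r) + k * r \<ge> hf (\<zeta> s) + k * s"
  proof (rule DERIV_nonpos_imp_decreasing_open[OF s(2)])
    fix x assume x: "r < x" "x < s"
    then have x': "a < x" "x < b" using s by auto
    have "((\<lambda>s. hf (\<zeta> s) + k * s) has_real_derivative (P (\<zeta> x) + k)) (at x)"
      by (auto intro!: derivative_eq_intros hf_flowline_derivative[OF \<zeta> x'])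
    then show "\<exists>y. ((\<lambda>s. hf (\<zeta> s) + k * s) has_real_derivative y) (at x) \<and> y \<le> 0"
      using P[of x] x' by (intro exI[of _ "P (\<zeta> x) + k"]) auto
  qed (intro continuous_intros continuous_on_subset[OF hf_flowline_cont[OF \<zeta>]], use s in auto)
  then show ?thesis by (simp add: algebra_simps)
qed

lemma Lg_flowline_cont:
  "flowline X a b \<zeta> \<Longrightarrow> \<zeta> ` {a..b} \<subseteq> D \<Longrightarrow> continuous_on {a..b} (\<lambda>s. Lg (\<zeta> s))"
  using continuous_on_compose2[OF Ck_on_continuous[OF CkL] flowline_cont] by blast

text \<open>The first variation formula on a stretch without impact. \<open>F\<close> is the
  difference of the actions minus the boundary term at the moving end. Its derivative is the
  quadratic defect from \<open>box\<close>, and Gronwall's bound reduces this to the initial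
  distance; length at most 1 keeps the factor below \<open>exp B\<close>.\<close>

lemma action_regular:
  assumes b: "box S B" and \<zeta>: "flowline X a b \<zeta>" "\<zeta> ` {a..b} \<subseteq> S" and \<zeta>': "flowline X a b \<zeta>'" "\<zeta>' ` {a..b} \<subseteq> S"
    and ab: "b - a \<le> 1"
  shows "\<bar>integral {a..b} (\<lambda>s. Lg (\<zeta>' s)) - integral {a..b} (\<lambda>s. Lg (\<zeta> s))
     - snd (\<zeta> b) \<bullet> (fst (\<zeta>' b) - fst (\<zeta> b)) + snd (\<zeta> a) \<bullet> (fst (\<zeta>' a) - fst (\<zeta> a))\<bar>
     \<le> B * (exp B * norm (\<zeta>' a - \<zeta> a))\<^sup>2"
proof -
  define F where "F s = integral {a..s} (\<lambda>s. Lg (\<zeta>' s)) - integral {a..s} (\<lambda>s. Lg (\<zeta> s))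
     - snd (\<zeta> s) \<bullet> (fst (\<zeta>' s) - fst (\<zeta> s))" for s
  have le: "a \<le> b" using flowline_le[OF \<zeta>(1)] .
  have SD: "S \<subseteq> D" and B1: "B \<ge> 1" using boxD[OF b] by auto
  note c = Lg_flowline_cont[OF \<zeta>(1) order_trans[OF \<zeta>(2) SD]] and c' = Lg_flowline_cont[OF \<zeta>'(1) order_trans[OF \<zeta>'(2) SD]]
  note k = flowline_cont[OF \<zeta>(1)] and k' = flowline_cont[OF \<zeta>'(1)]
  define F' where "F' s = Lg (\<zeta>' s) - Lg (\<zeta> s) - (snd (X (\<zeta> s)) \<bullet> (fst (\<zeta>' s) - fst (\<zeta> s)) + snd (\<zeta> s) \<bullet> (fst (X (\<zeta>' s)) - fst (X (\<zeta> s))))" for s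
  have "norm (F b - F a) \<le> (B * (exp B * norm (\<zeta>' a - \<zeta> a))\<^sup>2) * (b - a)"
  proof (rule increment_bound[OF le, of F F'])
    show "continuous_on {a..b} F"
      unfolding F_def[abs_def]
      by (intro continuous_intros indefinite_integral_continuous_1 integrable_continuous_real c c' k k')
    fix s assume s: "a < s" "s < b"
    have I: "((\<lambda>u. integral {a..u} f) has_vector_derivative f s) (at s)" if "continuous_on {a..b} f" for f :: "real \<Rightarrow> real"
      using integral_has_vector_derivative[OF that, of s] s at_within_Icc_at[OF s] by simp
    have d: "(\<zeta> has_derivative (\<lambda>h. h *\<^sub>R X (\<zeta> s))) (at s)" "(\<zeta>' has_derivative (\<lambda>h. h *\<^sub>R X (\<zeta>' s))) (at s)"
      using flowline_deriv[OF \<zeta>(1) s] flowline_deriv[OF \<zeta>'(1) s] by (simp_all add: has_vector_derivative_def)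
    have "((\<lambda>s. snd (\<zeta> s) \<bullet> (fst (\<zeta>' s) - fst (\<zeta> s))) has_vector_derivative
        (snd (X (\<zeta> s)) \<bullet> (fst (\<zeta>' s) - fst (\<zeta> s)) + snd (\<zeta> s) \<bullet> (fst (X (\<zeta>' s)) - fst (X (\<zeta> s))))) (at s)"
      unfolding has_vector_derivative_def
      by (rule has_derivative_eq_rhs[OF has_derivative_inner[OF has_derivative_snd[OF d(1)] has_derivative_diff[OF has_derivative_fst[OF d(2)] has_derivative_fst[OF d(1)]]]])
         (auto simp: fun_eq_iff algebra_simps inner_diff_right)
    then show "(F has_vector_derivative F' s) (at s)"
      unfolding F_def[abs_def] F'_def by (intro has_vector_derivative_diff I c c')
    have z: "\<zeta> s \<in> S" "\<zeta>' s \<in> S" using \<zeta>(2) \<zeta>'(2) s by auto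
    have g: "norm (\<zeta>' s - \<zeta> s) \<le> exp B * norm (\<zeta>' a - \<zeta> a)"
    proof -
      have "norm (\<zeta>' s - \<zeta> s) \<le> exp (B * (s - a)) * norm (\<zeta>' a - \<zeta> a)"
        by (rule gronwall(1)[of X a s \<zeta> S \<zeta>'])
           (use \<zeta> \<zeta>' s B1 boxD(5)[OF b] in \<open>auto intro: flowline_sub\<close>)
      also have "\<dots> \<le> exp B * norm (\<zeta>' a - \<zeta> a)"
        using s ab B1 by (intro mult_right_mono) (auto intro: mult_left_le)
      finally show ?thesis .
    qed
    have "norm (F' s) \<le> B * (norm (\<zeta>' s - \<zeta> s))\<^sup>2"
      using boxD(10)[OF b z] unfolding F'_def by (simp add: algebra_simps)
    also have "\<dots> \<le> B * (exp B * norm (\<zeta>' a - \<zeta> a))\<^sup>2"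
      using g B1 by (intro mult_left_mono power_mono) auto
    finally show "norm (F' s) \<le> B * (exp B * norm (\<zeta>' a - \<zeta> a))\<^sup>2" .
  qed
  also have "\<dots> \<le> B * (exp B * norm (\<zeta>' a - \<zeta> a))\<^sup>2"
    using ab B1 le by (intro mult_left_le) auto
  finally show ?thesis by (simp add: F_def algebra_simps)
qed

end

section \<open>First variation of the action across one impact\<close>

lemma flowline_increment_linear:
  fixes \<zeta> :: "real \<Rightarrow> 'd::real_inner"
  assumes \<zeta>: "flowline X a b \<zeta>" and M: "\<And>s. s \<in> {a..b} \<Longrightarrow> norm (X (\<zeta> s) - v) \<le> M"
  shows "norm (\<zeta> b - \<zeta> a - (b - a) *\<^sub>R v) \<le> M * (b - a)"
proof -
  have "norm ((\<zeta> b - b *\<^sub>R v) - (\<zeta> a - a *\<^sub>R v)) \<le> M * (b - a)"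
  proof (rule increment_bound[OF flowline_le[OF \<zeta>], of "\<lambda>s. \<zeta> s - s *\<^sub>R v" "\<lambda>s. X (\<zeta> s) - v"])
    show "continuous_on {a..b} (\<lambda>s. \<zeta> s - s *\<^sub>R v)" by (intro continuous_intros flowline_cont[OF \<zeta>])
    fix s assume s: "a < s" "s < b"
    show "((\<lambda>s. \<zeta> s - s *\<^sub>R v) has_vector_derivative X (\<zeta> s) - v) (at s)"
      by (auto intro!: derivative_eq_intros flowline_deriv[OF \<zeta> s])
  qed (use M in auto)
  then show ?thesis by (simp add: algebra_simps)
qed

lemma norm_fst_le_norm: "norm (fst z) \<le> norm z"
  using norm_fst_le[of "fst z" "snd z"] by simp

lemma norm_snd_le_norm: "norm (snd z) \<le> norm z"
  using norm_snd_le[of "snd z" "fst z"] by simp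

context impact_chart
begin

text \<open>\<open>S0\<close> holds incoming and \<open>S1\<close> outgoing states. The rate
  \<open>k\<close> makes every crossing uniformly transversal, so impact times depend on the state
  in a Lipschitz way.\<close>

definition impact_boxes :: "((real^'n) \<times> (real^'n)) set \<Rightarrow> ((real^'n) \<times> (real^'n)) set \<Rightarrow> real \<Rightarrow> real \<Rightarrow> bool" where
  "impact_boxes S0 S1 B k \<longleftrightarrow> box S0 B \<and> box S1 B \<and> k > 0 \<and> (\<forall>z\<in>S0. P z \<le> - k) \<and> (\<forall>z\<in>S1. P z \<ge> k) \<and>
     (\<forall>z\<in>S0. \<forall>z'\<in>S0. norm (R z' - R z) \<le> B * norm (z' - z)) \<and> (\<forall>z\<in>S0. \<bar>lam z\<bar> \<le> B)"

text \<open>A piece of hybrid trajectory with one impact, cut at the impact time \<tau> into the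
  incoming part \<zeta> and the outgoing part \<open>\<zeta>p\<close>, which starts at the
  post-impact state.\<close>

definition broken :: "((real^'n) \<times> (real^'n)) set \<Rightarrow> ((real^'n) \<times> (real^'n)) set \<Rightarrow> real \<Rightarrow> real \<Rightarrow> real \<Rightarrow>
    (real \<Rightarrow> (real^'n) \<times> (real^'n)) \<Rightarrow> (real \<Rightarrow> (real^'n) \<times> (real^'n)) \<Rightarrow> bool" where
  "broken S0 S1 a \<tau> b \<zeta> \<zeta>p \<longleftrightarrow> flowline X a \<tau> \<zeta> \<and> flowline X \<tau> b \<zeta>p \<and> \<zeta> ` {a..\<tau>} \<subseteq> S0 \<and> \<zeta>p ` {\<tau>..b} \<subseteq> S1 \<and>
     hf (\<zeta> \<tau>) = 0 \<and> \<zeta>p \<tau> = R (\<zeta> \<tau>)"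

definition broken_action :: "real \<Rightarrow> real \<Rightarrow> real \<Rightarrow> (real \<Rightarrow> (real^'n) \<times> (real^'n)) \<Rightarrow> (real \<Rightarrow> (real^'n) \<times> (real^'n)) \<Rightarrow> real" where
  "broken_action a \<tau> b \<zeta> \<zeta>p = integral {a..\<tau>} (\<lambda>s. Lg (\<zeta> s)) + integral {\<tau>..b} (\<lambda>s. Lg (\<zeta>p s))"

text \<open>The impact points of the two trajectories differ by a first-order amount tangent to the level set,
  up to a quadratic error, so the momentum jump does not contribute to the first variation of the
  action. Between the two impact times the trajectories run on opposite sides of the impact; there
  the Lagrangians agree up to first order because the impact preserves energy.\<close>

lemma broken_pair_ordered:
  assumes bx: "impact_boxes S0 S1 B k" and br: "broken S0 S1 a \<tau> b \<zeta> \<zeta>p" and br': "broken S0 S1 a \<tau>' b \<zeta>' \<zeta>p'"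
    and ab: "b - a \<le> 1" and \<tau>: "\<tau> \<le> \<tau>'"
    and K: "K = exp B" and t1: "t1 = B * K / k" and k2: "k2 = B * t1 + K" and k3: "k3 = B * k2 + B * t1"
  shows "norm (\<zeta>p' b - \<zeta>p b) \<le> K * k3 * norm (\<zeta>' a - \<zeta> a)"
    and "\<zeta>p' b = \<zeta>p b \<Longrightarrow> \<zeta>' a = \<zeta> a"
    and "\<bar>broken_action a \<tau>' b \<zeta>' \<zeta>p' - broken_action a \<tau> b \<zeta> \<zeta>p
      - snd (\<zeta>p b) \<bullet> (fst (\<zeta>p' b) - fst (\<zeta>p b)) + snd (\<zeta> a) \<bullet> (fst (\<zeta>' a) - fst (\<zeta> a))\<bar>
      \<le> (B * K\<^sup>2 + B * (K * k3)\<^sup>2 + t1 * (B * k2 + B * B * t1) + B * (B * k2\<^sup>2) + B * (B * k2 * t1) + B * (B * B * t1 * t1) + B * t1 * k3) * (norm (\<zeta>' a - \<zeta> a))\<^sup>2"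
proof -
  note bxD = bx[unfolded impact_boxes_def]
  have b0: "box S0 B" and b1: "box S1 B" and k: "k > 0" and P0: "\<And>z. z \<in> S0 \<Longrightarrow> P z \<le> - k" and P1: "\<And>z. z \<in> S1 \<Longrightarrow> P z \<ge> k"
    and RL: "\<And>z z'. z \<in> S0 \<Longrightarrow> z' \<in> S0 \<Longrightarrow> norm (R z' - R z) \<le> B * norm (z' - z)" and lamB: "\<And>z. z \<in> S0 \<Longrightarrow> \<bar>lam z\<bar> \<le> B"
    using bxD by auto
  have f: "flowline X a \<tau> \<zeta>" "flowline X \<tau> b \<zeta>p" "\<zeta> ` {a..\<tau>} \<subseteq> S0" "\<zeta>p ` {\<tau>..b} \<subseteq> S1" "hf (\<zeta> \<tau>) = 0" "\<zeta>p \<tau> = R (\<zeta> \<tau>)"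
    and f': "flowline X a \<tau>' \<zeta>'" "flowline X \<tau>' b \<zeta>p'" "\<zeta>' ` {a..\<tau>'} \<subseteq> S0" "\<zeta>p' ` {\<tau>'..b} \<subseteq> S1" "hf (\<zeta>' \<tau>') = 0" "\<zeta>p' \<tau>' = R (\<zeta>' \<tau>')"
    using br br' unfolding broken_def by auto
  \<comment> \<open>In units of \<delta>: \<open>K\<close> bounds the distance up to the first of
    the two impacts, \<open>t1\<close> the delay between them, \<open>k2\<close> the distance of
    \<zeta>' from the impact state \<open>\<zeta> \<tau>\<close> during the delay, and
    \<open>k3\<close> the distance just after the second impact.\<close>
  define \<delta> where "\<delta> = norm (\<zeta>' a - \<zeta> a)"
  define T where "T = \<tau>' - \<tau>"
  have B1: "B \<ge> 1" using boxD(2)[OF b0] .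
  have K1: "K \<ge> 1" using B1 by (simp add: K)
  have \<delta>0: "\<delta> \<ge> 0" by (simp add: \<delta>_def)
  have T0: "T \<ge> 0" using \<tau> by (simp add: T_def)
  have t10: "t1 \<ge> 0" unfolding t1 using B1 K1 k by simp
  have k20: "k2 \<ge> 0" unfolding k2 using t10 B1 K1 by simp
  have k30: "k3 \<ge> 0" unfolding k3 using t10 k20 B1 by simp
  have le: "a \<le> \<tau>" "\<tau>' \<le> b" using flowline_le[OF f(1)] flowline_le[OF f'(2)] by auto
  have S0D: "S0 \<subseteq> D" and S1D: "S1 \<subseteq> D" using boxD(1) b0 b1 by auto
  have eK: "exp (B * r) \<le> K" if "r \<le> 1" for r
    unfolding K using that B1 by (simp add: mult_left_le)
  have f'1: "flowline X a \<tau> \<zeta>'" and f'2: "flowline X \<tau> \<tau>' \<zeta>'" using flowline_sub[OF f'(1)] le \<tau> by auto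
  have f1: "flowline X \<tau> \<tau>' \<zeta>p" and f2: "flowline X \<tau>' b \<zeta>p" using flowline_sub[OF f(2)] le \<tau> by auto
  have i'1: "\<zeta>' ` {a..\<tau>} \<subseteq> S0" using f'(3) \<tau> by auto
  have m0: "\<zeta>' s \<in> S0" and m1: "\<zeta>p s \<in> S1" if "s \<in> {\<tau>..\<tau>'}" for s
    using f'(3) f(4) le that by (auto simp: image_subset_iff)
  have m0D: "\<zeta>' ` {\<tau>..\<tau>'} \<subseteq> D" and m1D: "\<zeta>p ` {\<tau>..\<tau>'} \<subseteq> D" using m0 m1 S0D S1D by blast+
  have i2: "\<zeta>p ` {\<tau>'..b} \<subseteq> S1" using f(4) \<tau> by auto
  have in0: "\<zeta> \<tau> \<in> S0" "\<zeta>' \<tau> \<in> S0" "\<zeta>' \<tau>' \<in> S0" and in1: "\<zeta>p \<tau> \<in> S1" "\<zeta>p \<tau>' \<in> S1" "\<zeta>p' \<tau>' \<in> S1"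
    using f(3,4) f'(3,4) le \<tau> by (auto simp del: f(6) f'(6))
  have d1: "norm (\<zeta>' \<tau> - \<zeta> \<tau>) \<le> K * \<delta>"
    using gronwall(1)[OF f(1,3) f'1 i'1, of B] boxD(5)[OF b0] B1 eK[of "\<tau> - a"] le \<tau> ab \<delta>0
      mult_right_mono[OF eK[of "\<tau> - a"], of \<delta>] unfolding \<delta>_def by force
  \<comment> \<open>At time \<tau> the later trajectory has \<open>hf\<close> at most
    \<open>B * K * \<delta>\<close>, since \<open>\<zeta> \<tau>\<close> lies on the level set. From
    there it descends to zero at rate at least \<open>k\<close>.\<close>
  have T1: "T \<le> t1 * \<delta>"
  proof -
    have "k * T \<le> hf (\<zeta>' \<tau>) - hf (\<zeta>' \<tau>')"
      unfolding T_def by (rule hf_decrease[OF f'2 m0D P0[OF m0]]) (use \<tau> in auto)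
    also have "\<dots> \<le> B * norm (\<zeta>' \<tau> - \<zeta> \<tau>)"
      using boxD(6)[OF b0 in0(1,2)] f(5) f'(5) by simp
    also have "\<dots> \<le> B * (K * \<delta>)" using d1 B1 by simp
    finally show ?thesis using k by (simp add: t1 field_simps)
  qed
  have i: "norm (\<zeta>' s - \<zeta>' \<tau>) \<le> B * T" if "s \<in> {\<tau>..\<tau>'}" for s
  proof -
    have "norm (\<zeta>' s - \<zeta>' \<tau>) \<le> B * (s - \<tau>)"
      by (rule flowline_increment[OF f'2 _ _ _ boxD(4)[OF b0 m0]]) (use that in auto)
    also have "\<dots> \<le> B * T" using that B1 by (simp add: T_def)
    finally show ?thesis .
  qed
  have d2: "norm (\<zeta>' s - \<zeta> \<tau>) \<le> k2 * \<delta>" if "s \<in> {\<tau>..\<tau>'}" for s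
  proof -
    have "norm (\<zeta>' s - \<zeta> \<tau>) \<le> norm (\<zeta>' s - \<zeta>' \<tau>) + norm (\<zeta>' \<tau> - \<zeta> \<tau>)"
      using norm_triangle_ineq[of "\<zeta>' s - \<zeta>' \<tau>" "\<zeta>' \<tau> - \<zeta> \<tau>"] by simp
    also have "\<dots> \<le> B * (t1 * \<delta>) + K * \<delta>" using i[OF that] d1 mult_left_mono[OF T1, of B] B1 by linarith
    finally show ?thesis by (simp add: k2 algebra_simps)
  qed
  have j: "norm (\<zeta>p s - \<zeta>p \<tau>) \<le> B * T" if "s \<in> {\<tau>..\<tau>'}" for s
  proof -
    have "norm (\<zeta>p s - \<zeta>p \<tau>) \<le> B * (s - \<tau>)"
      by (rule flowline_increment[OF f1 _ _ _ boxD(4)[OF b1 m1]]) (use that in auto)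
    also have "\<dots> \<le> B * T" using that B1 by (simp add: T_def)
    finally show ?thesis .
  qed
  have BT: "B * T \<le> B * t1 * \<delta>" using mult_left_mono[OF T1, of B] B1 by (simp add: mult.assoc)
  have d3: "norm (\<zeta>p' \<tau>' - \<zeta>p \<tau>') \<le> k3 * \<delta>"
  proof -
    have "norm (\<zeta>p' \<tau>' - \<zeta>p \<tau>') \<le> norm (R (\<zeta>' \<tau>') - R (\<zeta> \<tau>)) + norm (\<zeta>p \<tau>' - \<zeta>p \<tau>)"
      using norm_triangle_ineq4[of "R (\<zeta>' \<tau>') - R (\<zeta> \<tau>)" "\<zeta>p \<tau>' - \<zeta>p \<tau>"] f(6) f'(6) by simp
    also have "\<dots> \<le> B * (k2 * \<delta>) + B * t1 * \<delta>"
    proof -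
      have "norm (\<zeta>' \<tau>' - \<zeta> \<tau>) \<le> k2 * \<delta>" "norm (\<zeta>p \<tau>' - \<zeta>p \<tau>) \<le> B * T" using d2[of \<tau>'] j[of \<tau>'] \<tau> by auto
      with RL[OF in0(1,3)] mult_left_mono[of "norm (\<zeta>' \<tau>' - \<zeta> \<tau>)" "k2 * \<delta>" B] B1 BT show ?thesis by linarith
    qed
    finally show ?thesis by (simp add: k3 algebra_simps)
  qed
  show "norm (\<zeta>p' b - \<zeta>p b) \<le> K * k3 * norm (\<zeta>' a - \<zeta> a)"
  proof -
    have "norm (\<zeta>p' b - \<zeta>p b) \<le> exp (B * (b - \<tau>')) * norm (\<zeta>p' \<tau>' - \<zeta>p \<tau>')"
      by (rule gronwall(1)[OF f2 i2 f'(2,4)]) (use boxD(5)[OF b1] B1 in auto)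
    also have "\<dots> \<le> K * (k3 * \<delta>)"
      using eK[of "b - \<tau>'"] le \<tau> ab d3 K1 by (intro mult_mono) auto
    finally show ?thesis by (simp add: \<delta>_def)
  qed
  show "\<zeta>' a = \<zeta> a" if eq: "\<zeta>p' b = \<zeta>p b"
  proof -
    have "norm (\<zeta>p' \<tau>' - \<zeta>p \<tau>') \<le> exp (B * (b - \<tau>')) * norm (\<zeta>p' b - \<zeta>p b)"
      by (rule gronwall(2)[OF f2 i2 f'(2,4)]) (use boxD(5)[OF b1] B1 in auto)
    then have e1: "\<zeta>p' \<tau>' = \<zeta>p \<tau>'" using eq by simp
    \<comment> \<open>The states at \<tau>' coincide and one of them has just been reset, so
      \<open>\<zeta>p\<close> is on the level set both at \<tau> and at \<tau>'. As
      \<open>hf\<close> grows along it at rate at least \<open>k\<close>, the two impact times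
      agree.\<close>
    have "k * T \<le> hf (\<zeta>p \<tau>') - hf (\<zeta>p \<tau>)"
      unfolding T_def by (rule hf_increase[OF f1 m1D P1[OF m1]]) (use \<tau> in auto)
    moreover have "hf (\<zeta>p \<tau>') = 0" using R(3)[of "\<zeta>' \<tau>'"] f'(5,6) in0 S0D e1 by auto
    moreover have "hf (\<zeta>p \<tau>) = 0" using R(3)[of "\<zeta> \<tau>"] f(5,6) in0 S0D by auto
    ultimately have "T \<le> 0" using k by (simp add: mult_le_0_iff)
    then have tt: "\<tau>' = \<tau>" using T0 by (simp add: T_def)
    then have "R (\<zeta>' \<tau>) = R (\<zeta> \<tau>)" using e1 f(6) f'(6) by simp
    then have "\<zeta>' \<tau> = \<zeta> \<tau>" using R(5)[of "\<zeta>' \<tau>"] R(5)[of "\<zeta> \<tau>"] f(5) f'(5) tt in0 S0D by (metis subsetD)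
    moreover have "norm (\<zeta>' a - \<zeta> a) \<le> exp (B * (\<tau> - a)) * norm (\<zeta>' \<tau> - \<zeta> \<tau>)"
      by (rule gronwall(2)[OF f(1,3) f'1 i'1]) (use boxD(5)[OF b0] B1 in auto)
    ultimately show ?thesis by simp
  qed
  \<comment> \<open>The boundary terms at the two ends of the delay, left over by the regular
    stretches before \<tau> and after \<tau>'. The crux is that they cancel up to second
    order.\<close>
  define A1 A2 where "A1 = snd (\<zeta>p \<tau>') \<bullet> (fst (\<zeta>p' \<tau>') - fst (\<zeta>p \<tau>'))" and "A2 = snd (\<zeta> \<tau>) \<bullet> (fst (\<zeta>' \<tau>) - fst (\<zeta> \<tau>))"
  define I where "I a b \<zeta> = integral {a..b} (\<lambda>s. Lg (\<zeta> s))" for a b :: real and \<zeta> :: "real \<Rightarrow> (real^'n) \<times> (real^'n)"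
  have reg1: "\<bar>I a \<tau> \<zeta>' - I a \<tau> \<zeta> - A2 + snd (\<zeta> a) \<bullet> (fst (\<zeta>' a) - fst (\<zeta> a))\<bar> \<le> B * K\<^sup>2 * \<delta>\<^sup>2"
    using action_regular[OF b0 f(1,3) f'1 i'1] le \<tau> ab unfolding I_def A2_def K \<delta>_def by (simp add: power_mult_distrib)
  have reg2: "\<bar>I \<tau>' b \<zeta>p' - I \<tau>' b \<zeta>p - snd (\<zeta>p b) \<bullet> (fst (\<zeta>p' b) - fst (\<zeta>p b)) + A1\<bar> \<le> B * (K * k3)\<^sup>2 * \<delta>\<^sup>2"
  proof -
    have "\<bar>I \<tau>' b \<zeta>p' - I \<tau>' b \<zeta>p - snd (\<zeta>p b) \<bullet> (fst (\<zeta>p' b) - fst (\<zeta>p b)) + A1\<bar> \<le> B * (K * norm (\<zeta>p' \<tau>' - \<zeta>p \<tau>'))\<^sup>2"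
      using action_regular[OF b1 f2 i2 f'(2,4)] le \<tau> ab unfolding I_def A1_def K by simp
    also have "\<dots> \<le> B * (K * (k3 * \<delta>))\<^sup>2"
      using d3 B1 K1 by (intro mult_left_mono power_mono) auto
    finally show ?thesis by (simp add: power_mult_distrib mult.assoc)
  qed
  have c': "continuous_on {a..\<tau>'} (\<lambda>s. Lg (\<zeta>' s))" by (rule Lg_flowline_cont[OF f'(1) order_trans[OF f'(3) S0D]])
  have cp: "continuous_on {\<tau>..b} (\<lambda>s. Lg (\<zeta>p s))" by (rule Lg_flowline_cont[OF f(2) order_trans[OF f(4) S1D]])
  have c'm: "continuous_on {\<tau>..\<tau>'} (\<lambda>s. Lg (\<zeta>' s))" and cpm: "continuous_on {\<tau>..\<tau>'} (\<lambda>s. Lg (\<zeta>p s))"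
    using continuous_on_subset[OF c'] continuous_on_subset[OF cp] le \<tau> by auto
  have split': "I a \<tau>' \<zeta>' = I a \<tau> \<zeta>' + I \<tau> \<tau>' \<zeta>'"
    unfolding I_def using Henstock_Kurzweil_Integration.integral_combine[OF le(1) \<tau> integrable_continuous_real[OF c']] by simp
  have split: "I \<tau> b \<zeta>p = I \<tau> \<tau>' \<zeta>p + I \<tau>' b \<zeta>p"
    unfolding I_def using Henstock_Kurzweil_Integration.integral_combine[OF \<tau> le(2) integrable_continuous_real[OF cp]] by simp
  \<comment> \<open>The delay is of order \<delta>, and during it both Lagrangians are within order
    \<delta> of their common value at the impact of \<zeta>.\<close>
  have mid: "\<bar>I \<tau> \<tau>' \<zeta>' - I \<tau> \<tau>' \<zeta>p\<bar> \<le> t1 * (B * k2 + B * B * t1) * \<delta>\<^sup>2"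
  proof -
    have "norm (integral {\<tau>..\<tau>'} (\<lambda>s. Lg (\<zeta>' s) - Lg (\<zeta>p s))) \<le> ((B * k2 + B * B * t1) * \<delta>) * (\<tau>' - \<tau>)"
    proof (rule integral_bound[OF \<tau>])
      fix s assume s: "s \<in> {\<tau>..\<tau>'}"
      have "\<bar>Lg (\<zeta>' s) - Lg (\<zeta> \<tau>)\<bar> \<le> B * norm (\<zeta>' s - \<zeta> \<tau>)"
        by (rule boxD(8)[OF b0 in0(1) m0[OF s]])
      also have "\<dots> \<le> B * (k2 * \<delta>)" using d2[OF s] B1 by simp
      finally have 1: "\<bar>Lg (\<zeta>' s) - Lg (\<zeta> \<tau>)\<bar> \<le> B * k2 * \<delta>" by simp
      have "\<bar>Lg (\<zeta>p s) - Lg (\<zeta>p \<tau>)\<bar> \<le> B * norm (\<zeta>p s - \<zeta>p \<tau>)"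
        by (rule boxD(8)[OF b1 in1(1) m1[OF s]])
      also have "\<dots> \<le> B * (B * t1 * \<delta>)" by (rule mult_left_mono[OF order_trans[OF j[OF s] BT]]) (use B1 in auto)
      finally have 2: "\<bar>Lg (\<zeta>p s) - Lg (\<zeta>p \<tau>)\<bar> \<le> B * B * t1 * \<delta>" by simp
      have "Lg (\<zeta>p \<tau>) = Lg (\<zeta> \<tau>)" using R(6)[of "\<zeta> \<tau>"] f(5,6) in0(1) S0D by auto
      then show "norm (Lg (\<zeta>' s) - Lg (\<zeta>p s)) \<le> (B * k2 + B * B * t1) * \<delta>"
        using 1 2 by (simp add: distrib_right)
    qed (intro continuous_intros c'm cpm)
    also have "\<dots> \<le> ((B * k2 + B * B * t1) * \<delta>) * (t1 * \<delta>)"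
      using T1 B1 k20 t10 \<delta>0 unfolding T_def by (intro mult_left_mono) auto
    finally show ?thesis unfolding I_def
      using Henstock_Kurzweil_Integration.integral_diff[OF integrable_continuous_real[OF c'm] integrable_continuous_real[OF cpm]]
      by (simp add: power2_eq_square mult_ac)
  qed
  have bd: "\<bar>A2 - A1\<bar> \<le> (B * (B * k2\<^sup>2) + B * (B * k2 * t1) + B * (B * B * t1 * t1) + B * t1 * k3) * \<delta>\<^sup>2"
  proof -
    \<comment> \<open>\<xi> is the displacement of the impact point, \<open>r1\<close> and
      \<open>r2\<close> are the errors of treating the motion during the delay as uniform, and
      \<open>r3\<close> is the momentum change in that time. The terms linear in \<open>T\<close>
      cancel by \<open>kin\<close>, the equality of the kinetic energies before and after the
      impact.\<close>
    define \<xi> where "\<xi> = fst (\<zeta>' \<tau>') - fst (\<zeta> \<tau>)"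
    define r1 where "r1 = fst (\<zeta>p \<tau>') - fst (\<zeta>p \<tau>) - T *\<^sub>R fst (X (\<zeta>p \<tau>))"
    define r2 where "r2 = fst (\<zeta>' \<tau>') - fst (\<zeta>' \<tau>) - T *\<^sub>R fst (X (\<zeta> \<tau>))"
    define r3 where "r3 = snd (\<zeta>p \<tau>') - snd (\<zeta>p \<tau>)"
    define w1 where "w1 = fst (\<zeta>p' \<tau>') - fst (\<zeta>p \<tau>')"
    have zD: "\<zeta> \<tau> \<in> D" "\<zeta>' \<tau>' \<in> D" using in0 S0D by auto
    have fs: "fst (\<zeta>p' \<tau>') = fst (\<zeta>' \<tau>')" "fst (\<zeta>p \<tau>) = fst (\<zeta> \<tau>)"
      using R(2)[OF zD(1) f(5)] R(2)[OF zD(2) f'(5)] f(6) f'(6) by auto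
    have kin: "snd (\<zeta>p \<tau>) \<bullet> fst (X (\<zeta>p \<tau>)) = snd (\<zeta> \<tau>) \<bullet> fst (X (\<zeta> \<tau>))" using R(7)[OF zD(1) f(5)] f(6) by simp
    have w1: "w1 = \<xi> - T *\<^sub>R fst (X (\<zeta>p \<tau>)) - r1" unfolding w1_def \<xi>_def r1_def fs by simp
    have w2: "fst (\<zeta>' \<tau>) - fst (\<zeta> \<tau>) = \<xi> - T *\<^sub>R fst (X (\<zeta> \<tau>)) - r2" unfolding \<xi>_def r2_def by simp
    have e0: "A1 = snd (\<zeta>p \<tau>) \<bullet> w1 + r3 \<bullet> w1" unfolding A1_def w1_def[symmetric] r3_def by (simp add: inner_diff_left)
    have e1: "snd (\<zeta>p \<tau>) \<bullet> w1 = snd (\<zeta>p \<tau>) \<bullet> \<xi> - T * (snd (\<zeta>p \<tau>) \<bullet> fst (X (\<zeta>p \<tau>))) - snd (\<zeta>p \<tau>) \<bullet> r1"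
      by (subst w1) (simp add: inner_diff_right)
    have e2: "A2 = snd (\<zeta> \<tau>) \<bullet> \<xi> - T * (snd (\<zeta> \<tau>) \<bullet> fst (X (\<zeta> \<tau>))) - snd (\<zeta> \<tau>) \<bullet> r2"
      unfolding A2_def w2 by (simp add: inner_diff_right)
    have e3: "(snd (\<zeta>p \<tau>) - snd (\<zeta> \<tau>)) \<bullet> \<xi> = snd (\<zeta>p \<tau>) \<bullet> \<xi> - snd (\<zeta> \<tau>) \<bullet> \<xi>" by (rule inner_diff_left)
    have "A2 - A1 = - ((snd (\<zeta>p \<tau>) - snd (\<zeta> \<tau>)) \<bullet> \<xi>) - snd (\<zeta> \<tau>) \<bullet> r2 + snd (\<zeta>p \<tau>) \<bullet> r1 - r3 \<bullet> w1"
      unfolding e0 e1 e2 e3 kin by linarith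
    \<comment> \<open>Both impact points satisfy \<open>hf = 0\<close>, so \<open>dh\<close> applied
      to their displacement is of second order, and the momentum jump is a multiple of
      \<open>dh\<close>.\<close>
    moreover have "\<bar>(snd (\<zeta>p \<tau>) - snd (\<zeta> \<tau>)) \<bullet> \<xi>\<bar> \<le> B * (B * k2\<^sup>2) * \<delta>\<^sup>2"
    proof -
      let ?dh = "frechet_derivative hf (at (\<zeta> \<tau>))"
      have "Ck_on (Suc 1) D hf" using Ckh by (simp only: numeral_2_eq_2 One_nat_def)
      then have l: "linear ?dh" using Ck_on_SucD(1) zD(1) has_derivative_linear by blast
      have "\<zeta>' \<tau>' - \<zeta> \<tau> = (\<xi>, 0) + (0, snd (\<zeta>' \<tau>') - snd (\<zeta> \<tau>))" by (simp add: \<xi>_def prod_eq_iff)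
      then have "?dh (\<zeta>' \<tau>' - \<zeta> \<tau>) = ?dh (\<xi>, 0)" by (simp only: linear_add[OF l] hf_vertical[OF zD(1)] add_0_right)
      then have "\<bar>?dh (\<xi>, 0)\<bar> \<le> B * (norm (\<zeta>' \<tau>' - \<zeta> \<tau>))\<^sup>2"
        using boxD(9)[OF b0 in0(1) in0(3)] f(5) f'(5) by simp
      also have "\<dots> \<le> B * (k2 * \<delta>)\<^sup>2" using d2[of \<tau>'] \<tau> B1 by (intro mult_left_mono power_mono) auto
      finally have "\<bar>lam (\<zeta> \<tau>)\<bar> * \<bar>?dh (\<xi>, 0)\<bar> \<le> B * (B * (k2 * \<delta>)\<^sup>2)"
        using lamB[OF in0(1)] B1 by (intro mult_mono) auto
      then show ?thesis using R(8)[OF zD(1) f(5), of \<xi>] f(6) by (simp add: abs_mult power_mult_distrib mult.assoc)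
    qed
    moreover have "\<bar>snd (\<zeta> \<tau>) \<bullet> r2\<bar> \<le> B * (B * k2 * t1) * \<delta>\<^sup>2"
    proof -
      have "norm r2 \<le> norm (\<zeta>' \<tau>' - \<zeta>' \<tau> - T *\<^sub>R X (\<zeta> \<tau>))"
        unfolding r2_def using norm_fst_le_norm[of "\<zeta>' \<tau>' - \<zeta>' \<tau> - T *\<^sub>R X (\<zeta> \<tau>)"] by simp
      also have "\<dots> \<le> (B * (k2 * \<delta>)) * (\<tau>' - \<tau>)"
        unfolding T_def
      proof (rule flowline_increment_linear[OF f'2])
        fix s assume s: "s \<in> {\<tau>..\<tau>'}"
        have "norm (X (\<zeta>' s) - X (\<zeta> \<tau>)) \<le> B * norm (\<zeta>' s - \<zeta> \<tau>)"
          by (rule boxD(5)[OF b0 in0(1) m0[OF s]])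
        also have "\<dots> \<le> B * (k2 * \<delta>)" using d2[OF s] B1 by simp
        finally show "norm (X (\<zeta>' s) - X (\<zeta> \<tau>)) \<le> B * (k2 * \<delta>)" .
      qed
      also have "\<dots> \<le> (B * (k2 * \<delta>)) * (t1 * \<delta>)" using T1 B1 k20 \<delta>0 unfolding T_def by (intro mult_left_mono) auto
      finally have r2: "norm r2 \<le> B * k2 * t1 * \<delta>\<^sup>2" by (simp add: power2_eq_square mult_ac)
      have "\<bar>snd (\<zeta> \<tau>) \<bullet> r2\<bar> \<le> norm (snd (\<zeta> \<tau>)) * norm r2" by (rule Cauchy_Schwarz_ineq2)
      also have "\<dots> \<le> B * (B * k2 * t1 * \<delta>\<^sup>2)"
        using r2 boxD(3)[OF b0 in0(1)] norm_snd_le_norm[of "\<zeta> \<tau>"] B1 by (intro mult_mono) auto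
      finally show ?thesis by (simp add: mult.assoc)
    qed
    moreover have "\<bar>snd (\<zeta>p \<tau>) \<bullet> r1\<bar> \<le> B * (B * B * t1 * t1) * \<delta>\<^sup>2"
    proof -
      have "norm r1 \<le> norm (\<zeta>p \<tau>' - \<zeta>p \<tau> - T *\<^sub>R X (\<zeta>p \<tau>))"
        unfolding r1_def using norm_fst_le_norm[of "\<zeta>p \<tau>' - \<zeta>p \<tau> - T *\<^sub>R X (\<zeta>p \<tau>)"] by simp
      also have "\<dots> \<le> (B * (B * t1 * \<delta>)) * (\<tau>' - \<tau>)"
        unfolding T_def
      proof (rule flowline_increment_linear[OF f1])
        fix s assume s: "s \<in> {\<tau>..\<tau>'}"
        have "norm (X (\<zeta>p s) - X (\<zeta>p \<tau>)) \<le> B * norm (\<zeta>p s - \<zeta>p \<tau>)"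
          by (rule boxD(5)[OF b1 in1(1) m1[OF s]])
        also have "\<dots> \<le> B * (B * t1 * \<delta>)" by (rule mult_left_mono[OF order_trans[OF j[OF s] BT]]) (use B1 in auto)
        finally show "norm (X (\<zeta>p s) - X (\<zeta>p \<tau>)) \<le> B * (B * t1 * \<delta>)" .
      qed
      also have "\<dots> \<le> (B * (B * t1 * \<delta>)) * (t1 * \<delta>)" using T1 B1 t10 \<delta>0 unfolding T_def by (intro mult_left_mono) auto
      finally have r1: "norm r1 \<le> B * B * t1 * t1 * \<delta>\<^sup>2" by (simp add: power2_eq_square mult_ac)
      have "\<bar>snd (\<zeta>p \<tau>) \<bullet> r1\<bar> \<le> norm (snd (\<zeta>p \<tau>)) * norm r1" by (rule Cauchy_Schwarz_ineq2)
      also have "\<dots> \<le> B * (B * B * t1 * t1 * \<delta>\<^sup>2)"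
        using r1 boxD(3)[OF b1 in1(1)] norm_snd_le_norm[of "\<zeta>p \<tau>"] B1 by (intro mult_mono) auto
      finally show ?thesis by (simp add: mult.assoc)
    qed
    moreover have "\<bar>r3 \<bullet> w1\<bar> \<le> B * t1 * k3 * \<delta>\<^sup>2"
    proof -
      have "norm r3 \<le> B * t1 * \<delta>"
        using norm_snd_le_norm[of "\<zeta>p \<tau>' - \<zeta>p \<tau>"] j[of \<tau>'] \<tau> BT unfolding r3_def by simp
      moreover have "norm w1 \<le> k3 * \<delta>"
        using norm_fst_le_norm[of "\<zeta>p' \<tau>' - \<zeta>p \<tau>'"] d3 unfolding w1_def by simp
      ultimately have "norm r3 * norm w1 \<le> (B * t1 * \<delta>) * (k3 * \<delta>)" by (intro mult_mono) (use B1 t10 \<delta>0 in auto)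
      then show ?thesis using Cauchy_Schwarz_ineq2[of r3 w1] by (simp add: power2_eq_square mult_ac)
    qed
    ultimately have "\<bar>A2 - A1\<bar> \<le> B * (B * k2\<^sup>2) * \<delta>\<^sup>2 + B * (B * k2 * t1) * \<delta>\<^sup>2 + B * (B * B * t1 * t1) * \<delta>\<^sup>2 + B * t1 * k3 * \<delta>\<^sup>2"
      by linarith
    then show ?thesis by (simp only: distrib_right)
  qed
  have "broken_action a \<tau>' b \<zeta>' \<zeta>p' - broken_action a \<tau> b \<zeta> \<zeta>p = (I a \<tau> \<zeta>' - I a \<tau> \<zeta>) + (I \<tau> \<tau>' \<zeta>' - I \<tau> \<tau>' \<zeta>p) + (I \<tau>' b \<zeta>p' - I \<tau>' b \<zeta>p)"
    unfolding broken_action_def I_def[symmetric] split split' by simp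
  then have "\<bar>broken_action a \<tau>' b \<zeta>' \<zeta>p' - broken_action a \<tau> b \<zeta> \<zeta>p
      - snd (\<zeta>p b) \<bullet> (fst (\<zeta>p' b) - fst (\<zeta>p b)) + snd (\<zeta> a) \<bullet> (fst (\<zeta>' a) - fst (\<zeta> a))\<bar>
      \<le> B * K\<^sup>2 * \<delta>\<^sup>2 + B * (K * k3)\<^sup>2 * \<delta>\<^sup>2 + t1 * (B * k2 + B * B * t1) * \<delta>\<^sup>2 + (B * (B * k2\<^sup>2) + B * (B * k2 * t1) + B * (B * B * t1 * t1) + B * t1 * k3) * \<delta>\<^sup>2"
    using reg1 reg2 mid bd by linarith
  then show "\<bar>broken_action a \<tau>' b \<zeta>' \<zeta>p' - broken_action a \<tau> b \<zeta> \<zeta>p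
      - snd (\<zeta>p b) \<bullet> (fst (\<zeta>p' b) - fst (\<zeta>p b)) + snd (\<zeta> a) \<bullet> (fst (\<zeta>' a) - fst (\<zeta> a))\<bar>
      \<le> (B * K\<^sup>2 + B * (K * k3)\<^sup>2 + t1 * (B * k2 + B * B * t1) + B * (B * k2\<^sup>2) + B * (B * k2 * t1) + B * (B * B * t1 * t1) + B * t1 * k3) * (norm (\<zeta>' a - \<zeta> a))\<^sup>2"
    unfolding \<delta>_def[symmetric] by (simp only: distrib_right add.assoc)
qed

lemma broken_pair:
  assumes bx: "impact_boxes S0 S1 B k"
  shows "\<exists>C>0. \<forall>a b \<tau> \<zeta> \<zeta>p \<tau>' \<zeta>' \<zeta>p'. broken S0 S1 a \<tau> b \<zeta> \<zeta>p \<longrightarrow> broken S0 S1 a \<tau>' b \<zeta>' \<zeta>p' \<longrightarrow> b - a \<le> 1 \<longrightarrow>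
     norm (\<zeta>p' b - \<zeta>p b) \<le> C * norm (\<zeta>' a - \<zeta> a) \<and> (\<zeta>p' b = \<zeta>p b \<longrightarrow> \<zeta>' a = \<zeta> a) \<and>
     \<bar>broken_action a \<tau>' b \<zeta>' \<zeta>p' - broken_action a \<tau> b \<zeta> \<zeta>p
      - snd (\<zeta>p b) \<bullet> (fst (\<zeta>p' b) - fst (\<zeta>p b)) + snd (\<zeta> a) \<bullet> (fst (\<zeta>' a) - fst (\<zeta> a))\<bar>
      \<le> C * (norm (\<zeta>' a - \<zeta> a))\<^sup>2"
proof -
  define K t1 k2 k3 where "K = exp B" and "t1 = B * K / k" and "k2 = B * t1 + K" and "k3 = B * k2 + B * t1"
  define C0 where "C0 = B * K\<^sup>2 + B * (K * k3)\<^sup>2 + t1 * (B * k2 + B * B * t1) + B * (B * k2\<^sup>2) + B * (B * k2 * t1) + B * (B * B * t1 * t1) + B * t1 * k3"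
  define C where "C = \<bar>K * k3\<bar> + \<bar>C0\<bar> + (K * k3)\<^sup>2 + 1"
  note ord = broken_pair_ordered[OF bx _ _ _ _ K_def t1_def k2_def k3_def, folded C0_def]
  have C: "C > 0" "K * k3 \<le> C" "C0 \<le> C" "C0 + (K * k3)\<^sup>2 + 1 \<le> C"
    unfolding C_def by (smt (verit) abs_ge_zero abs_ge_self zero_le_power2)+
  have m: "x \<le> c * y \<Longrightarrow> c \<le> C \<Longrightarrow> 0 \<le> y \<Longrightarrow> x \<le> C * y" for x c y :: real by (meson mult_right_mono order_trans)
  show ?thesis
  proof (intro exI[of _ C] conjI C(1) allI impI)
    fix a b \<tau> \<zeta> \<zeta>p \<tau>' \<zeta>' \<zeta>p'
    assume br: "broken S0 S1 a \<tau> b \<zeta> \<zeta>p" and br': "broken S0 S1 a \<tau>' b \<zeta>' \<zeta>p'" and ab: "b - a \<le> 1"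
    show "norm (\<zeta>p' b - \<zeta>p b) \<le> C * norm (\<zeta>' a - \<zeta> a)"
    proof (cases "\<tau> \<le> \<tau>'")
      case True
      show ?thesis by (rule m[OF ord(1)[OF br br' ab True] C(2)]) simp
    next
      case False
      show ?thesis
        using m[OF ord(1)[OF br' br ab] C(2)] False by (simp add: norm_minus_commute)
    qed
    show "\<zeta>' a = \<zeta> a" if "\<zeta>p' b = \<zeta>p b"
      using ord(2)[OF br br' ab] ord(2)[OF br' br ab] that by (cases "\<tau> \<le> \<tau>'") auto
    show "\<bar>broken_action a \<tau>' b \<zeta>' \<zeta>p' - broken_action a \<tau> b \<zeta> \<zeta>p
      - snd (\<zeta>p b) \<bullet> (fst (\<zeta>p' b) - fst (\<zeta>p b)) + snd (\<zeta> a) \<bullet> (fst (\<zeta>' a) - fst (\<zeta> a))\<bar>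
      \<le> C * (norm (\<zeta>' a - \<zeta> a))\<^sup>2"
    proof (cases "\<tau> \<le> \<tau>'")
      case True
      show ?thesis by (rule m[OF ord(3)[OF br br' ab True] C(3)]) simp
    next
      case False
      let ?\<delta> = "norm (\<zeta>' a - \<zeta> a)"
      define E where "E = broken_action a \<tau>' b \<zeta>' \<zeta>p' - broken_action a \<tau> b \<zeta> \<zeta>p
        - snd (\<zeta>p b) \<bullet> (fst (\<zeta>p' b) - fst (\<zeta>p b)) + snd (\<zeta> a) \<bullet> (fst (\<zeta>' a) - fst (\<zeta> a))"
      define E' where "E' = broken_action a \<tau> b \<zeta> \<zeta>p - broken_action a \<tau>' b \<zeta>' \<zeta>p'
        - snd (\<zeta>p' b) \<bullet> (fst (\<zeta>p b) - fst (\<zeta>p' b)) + snd (\<zeta>' a) \<bullet> (fst (\<zeta> a) - fst (\<zeta>' a))"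
      have E': "\<bar>E'\<bar> \<le> C0 * ?\<delta>\<^sup>2"
        using ord(3)[OF br' br ab] False unfolding E'_def by (simp add: norm_minus_commute)
      \<comment> \<open>Exchanging the two trajectories changes the formula only by products of a
        momentum difference and a position difference at the two ends. These are quadratic and
        account for the summands \<open>(K * k3)\<^sup>2\<close> and 1 in \<open>C\<close>.\<close>
      have EE: "E + E' = (snd (\<zeta>p' b) - snd (\<zeta>p b)) \<bullet> (fst (\<zeta>p' b) - fst (\<zeta>p b)) - (snd (\<zeta>' a) - snd (\<zeta> a)) \<bullet> (fst (\<zeta>' a) - fst (\<zeta> a))"
        unfolding E_def E'_def by (simp add: inner_diff_left inner_diff_right)
      have cs: "\<bar>(snd x - snd y) \<bullet> (fst x - fst y)\<bar> \<le> (norm (x - y))\<^sup>2" for x y :: "(real^'n) \<times> (real^'n)"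
      proof -
        have "\<bar>(snd x - snd y) \<bullet> (fst x - fst y)\<bar> \<le> norm (snd (x - y)) * norm (fst (x - y))"
          using Cauchy_Schwarz_ineq2 by simp
        also have "\<dots> \<le> norm (x - y) * norm (x - y)"
          by (intro mult_mono norm_fst_le_norm norm_snd_le_norm) auto
        finally show ?thesis by (simp add: power2_eq_square)
      qed
      have "norm (\<zeta>p' b - \<zeta>p b) \<le> K * k3 * ?\<delta>" using ord(1)[OF br' br ab] False by (simp add: norm_minus_commute)
      then have "(norm (\<zeta>p' b - \<zeta>p b))\<^sup>2 \<le> (K * k3)\<^sup>2 * ?\<delta>\<^sup>2" by (metis norm_ge_zero power_mono power_mult_distrib)
      then have "\<bar>E + E'\<bar> \<le> (K * k3)\<^sup>2 * ?\<delta>\<^sup>2 + ?\<delta>\<^sup>2"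
        unfolding EE using cs[of "\<zeta>p' b" "\<zeta>p b"] cs[of "\<zeta>' a" "\<zeta> a"] by linarith
      then have "\<bar>E\<bar> \<le> (C0 + (K * k3)\<^sup>2 + 1) * ?\<delta>\<^sup>2" using E' by (simp add: distrib_right)
      then show ?thesis unfolding E_def by (rule m[OF _ C(4)]) simp
    qed
  qed
qed

end

section \<open>Neighbourhoods of impact states and avoidance of grazing states\<close>

context impact_chart
begin

lemma R_cont: "continuous_on DR R"
  using Ck_on_continuous[OF DR(4)] .

text \<open>The reset reverses the sign of \<open>P\<close>, so \<open>P\<close> is bounded away
  from zero near the impact and near its image. Half of the radius \<open>r\<close> is kept free so
  that curves starting in the image can move by \<open>r / 2\<close> inside the outgoing
  ball.\<close>

lemma impact_boxes_exist:
  assumes z0: "z0 \<in> D" "hf z0 = 0" "P z0 < 0"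
  shows "\<exists>\<rho>>0. \<exists>r>0. \<exists>B k. impact_boxes (cball z0 \<rho>) (cball (R z0) r) B k \<and> R ` cball z0 \<rho> \<subseteq> ball (R z0) (r / 2)"
proof -
  define k where "k = - P z0 / 2"
  have k: "k > 0" using z0 by (simp add: k_def)
  have cP: "continuous_on D P" using Ck_on_continuous[OF CkP] .
  have "open (D \<inter> P -` {k<..})" by (rule continuous_open_preimage[OF cP D]) auto
  moreover have "R z0 \<in> D \<inter> P -` {k<..}" using R(1)[OF z0(1,2)] R(4)[OF z0(1,2)] k by (auto simp: k_def)
  ultimately obtain r where r: "r > 0" "cball (R z0) r \<subseteq> D \<inter> P -` {k<..}" by (meson open_contains_cball)
  have "open (D \<inter> P -` {..<-k})" by (rule continuous_open_preimage[OF cP D]) auto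
  moreover have "open (DR \<inter> R -` ball (R z0) (r / 2))" by (rule continuous_open_preimage[OF R_cont DR(1)]) auto
  ultimately have "open ((D \<inter> P -` {..<-k}) \<inter> (DR \<inter> R -` ball (R z0) (r / 2)))" by blast
  moreover have "z0 \<in> (D \<inter> P -` {..<-k}) \<inter> (DR \<inter> R -` ball (R z0) (r / 2))"
    using z0 DR(3)[OF z0(1,2)] r k by (auto simp: k_def)
  ultimately obtain \<rho> where \<rho>: "\<rho> > 0" "cball z0 \<rho> \<subseteq> (D \<inter> P -` {..<-k}) \<inter> (DR \<inter> R -` ball (R z0) (r / 2))"
    by (meson open_contains_cball)
  have sD: "cball z0 \<rho> \<subseteq> D" "cball (R z0) r \<subseteq> D" "cball z0 \<rho> \<subseteq> DR" using \<rho> r by auto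
  obtain B0 where B0: "box (cball z0 \<rho>) B0" using box_exists[OF compact_cball convex_cball sD(1)] by blast
  obtain B1 where B1: "box (cball (R z0) r) B1" using box_exists[OF compact_cball convex_cball sD(2)] by blast
  obtain B2 where B2: "\<And>z z'. z \<in> cball z0 \<rho> \<Longrightarrow> z' \<in> cball z0 \<rho> \<Longrightarrow> norm (R z' - R z) \<le> B2 * norm (z' - z)"
    using Ck1_lipschitz[OF compact_cball convex_cball sD(3) DR(4)] by blast
  have "bounded (lam ` cball z0 \<rho>)"
    by (rule compact_imp_bounded[OF compact_continuous_image[OF continuous_on_subset[OF DR(5) sD(3)] compact_cball]])
  then obtain B3 where "\<forall>y\<in>lam ` cball z0 \<rho>. norm y \<le> B3" using bounded_iff by blast
  then have B3: "\<And>z. z \<in> cball z0 \<rho> \<Longrightarrow> \<bar>lam z\<bar> \<le> B3" by simp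
  define B where "B = \<bar>B0\<bar> + \<bar>B1\<bar> + \<bar>B2\<bar> + \<bar>B3\<bar>"
  have le: "B0 \<le> B" "B1 \<le> B" "B2 \<le> B" "B3 \<le> B" unfolding B_def by linarith+
  have "impact_boxes (cball z0 \<rho>) (cball (R z0) r) B k"
    unfolding impact_boxes_def
  proof (intro conjI ballI k)
    show "box (cball z0 \<rho>) B" "box (cball (R z0) r) B" using box_mono[OF B0 le(1)] box_mono[OF B1 le(2)] by auto
    show "P z \<le> - k" if "z \<in> cball z0 \<rho>" for z using that \<rho>(2) by (auto intro: less_imp_le)
    show "k \<le> P z" if "z \<in> cball (R z0) r" for z using that r(2) by (auto intro: less_imp_le)
    show "norm (R z' - R z) \<le> B * norm (z' - z)" if "z \<in> cball z0 \<rho>" "z' \<in> cball z0 \<rho>" for z z'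
      using B2[OF that] mult_right_mono[OF le(3), of "norm (z' - z)"] by simp
    show "\<bar>lam z\<bar> \<le> B" if "z \<in> cball z0 \<rho>" for z using B3[OF that] le(4) by simp
  qed
  moreover have "R ` cball z0 \<rho> \<subseteq> ball (R z0) (r / 2)" using \<rho>(2) by auto
  ultimately show ?thesis using \<rho>(1) r(1) by blast
qed

text \<open>At a graze both \<open>hf\<close> and its time derivative \<open>P\<close> vanish, so
  \<open>hf\<close> is quadratically small in the remaining time.\<close>

lemma hf_near_graze:
  assumes b: "box S B" and \<zeta>: "flowline X a \<tau> \<zeta>" "\<zeta> ` {a..\<tau>} \<subseteq> S" and z: "hf (\<zeta> \<tau>) = 0" "P (\<zeta> \<tau>) = 0" and s: "a \<le> s" "s \<le> \<tau>"
  shows "\<bar>hf (\<zeta> s)\<bar> \<le> B\<^sup>2 * (\<tau> - s)\<^sup>2"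
proof -
  note \<zeta>s = flowline_sub[OF \<zeta>(1) s order_refl]
  have in_S: "\<zeta> x \<in> S" if "x \<in> {s..\<tau>}" for x using \<zeta>(2) s that by (auto simp: image_subset_iff)
  have B1: "B \<ge> 1" using boxD(2)[OF b] .
  have Pb: "\<bar>P (\<zeta> x)\<bar> \<le> B\<^sup>2 * (\<tau> - s)" if x: "x \<in> {s..\<tau>}" for x
  proof -
    have "norm (\<zeta> \<tau> - \<zeta> x) \<le> B * (\<tau> - x)"
      by (rule flowline_increment[OF \<zeta>s _ _ _ boxD(4)[OF b in_S]]) (use x in auto)
    also have "\<dots> \<le> B * (\<tau> - s)" using x B1 by simp
    finally have "B * norm (\<zeta> x - \<zeta> \<tau>) \<le> B * (B * (\<tau> - s))" using B1 by (simp add: norm_minus_commute)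
    moreover have "\<bar>P (\<zeta> x) - P (\<zeta> \<tau>)\<bar> \<le> B * norm (\<zeta> x - \<zeta> \<tau>)" by (rule boxD(7)[OF b in_S in_S]) (use x s in auto)
    ultimately show ?thesis using z by (simp add: power2_eq_square mult.assoc)
  qed
  have Pb1: "- (B\<^sup>2 * (\<tau> - s)) \<le> P (\<zeta> x)" and Pb2: "P (\<zeta> x) \<le> - (- (B\<^sup>2 * (\<tau> - s)))" if "x \<in> {s..\<tau>}" for x
    using Pb[OF that] by linarith+
  have iD: "\<zeta> ` {s..\<tau>} \<subseteq> D" using in_S boxD(1)[OF b] by auto
  have "hf (\<zeta> \<tau>) - hf (\<zeta> s) \<ge> (- (B\<^sup>2 * (\<tau> - s))) * (\<tau> - s)"
    by (rule hf_increase[OF \<zeta>s iD Pb1]) (use s in auto)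
  moreover have "hf (\<zeta> s) - hf (\<zeta> \<tau>) \<ge> (- (B\<^sup>2 * (\<tau> - s))) * (\<tau> - s)"
    by (rule hf_decrease[OF \<zeta>s iD Pb2]) (use s in auto)
  ultimately show ?thesis using z by (simp add: power2_eq_square mult.assoc abs_le_iff)
qed

text \<open>A pigeonhole form of the one-dimensional Sard theorem: on a segment transversal to the level
  sets of \<open>hf\<close>, starting points whose flow line grazes within the same time cell of length \<open>\<delta> / N\<close>
  have distance \<open>O(N\<^sup>-\<^sup>2)\<close>, so not all of \<open>N + 3\<close> equidistant points can graze.\<close>

lemma graze_avoidable:
  assumes z0: "z0 \<in> D" "hf z0 = 0"
  shows "\<exists>\<rho>>0. \<exists>\<delta>>0. cball z0 \<rho> \<subseteq> D \<and> (\<forall>Y s1. open Y \<and> Y \<noteq> {} \<and> Y \<subseteq> ball z0 \<rho> \<longrightarrow>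
     (\<exists>z\<in>Y. \<forall>\<zeta> \<tau>. \<tau> \<le> \<delta> \<and> flowline X 0 \<tau> \<zeta> \<and> \<zeta> ` {0..\<tau>} \<subseteq> cball z0 \<rho> \<and> \<zeta> 0 = z \<longrightarrow>
        \<not> (hf (\<zeta> \<tau>) = 0 \<and> P (\<zeta> \<tau>) = 0) \<and> (\<tau> = s1 \<longrightarrow> hf (\<zeta> \<tau>) \<noteq> 0)))"
proof -
  let ?dh = "frechet_derivative hf (at z0)"
  have h1: "Ck_on 1 D hf" using Ck_on_le[OF Ckh, of 1] by simp
  have "(hf has_derivative ?dh) (at z0)" using Ck_on_SucD(1)[of 0 D hf] h1 z0(1) by (simp only: One_nat_def)
  then have bl: "bounded_linear ?dh" and l: "linear ?dh" using has_derivative_bounded_linear has_derivative_linear by auto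
  obtain v0 where v0: "?dh v0 \<noteq> 0" using nondeg[OF z0] by blast
  \<comment> \<open>Normalised so that, to first order, \<open>hf\<close> equals the parameter along
    the segment in direction \<open>v\<close>.\<close>
  define v where "v = (1 / ?dh v0) *\<^sub>R v0"
  have dv: "?dh v = 1" using v0 by (simp add: v_def linear_cmul[OF l])
  define nv where "nv = norm v"
  have nv: "nv > 0" using dv linear_0[OF l] unfolding nv_def by auto
  obtain Nd where Nd: "Nd > 0" "\<And>u. norm (?dh u) \<le> norm u * Nd" using bounded_linear.pos_bounded[OF bl] by blast
  \<comment> \<open>A distortion of \<open>v\<close> by the relative amount \<eta> changes the
    increment of \<open>hf\<close> by at most a quarter.\<close>
  define \<eta> where "\<eta> = min 1 (1 / (4 * Nd * nv))"
  have \<eta>: "\<eta> > 0" "\<eta> \<le> 1" "Nd * \<eta> * nv \<le> 1/4"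
  proof -
    show "\<eta> > 0" "\<eta> \<le> 1" using Nd nv by (auto simp: \<eta>_def)
    have "Nd * nv * \<eta> \<le> Nd * nv * (1 / (4 * Nd * nv))" using Nd nv by (intro mult_left_mono) (auto simp: \<eta>_def)
    then show "Nd * \<eta> * nv \<le> 1/4" using Nd nv by (simp add: mult_ac)
  qed
  \<comment> \<open>Since the displacement will have length at most \<open>2 * d\<close>, the
    constant \<open>1 / (8 * nv)\<close> costs another quarter.\<close>
  obtain \<rho> where \<rho>: "\<rho> > 0" "cball z0 \<rho> \<subseteq> D"
    "\<And>z z'. z \<in> cball z0 \<rho> \<Longrightarrow> z' \<in> cball z0 \<rho> \<Longrightarrow> norm (hf z' - hf z - ?dh (z' - z)) \<le> (1 / (8 * nv)) * norm (z' - z)"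
  proof -
    have "1 / (8 * nv) > 0" using nv by simp
    from Ck1_strict_derivative[OF D z0(1) h1 this] show ?thesis using that by blast
  qed
  obtain B where b: "box (cball z0 \<rho>) B" using box_exists[OF compact_cball convex_cball \<rho>(2)] by blast
  have B1: "B \<ge> 1" using boxD(2)[OF b] .
  \<comment> \<open>Short enough that the difference of two flow lines drifts by at most \<eta>
    times its initial length; the 3 bounds the Gronwall factor through \<open>exp 1\<close>.\<close>
  define \<delta> where "\<delta> = \<eta> / (3 * B)"
  have \<delta>: "\<delta> > 0" using \<eta> B1 by (simp add: \<delta>_def)
  have eB: "exp (B * s) \<le> 3" if "s \<le> \<delta>" for s
  proof -
    have "B * s \<le> B * \<delta>" using that B1 by simp
    also have "\<dots> = \<eta> / 3" using B1 by (simp add: \<delta>_def)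
    also have "\<dots> \<le> 1" using \<eta> by simp
    finally have "exp (B * s) \<le> exp 1" by simp
    then show ?thesis using exp_le by linarith
  qed
  show ?thesis
  proof (rule exI[of _ \<rho>], rule conjI[OF \<rho>(1)], rule exI[of _ \<delta>], rule conjI[OF \<delta>], rule conjI[OF \<rho>(2)], intro allI impI)
    fix Y s1 assume Y: "open Y \<and> Y \<noteq> {} \<and> Y \<subseteq> ball z0 \<rho>"
    define bad where "bad \<zeta> \<tau> z \<longleftrightarrow> \<tau> \<le> \<delta> \<and> flowline X 0 \<tau> \<zeta> \<and> \<zeta> ` {0..\<tau>} \<subseteq> cball z0 \<rho> \<and> \<zeta> 0 = z \<and>
       ((hf (\<zeta> \<tau>) = 0 \<and> P (\<zeta> \<tau>) = 0) \<or> (\<tau> = s1 \<and> hf (\<zeta> \<tau>) = 0))" for \<zeta> \<tau> z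
    show "\<exists>z\<in>Y. \<forall>\<zeta> \<tau>. \<tau> \<le> \<delta> \<and> flowline X 0 \<tau> \<zeta> \<and> \<zeta> ` {0..\<tau>} \<subseteq> cball z0 \<rho> \<and> \<zeta> 0 = z \<longrightarrow>
        \<not> (hf (\<zeta> \<tau>) = 0 \<and> P (\<zeta> \<tau>) = 0) \<and> (\<tau> = s1 \<longrightarrow> hf (\<zeta> \<tau>) \<noteq> 0)"
    proof (rule ccontr)
      assume "\<not> ?thesis"
      then have "\<forall>z\<in>Y. \<exists>\<zeta> \<tau>. bad \<zeta> \<tau> z" unfolding bad_def by blast
      then obtain Z T where ZT: "\<And>z. z \<in> Y \<Longrightarrow> bad (Z z) (T z) z" by metis
      obtain zs e where zs: "zs \<in> Y" "e > 0" "ball zs e \<subseteq> Y" using Y openE by (metis all_not_in_conv)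
      define len where "len = e / (2 * nv)"
      have len: "len > 0" using zs nv by (simp add: len_def)
      define c \<tau> where "c r = Z (zs + r *\<^sub>R v)" and "\<tau> r = T (zs + r *\<^sub>R v)" for r
      have bad: "bad (c r) (\<tau> r) (zs + r *\<^sub>R v)" if "r \<in> {0..len}" for r
      proof -
        have "r * nv \<le> len * nv" using that nv by (intro mult_right_mono) auto
        then have "r * nv < e" using zs nv by (simp add: len_def)
        then have "zs + r *\<^sub>R v \<in> ball zs e" using that by (simp add: dist_norm nv_def)
        then show ?thesis unfolding c_def \<tau>_def using ZT zs by blast
      qed
      \<comment> \<open>The flow distorts the segment so little that \<open>hf\<close> still
        separates two flow lines at any common time, by half their parameter difference; the two
        errors cost a quarter each.\<close>
      have sep: "hf (c r' s) - hf (c r s) \<ge> (r' - r) / 2"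
        if r: "r \<in> {0..len}" "r' \<in> {0..len}" "r < r'" and s: "0 \<le> s" "s \<le> \<tau> r" "s \<le> \<tau> r'" for r r' s
      proof -
        note B = bad[OF r(1), unfolded bad_def] bad[OF r(2), unfolded bad_def]
        have f: "flowline X 0 s (c r)" "flowline X 0 s (c r')" using B s by (auto intro: flowline_sub)
        have i: "c r x \<in> cball z0 \<rho>" "c r' x \<in> cball z0 \<rho>" if "x \<in> {0..s}" for x
        proof -
          have "x \<in> {0..\<tau> r}" "x \<in> {0..\<tau> r'}" using that s by auto
          then show "c r x \<in> cball z0 \<rho>" "c r' x \<in> cball z0 \<rho>" using B by (meson image_subset_iff)+
        qed
        have ii: "c r ` {0..x} \<subseteq> cball z0 \<rho>" "c r' ` {0..x} \<subseteq> cball z0 \<rho>" if "x \<le> s" for x using i that by auto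
        have s\<delta>: "s \<le> \<delta>" using B s by linarith
        define d where "d = (r' - r) * nv"
        have d0: "d \<ge> 0" using r nv by (simp add: d_def)
        have init: "c r' 0 - c r 0 = (r' - r) *\<^sub>R v" using B by (simp add: algebra_simps)
        have nd: "norm (c r' 0 - c r 0) = d" unfolding init using r by (simp add: d_def nv_def)
        have g: "norm (c r' x - c r x) \<le> 3 * d" if "0 \<le> x" "x \<le> s" for x
        proof -
          have "norm (c r' x - c r x) \<le> exp (B * (x - 0)) * norm (c r' 0 - c r 0)"
            by (rule gronwall(1)[OF flowline_sub[OF f(1)] ii(1) flowline_sub[OF f(2)] ii(2)])
               (use that B1 boxD(5)[OF b] in auto)
          also have "\<dots> \<le> 3 * d" unfolding nd using eB[of x] that s\<delta> d0 by (intro mult_right_mono) auto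
          finally show ?thesis .
        qed
        let ?\<Delta> = "c r' s - c r s"
        have \<Delta>: "norm (?\<Delta> - (r' - r) *\<^sub>R v) \<le> \<eta> * d"
        proof -
          have "norm ((c r' s - c r s) - (c r' 0 - c r 0)) \<le> (B * (3 * d)) * (s - 0)"
          proof (rule increment_bound[of 0 s "\<lambda>x. c r' x - c r x" "\<lambda>x. X (c r' x) - X (c r x)"])
            show "continuous_on {0..s} (\<lambda>x. c r' x - c r x)"
              by (intro continuous_on_diff flowline_cont[OF f(1)] flowline_cont[OF f(2)])
            fix x assume x: "0 < x" "x < s"
            show "((\<lambda>x. c r' x - c r x) has_vector_derivative X (c r' x) - X (c r x)) (at x)"
              by (intro has_vector_derivative_diff flowline_deriv[OF f(1) x] flowline_deriv[OF f(2) x])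
            have "norm (X (c r' x) - X (c r x)) \<le> B * norm (c r' x - c r x)"
              by (rule boxD(5)[OF b i(1) i(2)]) (use x in auto)
            also have "\<dots> \<le> B * (3 * d)" using g[of x] x B1 by (intro mult_left_mono) auto
            finally show "norm (X (c r' x) - X (c r x)) \<le> B * (3 * d)" .
          qed (use s in auto)
          also have "\<dots> \<le> (B * (3 * d)) * \<delta>" using s\<delta> B1 d0 by (intro mult_left_mono) auto
          also have "\<dots> = \<eta> * d" using B1 by (simp add: \<delta>_def)
          finally show ?thesis unfolding init .
        qed
        have n\<Delta>: "norm ?\<Delta> \<le> 2 * d"
        proof -
          have "norm ?\<Delta> \<le> norm (?\<Delta> - (r' - r) *\<^sub>R v) + norm ((r' - r) *\<^sub>R v)"
            using norm_triangle_ineq[of "?\<Delta> - (r' - r) *\<^sub>R v" "(r' - r) *\<^sub>R v"] by simp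
          also have "norm ((r' - r) *\<^sub>R v) = d" using nd init by simp
          finally show ?thesis using \<Delta> \<eta> d0 mult_right_mono[OF \<eta>(2) d0] by linarith
        qed
        have "\<bar>?dh (?\<Delta> - (r' - r) *\<^sub>R v)\<bar> \<le> (\<eta> * d) * Nd"
          by (rule order_trans[OF Nd(2)[unfolded real_norm_def] mult_right_mono[OF \<Delta>]]) (use Nd(1) in simp)
        also have "\<dots> = (Nd * \<eta> * nv) * (r' - r)" by (simp add: d_def)
        also have "\<dots> \<le> 1/4 * (r' - r)" using \<eta>(3) r by (intro mult_right_mono) auto
        finally have "\<bar>?dh ?\<Delta> - (r' - r)\<bar> \<le> (r' - r) / 4"
          unfolding linear_diff[OF l] linear_cmul[OF l] dv by simp
        moreover have "\<bar>hf (c r' s) - hf (c r s) - ?dh ?\<Delta>\<bar> \<le> (r' - r) / 4"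
        proof -
          have "\<bar>hf (c r' s) - hf (c r s) - ?dh ?\<Delta>\<bar> \<le> (1 / (8 * nv)) * norm ?\<Delta>"
            using \<rho>(3)[OF i(1) i(2), of s s] s by simp
          also have "\<dots> \<le> (1 / (8 * nv)) * (2 * d)" using n\<Delta> nv by (intro mult_left_mono) auto
          also have "\<dots> = (r' - r) / 4" using nv by (simp add: d_def)
          finally show ?thesis .
        qed
        moreover have "w / 2 \<le> x" if "\<bar>y - w\<bar> \<le> w / 4" "\<bar>x - y\<bar> \<le> w / 4" for x y w :: real
          using abs_le_D2[OF that(1)] abs_le_D2[OF that(2)] by linarith
        ultimately show ?thesis by blast
      qed
      \<comment> \<open>Makes the quadratic bound on \<open>hf\<close>, of order \<open>N\<close> to
        the power -2, smaller than the spacing of the points, of order \<open>1 / N\<close>. The 12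
        is a factor 4 from the two bounds and separation by one half, times 3 from
        \<open>N + 2 \<le> 3 * N\<close>.\<close>
      obtain N :: nat where N: "real N > 12 * B\<^sup>2 * \<delta>\<^sup>2 / len" "N \<ge> 1"
      proof -
        obtain N0 :: nat where "12 * B\<^sup>2 * \<delta>\<^sup>2 / len < real N0" using reals_Archimedean2 by blast
        then show ?thesis by (intro that[of "max N0 1"]) auto
      qed
      have N0: "real N > 0" using N(2) by simp
      define r where "r i = real i * len / real (N + 2)" for i :: nat
      have r01: "r i \<in> {0..len}" if "i \<in> {0..N+2}" for i
      proof -
        have "real i * len \<le> real (N + 2) * len" using that len by (intro mult_right_mono) auto
        then show ?thesis using len by (auto simp: r_def field_simps)
      qed
      define gr where "gr i \<longleftrightarrow> hf (c (r i) (\<tau> (r i))) = 0 \<and> P (c (r i) (\<tau> (r i))) = 0" for i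
      \<comment> \<open>Grazing times fall into the cells \<open>0\<close> to \<open>N\<close>, the
        last one reached only by the time \<delta> itself. The extra value \<open>N + 1\<close>
        collects points that are bad because \<open>hf\<close> vanishes at time \<open>s1\<close>.
        This gives \<open>N + 2\<close> values for \<open>N + 3\<close> points.\<close>
      define f where "f i = (if gr i then nat \<lfloor>real N * \<tau> (r i) / \<delta>\<rfloor> else N + 1)" for i
      have \<tau>b: "0 \<le> \<tau> (r i)" "\<tau> (r i) \<le> \<delta>" if "i \<in> {0..N+2}" for i
        using bad[OF r01[OF that]] flowline_le unfolding bad_def by blast+
      have fN: "nat \<lfloor>real N * \<tau> (r i) / \<delta>\<rfloor> \<le> N" if "i \<in> {0..N+2}" for i
      proof -
        have "real N * \<tau> (r i) / \<delta> \<le> real N" using \<tau>b[OF that] \<delta> N0 by (simp add: field_simps)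
        then show ?thesis by linarith
      qed
      have "f ` {0..N+2} \<subseteq> {0..N+1}" using fN by (auto simp: f_def le_SucI)
      then have "card (f ` {0..N+2}) \<le> card {0..N+1}" by (intro card_mono) auto
      then have "\<not> inj_on f {0..N+2}" by (intro pigeonhole) auto
      then obtain i j where ij: "i \<in> {0..N+2}" "j \<in> {0..N+2}" "f i = f j" "i < j"
        unfolding inj_on_def by (metis linorder_neqE_nat)
      have rij: "r j - r i \<ge> len / real (N + 2)"
      proof -
        have "1 * len \<le> (real j - real i) * len" using ij(4) len by (intro mult_right_mono) auto
        then have "len / real (N + 2) \<le> (real j - real i) * len / real (N + 2)" by (intro divide_right_mono) auto
        then show ?thesis by (simp add: r_def diff_divide_distrib left_diff_distrib)
      qed
      have rlt: "r i < r j" using rij len by (smt (verit) divide_pos_pos of_nat_0_less_iff add_gr_0 zero_less_numeral)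
      show False
      proof (cases "gr i")
        case True
        then have gj: "gr j" using ij(3) fN[OF ij(1)] by (auto simp: f_def split: if_splits)
        define kk where "kk = nat \<lfloor>real N * \<tau> (r i) / \<delta>\<rfloor>"
        have kk: "kk = nat \<lfloor>real N * \<tau> (r j) / \<delta>\<rfloor>" using ij(3) True gj by (simp add: f_def kk_def)
        \<comment> \<open>The left end of the common cell is a time at which both flow lines are
          still present, and both graze within \<open>\<delta> / real N\<close> of it.\<close>
        define s where "s = real kk * \<delta> / real N"
        have st: "0 \<le> s \<and> s \<le> \<tau> (r m) \<and> \<tau> (r m) - s \<le> \<delta> / real N"
          if "m \<in> {0..N+2}" "kk = nat \<lfloor>real N * \<tau> (r m) / \<delta>\<rfloor>" for m
        proof -
          have "0 \<le> real N * \<tau> (r m) / \<delta>" using \<tau>b[OF that(1)] \<delta> by simp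
          then have "real kk \<le> real N * \<tau> (r m) / \<delta>" "real N * \<tau> (r m) / \<delta> \<le> real kk + 1" using that(2) by linarith+
          then have 1: "real kk * \<delta> \<le> \<tau> (r m) * real N" and 2: "\<tau> (r m) * real N \<le> (real kk + 1) * \<delta>"
            using \<delta> by (simp_all add: field_simps)
          have "s \<le> \<tau> (r m)" unfolding s_def using 1 N0 by (simp add: pos_divide_le_eq)
          moreover have "\<tau> (r m) \<le> (real kk + 1) * \<delta> / real N" using 2 N0 by (simp only: pos_le_divide_eq)
          then have "\<tau> (r m) - s \<le> \<delta> / real N" by (simp add: s_def distrib_right add_divide_distrib)
          ultimately show ?thesis using \<delta> N0 by (simp add: s_def)
        qed
        note si = st[OF ij(1) kk_def] and sj = st[OF ij(2) kk]
        have hb: "\<bar>hf (c (r m) s)\<bar> \<le> B\<^sup>2 * (\<delta> / real N)\<^sup>2"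
          if m: "m \<in> {0..N+2}" "gr m" and sm: "0 \<le> s \<and> s \<le> \<tau> (r m) \<and> \<tau> (r m) - s \<le> \<delta> / real N" for m
        proof -
          have "\<bar>hf (c (r m) s)\<bar> \<le> B\<^sup>2 * (\<tau> (r m) - s)\<^sup>2"
            by (rule hf_near_graze[OF b, of 0]) (use bad[OF r01[OF m(1)]] m sm in \<open>auto simp: bad_def gr_def\<close>)
          also have "\<dots> \<le> B\<^sup>2 * (\<delta> / real N)\<^sup>2" using sm by (intro mult_left_mono power_mono) auto
          finally show ?thesis .
        qed
        have "(r j - r i) / 2 \<le> 2 * (B\<^sup>2 * (\<delta> / real N)\<^sup>2)"
          using sep[OF r01[OF ij(1)] r01[OF ij(2)] rlt, of s] si sj hb[OF ij(1) True si] hb[OF ij(2) gj sj] by linarith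
        then have "len / real (N + 2) \<le> 4 * B\<^sup>2 * \<delta>\<^sup>2 / (real N)\<^sup>2" using rij by (simp add: power_divide)
        moreover have "len / (3 * real N) \<le> len / real (N + 2)" using N(2) len by (intro divide_left_mono) auto
        ultimately have "len / (3 * real N) \<le> 4 * B\<^sup>2 * \<delta>\<^sup>2 / (real N)\<^sup>2" by linarith
        then have "len * real N \<le> 12 * B\<^sup>2 * \<delta>\<^sup>2" using N0 by (simp add: field_simps power2_eq_square)
        then show False using N(1) len by (simp add: field_simps)
      next
        case False
        then have gj: "\<not> gr j" using ij(3) fN[OF ij(2)] by (auto simp: f_def split: if_splits)
        have "\<tau> (r i) = s1" "hf (c (r i) (\<tau> (r i))) = 0" "\<tau> (r j) = s1" "hf (c (r j) (\<tau> (r j))) = 0"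
          using bad[OF r01[OF ij(1)]] bad[OF r01[OF ij(2)]] False gj unfolding bad_def gr_def by auto
        then show False using sep[OF r01[OF ij(1)] r01[OF ij(2)] rlt, of s1] \<tau>b[OF ij(1)] rlt by simp
      qed
    qed
  qed
qed

end

section \<open>Hybrid trajectories in canonical charts\<close>

locale impact_system = mechanical_system A g V h
  for A :: "('q, real^'n) atlas" and g V h +
  assumes hd: "Hausdorff_space (atlas_topology A)"
begin

abbreviation "\<B> \<equiv> cotangent_atlas A"
abbreviation "\<kappa> c \<equiv> snd (cotangent_chart A c)"
abbreviation "cdom c \<equiv> fst (cotangent_chart A c)"
abbreviation "Guard \<equiv> impact_guard A g h"
abbreviation "\<Delta> \<equiv> impact_map A g h"
abbreviation "traj \<equiv> hybrid_trajectory (hamiltonian_impact_system A g V h)"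

definition Graze :: "('q, real^'n) phase set" where
  "Graze = {z \<in> points \<B>. h (fst z) = 0 \<and> snd z (gradient A g h (fst z)) = 0}"

text \<open>The global counterpart of \<open>LE\<close>, so that action integrals can run through
  several charts.\<close>

definition Lag :: "('q, real^'n) phase \<Rightarrow> real" where
  "Lag z = hamiltonian A g V z - 2 * V (fst z)"

lemmas smooth_B = smooth_cotangent_atlas[OF A]

lemma chart_in_B: "c \<in> A \<Longrightarrow> cotangent_chart A c \<in> \<B>"
  by (auto simp: cotangent_atlas_def)

lemma dom_points: "c \<in> A \<Longrightarrow> z \<in> cdom c \<Longrightarrow> z \<in> points \<B>"
  using chart_in_B[of c] by (auto simp: points_def)

lemma dom_exists: "z \<in> points \<B> \<Longrightarrow> \<exists>c\<in>A. z \<in> cdom c"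
  by (auto simp: points_def cotangent_atlas_def)

lemma \<kappa>_in_\<Omega>: "c \<in> A \<Longrightarrow> z \<in> cdom c \<Longrightarrow> \<kappa> c z \<in> \<Omega> c"
  using cotangent_chart_image[OF A] by blast

lemma \<kappa>_surj: "c \<in> A \<Longrightarrow> w \<in> \<Omega> c \<Longrightarrow> \<exists>z\<in>cdom c. \<kappa> c z = w"
  unfolding cotangent_chart_image[OF A, symmetric] by blast

lemma \<kappa>_inj: "c \<in> A \<Longrightarrow> z \<in> cdom c \<Longrightarrow> w \<in> cdom c \<Longrightarrow> \<kappa> c z = \<kappa> c w \<Longrightarrow> z = w"
  by (rule inj_onD[OF cotangent_chart_inj[OF A]])

lemma Guard_chart: "c \<in> A \<Longrightarrow> z \<in> cdom c \<Longrightarrow> z \<in> Guard \<longleftrightarrow> hE c (\<kappa> c z) = 0 \<and> PE c (\<kappa> c z) < 0"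
  using guard_in_chart[of c z] dom_points[of c z] by (cases z) (auto simp: impact_guard_def)

lemma Graze_chart: "c \<in> A \<Longrightarrow> z \<in> cdom c \<Longrightarrow> z \<in> Graze \<longleftrightarrow> hE c (\<kappa> c z) = 0 \<and> PE c (\<kappa> c z) = 0"
  using guard_in_chart[of c z] dom_points[of c z] by (auto simp: Graze_def)

lemma Lag_chart:
  assumes c: "c \<in> A" and z: "z \<in> cdom c"
  shows "Lag z = LE c (\<kappa> c z)"
proof -
  obtain q p where zqp: "z = (q, p)" by (metis surj_pair)
  then have q: "q \<in> fst c" using z by (auto simp: cotangent_chart_domain)
  show ?thesis
    using hamiltonian_in_chart[OF c z] chart_inv_left[OF A c q]
    by (simp add: Lag_def LE_def[OF c] zqp cotangent_chart_apply)
qed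

lemma impact_chart_local:
  assumes c: "c \<in> A"
  shows "impact_chart (\<Omega> c) (XH c) (hE c) (PE c) (LE c) (ham_chart A g V c) (refl_chart A g h c)
    {z \<in> \<Omega> c. nE c z \<noteq> 0} (\<lambda>z. - 2 * PE c z / nE c z)"
proof
  show "open (\<Omega> c)" using open_\<Omega>[OF c] .
  show "Ck_on 1 (\<Omega> c) (XH c)" "Ck_on 2 (\<Omega> c) (hE c)" "Ck_on 1 (\<Omega> c) (PE c)" "Ck_on 1 (\<Omega> c) (LE c)" "Ck_on 2 (\<Omega> c) (ham_chart A g V c)"
    using Ck_XH[OF c] Ck_hE[OF c] Ck_PE[OF c] Ck_LE[OF c] Ck_ham_chart[OF c] by blast+
  show "PE c z = frechet_derivative (hE c) (at z) (XH c z)" if "z \<in> \<Omega> c" for z using PE_eq[OF c that] .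
  show "frechet_derivative (hE c) (at z) (0, b) = 0" if "z \<in> \<Omega> c" for z b using hE_derivative[OF c that] by simp
  show "omega0 (XH c z) v = frechet_derivative (ham_chart A g V c) (at z) v" if "z \<in> \<Omega> c" for z v using omega0_XH[OF c that] .
  show "LE c z = snd z \<bullet> fst (XH c z) - ham_chart A g V c z" if "z \<in> \<Omega> c" for z using LE_eq[OF c that] .
  show "open {z \<in> \<Omega> c. nE c z \<noteq> 0}" using open_nE[OF c] .
  show "{z \<in> \<Omega> c. nE c z \<noteq> 0} \<subseteq> \<Omega> c" by blast
  show "z \<in> {z \<in> \<Omega> c. nE c z \<noteq> 0}" if "z \<in> \<Omega> c" "hE c z = 0" for z using nE_pos(1)[OF c that] that by simp
  show "Ck_on 1 {z \<in> \<Omega> c. nE c z \<noteq> 0} (refl_chart A g h c)" using Ck_RE[OF c] .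
  show "continuous_on {z \<in> \<Omega> c. nE c z \<noteq> 0} (\<lambda>z. - 2 * PE c z / nE c z)"
    by (intro continuous_intros continuous_on_subset[OF Ck_on_continuous[OF Ck_PE[OF c]]] continuous_on_subset[OF Ck_on_continuous[OF Ck_nE[OF c]]]) auto
  show "\<exists>v. frechet_derivative (hE c) (at z) v \<noteq> 0" if "z \<in> \<Omega> c" "hE c z = 0" for z
    using nE_pos(2)[OF c that] hE_derivative[OF c that(1), of "(dvec c h (fst z), 0)"]
    by (intro exI[of _ "(dvec c h (fst z), 0)"]) simp
qed (use RE_props[OF c] in auto)

section \<open>Hybrid trajectories as integral curves in a chart\<close>

lemma trajD:
  assumes "traj t \<gamma>"
  shows "0 \<le> t" "\<And>s. s \<in> {0..t} \<Longrightarrow> \<gamma> s \<in> points \<B>" "finite {s\<in>{0..t}. \<gamma> s \<in> Guard}"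
    "\<And>s. 0 < s \<Longrightarrow> s \<le> t \<Longrightarrow> limitin (atlas_topology \<B>) \<gamma> (\<gamma> s) (at_left s)"
    "\<And>s. 0 \<le> s \<Longrightarrow> s < t \<Longrightarrow> limitin (atlas_topology \<B>) \<gamma> (if \<gamma> s \<in> Guard then \<Delta> (\<gamma> s) else \<gamma> s) (at_right s)"
    "\<And>s c. s \<in> {0..t} \<Longrightarrow> \<gamma> s \<notin> Guard \<Longrightarrow> c \<in> A \<Longrightarrow> \<gamma> s \<in> cdom c \<Longrightarrow>
       ((\<lambda>s. \<kappa> c (\<gamma> s)) has_vector_derivative XH c (\<kappa> c (\<gamma> s))) (at s within {0..t})"
proof -
  note T = assms[unfolded hybrid_trajectory_def hamiltonian_impact_system_def hybrid_system.simps]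
  show "0 \<le> t" "\<And>s. s \<in> {0..t} \<Longrightarrow> \<gamma> s \<in> points \<B>" "finite {s\<in>{0..t}. \<gamma> s \<in> Guard}"
    "\<And>s. 0 < s \<Longrightarrow> s \<le> t \<Longrightarrow> limitin (atlas_topology \<B>) \<gamma> (\<gamma> s) (at_left s)"
    "\<And>s. 0 \<le> s \<Longrightarrow> s < t \<Longrightarrow> limitin (atlas_topology \<B>) \<gamma> (if \<gamma> s \<in> Guard then \<Delta> (\<gamma> s) else \<gamma> s) (at_right s)"
    using T by auto
  fix s c assume s: "s \<in> {0..t}" "\<gamma> s \<notin> Guard" and c: "c \<in> A" "\<gamma> s \<in> cdom c"
  have "(\<kappa> c \<circ> \<gamma> has_vector_derivative hamiltonian_vector_field A (hamiltonian A g V) (\<gamma> s) (cotangent_chart A c)) (at s within {0..t})"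
    using T s c(2) chart_in_B[OF c(1)] by blast
  then show "((\<lambda>s. \<kappa> c (\<gamma> s)) has_vector_derivative XH c (\<kappa> c (\<gamma> s))) (at s within {0..t})"
    unfolding vector_field_in_chart[OF c] comp_def .
qed

text \<open>The right limit at \<open>s\<close>, that is, the state from which the motion
  continues.\<close>

definition post :: "(real \<Rightarrow> ('q, real^'n) phase) \<Rightarrow> real \<Rightarrow> ('q, real^'n) phase" where
  "post \<gamma> s = (if \<gamma> s \<in> Guard then \<Delta> (\<gamma> s) else \<gamma> s)"

lemma Hausdorff_B: "Hausdorff_space (atlas_topology \<B>)"
  using Hausdorff_cotangent[OF A hd] .

text \<open>Speed at most \<open>M\<close> keeps a curve inside the ball for a time below
  \<open>r / M\<close>. The trajectory is given only through limits on the manifold, so staying in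
  the chart domain must be proved along with the bound: both are continued up to the supremum of the
  times where they hold. Starting from \<open>post\<close> makes this apply right after an impact
  too.\<close>

lemma confine:
  assumes tr: "traj t \<gamma>" and c: "c \<in> A" and ab: "0 \<le> a" "a \<le> b" "b \<le> t"
    and ni: "\<And>s. a < s \<Longrightarrow> s < b \<Longrightarrow> \<gamma> s \<notin> Guard"
    and w: "post \<gamma> a \<in> cdom c" "w = \<kappa> c (post \<gamma> a)"
    and r: "cball w r \<subseteq> \<Omega> c" "r > 0" and M: "\<And>z. z \<in> cball w r \<Longrightarrow> norm (XH c z) \<le> M" "M * (b - a) < r"
  shows "\<exists>\<zeta>. flowline (XH c) a b \<zeta> \<and> \<zeta> a = w \<and> \<zeta> ` {a..b} \<subseteq> cball w r \<and> (\<forall>s\<in>{a<..b}. \<gamma> s \<in> cdom c \<and> \<zeta> s = \<kappa> c (\<gamma> s))"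
proof -
  define \<zeta> where "\<zeta> s = (if s = a then w else \<kappa> c (\<gamma> s))" for s
  note C = chart_in_B[OF c]
  have M0: "M \<ge> 0" using order_trans[OF norm_ge_zero M(1)[of w]] r(2) by simp
  have M': "M * (s - a) < r" if "s \<le> b" for s
    using M(2) mult_left_mono[of "s - a" "b - a" M] M0 that by linarith
  have fl: "flowline (XH c) a s \<zeta>" if s: "a < s" "s \<le> b" and dom: "\<And>x. a < x \<Longrightarrow> x \<le> s \<Longrightarrow> \<gamma> x \<in> cdom c" for s
  proof -
    have d: "(\<zeta> has_vector_derivative XH c (\<zeta> x)) (at x)" if x: "a < x" "x < s" for x
    proof -
      have "((\<lambda>s. \<kappa> c (\<gamma> s)) has_vector_derivative XH c (\<kappa> c (\<gamma> x))) (at x within {0..t})"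
        by (rule trajD(6)[OF tr _ ni c dom]) (use x s ab in auto)
      moreover have "at x within {0..t} = at x" using x s ab by (intro at_within_Icc_at) auto
      ultimately have "((\<lambda>s. \<kappa> c (\<gamma> s)) has_vector_derivative XH c (\<zeta> x)) (at x)" using x by (simp add: \<zeta>_def)
      then show ?thesis
        by (rule has_vector_derivative_transform_within_open[of _ _ _ "{a<..}"]) (use x in \<open>auto simp: \<zeta>_def\<close>)
    qed
    have "continuous (at x within {a..s}) \<zeta>" if x: "x \<in> {a..s}" for x
    proof -
      consider "x = a" | "x = s" | "a < x" "x < s" using x by force
      then show ?thesis
      proof cases
        case 1
        have "limitin (atlas_topology \<B>) \<gamma> (post \<gamma> a) (at_right a)"
          using trajD(5)[OF tr, of a] ab s unfolding post_def by simp
        from limitin_chartD(2)[OF smooth_B this C w(1)]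
        have "((\<lambda>s. \<kappa> c (\<gamma> s)) \<longlongrightarrow> w) (at_right a)" by (simp add: w(2))
        then have "(\<zeta> \<longlongrightarrow> w) (at_right a)"
          by (rule Lim_transform_eventually) (auto simp: eventually_at_right_less \<zeta>_def eventually_at_filter)
        then show ?thesis using s 1 by (simp add: continuous_within at_within_Icc_at_right \<zeta>_def)
      next
        case 2
        have "limitin (atlas_topology \<B>) \<gamma> (\<gamma> s) (at_left s)" using trajD(4)[OF tr, of s] ab s by simp
        from limitin_chartD(2)[OF smooth_B this C dom]
        have "((\<lambda>s. \<kappa> c (\<gamma> s)) \<longlongrightarrow> \<kappa> c (\<gamma> s)) (at_left s)" using s by simp
        moreover have "\<forall>\<^sub>F x in at_left s. \<kappa> c (\<gamma> x) = \<zeta> x"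
          using eventually_at_left_real[OF s(1)] by eventually_elim (auto simp: \<zeta>_def)
        ultimately have "(\<zeta> \<longlongrightarrow> \<kappa> c (\<gamma> s)) (at_left s)" by (rule Lim_transform_eventually)
        then show ?thesis using s 2 by (simp add: continuous_within at_within_Icc_at_left \<zeta>_def)
      next
        case 3
        then show ?thesis
          using continuous_at_imp_continuous_at_within[OF has_vector_derivative_continuous[OF d]] by blast
      qed
    qed
    then show ?thesis using s d by (simp add: flowline_def continuous_on_eq_continuous_within)
  qed
  have dist: "norm (\<zeta> y - \<zeta> x) \<le> M * (y - x)"
    if s: "a < s" "s \<le> b" and good: "\<And>x. a < x \<Longrightarrow> x \<le> s \<Longrightarrow> \<gamma> x \<in> cdom c \<and> \<kappa> c (\<gamma> x) \<in> cball w r" and xy: "a \<le> x" "x \<le> y" "y \<le> s" for s x y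
  proof (rule flowline_increment[OF fl[OF s] xy])
    show "\<gamma> x \<in> cdom c" if "a < x" "x \<le> s" for x using good that by blast
    show "norm (XH c (\<zeta> x)) \<le> M" if "x \<in> {a..s}" for x
      using M(1)[of w] M(1)[of "\<kappa> c (\<gamma> x)"] good[of x] that r(2) by (cases "x = a") (auto simp: \<zeta>_def)
  qed
  define good where "good s \<longleftrightarrow> (\<forall>x\<in>{a<..s}. \<gamma> x \<in> cdom c \<and> \<kappa> c (\<gamma> x) \<in> cball w r)" for s
  define S where "S = {s \<in> {a..b}. good s}"
  define T where "T = Sup S"
  have aS: "a \<in> S" using ab by (simp add: S_def good_def)
  have bdd: "bdd_above S" unfolding S_def by auto
  have aT: "a \<le> T" unfolding T_def by (rule cSup_upper[OF aS bdd])
  have Tb: "T \<le> b" unfolding T_def by (rule cSup_least) (use aS in \<open>auto simp: S_def\<close>)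
  have below: "good s" if sT: "s < T" for s
  proof -
    obtain s' where "s' \<in> S" "s < s'" using sT aS less_cSup_iff[OF _ bdd, of s] unfolding T_def by blast
    then show ?thesis by (auto simp: S_def good_def)
  qed
  have goodT: "good T"
  proof (cases "T = a")
    case False
    then have aT: "a < T" using aT by simp
    have lip: "norm (\<zeta> y - \<zeta> x) \<le> M * \<bar>y - x\<bar>" if "x \<in> {a<..<T}" "y \<in> {a<..<T}" for x y
    proof -
      have 1: "norm (\<zeta> y - \<zeta> x) \<le> M * (y - x)" if "a < x" "x \<le> y" "y < T" for x y
        by (rule dist[of y]) (use that below[of y] Tb in \<open>auto simp: good_def\<close>)
      show ?thesis using 1[of x y] 1[of y x] that by (cases "x \<le> y") (auto simp: norm_minus_commute)
    qed
    \<comment> \<open>The coordinates are Lipschitz below \<open>T\<close>, so they have a limit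
      there before it is known that \<open>\<gamma> T\<close> lies in the chart domain.\<close>
    have "uniformly_continuous_on {a<..<T} \<zeta>"
      unfolding uniformly_continuous_on_def dist_norm
    proof (intro allI impI)
      fix e :: real assume e: "e > 0"
      show "\<exists>d>0. \<forall>x\<in>{a<..<T}. \<forall>x'\<in>{a<..<T}. norm (x' - x) < d \<longrightarrow> norm (\<zeta> x' - \<zeta> x) < e"
      proof (intro exI[of _ "e / (M + 1)"] conjI ballI impI)
        show "e / (M + 1) > 0" using e M0 by simp
        fix x x' assume x: "x \<in> {a<..<T}" "x' \<in> {a<..<T}" "norm (x' - x) < e / (M + 1)"
        have "norm (\<zeta> x' - \<zeta> x) \<le> M * \<bar>x' - x\<bar>" by (rule lip[OF x(1,2)])
        also have "\<dots> \<le> (M + 1) * \<bar>x' - x\<bar>" by (intro mult_right_mono) auto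
        also have "\<dots> < e" using x(3) M0 by (simp add: field_simps)
        finally show "norm (\<zeta> x' - \<zeta> x) < e" .
      qed
    qed
    moreover have "T \<in> closure {a<..<T}" using aT by simp
    ultimately obtain l where l: "(\<zeta> \<longlongrightarrow> l) (at T within {a<..<T})"
      using uniformly_continuous_on_extension_at_closure by blast
    have atl: "at T within {a<..<T} = at_left T" by (rule at_within_nhd[of _ "{a<..}"]) (use aT in auto)
    have ev: "\<forall>\<^sub>F x in at_left T. a < x \<and> x < T" using eventually_at_left_real[OF aT] by eventually_elim auto
    have lc: "l \<in> cball w r"
    proof (rule Lim_in_closed_set[OF closed_cball _ trivial_limit_at_left_real])
      show "(\<zeta> \<longlongrightarrow> l) (at_left T)" using l atl by simp
      show "\<forall>\<^sub>F x in at_left T. \<zeta> x \<in> cball w r"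
        using ev by eventually_elim (use below in \<open>auto simp: \<zeta>_def good_def\<close>)
    qed
    obtain zs where zs: "zs \<in> cdom c" "\<kappa> c zs = l" using \<kappa>_surj[OF c] lc r(1) by blast
    have "limitin (atlas_topology \<B>) \<gamma> zs (at_left T)"
    proof (rule limitin_chartI[OF smooth_B C zs(1)])
      show "\<forall>\<^sub>F s in at_left T. \<gamma> s \<in> cdom c" using ev by eventually_elim (use below in \<open>auto simp: good_def\<close>)
      have "\<forall>\<^sub>F x in at_left T. \<zeta> x = \<kappa> c (\<gamma> x)" using ev by eventually_elim (auto simp: \<zeta>_def)
      then show "((\<lambda>s. \<kappa> c (\<gamma> s)) \<longlongrightarrow> \<kappa> c zs) (at_left T)"
        unfolding zs(2) by (rule Lim_transform_eventually[OF l[unfolded atl]])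
    qed
    moreover have "limitin (atlas_topology \<B>) \<gamma> (\<gamma> T) (at_left T)" using trajD(4)[OF tr, of T] aT ab Tb by simp
    \<comment> \<open>The lifted limit and \<open>\<gamma> T\<close> are both left limits of the
      trajectory at \<open>T\<close>, hence equal.\<close>
    ultimately have "\<gamma> T = zs"
      using limitin_Hausdorff_unique[of "atlas_topology \<B>" \<gamma> _ "at_left T"] Hausdorff_B trivial_limit_at_left_real by blast
    then have "\<gamma> T \<in> cdom c \<and> \<kappa> c (\<gamma> T) \<in> cball w r" using zs lc by simp
    moreover have "\<gamma> x \<in> cdom c \<and> \<kappa> c (\<gamma> x) \<in> cball w r" if "a < x" "x < T" for x
      using below[OF that(2)] that(1) by (auto simp: good_def)
    ultimately show ?thesis unfolding good_def by (metis greaterThanAtMost_iff order_le_less)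
  qed (simp add: good_def)
  have "T = b"
  proof (rule ccontr)
    assume "T \<noteq> b"
    then have Tb: "T < b" using Tb by simp
    \<comment> \<open>At \<open>T\<close> the curve is still strictly inside the ball, so the right
      limit carries it on, against the choice of \<open>T\<close>.\<close>
    have near: "post \<gamma> T \<in> cdom c \<and> \<kappa> c (post \<gamma> T) \<in> ball w r"
    proof (cases "T = a")
      case True
      then show ?thesis using w r(2) by simp
    next
      case False
      then have aT: "a < T" using aT by simp
      have "norm (\<zeta> T - \<zeta> a) \<le> M * (T - a)"
        by (rule dist[of T]) (use aT Tb goodT in \<open>auto simp: good_def\<close>)
      then have "norm (\<kappa> c (\<gamma> T) - w) < r" using M'[of T] Tb aT by (simp add: \<zeta>_def)
      then show ?thesis using goodT aT ni[OF aT Tb] by (auto simp: good_def post_def dist_norm norm_minus_commute)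
    qed
    have "limitin (atlas_topology \<B>) \<gamma> (post \<gamma> T) (at_right T)"
      using trajD(5)[OF tr, of T] aT Tb ab unfolding post_def by simp
    note lim = limitin_chartD[OF smooth_B this C conjunct1[OF near]]
    have "\<forall>\<^sub>F x in at_right T. \<gamma> x \<in> cdom c \<and> \<kappa> c (\<gamma> x) \<in> ball w r"
      using lim(1) topological_tendstoD[OF lim(2) open_ball conjunct2[OF near]] by eventually_elim auto
    then obtain u where u: "u > T" "\<And>x. T < x \<Longrightarrow> x < u \<Longrightarrow> \<gamma> x \<in> cdom c \<and> \<kappa> c (\<gamma> x) \<in> ball w r"
      unfolding eventually_at_right_field by blast
    define y where "y = min b ((T + u) / 2)"
    have y: "T < y" "y < u" "y \<le> b" using u Tb by (auto simp: y_def min_def)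
    have "good y" unfolding good_def
    proof
      fix x assume x: "x \<in> {a<..y}"
      show "\<gamma> x \<in> cdom c \<and> \<kappa> c (\<gamma> x) \<in> cball w r"
        using goodT u(2)[of x] x y by (cases "x \<le> T") (auto simp: good_def)
    qed
    then have "y \<in> S" using y aT by (simp add: S_def)
    then have "y \<le> T" unfolding T_def by (rule cSup_upper[OF _ bdd])
    then show False using y by simp
  qed
  then have gb: "good b" using goodT by simp
  have "flowline (XH c) a b \<zeta>"
  proof (cases "a = b")
    case True
    then show ?thesis by (simp add: flowline_def)
  next
    case False
    then show ?thesis using fl[of b] gb ab by (auto simp: good_def)
  qed
  moreover have "\<zeta> ` {a..b} \<subseteq> cball w r"
  proof
    fix y assume "y \<in> \<zeta> ` {a..b}"
    then obtain x where x: "x \<in> {a..b}" "y = \<zeta> x" by blast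
    then show "y \<in> cball w r" using gb r(2) by (cases "x = a") (auto simp: \<zeta>_def good_def)
  qed
  ultimately show ?thesis
    by (intro exI[of _ \<zeta>]) (use gb in \<open>auto simp: \<zeta>_def good_def\<close>)
qed

end

section \<open>Comparison of trajectories over short time windows\<close>

context impact_system
begin

text \<open>The reset keeps position and energy, hence the Lagrangian, so the action integrand has
  no jump where the trajectory has one. This lets action integrals be split at arbitrary
  times.\<close>

lemma Lag_cont:
  assumes tr: "traj t \<gamma>"
  shows "continuous_on {0..t} (\<lambda>s. Lag (\<gamma> s))"
  unfolding continuous_on_eq_continuous_within
proof
  fix s assume s: "s \<in> {0..t}"
  have lim: "((\<lambda>s. Lag (\<gamma> s)) \<longlongrightarrow> Lag z) F" if l: "limitin (atlas_topology \<B>) \<gamma> z F" and z: "z \<in> points \<B>" for z F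
  proof -
    obtain c where c: "c \<in> A" "z \<in> cdom c" using dom_exists[OF z] by blast
    note L = limitin_chartD[OF smooth_B l chart_in_B[OF c(1)] c(2)]
    interpret I: impact_chart "\<Omega> c" "XH c" "hE c" "PE c" "LE c" "ham_chart A g V c" "refl_chart A g h c"
      "{z \<in> \<Omega> c. nE c z \<noteq> 0}" "\<lambda>z. - 2 * PE c z / nE c z" by (rule impact_chart_local[OF c(1)])
    have "isCont (LE c) (\<kappa> c z)"
      using Ck_on_continuous[OF I.CkL] \<kappa>_in_\<Omega>[OF c] unfolding continuous_on_eq_continuous_at[OF I.D] by (rule bspec)
    from isCont_tendsto_compose[OF this L(2)]
    have "((\<lambda>s. LE c (\<kappa> c (\<gamma> s))) \<longlongrightarrow> Lag z) F" by (simp add: Lag_chart[OF c])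
    moreover have "\<forall>\<^sub>F s in F. LE c (\<kappa> c (\<gamma> s)) = Lag (\<gamma> s)"
      using L(1) by eventually_elim (simp add: Lag_chart[OF c(1)])
    ultimately show ?thesis by (rule Lim_transform_eventually)
  qed
  have left: "((\<lambda>s. Lag (\<gamma> s)) \<longlongrightarrow> Lag (\<gamma> s)) (at_left s)" if "0 < s"
    using lim[OF trajD(4)[OF tr that] trajD(2)[OF tr s]] s by simp
  have right: "((\<lambda>s. Lag (\<gamma> s)) \<longlongrightarrow> Lag (\<gamma> s)) (at_right s)" if st: "s < t"
  proof (cases "\<gamma> s \<in> Guard")
    case True
    obtain c where c: "c \<in> A" "\<gamma> s \<in> cdom c" using dom_exists[OF trajD(2)[OF tr s]] by blast
    note im = impact_map_in_chart[OF c]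
    have "Lag (\<Delta> (\<gamma> s)) = Lag (\<gamma> s)"
      using Lag_chart[OF c] Lag_chart[OF c(1) im(1)] im(2) RE_props(7)[OF c(1) \<kappa>_in_\<Omega>[OF c]] Guard_chart[OF c] True by simp
    then show ?thesis using lim[OF trajD(5)[OF tr _ st]] s True dom_points[OF c(1) im(1)] by simp
  next
    case False
    then show ?thesis using lim[OF trajD(5)[OF tr _ st]] s trajD(2)[OF tr s] by simp
  qed
  consider "s = 0" "t = 0" | "s = 0" "0 < t" | "s = t" "0 < t" | "0 < s" "s < t" using s by force
  then show "continuous (at s within {0..t}) (\<lambda>s. Lag (\<gamma> s))"
  proof cases
    case 1
    then show ?thesis using continuous_on_sing[of 0 "\<lambda>s. Lag (\<gamma> s)"] by (simp add: continuous_on_eq_continuous_within)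
  next
    case 2
    then show ?thesis using right by (simp add: continuous_within at_within_Icc_at_right)
  next
    case 3
    then show ?thesis using left by (simp add: continuous_within at_within_Icc_at_left)
  next
    case 4
    then have "isCont (\<lambda>s. Lag (\<gamma> s)) s" using left right by (simp add: isCont_def filterlim_split_at)
    then show ?thesis by (rule continuous_at_imp_continuous_at_within)
  qed
qed

text \<open>The last conjunct is the first variation formula for the action with an error bound that
  survives composition of windows.\<close>

definition window_est :: "('q, real^'n) chart \<Rightarrow> real \<Rightarrow> real \<Rightarrow> real \<Rightarrow> (real \<Rightarrow> ('q, real^'n) phase) \<Rightarrow> (real \<Rightarrow> ('q, real^'n) phase) \<Rightarrow> bool" where
  "window_est c C a b \<gamma> \<gamma>' \<longleftrightarrow>
     norm (\<kappa> c (\<gamma>' b) - \<kappa> c (\<gamma> b)) \<le> C * norm (\<kappa> c (\<gamma>' a) - \<kappa> c (\<gamma> a)) \<and>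
     (\<kappa> c (\<gamma>' b) = \<kappa> c (\<gamma> b) \<longrightarrow> \<kappa> c (\<gamma>' a) = \<kappa> c (\<gamma> a)) \<and>
     \<bar>integral {a..b} (\<lambda>s. Lag (\<gamma>' s)) - integral {a..b} (\<lambda>s. Lag (\<gamma> s))
       - snd (\<kappa> c (\<gamma> b)) \<bullet> (fst (\<kappa> c (\<gamma>' b)) - fst (\<kappa> c (\<gamma> b)))
       + snd (\<kappa> c (\<gamma> a)) \<bullet> (fst (\<kappa> c (\<gamma>' a)) - fst (\<kappa> c (\<gamma> a)))\<bar>
       \<le> C * (norm (\<kappa> c (\<gamma>' a) - \<kappa> c (\<gamma> a)))\<^sup>2"

lemma first_impact:
  assumes tr: "traj t \<gamma>" and ab: "0 \<le> a" "b \<le> t" and im: "s \<in> {a..b}" "\<gamma> s \<in> Guard"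
  shows "\<exists>\<tau>\<in>{a..b}. \<gamma> \<tau> \<in> Guard \<and> (\<forall>s\<in>{a..<\<tau>}. \<gamma> s \<notin> Guard)"
proof -
  let ?F = "{s\<in>{a..b}. \<gamma> s \<in> Guard}"
  have "?F \<subseteq> {s\<in>{0..t}. \<gamma> s \<in> Guard}" using ab by auto
  then have fin: "finite ?F" using trajD(3)[OF tr] finite_subset by blast
  have ne: "?F \<noteq> {}" using im by blast
  have "Min ?F \<in> ?F" by (rule Min_in[OF fin ne])
  moreover have "\<gamma> s \<notin> Guard" if "s \<in> {a..<Min ?F}" for s
  proof
    assume "\<gamma> s \<in> Guard"
    then have "s \<in> ?F" using that calculation by auto
    then have "Min ?F \<le> s" by (rule Min_le[OF fin])
    then show False using that by simp
  qed
  ultimately show ?thesis by blast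
qed

text \<open>\<open>S\<close> contains neither impact nor grazing states. Up to a first impact
  \<open>confine\<close> would keep the trajectory in \<open>S\<close>, including the impact state,
  which is absurd.\<close>

lemma regular_segment:
  assumes c: "c \<in> A" and S: "cball w \<rho>' \<subseteq> S" "S \<subseteq> \<Omega> c" "\<rho>' > 0" and nG: "\<And>z. z \<in> S \<Longrightarrow> \<not> (hE c z = 0 \<and> PE c z \<le> 0)"
    and M: "\<And>z. z \<in> S \<Longrightarrow> norm (XH c z) \<le> M" "M * (b - a) < \<rho>'"
    and tr: "traj t \<gamma>" and ab: "0 \<le> a" "a \<le> b" "b \<le> t" and w: "\<gamma> a \<in> cdom c" "w = \<kappa> c (\<gamma> a)"
  shows "\<exists>\<zeta>. flowline (XH c) a b \<zeta> \<and> \<zeta> ` {a..b} \<subseteq> S \<and> (\<forall>s\<in>{a..b}. \<gamma> s \<in> cdom c \<and> \<zeta> s = \<kappa> c (\<gamma> s) \<and> \<gamma> s \<notin> Guard \<and> \<gamma> s \<notin> Graze)"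
proof -
  have wS: "w \<in> S" using S(1,3) by auto
  have M0: "M \<ge> 0" using order_trans[OF norm_ge_zero M(1)[OF wS]] .
  have nGuard: "z \<notin> Guard \<and> z \<notin> Graze" if "z \<in> cdom c" "\<kappa> c z \<in> S" for z
    using nG[OF that(2)] Guard_chart[OF c that(1)] Graze_chart[OF c that(1)] by auto
  have pa: "post \<gamma> a = \<gamma> a" using nGuard[of "\<gamma> a"] w wS by (simp add: post_def)
  have cf: "\<exists>\<zeta>. flowline (XH c) a b' \<zeta> \<and> \<zeta> a = w \<and> \<zeta> ` {a..b'} \<subseteq> cball w \<rho>' \<and> (\<forall>s\<in>{a<..b'}. \<gamma> s \<in> cdom c \<and> \<zeta> s = \<kappa> c (\<gamma> s))"
    if b': "a \<le> b'" "b' \<le> b" "\<And>s. a < s \<Longrightarrow> s < b' \<Longrightarrow> \<gamma> s \<notin> Guard" for b'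
  proof (rule confine[OF tr c ab(1) b'(1) _ b'(3)])
    show "b' \<le> t" using b' ab by simp
    show "post \<gamma> a \<in> cdom c" "w = \<kappa> c (post \<gamma> a)" using pa w by auto
    show "cball w \<rho>' \<subseteq> \<Omega> c" "0 < \<rho>'" using S by auto
    show "norm (XH c z) \<le> M" if "z \<in> cball w \<rho>'" for z using M(1) S(1) that by blast
    have "M * (b' - a) \<le> M * (b - a)" using b' M0 by (intro mult_left_mono) auto
    then show "M * (b' - a) < \<rho>'" using M(2) by simp
  qed
  have no: "\<gamma> s \<notin> Guard" if sab: "s \<in> {a..b}" for s
  proof
    assume "\<gamma> s \<in> Guard"
    then obtain \<tau> where \<tau>: "\<tau> \<in> {a..b}" "\<gamma> \<tau> \<in> Guard" "\<forall>s\<in>{a..<\<tau>}. \<gamma> s \<notin> Guard"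
      using first_impact[OF tr ab(1,3) sab] by blast
    have "a \<noteq> \<tau>" using \<tau>(2) nGuard[of "\<gamma> a"] w wS by auto
    then have at: "a < \<tau>" using \<tau>(1) by auto
    obtain \<zeta> where \<zeta>: "\<zeta> ` {a..\<tau>} \<subseteq> cball w \<rho>'" "\<forall>s\<in>{a<..\<tau>}. \<gamma> s \<in> cdom c \<and> \<zeta> s = \<kappa> c (\<gamma> s)"
      using cf[of \<tau>] \<tau> by auto
    have "\<zeta> \<tau> \<in> S" by (rule subsetD[OF S(1) subsetD[OF \<zeta>(1)]]) (use at in auto)
    then have "\<gamma> \<tau> \<in> cdom c" "\<kappa> c (\<gamma> \<tau>) \<in> S" using at \<zeta>(2) by auto
    then show False using nGuard \<tau>(2) by blast
  qed
  obtain \<zeta> where \<zeta>: "flowline (XH c) a b \<zeta>" "\<zeta> a = w" "\<zeta> ` {a..b} \<subseteq> cball w \<rho>'" "\<forall>s\<in>{a<..b}. \<gamma> s \<in> cdom c \<and> \<zeta> s = \<kappa> c (\<gamma> s)"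
    using cf[OF ab(2)] no by auto
  have all: "\<gamma> s \<in> cdom c \<and> \<zeta> s = \<kappa> c (\<gamma> s)" if "s \<in> {a..b}" for s
    using \<zeta>(2,4) w that by (cases "s = a") auto
  have SS: "\<zeta> ` {a..b} \<subseteq> S" using \<zeta>(3) S(1) by blast
  have "\<gamma> s \<notin> Guard \<and> \<gamma> s \<notin> Graze" if "s \<in> {a..b}" for s
    using nGuard[of "\<gamma> s"] all[OF that] SS that by (metis image_subset_iff)
  then show ?thesis using \<zeta>(1) SS all by blast
qed

lemma regular_window:
  assumes c: "c \<in> A" and z0: "z0 \<in> cdom c" "z0 \<notin> Guard" "z0 \<notin> Graze"
  shows "\<exists>\<rho>>0. \<exists>\<epsilon>>0. \<exists>C>0. \<forall>t \<gamma> \<gamma>' a b. traj t \<gamma> \<longrightarrow> traj t \<gamma>' \<longrightarrow> 0 \<le> a \<longrightarrow> a \<le> b \<longrightarrow> b \<le> t \<longrightarrow> b - a \<le> \<epsilon> \<longrightarrow>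
     \<gamma> a \<in> cdom c \<longrightarrow> \<gamma>' a \<in> cdom c \<longrightarrow> dist (\<kappa> c z0) (\<kappa> c (\<gamma> a)) < \<rho> \<longrightarrow> dist (\<kappa> c z0) (\<kappa> c (\<gamma>' a)) < \<rho> \<longrightarrow>
     (\<forall>s\<in>{a..b}. \<gamma> s \<in> cdom c \<and> \<gamma> s \<notin> Guard \<and> \<gamma> s \<notin> Graze) \<and> window_est c C a b \<gamma> \<gamma>'"
proof -
  interpret I: impact_chart "\<Omega> c" "XH c" "hE c" "PE c" "LE c" "ham_chart A g V c" "refl_chart A g h c"
      "{z \<in> \<Omega> c. nE c z \<noteq> 0}" "\<lambda>z. - 2 * PE c z / nE c z" by (rule impact_chart_local[OF c])
  let ?w0 = "\<kappa> c z0"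
  \<comment> \<open>The neighbourhood may contain states on the level set with \<open>P > 0\<close>,
    such as those right after a reset; the motion leaves the level set from them.\<close>
  let ?Y = "(\<Omega> c \<inter> hE c -` (- {0})) \<union> (\<Omega> c \<inter> PE c -` {0<..})"
  have "open ?Y"
    by (intro open_Un continuous_open_preimage I.D Ck_on_continuous[OF I.Ckh] Ck_on_continuous[OF I.CkP]) auto
  moreover have "?w0 \<in> ?Y" using z0 Guard_chart[OF c z0(1)] Graze_chart[OF c z0(1)] \<kappa>_in_\<Omega>[OF c z0(1)] by auto
  ultimately obtain r where r: "r > 0" "cball ?w0 r \<subseteq> ?Y" by (meson open_contains_cball)
  define S where "S = cball ?w0 r"
  have S\<Omega>: "S \<subseteq> \<Omega> c" using r unfolding S_def by blast
  have nG: "\<not> (hE c z = 0 \<and> PE c z \<le> 0)" if "z \<in> S" for z using r(2) that unfolding S_def by auto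
  obtain B where b: "I.box S B" using I.box_exists[of S] S\<Omega> unfolding S_def by auto
  have B1: "B \<ge> 1" using I.boxD(2)[OF b] .
  define \<rho> where "\<rho> = r / 2"
  define \<epsilon> where "\<epsilon> = min 1 (\<rho> / (2 * B))"
  have \<rho>: "\<rho> > 0" using r by (simp add: \<rho>_def)
  have \<epsilon>: "\<epsilon> > 0" "\<epsilon> \<le> 1" using \<rho> B1 by (auto simp: \<epsilon>_def)
  have B\<epsilon>: "B * s < \<rho>" if "s \<le> \<epsilon>" for s
  proof -
    have "B * s \<le> B * (\<rho> / (2 * B))" using that B1 by (intro mult_left_mono) (auto simp: \<epsilon>_def)
    also have "\<dots> = \<rho> / 2" using B1 by simp
    finally show ?thesis using \<rho> by simp
  qed
  define C where "C = exp B + B * (exp B)\<^sup>2"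
  have C: "C > 0" "exp B \<le> C" "B * (exp B)\<^sup>2 \<le> C" using B1 by (auto simp: C_def add_pos_nonneg)
  show ?thesis
  proof (rule exI[of _ \<rho>], rule conjI[OF \<rho>], rule exI[of _ \<epsilon>], rule conjI[OF \<epsilon>(1)], rule exI[of _ C], rule conjI[OF C(1)], intro allI impI)
    fix t \<gamma> \<gamma>' a b
    assume tr: "traj t \<gamma>" "traj t \<gamma>'" and ab: "0 \<le> a" "a \<le> b" "b \<le> t" "b - a \<le> \<epsilon>"
      and d: "\<gamma> a \<in> cdom c" "\<gamma>' a \<in> cdom c" and near: "dist ?w0 (\<kappa> c (\<gamma> a)) < \<rho>" "dist ?w0 (\<kappa> c (\<gamma>' a)) < \<rho>"
    have sub: "cball w \<rho> \<subseteq> S" if w: "dist ?w0 w < \<rho>" for w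
    proof
      fix z assume "z \<in> cball w \<rho>"
      then show "z \<in> S" unfolding S_def using dist_triangle[of ?w0 z w] w by (auto simp: \<rho>_def)
    qed
    note seg = regular_segment[OF c sub S\<Omega> \<rho> nG I.boxD(4)[OF b] B\<epsilon>[OF ab(4)] _ ab(1-3) _ refl]
    obtain \<zeta> where \<zeta>: "flowline (XH c) a b \<zeta>" "\<zeta> ` {a..b} \<subseteq> S" and e: "\<And>s. s \<in> {a..b} \<Longrightarrow> \<gamma> s \<in> cdom c \<and> \<zeta> s = \<kappa> c (\<gamma> s) \<and> \<gamma> s \<notin> Guard \<and> \<gamma> s \<notin> Graze"
      using seg[OF near(1) _ _ tr(1) d(1)] by blast
    obtain \<zeta>' where \<zeta>': "flowline (XH c) a b \<zeta>'" "\<zeta>' ` {a..b} \<subseteq> S" and e': "\<And>s. s \<in> {a..b} \<Longrightarrow> \<gamma>' s \<in> cdom c \<and> \<zeta>' s = \<kappa> c (\<gamma>' s) \<and> \<gamma>' s \<notin> Guard \<and> \<gamma>' s \<notin> Graze"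
      using seg[OF near(2) _ _ tr(2) d(2)] by blast
    have B0: "B \<ge> 0" using B1 by simp
    note gw = gronwall[OF \<zeta> \<zeta>' B0 I.boxD(5)[OF b]]
    have eB: "exp (B * (b - a)) \<le> exp B" using ab \<epsilon> B1 by (simp add: mult_left_le)
    have ea: "\<kappa> c (\<gamma> a) = \<zeta> a" "\<kappa> c (\<gamma>' a) = \<zeta>' a" "\<kappa> c (\<gamma> b) = \<zeta> b" "\<kappa> c (\<gamma>' b) = \<zeta>' b"
      using e[of a] e'[of a] e[of b] e'[of b] ab by auto
    have i: "integral {a..b} (\<lambda>s. Lag (\<gamma> s)) = integral {a..b} (\<lambda>s. LE c (\<zeta> s))"
      by (rule integral_cong) (use e Lag_chart[OF c] in auto)
    have i': "integral {a..b} (\<lambda>s. Lag (\<gamma>' s)) = integral {a..b} (\<lambda>s. LE c (\<zeta>' s))"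
      by (rule integral_cong) (use e' Lag_chart[OF c] in auto)
    have "window_est c C a b \<gamma> \<gamma>'"
      unfolding window_est_def ea i i'
    proof (intro conjI impI)
      have "norm (\<zeta>' b - \<zeta> b) \<le> exp B * norm (\<zeta>' a - \<zeta> a)"
        using gw(1) mult_right_mono[OF eB, of "norm (\<zeta>' a - \<zeta> a)"] by simp
      also have "\<dots> \<le> C * norm (\<zeta>' a - \<zeta> a)" using C(2) by (intro mult_right_mono) auto
      finally show "norm (\<zeta>' b - \<zeta> b) \<le> C * norm (\<zeta>' a - \<zeta> a)" .
      show "\<zeta>' a = \<zeta> a" if "\<zeta>' b = \<zeta> b" using gw(2) that by simp
      have "B * (exp B * norm (\<zeta>' a - \<zeta> a))\<^sup>2 = (B * (exp B)\<^sup>2) * (norm (\<zeta>' a - \<zeta> a))\<^sup>2"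
        by (simp add: power_mult_distrib)
      also have "\<dots> \<le> C * (norm (\<zeta>' a - \<zeta> a))\<^sup>2" using C(3) by (intro mult_right_mono) auto
      finally show "\<bar>integral {a..b} (\<lambda>s. LE c (\<zeta>' s)) - integral {a..b} (\<lambda>s. LE c (\<zeta> s)) - snd (\<zeta> b) \<bullet> (fst (\<zeta>' b) - fst (\<zeta> b)) + snd (\<zeta> a) \<bullet> (fst (\<zeta>' a) - fst (\<zeta> a))\<bar> \<le> C * (norm (\<zeta>' a - \<zeta> a))\<^sup>2"
        using I.action_regular[OF b \<zeta> \<zeta>'] ab \<epsilon> by linarith
    qed
    then show "(\<forall>s\<in>{a..b}. \<gamma> s \<in> cdom c \<and> \<gamma> s \<notin> Guard \<and> \<gamma> s \<notin> Graze) \<and> window_est c C a b \<gamma> \<gamma>'"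
      using e by blast
  qed
qed

text \<open>Three facts about a neighbourhood of an impact state: two trajectories that both hit
  within the window can be compared across it; hitting within the window persists under perturbation
  of the state at its left end; and any trajectory arriving at \<open>z0\<close> is shortly before
  in the admissible position with \<open>h > 0\<close>.\<close>

lemma impact_window:
  assumes c: "c \<in> A" and z0: "z0 \<in> cdom c" "z0 \<in> Guard"
  shows "\<exists>\<rho>>0. \<exists>\<epsilon>>0. \<exists>C>0.
    (\<forall>t \<gamma> \<gamma>' a b. traj t \<gamma> \<longrightarrow> traj t \<gamma>' \<longrightarrow> 0 \<le> a \<longrightarrow> a \<le> b \<longrightarrow> b \<le> t \<longrightarrow> b - a \<le> \<epsilon> \<longrightarrow>
     \<gamma> a \<in> cdom c \<longrightarrow> \<gamma>' a \<in> cdom c \<longrightarrow> dist (\<kappa> c z0) (\<kappa> c (\<gamma> a)) < \<rho> \<longrightarrow> dist (\<kappa> c z0) (\<kappa> c (\<gamma>' a)) < \<rho> \<longrightarrow>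
     hE c (\<kappa> c (\<gamma> a)) > 0 \<longrightarrow> hE c (\<kappa> c (\<gamma>' a)) > 0 \<longrightarrow> (\<exists>s\<in>{a..<b}. \<gamma> s \<in> Guard) \<longrightarrow> (\<exists>s\<in>{a..<b}. \<gamma>' s \<in> Guard) \<longrightarrow>
     (\<forall>s\<in>{a..b}. \<gamma> s \<notin> Graze) \<and> \<gamma> b \<in> cdom c \<and> \<gamma> b \<notin> Guard \<and> (\<exists>\<tau>. {s\<in>{a..b}. \<gamma> s \<in> Guard} = {\<tau>}) \<and> window_est c C a b \<gamma> \<gamma>') \<and>
    (\<forall>t \<gamma> a b s0. traj t \<gamma> \<longrightarrow> 0 \<le> a \<longrightarrow> a < s0 \<longrightarrow> s0 < b \<longrightarrow> b \<le> t \<longrightarrow> b - a \<le> \<epsilon> \<longrightarrow> \<gamma> a \<in> cdom c \<longrightarrow>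
      dist (\<kappa> c z0) (\<kappa> c (\<gamma> a)) < \<rho> \<longrightarrow> hE c (\<kappa> c (\<gamma> a)) > 0 \<longrightarrow> \<gamma> s0 \<in> Guard \<longrightarrow>
      (\<exists>d>0. \<forall>\<gamma>'. traj t \<gamma>' \<longrightarrow> \<gamma>' a \<in> cdom c \<longrightarrow> norm (\<kappa> c (\<gamma>' a) - \<kappa> c (\<gamma> a)) < d \<longrightarrow>
         dist (\<kappa> c z0) (\<kappa> c (\<gamma>' a)) < \<rho> \<and> hE c (\<kappa> c (\<gamma>' a)) > 0 \<and> (\<exists>s\<in>{a..<b}. \<gamma>' s \<in> Guard))) \<and>
    (\<forall>t \<gamma> s0. traj t \<gamma> \<longrightarrow> 0 < s0 \<longrightarrow> s0 \<le> t \<longrightarrow> \<gamma> s0 = z0 \<longrightarrow>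
      (\<exists>a0<s0. \<forall>a. a0 < a \<longrightarrow> a < s0 \<longrightarrow> 0 \<le> a \<and> \<gamma> a \<in> cdom c \<and> dist (\<kappa> c z0) (\<kappa> c (\<gamma> a)) < \<rho> \<and> hE c (\<kappa> c (\<gamma> a)) > 0))"
proof -
  interpret I: impact_chart "\<Omega> c" "XH c" "hE c" "PE c" "LE c" "ham_chart A g V c" "refl_chart A g h c"
      "{z \<in> \<Omega> c. nE c z \<noteq> 0}" "\<lambda>z. - 2 * PE c z / nE c z" by (rule impact_chart_local[OF c])
  let ?w0 = "\<kappa> c z0" and ?R = "refl_chart A g h c"
  have w0: "?w0 \<in> \<Omega> c" "hE c ?w0 = 0" "PE c ?w0 < 0" using \<kappa>_in_\<Omega>[OF c z0(1)] Guard_chart[OF c z0(1)] z0(2) by auto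
  obtain \<rho>0 r B k where \<rho>0: "\<rho>0 > 0" and r: "r > 0" and bx: "I.impact_boxes (cball ?w0 \<rho>0) (cball (?R ?w0) r) B k"
    and Rs: "?R ` cball ?w0 \<rho>0 \<subseteq> ball (?R ?w0) (r / 2)"
    using I.impact_boxes_exist[OF w0] by blast
  define S0 S1 where "S0 = cball ?w0 \<rho>0" and "S1 = cball (?R ?w0) r"
  have b0: "I.box S0 B" and b1: "I.box S1 B" and k: "k > 0" and P0: "\<And>z. z \<in> S0 \<Longrightarrow> PE c z \<le> - k" and P1: "\<And>z. z \<in> S1 \<Longrightarrow> PE c z \<ge> k"
    using bx unfolding I.impact_boxes_def S0_def S1_def by auto
  have bx: "I.impact_boxes S0 S1 B k" using bx unfolding S0_def S1_def .
  have B1: "B \<ge> 1" using I.boxD(2)[OF b0] .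
  have S0\<Omega>: "S0 \<subseteq> \<Omega> c" and S1\<Omega>: "S1 \<subseteq> \<Omega> c" using I.boxD(1) b0 b1 by auto
  obtain C where C: "C > 0" and est: "\<And>a b \<tau> \<zeta> \<zeta>p \<tau>' \<zeta>' \<zeta>p'. I.broken S0 S1 a \<tau> b \<zeta> \<zeta>p \<Longrightarrow> I.broken S0 S1 a \<tau>' b \<zeta>' \<zeta>p' \<Longrightarrow> b - a \<le> 1 \<Longrightarrow>
     norm (\<zeta>p' b - \<zeta>p b) \<le> C * norm (\<zeta>' a - \<zeta> a) \<and> (\<zeta>p' b = \<zeta>p b \<longrightarrow> \<zeta>' a = \<zeta> a) \<and>
     \<bar>I.broken_action a \<tau>' b \<zeta>' \<zeta>p' - I.broken_action a \<tau> b \<zeta> \<zeta>p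
      - snd (\<zeta>p b) \<bullet> (fst (\<zeta>p' b) - fst (\<zeta>p b)) + snd (\<zeta> a) \<bullet> (fst (\<zeta>' a) - fst (\<zeta> a))\<bar>
      \<le> C * (norm (\<zeta>' a - \<zeta> a))\<^sup>2"
    using I.broken_pair[OF bx] by blast
  define \<rho> where "\<rho> = \<rho>0 / 2"
  define m where "m = min \<rho> (r / 2)"
  define \<epsilon> where "\<epsilon> = min 1 (m / (2 * B))"
  have \<rho>: "\<rho> > 0" using \<rho>0 by (simp add: \<rho>_def)
  have m: "m > 0" "m \<le> \<rho>" "m \<le> r / 2" using \<rho> r by (auto simp: m_def)
  have \<epsilon>: "\<epsilon> > 0" "\<epsilon> \<le> 1" using m B1 by (auto simp: \<epsilon>_def)
  have B\<epsilon>: "B * s < m" if "s \<le> \<epsilon>" for s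
  proof -
    have "B * s \<le> B * (m / (2 * B))" using that B1 by (intro mult_left_mono) (auto simp: \<epsilon>_def)
    also have "\<dots> = m / 2" using B1 by simp
    finally show ?thesis using m by simp
  qed
  have sub0: "cball w \<rho> \<subseteq> S0" if w: "dist ?w0 w < \<rho>" for w
  proof
    fix z assume "z \<in> cball w \<rho>"
    then show "z \<in> S0" unfolding S0_def using dist_triangle[of ?w0 z w] w by (auto simp: \<rho>_def)
  qed
  have pre: "\<exists>\<zeta>. flowline (XH c) a b' \<zeta> \<and> \<zeta> ` {a..b'} \<subseteq> S0 \<and> (\<forall>s\<in>{a..b'}. \<gamma> s \<in> cdom c \<and> \<zeta> s = \<kappa> c (\<gamma> s))"
    if tr: "traj t \<gamma>" and ab: "0 \<le> a" "a \<le> b'" "b' \<le> t" "b' - a \<le> \<epsilon>" and d: "\<gamma> a \<in> cdom c" "dist ?w0 (\<kappa> c (\<gamma> a)) < \<rho>"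
      and ng: "\<And>s. a \<le> s \<Longrightarrow> s < b' \<Longrightarrow> \<gamma> s \<notin> Guard" for t \<gamma> a b'
  proof (cases "a = b'")
    case True
    have "\<kappa> c (\<gamma> a) \<in> S0" using sub0[OF d(2)] \<rho> by auto
    then show ?thesis using True d(1) by (intro exI[of _ "\<lambda>_. \<kappa> c (\<gamma> a)"]) (auto simp: flowline_def)
  next
    case False
    then have pa: "post \<gamma> a = \<gamma> a" using ng[of a] ab by (simp add: post_def)
    have "\<exists>\<zeta>. flowline (XH c) a b' \<zeta> \<and> \<zeta> a = \<kappa> c (\<gamma> a) \<and> \<zeta> ` {a..b'} \<subseteq> cball (\<kappa> c (\<gamma> a)) \<rho> \<and> (\<forall>s\<in>{a<..b'}. \<gamma> s \<in> cdom c \<and> \<zeta> s = \<kappa> c (\<gamma> s))"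
    proof (rule confine[OF tr c ab(1-3) ng _ _ order_trans[OF sub0[OF d(2)] S0\<Omega>] \<rho>])
      show "norm (XH c z) \<le> B" if "z \<in> cball (\<kappa> c (\<gamma> a)) \<rho>" for z using I.boxD(4)[OF b0] sub0[OF d(2)] that by blast
      show "B * (b' - a) < \<rho>" using B\<epsilon>[OF ab(4)] m by linarith
    qed (use pa d in auto)
    then obtain \<zeta> where \<zeta>: "flowline (XH c) a b' \<zeta>" "\<zeta> a = \<kappa> c (\<gamma> a)" "\<zeta> ` {a..b'} \<subseteq> cball (\<kappa> c (\<gamma> a)) \<rho>"
      "\<And>s. s \<in> {a<..b'} \<Longrightarrow> \<gamma> s \<in> cdom c \<and> \<zeta> s = \<kappa> c (\<gamma> s)" by blast
    have "\<gamma> s \<in> cdom c \<and> \<zeta> s = \<kappa> c (\<gamma> s)" if "s \<in> {a..b'}" for s using \<zeta>(2,4) d(1) that by (cases "s = a") auto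
    then show ?thesis using \<zeta>(1,3) sub0[OF d(2)] by blast
  qed
  \<comment> \<open>A trajectory that hits within the window is a \<open>broken\<close> curve there:
    after its first impact it stays in \<open>S1\<close>, where \<open>P > 0\<close> excludes
    another one.\<close>
  have single: "\<exists>\<tau> \<zeta> \<zeta>p. a < \<tau> \<and> \<tau> < b \<and> I.broken S0 S1 a \<tau> b \<zeta> \<zeta>p \<and> \<kappa> c (\<gamma> a) = \<zeta> a \<and> \<kappa> c (\<gamma> b) = \<zeta>p b \<and> \<gamma> b \<in> cdom c \<and>
      {s\<in>{a..b}. \<gamma> s \<in> Guard} = {\<tau>} \<and> (\<forall>s\<in>{a..b}. \<gamma> s \<notin> Graze) \<and> integral {a..b} (\<lambda>s. Lag (\<gamma> s)) = I.broken_action a \<tau> b \<zeta> \<zeta>p \<and>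
      (\<forall>s\<in>{a..\<tau>}. \<zeta> s = \<kappa> c (\<gamma> s))"
    if tr: "traj t \<gamma>" and ab: "0 \<le> a" "a \<le> b" "b \<le> t" "b - a \<le> \<epsilon>" and d: "\<gamma> a \<in> cdom c" "dist ?w0 (\<kappa> c (\<gamma> a)) < \<rho>"
      and ha: "hE c (\<kappa> c (\<gamma> a)) > 0" and im: "\<exists>s\<in>{a..<b}. \<gamma> s \<in> Guard" for t \<gamma> a b
  proof -
    obtain s1 where s1: "s1 \<in> {a..<b}" "\<gamma> s1 \<in> Guard" using im by blast
    then obtain \<tau> where \<tau>: "\<tau> \<in> {a..s1}" "\<gamma> \<tau> \<in> Guard" "\<forall>s\<in>{a..<\<tau>}. \<gamma> s \<notin> Guard"
      using first_impact[OF tr ab(1), of s1 s1] ab by auto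
    have "a \<noteq> \<tau>" using \<tau>(2) Guard_chart[OF c d(1)] ha by auto
    then have at: "a < \<tau>" "\<tau> < b" using \<tau>(1) s1 by auto
    obtain \<zeta> where \<zeta>: "flowline (XH c) a \<tau> \<zeta>" "\<zeta> ` {a..\<tau>} \<subseteq> S0" and e: "\<And>s. s \<in> {a..\<tau>} \<Longrightarrow> \<gamma> s \<in> cdom c \<and> \<zeta> s = \<kappa> c (\<gamma> s)"
      using pre[OF tr ab(1) _ _ _ d, of \<tau>] at \<tau>(3) ab by auto
    have \<gamma>\<tau>: "\<gamma> \<tau> \<in> cdom c" "\<kappa> c (\<gamma> \<tau>) = \<zeta> \<tau>" using e[of \<tau>] at by auto
    have h\<tau>: "hE c (\<zeta> \<tau>) = 0" using Guard_chart[OF c \<gamma>\<tau>(1)] \<tau>(2) \<gamma>\<tau>(2) by simp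
    have \<zeta>S: "\<zeta> \<tau> \<in> S0" using \<zeta>(2) at by auto
    have po: "post \<gamma> \<tau> \<in> cdom c" "\<kappa> c (post \<gamma> \<tau>) = ?R (\<zeta> \<tau>)"
      using impact_map_in_chart[OF c \<gamma>\<tau>(1)] \<tau>(2) \<gamma>\<tau>(2) by (auto simp: post_def)
    have near1: "dist (?R ?w0) (?R (\<zeta> \<tau>)) < r / 2" using Rs \<zeta>S unfolding S0_def by (auto simp: image_subset_iff)
    have sub1: "cball (?R (\<zeta> \<tau>)) (r / 2) \<subseteq> S1"
    proof
      fix z assume "z \<in> cball (?R (\<zeta> \<tau>)) (r / 2)"
      then show "z \<in> S1" unfolding S1_def using dist_triangle[of "?R ?w0" z "?R (\<zeta> \<tau>)"] near1 by auto
    qed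
    have cf: "\<exists>\<zeta>p. flowline (XH c) \<tau> b' \<zeta>p \<and> \<zeta>p \<tau> = ?R (\<zeta> \<tau>) \<and> \<zeta>p ` {\<tau>..b'} \<subseteq> cball (?R (\<zeta> \<tau>)) (r / 2) \<and> (\<forall>s\<in>{\<tau><..b'}. \<gamma> s \<in> cdom c \<and> \<zeta>p s = \<kappa> c (\<gamma> s))"
      if b': "\<tau> \<le> b'" "b' \<le> b" and ng: "\<And>s. \<tau> < s \<Longrightarrow> s < b' \<Longrightarrow> \<gamma> s \<notin> Guard" for b'
    proof (rule confine[OF tr c _ b'(1) _ ng po(1) po(2)[symmetric] order_trans[OF sub1 S1\<Omega>]])
      show "norm (XH c z) \<le> B" if "z \<in> cball (?R (\<zeta> \<tau>)) (r / 2)" for z using I.boxD(4)[OF b1] sub1 that by blast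
      show "B * (b' - \<tau>) < r / 2" using B\<epsilon>[of "b' - \<tau>"] m b' at ab by linarith
    qed (use at ab b' r in auto)
    have nog: "\<gamma> s \<notin> Guard" if s: "s \<in> {\<tau><..b}" for s
    proof
      assume gs: "\<gamma> s \<in> Guard"
      let ?F = "{x\<in>{\<tau><..b}. \<gamma> x \<in> Guard}"
      have "?F \<subseteq> {s\<in>{0..t}. \<gamma> s \<in> Guard}" using ab at by auto
      then have fin: "finite ?F" using trajD(3)[OF tr] finite_subset by blast
      have ne: "?F \<noteq> {}" using gs s by blast
      define x where "x = Min ?F"
      have x: "x \<in> ?F" unfolding x_def by (rule Min_in[OF fin ne])
      have xm: "\<gamma> y \<notin> Guard" if "\<tau> < y" "y < x" for y
      proof
        assume "\<gamma> y \<in> Guard"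
        then have "y \<in> ?F" using that x by auto
        then have "x \<le> y" unfolding x_def by (rule Min_le[OF fin])
        then show False using that by simp
      qed
      obtain \<zeta>p where "\<zeta>p ` {\<tau>..x} \<subseteq> cball (?R (\<zeta> \<tau>)) (r / 2)" "\<forall>s\<in>{\<tau><..x}. \<gamma> s \<in> cdom c \<and> \<zeta>p s = \<kappa> c (\<gamma> s)"
        using cf[of x] x xm by auto
      moreover have "\<zeta>p x \<in> S1" by (rule subsetD[OF sub1 subsetD[OF calculation(1)]]) (use x in auto)
      ultimately have "\<gamma> x \<in> cdom c" "\<kappa> c (\<gamma> x) \<in> S1" using x by auto
      then show False using P1[of "\<kappa> c (\<gamma> x)"] Guard_chart[OF c, of "\<gamma> x"] x k by auto
    qed
    obtain \<zeta>p where \<zeta>p: "flowline (XH c) \<tau> b \<zeta>p" "\<zeta>p \<tau> = ?R (\<zeta> \<tau>)" "\<zeta>p ` {\<tau>..b} \<subseteq> cball (?R (\<zeta> \<tau>)) (r / 2)"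
      and ep: "\<And>s. s \<in> {\<tau><..b} \<Longrightarrow> \<gamma> s \<in> cdom c \<and> \<zeta>p s = \<kappa> c (\<gamma> s)"
      using cf[of b] at nog by auto
    have \<zeta>pS: "\<zeta>p ` {\<tau>..b} \<subseteq> S1" using \<zeta>p(3) sub1 by blast
    have br: "I.broken S0 S1 a \<tau> b \<zeta> \<zeta>p" unfolding I.broken_def using \<zeta> \<zeta>p(1,2) \<zeta>pS h\<tau> by blast
    have G: "{s\<in>{a..b}. \<gamma> s \<in> Guard} = {\<tau>}"
      using \<tau>(2,3) nog at by (auto) (meson atLeastLessThan_iff greaterThanAtMost_iff linorder_less_linear)
    have Gr: "\<gamma> s \<notin> Graze" if s: "s \<in> {a..b}" for s
    proof (cases "s \<le> \<tau>")
      case True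
      have "\<zeta> s \<in> S0" by (rule subsetD[OF \<zeta>(2)]) (use s True in auto)
      then have "\<gamma> s \<in> cdom c" "\<kappa> c (\<gamma> s) \<in> S0" using e[of s] s True by auto
      then show ?thesis using P0[of "\<kappa> c (\<gamma> s)"] Graze_chart[OF c, of "\<gamma> s"] k by auto
    next
      case False
      have "\<zeta>p s \<in> S1" by (rule subsetD[OF \<zeta>pS]) (use s False in auto)
      then have "\<gamma> s \<in> cdom c" "\<kappa> c (\<gamma> s) \<in> S1" using ep[of s] s False by auto
      then show ?thesis using P1[of "\<kappa> c (\<gamma> s)"] Graze_chart[OF c, of "\<gamma> s"] k by auto
    qed
    have L\<tau>: "Lag (\<gamma> \<tau>) = LE c (\<zeta>p \<tau>)"
      using Lag_chart[OF c \<gamma>\<tau>(1)] \<gamma>\<tau>(2) I.R(6)[OF _ h\<tau>] \<zeta>S S0\<Omega> \<zeta>p(2) by auto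
    have "continuous_on {a..b} (\<lambda>s. Lag (\<gamma> s))" using continuous_on_subset[OF Lag_cont[OF tr]] ab by auto
    then have "integral {a..b} (\<lambda>s. Lag (\<gamma> s)) = integral {a..\<tau>} (\<lambda>s. Lag (\<gamma> s)) + integral {\<tau>..b} (\<lambda>s. Lag (\<gamma> s))"
      using Henstock_Kurzweil_Integration.integral_combine[of a \<tau> b] at integrable_continuous_real by fastforce
    also have "integral {a..\<tau>} (\<lambda>s. Lag (\<gamma> s)) = integral {a..\<tau>} (\<lambda>s. LE c (\<zeta> s))"
      by (rule integral_cong) (use e Lag_chart[OF c] in auto)
    also have "integral {\<tau>..b} (\<lambda>s. Lag (\<gamma> s)) = integral {\<tau>..b} (\<lambda>s. LE c (\<zeta>p s))"
    proof (rule integral_cong)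
      fix s assume "s \<in> {\<tau>..b}"
      then show "Lag (\<gamma> s) = LE c (\<zeta>p s)" using ep[of s] Lag_chart[OF c, of "\<gamma> s"] L\<tau> by (cases "s = \<tau>") auto
    qed
    finally have act: "integral {a..b} (\<lambda>s. Lag (\<gamma> s)) = I.broken_action a \<tau> b \<zeta> \<zeta>p" unfolding I.broken_action_def .
    show ?thesis
      by (rule exI[of _ \<tau>], rule exI[of _ \<zeta>], rule exI[of _ \<zeta>p])
         (use at br act G Gr e ep[of b] in auto)
  qed
  show ?thesis
  proof (rule exI[of _ \<rho>], rule conjI[OF \<rho>], rule exI[of _ \<epsilon>], rule conjI[OF \<epsilon>(1)], rule exI[of _ C], rule conjI[OF C(1)], intro conjI[of "All _"] allI impI)
    fix t \<gamma> \<gamma>' a b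
    assume tr: "traj t \<gamma>" "traj t \<gamma>'" and ab: "0 \<le> a" "a \<le> b" "b \<le> t" "b - a \<le> \<epsilon>"
      and d: "\<gamma> a \<in> cdom c" "\<gamma>' a \<in> cdom c" and near: "dist ?w0 (\<kappa> c (\<gamma> a)) < \<rho>" "dist ?w0 (\<kappa> c (\<gamma>' a)) < \<rho>"
      and ha: "hE c (\<kappa> c (\<gamma> a)) > 0" "hE c (\<kappa> c (\<gamma>' a)) > 0" and im: "\<exists>s\<in>{a..<b}. \<gamma> s \<in> Guard" "\<exists>s\<in>{a..<b}. \<gamma>' s \<in> Guard"
    obtain \<tau> \<zeta> \<zeta>p where 1: "a < \<tau>" "\<tau> < b" "I.broken S0 S1 a \<tau> b \<zeta> \<zeta>p" "\<kappa> c (\<gamma> a) = \<zeta> a" "\<kappa> c (\<gamma> b) = \<zeta>p b" "\<gamma> b \<in> cdom c"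
      "{s\<in>{a..b}. \<gamma> s \<in> Guard} = {\<tau>}" "\<forall>s\<in>{a..b}. \<gamma> s \<notin> Graze" "integral {a..b} (\<lambda>s. Lag (\<gamma> s)) = I.broken_action a \<tau> b \<zeta> \<zeta>p"
      using single[OF tr(1) ab d(1) near(1) ha(1) im(1)] by blast
    obtain \<tau>' \<zeta>' \<zeta>p' where 2: "I.broken S0 S1 a \<tau>' b \<zeta>' \<zeta>p'" "\<kappa> c (\<gamma>' a) = \<zeta>' a" "\<kappa> c (\<gamma>' b) = \<zeta>p' b"
      "integral {a..b} (\<lambda>s. Lag (\<gamma>' s)) = I.broken_action a \<tau>' b \<zeta>' \<zeta>p'"
      using single[OF tr(2) ab d(2) near(2) ha(2) im(2)] by blast
    have "window_est c C a b \<gamma> \<gamma>'"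
      unfolding window_est_def 1(4,5,9) 2(2,3,4) using est[OF 1(3) 2(1)] ab \<epsilon> by simp
    moreover have "\<gamma> b \<notin> Guard"
    proof
      assume "\<gamma> b \<in> Guard"
      then have "b \<in> {s\<in>{a..b}. \<gamma> s \<in> Guard}" using ab by simp
      then have "b \<in> {\<tau>}" unfolding 1(7) .
      then show False using 1(2) by simp
    qed
    ultimately show "(\<forall>s\<in>{a..b}. \<gamma> s \<notin> Graze) \<and> \<gamma> b \<in> cdom c \<and> \<gamma> b \<notin> Guard \<and> (\<exists>\<tau>. {s\<in>{a..b}. \<gamma> s \<in> Guard} = {\<tau>}) \<and> window_est c C a b \<gamma> \<gamma>'"
      using 1 by blast
  next
    fix t \<gamma> a b s0
    assume tr: "traj t \<gamma>" and ab: "0 \<le> a" "a < s0" "s0 < b" "b \<le> t" "b - a \<le> \<epsilon>" and d: "\<gamma> a \<in> cdom c"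
      and near: "dist ?w0 (\<kappa> c (\<gamma> a)) < \<rho>" and ha: "hE c (\<kappa> c (\<gamma> a)) > 0" and im: "\<gamma> s0 \<in> Guard"
    have "a \<le> b" "\<exists>s\<in>{a..<b}. \<gamma> s \<in> Guard" using ab im by auto
    from single[OF tr ab(1) this(1) ab(4,5) d near ha this(2)]
    obtain \<tau> \<zeta> \<zeta>p where 1: "a < \<tau>" "\<tau> < b" "I.broken S0 S1 a \<tau> b \<zeta> \<zeta>p" "\<kappa> c (\<gamma> a) = \<zeta> a" "{s\<in>{a..b}. \<gamma> s \<in> Guard} = {\<tau>}"
      by blast
    have "s0 \<in> {s\<in>{a..b}. \<gamma> s \<in> Guard}" using ab im by auto
    then have \<tau>: "\<tau> = s0" unfolding 1(5) by simp
    note br = 1(3)[unfolded I.broken_def \<tau>]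
    have near_ev: "\<forall>\<^sub>F w in nhds (\<kappa> c (\<gamma> a)). dist ?w0 w < \<rho> \<and> hE c w > 0"
    proof -
      have "open (ball ?w0 \<rho> \<inter> (\<Omega> c \<inter> hE c -` {0<..}))"
        by (intro open_Int continuous_open_preimage I.D Ck_on_continuous[OF I.Ckh] open_ball open_greaterThan)
      from eventually_nhds_in_open[OF this, of "\<kappa> c (\<gamma> a)"]
      have "\<forall>\<^sub>F w in nhds (\<kappa> c (\<gamma> a)). w \<in> ball ?w0 \<rho> \<inter> (\<Omega> c \<inter> hE c -` {0<..})"
        using near ha \<kappa>_in_\<Omega>[OF c d] by simp
      then show ?thesis by eventually_elim auto
    qed
    then obtain d0 where d0: "d0 > 0" "\<And>w. dist w (\<kappa> c (\<gamma> a)) < d0 \<Longrightarrow> dist ?w0 w < \<rho> \<and> hE c w > 0"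
      unfolding eventually_nhds_metric by blast
    define b' where "b' = (s0 + b) / 2"
    have b': "s0 < b'" "b' < b" using ab by (auto simp: b'_def)
    \<comment> \<open>The second bound keeps \<open>hf\<close> of a perturbed trajectory at time
      \<open>s0\<close> below \<open>k * (b' - s0)\<close>, the amount it would lose until
      \<open>b'\<close> if there were no impact. It would then change sign, which is itself an
      impact.\<close>
    define d1 where "d1 = min d0 (k * (b' - s0) / (B * exp B))"
    have d1: "d1 > 0" using d0 k b' B1 by (simp add: d1_def)
    show "\<exists>d>0. \<forall>\<gamma>'. traj t \<gamma>' \<longrightarrow> \<gamma>' a \<in> cdom c \<longrightarrow> norm (\<kappa> c (\<gamma>' a) - \<kappa> c (\<gamma> a)) < d \<longrightarrow>
         dist (\<kappa> c z0) (\<kappa> c (\<gamma>' a)) < \<rho> \<and> hE c (\<kappa> c (\<gamma>' a)) > 0 \<and> (\<exists>s\<in>{a..<b}. \<gamma>' s \<in> Guard)"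
    proof (rule exI[of _ d1], rule conjI[OF d1], intro allI impI)
      fix \<gamma>' assume tr': "traj t \<gamma>'" and d': "\<gamma>' a \<in> cdom c" and nd: "norm (\<kappa> c (\<gamma>' a) - \<kappa> c (\<gamma> a)) < d1"
      have n': "dist ?w0 (\<kappa> c (\<gamma>' a)) < \<rho>" "hE c (\<kappa> c (\<gamma>' a)) > 0"
        using d0(2)[of "\<kappa> c (\<gamma>' a)"] nd by (auto simp: dist_norm d1_def)
      have "\<exists>s\<in>{a..<b}. \<gamma>' s \<in> Guard"
      proof (rule ccontr)
        assume no: "\<not> ?thesis"
        obtain \<zeta>' where \<zeta>': "flowline (XH c) a b' \<zeta>'" "\<zeta>' ` {a..b'} \<subseteq> S0" and e': "\<And>s. s \<in> {a..b'} \<Longrightarrow> \<gamma>' s \<in> cdom c \<and> \<zeta>' s = \<kappa> c (\<gamma>' s)"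
          using pre[OF tr' ab(1) _ _ _ d' n'(1), of b'] no b' ab by auto
        have f': "flowline (XH c) a s0 \<zeta>'" "\<zeta>' ` {a..s0} \<subseteq> S0" using flowline_sub[OF \<zeta>'(1)] \<zeta>'(2) ab b' by auto
        have "norm (\<zeta>' s0 - \<zeta> s0) \<le> exp (B * (s0 - a)) * norm (\<zeta>' a - \<zeta> a)"
          by (rule gronwall(1)[of "XH c" a s0 \<zeta> S0 \<zeta>' B]) (use br f' B1 I.boxD(5)[OF b0] in auto)
        also have "\<dots> \<le> exp B * norm (\<zeta>' a - \<zeta> a)"
          using ab \<epsilon> B1 by (intro mult_right_mono) (auto simp: mult_left_le)
        finally have g: "norm (\<zeta>' s0 - \<zeta> s0) \<le> exp B * norm (\<zeta>' a - \<zeta> a)" .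
        have in0: "\<zeta> s0 \<in> S0" "\<zeta>' s0 \<in> S0" using br f' ab by auto
        have ea: "\<zeta>' a = \<kappa> c (\<gamma>' a)" using e'[of a] ab b' by auto
        have "hE c (\<zeta>' s0) \<le> B * norm (\<zeta>' s0 - \<zeta> s0)" using I.boxD(6)[OF b0 in0] br by simp
        also have "\<dots> \<le> B * (exp B * norm (\<zeta>' a - \<zeta> a))" using g B1 by (intro mult_left_mono) auto
        also have "\<dots> < B * (exp B * (k * (b' - s0) / (B * exp B)))"
          using nd B1 1(4) ea by (intro mult_strict_left_mono) (auto simp: d1_def)
        also have "\<dots> = k * (b' - s0)" using B1 by simp
        finally have h0: "hE c (\<zeta>' s0) < k * (b' - s0)" .
        have z'D: "\<zeta>' ` {a..b'} \<subseteq> \<Omega> c" using \<zeta>'(2) S0\<Omega> by blast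
        have "hE c (\<zeta>' s0) - hE c (\<zeta>' b') \<ge> k * (b' - s0)"
          by (rule I.hf_decrease[OF \<zeta>'(1) z'D P0]) (use \<zeta>'(2) ab b' in auto)
        then have hb: "hE c (\<zeta>' b') < 0" using h0 by simp
        have "\<exists>x\<ge>a. x \<le> b' \<and> hE c (\<zeta>' x) = 0"
          by (rule IVT2'[OF _ _ _ I.hf_flowline_cont[OF \<zeta>'(1) z'D]]) (use hb n' ea ab b' in auto)
        then obtain x where x: "a \<le> x" "x \<le> b'" "hE c (\<zeta>' x) = 0" by blast
        have "\<zeta>' x \<in> S0" using \<zeta>'(2) x by auto
        then have "\<gamma>' x \<in> Guard" using Guard_chart[OF c, of "\<gamma>' x"] e'[of x] x P0[of "\<zeta>' x"] k by auto
        then show False using no x b' by auto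
      qed
      then show "dist (\<kappa> c z0) (\<kappa> c (\<gamma>' a)) < \<rho> \<and> hE c (\<kappa> c (\<gamma>' a)) > 0 \<and> (\<exists>s\<in>{a..<b}. \<gamma>' s \<in> Guard)"
        using n' by blast
    qed
  next
    fix t \<gamma> s0
    assume tr: "traj t \<gamma>" and s0: "0 < s0" "s0 \<le> t" and eq: "\<gamma> s0 = z0"
    have "limitin (atlas_topology \<B>) \<gamma> z0 (at_left s0)" using trajD(4)[OF tr s0] eq by simp
    note lim = limitin_chartD[OF smooth_B this chart_in_B[OF c] z0(1)]
    have "\<forall>\<^sub>F s in at_left s0. \<gamma> s \<in> cdom c \<and> dist ?w0 (\<kappa> c (\<gamma> s)) < \<rho>"
      using lim(1) topological_tendstoD[OF lim(2) open_ball[of ?w0 \<rho>]] \<rho> by (auto simp: eventually_conj_iff)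
    then obtain a1 where a1: "a1 < s0" "\<And>a. a1 < a \<Longrightarrow> a < s0 \<Longrightarrow> \<gamma> a \<in> cdom c \<and> dist ?w0 (\<kappa> c (\<gamma> a)) < \<rho>"
      unfolding eventually_at_left_field by blast
    have "finite {s\<in>{0..t}. \<gamma> s \<in> Guard}" using trajD(3)[OF tr] .
    then have fin: "finite ({s\<in>{0..t}. \<gamma> s \<in> Guard} \<inter> {..<s0})" by blast
    \<comment> \<open>Later than all earlier impacts and within \<epsilon> of \<open>s0\<close>, so
      that the stretch up to \<open>s0\<close> is free of impacts and fits into a window.\<close>
    define a0 where "a0 = Max (insert 0 (insert a1 (insert (s0 - \<epsilon>) ({s\<in>{0..t}. \<gamma> s \<in> Guard} \<inter> {..<s0}))))"
    have a0: "a0 < s0" "0 \<le> a0" "a1 \<le> a0" "s0 - \<epsilon> \<le> a0"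
      using fin a1(1) s0 \<epsilon> unfolding a0_def by (auto simp del: Max_insert simp: Max_less_iff intro!: Max_ge)
    have ng: "\<gamma> s \<notin> Guard" if "a0 < s" "s < s0" for s
    proof
      assume "\<gamma> s \<in> Guard"
      then have "s \<le> a0" unfolding a0_def using fin that a0(2) s0 by (intro Max_ge) auto
      then show False using that by simp
    qed
    show "\<exists>a0<s0. \<forall>a. a0 < a \<longrightarrow> a < s0 \<longrightarrow> 0 \<le> a \<and> \<gamma> a \<in> cdom c \<and> dist (\<kappa> c z0) (\<kappa> c (\<gamma> a)) < \<rho> \<and> hE c (\<kappa> c (\<gamma> a)) > 0"
    proof (rule exI[of _ a0], rule conjI[OF a0(1)], intro allI impI)
      fix a assume a: "a0 < a" "a < s0"
      have a': "0 \<le> a" "\<gamma> a \<in> cdom c" "dist ?w0 (\<kappa> c (\<gamma> a)) < \<rho>" using a a0 a1(2)[of a] by auto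
      obtain \<zeta> where \<zeta>: "flowline (XH c) a s0 \<zeta>" "\<zeta> ` {a..s0} \<subseteq> S0" and e: "\<And>s. s \<in> {a..s0} \<Longrightarrow> \<gamma> s \<in> cdom c \<and> \<zeta> s = \<kappa> c (\<gamma> s)"
        using pre[OF tr a'(1) _ s0(2) _ a'(2,3)] ng a a0 by auto
      have zD: "\<zeta> ` {a..s0} \<subseteq> \<Omega> c" using \<zeta>(2) S0\<Omega> by blast
      have "hE c (\<zeta> a) - hE c (\<zeta> s0) \<ge> k * (s0 - a)"
        by (rule I.hf_decrease[OF \<zeta>(1) zD P0]) (use \<zeta>(2) a in auto)
      moreover have "hE c (\<zeta> s0) = 0" using e[of s0] eq w0(2) a by auto
      moreover have "k * (s0 - a) > 0" using k a by simp
      ultimately have "hE c (\<kappa> c (\<gamma> a)) > 0" using e[of a] a by auto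
      then show "0 \<le> a \<and> \<gamma> a \<in> cdom c \<and> dist (\<kappa> c z0) (\<kappa> c (\<gamma> a)) < \<rho> \<and> hE c (\<kappa> c (\<gamma> a)) > 0"
        using a' by blast
    qed
  qed
qed

end

section \<open>Comparison of trajectories along a non-grazing trajectory\<close>

context impact_system
begin

text \<open>By \<open>momentum_transform\<close> the pairing of momentum with displacement is chart
  independent to first order; Taylor's formula for the base transition makes the error quadratic.
  Hence the variation formula can change charts in the middle of a trajectory.\<close>

lemma chart_change:
  assumes c: "c \<in> A" "c' \<in> A" and z0: "z0 \<in> cdom c" "z0 \<in> cdom c'"
  shows "\<exists>\<rho>>0. \<exists>C>0. \<forall>z z'. z \<in> cdom c \<longrightarrow> z' \<in> cdom c \<longrightarrow> dist (\<kappa> c z0) (\<kappa> c z) < \<rho> \<longrightarrow> dist (\<kappa> c z0) (\<kappa> c z') < \<rho> \<longrightarrow>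
     z \<in> cdom c' \<and> norm (\<kappa> c' z' - \<kappa> c' z) \<le> C * norm (\<kappa> c z' - \<kappa> c z) \<and>
     \<bar>snd (\<kappa> c' z) \<bullet> (fst (\<kappa> c' z') - fst (\<kappa> c' z)) - snd (\<kappa> c z) \<bullet> (fst (\<kappa> c z') - fst (\<kappa> c z))\<bar> \<le> C * (norm (\<kappa> c z' - \<kappa> c z))\<^sup>2"
proof -
  let ?C = "cotangent_chart A c" and ?C' = "cotangent_chart A c'" and ?w0 = "\<kappa> c z0"
  let ?S = "\<kappa> c ` (cdom c \<inter> cdom c')" and ?X = "snd c ` (fst c \<inter> fst c')"
  let ?T = "transition ?C ?C'" and ?\<psi> = "transition c c'"
  have S: "open ?S" by (rule open_overlap[OF smooth_B chart_in_B[OF c(1)] chart_in_B[OF c(2)]])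
  have X: "open ?X" by (rule open_overlap[OF A c])
  have SX: "?S = ?X \<times> UNIV" by (rule cotangent_chart_overlap[OF A c])
  have "?w0 \<in> ?S" using z0 by blast
  then obtain r where r: "r > 0" "cball ?w0 r \<subseteq> ?S" using S by (meson open_contains_cball)
  have fX: "cball (fst ?w0) r \<subseteq> ?X"
  proof
    fix x assume "x \<in> cball (fst ?w0) r"
    then have "dist ?w0 (x, snd ?w0) \<le> r" by (simp add: dist_prod_def)
    then have "(x, snd ?w0) \<in> ?S" using r(2) by auto
    then show "x \<in> ?X" unfolding SX by simp
  qed
  have T1: "Ck_on 1 ?S ?T" and \<psi>2: "Ck_on 2 ?X ?\<psi>"
    using smooth_on_Ck[OF transition_smooth[OF smooth_B chart_in_B[OF c(1)] chart_in_B[OF c(2)]]] smooth_on_Ck[OF transition_smooth[OF A c]] by auto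
  obtain B1 where B1: "B1 > 0" "\<And>x y. x \<in> cball ?w0 r \<Longrightarrow> y \<in> cball ?w0 r \<Longrightarrow> norm (?T y - ?T x) \<le> B1 * norm (y - x)"
    using Ck1_lipschitz[OF compact_cball convex_cball r(2) T1] by blast
  obtain B2 where B2: "B2 > 0" "\<And>x y. x \<in> cball (fst ?w0) r \<Longrightarrow> y \<in> cball (fst ?w0) r \<Longrightarrow>
      norm (?\<psi> y - ?\<psi> x - frechet_derivative ?\<psi> (at x) (y - x)) \<le> B2 * (norm (y - x))\<^sup>2"
    using Ck2_taylor[OF compact_cball convex_cball fX X \<psi>2] by blast
  have "bounded (?T ` cball ?w0 r)"
    by (rule compact_imp_bounded[OF compact_continuous_image[OF continuous_on_subset[OF Ck_on_continuous[OF T1] r(2)] compact_cball]])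
  then obtain B3 where B3: "\<forall>y\<in>?T ` cball ?w0 r. norm y \<le> B3" using bounded_iff by blast
  define C where "C = B1 + \<bar>B3\<bar> * B2"
  have C: "C > 0" "B1 \<le> C" "\<bar>B3\<bar> * B2 \<le> C" using B1 B2 by (auto simp: C_def add_pos_nonneg)
  show ?thesis
  proof (rule exI[of _ r], rule conjI[OF r(1)], rule exI[of _ C], rule conjI[OF C(1)], intro allI impI)
    fix z z' assume z: "z \<in> cdom c" "z' \<in> cdom c" "dist ?w0 (\<kappa> c z) < r" "dist ?w0 (\<kappa> c z') < r"
    let ?d = "norm (\<kappa> c z' - \<kappa> c z)"
    have w: "\<kappa> c z \<in> cball ?w0 r" "\<kappa> c z' \<in> cball ?w0 r" using z by auto
    have dom': "x \<in> cdom c'" if x: "x \<in> cdom c" "\<kappa> c x \<in> cball ?w0 r" for x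
    proof -
      obtain y where "y \<in> cdom c \<inter> cdom c'" "\<kappa> c x = \<kappa> c y" using x(2) r(2) by blast
      then show ?thesis using \<kappa>_inj[OF c(1) x(1), of y] by simp
    qed
    note zd = dom'[OF z(1) w(1)] dom'[OF z(2) w(2)]
    note Te = transition_apply[OF smooth_B chart_in_B[OF c(1)]]
    have lip: "norm (\<kappa> c' z' - \<kappa> c' z) \<le> C * ?d"
    proof -
      have "norm (\<kappa> c' z' - \<kappa> c' z) \<le> B1 * ?d" using B1(2)[OF w] Te[OF z(1), of ?C'] Te[OF z(2), of ?C'] by simp
      also have "\<dots> \<le> C * ?d" using C(2) by (intro mult_right_mono) auto
      finally show ?thesis .
    qed
    obtain q p where zqp: "z = (q, p)" by (metis surj_pair)
    obtain q' p' where zqp': "z' = (q', p')" by (metis surj_pair)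
    have q: "q \<in> fst c" "q \<in> fst c'" "p \<in> cotangent_space A q" "q' \<in> fst c" "q' \<in> fst c'"
      using z zd unfolding zqp zqp' cotangent_chart_domain by auto
    have k: "fst (\<kappa> c z) = snd c q" "fst (\<kappa> c' z) = snd c' q" "fst (\<kappa> c z') = snd c q'" "fst (\<kappa> c' z') = snd c' q'"
      "snd (\<kappa> c z) = momentum A c q p" "snd (\<kappa> c' z) = momentum A c' q p"
      by (simp_all add: zqp zqp' cotangent_chart_apply)
    have x: "snd c q \<in> cball (fst ?w0) r" "snd c q' \<in> cball (fst ?w0) r"
      using order_trans[OF dist_fst_le, of ?w0 "\<kappa> c z" r] order_trans[OF dist_fst_le, of ?w0 "\<kappa> c z'" r] z k by auto
    let ?u = "snd c q' - snd c q"
    have nu: "norm ?u \<le> ?d" using norm_fst_le_norm[of "\<kappa> c z' - \<kappa> c z"] k by simp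
    have "snd (\<kappa> c' z) \<bullet> (fst (\<kappa> c' z') - fst (\<kappa> c' z)) - snd (\<kappa> c z) \<bullet> (fst (\<kappa> c z') - fst (\<kappa> c z))
        = snd (\<kappa> c' z) \<bullet> (?\<psi> (snd c q') - ?\<psi> (snd c q) - frechet_derivative ?\<psi> (at (snd c q)) ?u)"
      unfolding k inner_diff_right[of _ "_ - _"] momentum_transform(1)[OF A c(1) q(1) c(2) q(2) q(3)]
        transition_apply[OF A c(1) q(1)] transition_apply[OF A c(1) q(4)] ..
    also have "\<bar>\<dots>\<bar> \<le> norm (snd (\<kappa> c' z)) * (B2 * (norm ?u)\<^sup>2)"
      by (rule order_trans[OF Cauchy_Schwarz_ineq2 mult_left_mono[OF B2(2)[OF x]]]) simp
    also have "\<dots> \<le> \<bar>B3\<bar> * (B2 * ?d\<^sup>2)"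
    proof (intro mult_mono)
      have "norm (\<kappa> c' z) \<le> B3" using B3 w(1) Te[OF z(1), of ?C'] by force
      then show "norm (snd (\<kappa> c' z)) \<le> \<bar>B3\<bar>" using norm_snd_le_norm[of "\<kappa> c' z"] by linarith
    qed (use nu B2 in \<open>auto intro!: power_mono\<close>)
    also have "\<dots> \<le> C * ?d\<^sup>2" using mult_right_mono[OF C(3), of "?d\<^sup>2"] by (simp add: mult.assoc)
    finally show "z \<in> cdom c' \<and> norm (\<kappa> c' z' - \<kappa> c' z) \<le> C * ?d \<and>
      \<bar>snd (\<kappa> c' z) \<bullet> (fst (\<kappa> c' z') - fst (\<kappa> c' z)) - snd (\<kappa> c z) \<bullet> (fst (\<kappa> c z') - fst (\<kappa> c z))\<bar> \<le> C * ?d\<^sup>2"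
      using zd lip by blast
  qed
qed

text \<open>\<open>window_est\<close> accumulated from time 0, with the initial states measured in
  \<open>c0\<close> and the states at time \<open>s\<close> in \<open>c\<close>. The implication in
  the middle encodes injectivity of the time-\<open>s\<close> map, and the last clause is the first
  variation formula.\<close>

definition est :: "('q, real^'n) chart \<Rightarrow> ('q, real^'n) chart \<Rightarrow> real \<Rightarrow> real \<Rightarrow> (real \<Rightarrow> ('q, real^'n) phase) \<Rightarrow> (real \<Rightarrow> ('q, real^'n) phase) \<Rightarrow> bool" where
  "est c0 c C s \<gamma> \<gamma>' \<longleftrightarrow>
     norm (\<kappa> c (\<gamma>' s) - \<kappa> c (\<gamma> s)) \<le> C * norm (\<kappa> c0 (\<gamma>' 0) - \<kappa> c0 (\<gamma> 0)) \<and>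
     (\<kappa> c (\<gamma>' s) = \<kappa> c (\<gamma> s) \<longrightarrow> \<kappa> c0 (\<gamma>' 0) = \<kappa> c0 (\<gamma> 0)) \<and>
     \<bar>integral {0..s} (\<lambda>s. Lag (\<gamma>' s)) - integral {0..s} (\<lambda>s. Lag (\<gamma> s))
       - snd (\<kappa> c (\<gamma> s)) \<bullet> (fst (\<kappa> c (\<gamma>' s)) - fst (\<kappa> c (\<gamma> s)))
       + snd (\<kappa> c0 (\<gamma> 0)) \<bullet> (fst (\<kappa> c0 (\<gamma>' 0)) - fst (\<kappa> c0 (\<gamma> 0)))\<bar>
       \<le> C * (norm (\<kappa> c0 (\<gamma>' 0) - \<kappa> c0 (\<gamma> 0)))\<^sup>2"

definition starts_near :: "('q, real^'n) chart \<Rightarrow> real \<Rightarrow> (real \<Rightarrow> ('q, real^'n) phase) \<Rightarrow> real \<Rightarrow> (real \<Rightarrow> ('q, real^'n) phase) \<Rightarrow> bool" where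
  "starts_near c0 t \<gamma>0 d \<gamma> \<longleftrightarrow> traj t \<gamma> \<and> \<gamma> 0 \<in> cdom c0 \<and> dist (\<kappa> c0 (\<gamma>0 0)) (\<kappa> c0 (\<gamma> 0)) < d"

text \<open>The estimate is uniform over pairs of trajectories near \<gamma>0: the action must be
  differentiated at neighbouring states too, and two trajectories with equal start give uniqueness.
  The impact number \<open>N\<close> is the same for all neighbours.\<close>

definition good_in :: "('q, real^'n) chart \<Rightarrow> ('q, real^'n) chart \<Rightarrow> real \<Rightarrow> (real \<Rightarrow> ('q, real^'n) phase) \<Rightarrow> real \<Rightarrow> bool" where
  "good_in c0 c t \<gamma>0 s \<longleftrightarrow> (\<exists>d>0. \<exists>C>0. \<exists>N. \<forall>\<gamma> \<gamma>'. starts_near c0 t \<gamma>0 d \<gamma> \<longrightarrow> starts_near c0 t \<gamma>0 d \<gamma>' \<longrightarrow>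
     \<gamma> s \<in> cdom c \<and> \<gamma> s \<notin> Guard \<and> (\<forall>r\<in>{0..s}. \<gamma> r \<notin> Graze) \<and> card {r\<in>{0..s}. \<gamma> r \<in> Guard} = N \<and> est c0 c C s \<gamma> \<gamma>')"

lemma starts_near_mono: "starts_near c0 t \<gamma>0 d \<gamma> \<Longrightarrow> d \<le> d' \<Longrightarrow> starts_near c0 t \<gamma>0 d' \<gamma>"
  by (auto simp: starts_near_def)

lemma est_dist:
  assumes "est c0 c C s \<gamma>0 \<gamma>" "C > 0" "dist (\<kappa> c0 (\<gamma>0 0)) (\<kappa> c0 (\<gamma> 0)) < e / C"
  shows "dist (\<kappa> c (\<gamma>0 s)) (\<kappa> c (\<gamma> s)) < e"
proof -
  have "dist (\<kappa> c (\<gamma>0 s)) (\<kappa> c (\<gamma> s)) \<le> C * dist (\<kappa> c0 (\<gamma>0 0)) (\<kappa> c0 (\<gamma> 0))"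
    using assms(1) unfolding est_def by (simp add: dist_norm norm_minus_commute)
  also have "\<dots> < e" using assms(2,3) by (simp add: field_simps)
  finally show ?thesis .
qed

lemma good_in_chart_change:
  assumes c: "c \<in> A" "c' \<in> A" and tr: "traj t \<gamma>0" "\<gamma>0 0 \<in> cdom c0" and G: "good_in c0 c t \<gamma>0 s" and c': "\<gamma>0 s \<in> cdom c'"
  shows "good_in c0 c' t \<gamma>0 s"
proof -
  obtain d C N where d: "d > 0" "C > 0" and good: "\<forall>\<gamma> \<gamma>'. starts_near c0 t \<gamma>0 d \<gamma> \<longrightarrow> starts_near c0 t \<gamma>0 d \<gamma>' \<longrightarrow>
     \<gamma> s \<in> cdom c \<and> \<gamma> s \<notin> Guard \<and> (\<forall>r\<in>{0..s}. \<gamma> r \<notin> Graze) \<and> card {r\<in>{0..s}. \<gamma> r \<in> Guard} = N \<and> est c0 c C s \<gamma> \<gamma>'"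
    using G unfolding good_in_def by blast
  note good = good[rule_format]
  have n0: "starts_near c0 t \<gamma>0 d \<gamma>0" using tr d by (simp add: starts_near_def)
  have "\<gamma>0 s \<in> cdom c" using good[OF n0 n0] by blast
  from chart_change[OF c this c'] obtain \<rho> K where \<rho>: "\<rho> > 0" "K > 0" and ch: "\<And>z z'. z \<in> cdom c \<Longrightarrow> z' \<in> cdom c \<Longrightarrow>
     dist (\<kappa> c (\<gamma>0 s)) (\<kappa> c z) < \<rho> \<Longrightarrow> dist (\<kappa> c (\<gamma>0 s)) (\<kappa> c z') < \<rho> \<Longrightarrow>
     z \<in> cdom c' \<and> norm (\<kappa> c' z' - \<kappa> c' z) \<le> K * norm (\<kappa> c z' - \<kappa> c z) \<and>
     \<bar>snd (\<kappa> c' z) \<bullet> (fst (\<kappa> c' z') - fst (\<kappa> c' z)) - snd (\<kappa> c z) \<bullet> (fst (\<kappa> c z') - fst (\<kappa> c z))\<bar> \<le> K * (norm (\<kappa> c z' - \<kappa> c z))\<^sup>2"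
    by blast
  define d' where "d' = min d (\<rho> / C)"
  have d': "d' > 0" using d \<rho> by (simp add: d'_def)
  define K' where "K' = K * C + K * C\<^sup>2 + C"
  have K': "K' > 0" "K * C \<le> K'" "K * C\<^sup>2 + C \<le> K'" using d \<rho> by (auto simp: K'_def add_pos_pos)
  show ?thesis unfolding good_in_def
  proof (rule exI[of _ d'], rule conjI[OF d'], rule exI[of _ K'], rule conjI[OF K'(1)], rule exI[of _ N], intro allI impI)
    fix \<gamma> \<gamma>' assume near: "starts_near c0 t \<gamma>0 d' \<gamma>" "starts_near c0 t \<gamma>0 d' \<gamma>'"
    then have nd: "starts_near c0 t \<gamma>0 d \<gamma>" "starts_near c0 t \<gamma>0 d \<gamma>'" by (auto elim: starts_near_mono simp: d'_def)
    have nr: "dist (\<kappa> c (\<gamma>0 s)) (\<kappa> c (\<gamma> s)) < \<rho>" "dist (\<kappa> c (\<gamma>0 s)) (\<kappa> c (\<gamma>' s)) < \<rho>"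
      using near est_dist[OF conjunct2[OF conjunct2[OF conjunct2[OF conjunct2[OF good[OF n0 nd(1)]]]]] d(2)]
        est_dist[OF conjunct2[OF conjunct2[OF conjunct2[OF conjunct2[OF good[OF n0 nd(2)]]]]] d(2)]
      by (auto simp: starts_near_def d'_def)
    note g1 = good[OF nd] and g2 = good[OF nd(2) nd(1)]
    have dc: "\<gamma> s \<in> cdom c" "\<gamma>' s \<in> cdom c" using g1 g2 by auto
    note h = ch[OF dc nr] and h' = ch[OF dc(2) dc(1) nr(2) nr(1)]
    let ?\<delta> = "norm (\<kappa> c0 (\<gamma>' 0) - \<kappa> c0 (\<gamma> 0))" and ?e = "norm (\<kappa> c (\<gamma>' s) - \<kappa> c (\<gamma> s))"
    have e: "?e \<le> C * ?\<delta>" and inj: "\<kappa> c (\<gamma>' s) = \<kappa> c (\<gamma> s) \<longrightarrow> \<kappa> c0 (\<gamma>' 0) = \<kappa> c0 (\<gamma> 0)"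
      and act: "\<bar>integral {0..s} (\<lambda>s. Lag (\<gamma>' s)) - integral {0..s} (\<lambda>s. Lag (\<gamma> s))
       - snd (\<kappa> c (\<gamma> s)) \<bullet> (fst (\<kappa> c (\<gamma>' s)) - fst (\<kappa> c (\<gamma> s)))
       + snd (\<kappa> c0 (\<gamma> 0)) \<bullet> (fst (\<kappa> c0 (\<gamma>' 0)) - fst (\<kappa> c0 (\<gamma> 0)))\<bar> \<le> C * ?\<delta>\<^sup>2"
      using g1 unfolding est_def by auto
    have e2: "K * ?e\<^sup>2 \<le> K * C\<^sup>2 * ?\<delta>\<^sup>2"
      using mult_left_mono[OF power_mono[OF e, of 2], of K] \<rho>(2) by (simp add: power_mult_distrib mult.assoc)
    have "est c0 c' K' s \<gamma> \<gamma>'" unfolding est_def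
    proof (intro conjI impI)
      have "norm (\<kappa> c' (\<gamma>' s) - \<kappa> c' (\<gamma> s)) \<le> K * (C * ?\<delta>)"
        using h mult_left_mono[OF e, of K] \<rho>(2) by linarith
      also have "\<dots> \<le> K' * ?\<delta>" using mult_right_mono[OF K'(2), of ?\<delta>] by simp
      finally show "norm (\<kappa> c' (\<gamma>' s) - \<kappa> c' (\<gamma> s)) \<le> K' * ?\<delta>" .
      show "\<kappa> c0 (\<gamma>' 0) = \<kappa> c0 (\<gamma> 0)" if "\<kappa> c' (\<gamma>' s) = \<kappa> c' (\<gamma> s)"
        using \<kappa>_inj[OF c(2) _ _ that] h h' inj by simp
      have "\<bar>integral {0..s} (\<lambda>s. Lag (\<gamma>' s)) - integral {0..s} (\<lambda>s. Lag (\<gamma> s))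
       - snd (\<kappa> c' (\<gamma> s)) \<bullet> (fst (\<kappa> c' (\<gamma>' s)) - fst (\<kappa> c' (\<gamma> s)))
       + snd (\<kappa> c0 (\<gamma> 0)) \<bullet> (fst (\<kappa> c0 (\<gamma>' 0)) - fst (\<kappa> c0 (\<gamma> 0)))\<bar> \<le> K * C\<^sup>2 * ?\<delta>\<^sup>2 + C * ?\<delta>\<^sup>2"
        using act h e2 by linarith
      also have "\<dots> \<le> K' * ?\<delta>\<^sup>2" using mult_right_mono[OF K'(3), of "?\<delta>\<^sup>2"] by (simp add: distrib_right)
      finally show "\<bar>integral {0..s} (\<lambda>s. Lag (\<gamma>' s)) - integral {0..s} (\<lambda>s. Lag (\<gamma> s))
       - snd (\<kappa> c' (\<gamma> s)) \<bullet> (fst (\<kappa> c' (\<gamma>' s)) - fst (\<kappa> c' (\<gamma> s)))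
       + snd (\<kappa> c0 (\<gamma> 0)) \<bullet> (fst (\<kappa> c0 (\<gamma>' 0)) - fst (\<kappa> c0 (\<gamma> 0)))\<bar> \<le> K' * ?\<delta>\<^sup>2" .
    qed
    then show "\<gamma> s \<in> cdom c' \<and> \<gamma> s \<notin> Guard \<and> (\<forall>r\<in>{0..s}. \<gamma> r \<notin> Graze) \<and> card {r\<in>{0..s}. \<gamma> r \<in> Guard} = N \<and> est c0 c' K' s \<gamma> \<gamma>'"
      using g1 h by blast
  qed
qed

text \<open>The inner boundary terms at time \<open>a\<close> cancel. The quadratic error of the
  window, expressed by the initial distance, picks up the squared Lipschitz constant of the earlier
  stretch.\<close>

lemma est_compose:
  assumes tr: "traj t \<gamma>" "traj t \<gamma>'" and ab: "0 \<le> a" "a \<le> b" "b \<le> t"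
    and e: "est c0 c C a \<gamma> \<gamma>'" and w: "window_est c C' a b \<gamma> \<gamma>'" and C: "C > 0" "C' > 0"
  shows "est c0 c (C' * C + C + C' * C\<^sup>2) b \<gamma> \<gamma>'"
proof -
  let ?\<delta> = "norm (\<kappa> c0 (\<gamma>' 0) - \<kappa> c0 (\<gamma> 0))" and ?e = "norm (\<kappa> c (\<gamma>' a) - \<kappa> c (\<gamma> a))"
  let ?K = "C' * C + C + C' * C\<^sup>2"
  note E = e[unfolded est_def] and W = w[unfolded window_est_def]
  have K: "C' * C \<le> ?K" "C + C' * C\<^sup>2 \<le> ?K" using C by auto
  have e1: "?e \<le> C * ?\<delta>" using E by blast
  have e2: "C' * ?e\<^sup>2 \<le> C' * C\<^sup>2 * ?\<delta>\<^sup>2"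
    using mult_left_mono[OF power_mono[OF e1, of 2], of C'] C by (simp add: power_mult_distrib mult.assoc)
  have sp: "integral {0..b} (\<lambda>s. Lag (x s)) = integral {0..a} (\<lambda>s. Lag (x s)) + integral {a..b} (\<lambda>s. Lag (x s))" if "traj t x" for x
  proof -
    have "continuous_on {0..b} (\<lambda>s. Lag (x s))" using continuous_on_subset[OF Lag_cont[OF that]] ab by auto
    from Henstock_Kurzweil_Integration.integral_combine[OF ab(1,2) integrable_continuous_real[OF this]] show ?thesis by simp
  qed
  show ?thesis unfolding est_def
  proof (intro conjI impI)
    have "norm (\<kappa> c (\<gamma>' b) - \<kappa> c (\<gamma> b)) \<le> C' * (C * ?\<delta>)" using W mult_left_mono[OF e1, of C'] C by linarith
    also have "\<dots> \<le> ?K * ?\<delta>" using mult_right_mono[OF K(1), of ?\<delta>] by simp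
    finally show "norm (\<kappa> c (\<gamma>' b) - \<kappa> c (\<gamma> b)) \<le> ?K * ?\<delta>" .
    show "\<kappa> c0 (\<gamma>' 0) = \<kappa> c0 (\<gamma> 0)" if "\<kappa> c (\<gamma>' b) = \<kappa> c (\<gamma> b)" using E W that by blast
    have "\<bar>integral {0..b} (\<lambda>s. Lag (\<gamma>' s)) - integral {0..b} (\<lambda>s. Lag (\<gamma> s))
       - snd (\<kappa> c (\<gamma> b)) \<bullet> (fst (\<kappa> c (\<gamma>' b)) - fst (\<kappa> c (\<gamma> b)))
       + snd (\<kappa> c0 (\<gamma> 0)) \<bullet> (fst (\<kappa> c0 (\<gamma>' 0)) - fst (\<kappa> c0 (\<gamma> 0)))\<bar> \<le> C * ?\<delta>\<^sup>2 + C' * C\<^sup>2 * ?\<delta>\<^sup>2"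
      unfolding sp[OF tr(1)] sp[OF tr(2)] using E W e2 by linarith
    also have "\<dots> \<le> ?K * ?\<delta>\<^sup>2" using mult_right_mono[OF K(2), of "?\<delta>\<^sup>2"] by (simp add: distrib_right)
    finally show "\<bar>integral {0..b} (\<lambda>s. Lag (\<gamma>' s)) - integral {0..b} (\<lambda>s. Lag (\<gamma> s))
       - snd (\<kappa> c (\<gamma> b)) \<bullet> (fst (\<kappa> c (\<gamma>' b)) - fst (\<kappa> c (\<gamma> b)))
       + snd (\<kappa> c0 (\<gamma> 0)) \<bullet> (fst (\<kappa> c0 (\<gamma>' 0)) - fst (\<kappa> c0 (\<gamma> 0)))\<bar> \<le> ?K * ?\<delta>\<^sup>2" .
  qed
qed

lemma good_in_zero:
  assumes c0: "c0 \<in> A" and tr: "traj t \<gamma>0" "\<gamma>0 0 \<in> cdom c0" and h0: "h (fst (\<gamma>0 0)) \<noteq> 0"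
  shows "good_in c0 c0 t \<gamma>0 0"
proof -
  let ?w = "\<kappa> c0 (\<gamma>0 0)"
  have "open (\<Omega> c0 \<inter> hE c0 -` (- {0}))"
    by (rule continuous_open_preimage[OF Ck_on_continuous[OF Ck_hE[OF c0]] open_\<Omega>[OF c0]]) auto
  moreover have "?w \<in> \<Omega> c0 \<inter> hE c0 -` (- {0})" using h0 guard_in_chart(2)[OF c0 tr(2)] \<kappa>_in_\<Omega>[OF c0 tr(2)] by simp
  ultimately obtain d where d: "d > 0" "ball ?w d \<subseteq> \<Omega> c0 \<inter> hE c0 -` (- {0})" by (meson open_contains_ball)
  show ?thesis unfolding good_in_def
  proof (rule exI[of _ d], rule conjI[OF d(1)], rule exI[of _ 1], rule conjI[OF zero_less_one], rule exI[of _ 0], intro allI impI)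
    fix \<gamma> \<gamma>' assume near: "starts_near c0 t \<gamma>0 d \<gamma>" "starts_near c0 t \<gamma>0 d \<gamma>'"
    then have g: "\<gamma> 0 \<in> cdom c0" "\<kappa> c0 (\<gamma> 0) \<in> ball ?w d" by (auto simp: starts_near_def)
    then have "hE c0 (\<kappa> c0 (\<gamma> 0)) \<noteq> 0" using d(2) by blast
    then have "\<gamma> 0 \<notin> Guard" "\<gamma> 0 \<notin> Graze" using Guard_chart[OF c0 g(1)] Graze_chart[OF c0 g(1)] by auto
    moreover have "{r \<in> {0..0}. \<gamma> r \<in> Guard} = {}" using calculation by auto
    ultimately show "\<gamma> 0 \<in> cdom c0 \<and> \<gamma> 0 \<notin> Guard \<and> (\<forall>r\<in>{0..0}. \<gamma> r \<notin> Graze) \<and> card {r\<in>{0..0}. \<gamma> r \<in> Guard} = 0 \<and> est c0 c0 1 0 \<gamma> \<gamma>'"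
      using g by (simp add: est_def)
  qed
qed

text \<open>One of the two steps of the continuation in \<open>good_nongrazing\<close>; the times
  \<open>a\<close> and \<open>b\<close> may lie on either side of \<open>s0\<close>.\<close>

lemma good_step_regular:
  assumes c0: "c0 \<in> A" and tr: "traj t \<gamma>0" "\<gamma>0 0 \<in> cdom c0" and s0: "s0 \<in> {0..t}" "\<gamma>0 s0 \<notin> Guard" "\<gamma>0 s0 \<notin> Graze"
  shows "\<exists>\<epsilon>>0. \<forall>a b. a \<in> {0..t} \<longrightarrow> b \<in> {0..t} \<longrightarrow> a \<le> b \<longrightarrow> s0 - \<epsilon> < a \<longrightarrow> b < s0 + \<epsilon> \<longrightarrow> (\<exists>c\<in>A. good_in c0 c t \<gamma>0 a) \<longrightarrow> (\<exists>c\<in>A. good_in c0 c t \<gamma>0 b)"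
proof -
  obtain c where c: "c \<in> A" "\<gamma>0 s0 \<in> cdom c" using dom_exists[OF trajD(2)[OF tr(1) s0(1)]] by blast
  obtain \<rho> \<epsilon>1 C1 where \<rho>: "\<rho> > 0" "\<epsilon>1 > 0" "C1 > 0" and win: "\<forall>t \<gamma> \<gamma>' a b. traj t \<gamma> \<longrightarrow> traj t \<gamma>' \<longrightarrow> 0 \<le> a \<longrightarrow> a \<le> b \<longrightarrow> b \<le> t \<longrightarrow> b - a \<le> \<epsilon>1 \<longrightarrow>
     \<gamma> a \<in> cdom c \<longrightarrow> \<gamma>' a \<in> cdom c \<longrightarrow> dist (\<kappa> c (\<gamma>0 s0)) (\<kappa> c (\<gamma> a)) < \<rho> \<longrightarrow> dist (\<kappa> c (\<gamma>0 s0)) (\<kappa> c (\<gamma>' a)) < \<rho> \<longrightarrow>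
     (\<forall>s\<in>{a..b}. \<gamma> s \<in> cdom c \<and> \<gamma> s \<notin> Guard \<and> \<gamma> s \<notin> Graze) \<and> window_est c C1 a b \<gamma> \<gamma>'"
    using regular_window[OF c s0(2,3)] by - (elim exE conjE, rule that)
  note win = win[rule_format]
  let ?near = "\<lambda>s. \<gamma>0 s \<in> cdom c \<and> dist (\<kappa> c (\<gamma>0 s0)) (\<kappa> c (\<gamma>0 s)) < \<rho> / 2"
  have lim: "\<forall>\<^sub>F s in F. ?near s" if "limitin (atlas_topology \<B>) \<gamma>0 (\<gamma>0 s0) F" for F
  proof -
    note L = limitin_chartD[OF smooth_B that chart_in_B[OF c(1)] c(2)]
    show ?thesis using L(1) topological_tendstoD[OF L(2) open_ball[of "\<kappa> c (\<gamma>0 s0)" "\<rho> / 2"]] \<rho>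
      by (auto simp: eventually_conj_iff)
  qed
  obtain l where l: "l < s0" "\<And>s. l < s \<Longrightarrow> s < s0 \<Longrightarrow> 0 < s0 \<Longrightarrow> ?near s"
  proof (cases "0 < s0")
    case True
    then have "\<forall>\<^sub>F s in at_left s0. ?near s" using lim trajD(4)[OF tr(1) True] s0 by simp
    then show ?thesis unfolding eventually_at_left_field using that by blast
  next
    case False
    then show ?thesis using that[of "s0 - 1"] by simp
  qed
  obtain u where u: "u > s0" "\<And>s. s0 < s \<Longrightarrow> s < u \<Longrightarrow> s0 < t \<Longrightarrow> ?near s"
  proof (cases "s0 < t")
    case True
    then have "\<forall>\<^sub>F s in at_right s0. ?near s" using lim trajD(5)[OF tr(1) _ True] s0 by simp
    then show ?thesis unfolding eventually_at_right_field using that by blast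
  next
    case False
    then show ?thesis using that[of "s0 + 1"] by simp
  qed
  define \<epsilon> where "\<epsilon> = min (\<epsilon>1 / 2) (min (s0 - l) (u - s0))"
  have \<epsilon>: "\<epsilon> > 0" using \<rho> l u by (simp add: \<epsilon>_def)
  show ?thesis
  proof (rule exI[of _ \<epsilon>], rule conjI[OF \<epsilon>], intro allI impI)
    fix a b assume ab: "a \<in> {0..t}" "b \<in> {0..t}" "a \<le> b" "s0 - \<epsilon> < a" "b < s0 + \<epsilon>" and ga: "\<exists>c\<in>A. good_in c0 c t \<gamma>0 a"
    have na: "?near a"
    proof (cases a s0 rule: linorder_cases)
      case less
      then show ?thesis using l(2)[of a] ab by (auto simp: \<epsilon>_def)
    next
      case equal
      then show ?thesis using c \<rho> by simp
    next
      case greater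
      then show ?thesis using u(2)[of a] ab by (auto simp: \<epsilon>_def)
    qed
    have G: "good_in c0 c t \<gamma>0 a" using good_in_chart_change[OF _ c(1) tr _ conjunct1[OF na]] ga by blast
    obtain d C N where d: "d > 0" "C > 0" and good: "\<forall>\<gamma> \<gamma>'. starts_near c0 t \<gamma>0 d \<gamma> \<longrightarrow> starts_near c0 t \<gamma>0 d \<gamma>' \<longrightarrow>
       \<gamma> a \<in> cdom c \<and> \<gamma> a \<notin> Guard \<and> (\<forall>r\<in>{0..a}. \<gamma> r \<notin> Graze) \<and> card {r\<in>{0..a}. \<gamma> r \<in> Guard} = N \<and> est c0 c C a \<gamma> \<gamma>'"
      using G unfolding good_in_def by blast
    note good = good[rule_format]
    have n0: "starts_near c0 t \<gamma>0 d \<gamma>0" using tr d by (simp add: starts_near_def)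
    \<comment> \<open>At time \<open>a\<close> nearby trajectories are within
      \<open>\<rho> / 2\<close> of \<gamma>0, which is itself within \<open>\<rho> / 2\<close> of
      its state at \<open>s0\<close>.\<close>
    define d' where "d' = min d ((\<rho> / 2) / C)"
    have d': "d' > 0" using d \<rho> by (simp add: d'_def)
    let ?K = "C1 * C + C + C1 * C\<^sup>2"
    have K: "?K > 0" using d \<rho> by (simp add: add_pos_pos)
    have "good_in c0 c t \<gamma>0 b" unfolding good_in_def
    proof (rule exI[of _ d'], rule conjI[OF d'], rule exI[of _ ?K], rule conjI[OF K], rule exI[of _ N], intro allI impI)
      fix \<gamma> \<gamma>' assume near: "starts_near c0 t \<gamma>0 d' \<gamma>" "starts_near c0 t \<gamma>0 d' \<gamma>'"
      then have nd: "starts_near c0 t \<gamma>0 d \<gamma>" "starts_near c0 t \<gamma>0 d \<gamma>'" by (auto elim: starts_near_mono simp: d'_def)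
      have T: "traj t \<gamma>" "traj t \<gamma>'" using near by (auto simp: starts_near_def)
      have nr: "dist (\<kappa> c (\<gamma>0 s0)) (\<kappa> c (x a)) < \<rho>" if x: "starts_near c0 t \<gamma>0 d' x" "starts_near c0 t \<gamma>0 d x" for x
      proof -
        have "est c0 c C a \<gamma>0 x" using good[OF n0 x(2)] by blast
        then have "dist (\<kappa> c (\<gamma>0 a)) (\<kappa> c (x a)) < \<rho> / 2"
          by (rule est_dist[OF _ d(2)]) (use x(1) in \<open>auto simp: starts_near_def d'_def\<close>)
        then show ?thesis using na dist_triangle[of "\<kappa> c (\<gamma>0 s0)" "\<kappa> c (x a)" "\<kappa> c (\<gamma>0 a)"] by linarith
      qed
      note g1 = good[OF nd] and g2 = good[OF nd(2) nd(1)]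
      have w: "(\<forall>s\<in>{a..b}. \<gamma> s \<in> cdom c \<and> \<gamma> s \<notin> Guard \<and> \<gamma> s \<notin> Graze) \<and> window_est c C1 a b \<gamma> \<gamma>'"
        by (rule win[OF T _ ab(3) _ _ _ _ nr[OF near(1) nd(1)] nr[OF near(2) nd(2)]])
           (use ab g1 g2 in \<open>auto simp: \<epsilon>_def\<close>)
      have "{r\<in>{0..b}. \<gamma> r \<in> Guard} = {r\<in>{0..a}. \<gamma> r \<in> Guard}"
      proof (intro set_eqI iffI)
        fix r assume r: "r \<in> {r\<in>{0..b}. \<gamma> r \<in> Guard}"
        then have "\<not> (a \<le> r)" using w by auto
        then show "r \<in> {r\<in>{0..a}. \<gamma> r \<in> Guard}" using r by auto
      qed (use ab in auto)
      moreover have "\<forall>r\<in>{0..b}. \<gamma> r \<notin> Graze"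
      proof
        fix r assume "r \<in> {0..b}"
        then show "\<gamma> r \<notin> Graze" using g1 w by (cases "r \<le> a") auto
      qed
      moreover have "est c0 c ?K b \<gamma> \<gamma>'"
        by (rule est_compose[OF T _ ab(3) _ _ _ d(2) \<rho>(3)]) (use g1 w ab in auto)
      ultimately show "\<gamma> b \<in> cdom c \<and> \<gamma> b \<notin> Guard \<and> (\<forall>r\<in>{0..b}. \<gamma> r \<notin> Graze) \<and> card {r\<in>{0..b}. \<gamma> r \<in> Guard} = N \<and> est c0 c ?K b \<gamma> \<gamma>'"
        using g1 w ab(3) by auto
    qed
    then show "\<exists>c\<in>A. good_in c0 c t \<gamma>0 b" using c(1) by blast
  qed
qed

text \<open>Nothing is claimed at the impact time itself, since neighbours may hit earlier or later.
  The step leads from a time before the impact to one after it, where all neighbours have been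
  reset.\<close>

lemma good_step_impact:
  assumes c0: "c0 \<in> A" and tr: "traj t \<gamma>0" "\<gamma>0 0 \<in> cdom c0" and s0: "0 < s0" "s0 < t" "\<gamma>0 s0 \<in> Guard"
  shows "\<exists>\<epsilon>>0. \<forall>a b. a \<in> {0..t} \<longrightarrow> b \<in> {0..t} \<longrightarrow> a < s0 \<longrightarrow> s0 < b \<longrightarrow> s0 - \<epsilon> < a \<longrightarrow> b < s0 + \<epsilon> \<longrightarrow> (\<exists>c\<in>A. good_in c0 c t \<gamma>0 a) \<longrightarrow> (\<exists>c\<in>A. good_in c0 c t \<gamma>0 b)"
proof -
  have s0t: "s0 \<in> {0..t}" using s0 by auto
  obtain c where c: "c \<in> A" "\<gamma>0 s0 \<in> cdom c" using dom_exists[OF trajD(2)[OF tr(1) s0t]] by blast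
  let ?w0 = "\<kappa> c (\<gamma>0 s0)"
  obtain \<rho> \<epsilon>1 C1 where \<rho>: "\<rho> > 0" "\<epsilon>1 > 0" "C1 > 0" and
    win: "\<forall>t \<gamma> \<gamma>' a b. traj t \<gamma> \<longrightarrow> traj t \<gamma>' \<longrightarrow> 0 \<le> a \<longrightarrow> a \<le> b \<longrightarrow> b \<le> t \<longrightarrow> b - a \<le> \<epsilon>1 \<longrightarrow>
     \<gamma> a \<in> cdom c \<longrightarrow> \<gamma>' a \<in> cdom c \<longrightarrow> dist ?w0 (\<kappa> c (\<gamma> a)) < \<rho> \<longrightarrow> dist ?w0 (\<kappa> c (\<gamma>' a)) < \<rho> \<longrightarrow>
     hE c (\<kappa> c (\<gamma> a)) > 0 \<longrightarrow> hE c (\<kappa> c (\<gamma>' a)) > 0 \<longrightarrow> (\<exists>s\<in>{a..<b}. \<gamma> s \<in> Guard) \<longrightarrow> (\<exists>s\<in>{a..<b}. \<gamma>' s \<in> Guard) \<longrightarrow>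
     (\<forall>s\<in>{a..b}. \<gamma> s \<notin> Graze) \<and> \<gamma> b \<in> cdom c \<and> \<gamma> b \<notin> Guard \<and> (\<exists>\<tau>. {s\<in>{a..b}. \<gamma> s \<in> Guard} = {\<tau>}) \<and> window_est c C1 a b \<gamma> \<gamma>'"
    and win2: "\<forall>t \<gamma> a b s0. traj t \<gamma> \<longrightarrow> 0 \<le> a \<longrightarrow> a < s0 \<longrightarrow> s0 < b \<longrightarrow> b \<le> t \<longrightarrow> b - a \<le> \<epsilon>1 \<longrightarrow> \<gamma> a \<in> cdom c \<longrightarrow>
      dist ?w0 (\<kappa> c (\<gamma> a)) < \<rho> \<longrightarrow> hE c (\<kappa> c (\<gamma> a)) > 0 \<longrightarrow> \<gamma> s0 \<in> Guard \<longrightarrow>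
      (\<exists>d>0. \<forall>\<gamma>'. traj t \<gamma>' \<longrightarrow> \<gamma>' a \<in> cdom c \<longrightarrow> norm (\<kappa> c (\<gamma>' a) - \<kappa> c (\<gamma> a)) < d \<longrightarrow>
         dist ?w0 (\<kappa> c (\<gamma>' a)) < \<rho> \<and> hE c (\<kappa> c (\<gamma>' a)) > 0 \<and> (\<exists>s\<in>{a..<b}. \<gamma>' s \<in> Guard))"
    and win3: "\<forall>t \<gamma> s. traj t \<gamma> \<longrightarrow> 0 < s \<longrightarrow> s \<le> t \<longrightarrow> \<gamma> s = \<gamma>0 s0 \<longrightarrow>
      (\<exists>a0<s. \<forall>a. a0 < a \<longrightarrow> a < s \<longrightarrow> 0 \<le> a \<and> \<gamma> a \<in> cdom c \<and> dist ?w0 (\<kappa> c (\<gamma> a)) < \<rho> \<and> hE c (\<kappa> c (\<gamma> a)) > 0)"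
    using impact_window[OF c s0(3)] by - (elim exE conjE, rule that)
  note win = win[rule_format] and win2 = win2[rule_format] and win3 = win3[rule_format, OF tr(1) s0(1) less_imp_le[OF s0(2)] refl]
  obtain a0 where a0: "a0 < s0" "\<And>a. a0 < a \<Longrightarrow> a < s0 \<Longrightarrow> 0 \<le> a \<and> \<gamma>0 a \<in> cdom c \<and> dist ?w0 (\<kappa> c (\<gamma>0 a)) < \<rho> \<and> hE c (\<kappa> c (\<gamma>0 a)) > 0"
    using win3 by auto
  define \<epsilon> where "\<epsilon> = min (\<epsilon>1 / 2) (s0 - a0)"
  have \<epsilon>: "\<epsilon> > 0" using \<rho> a0 by (simp add: \<epsilon>_def)
  show ?thesis
  proof (rule exI[of _ \<epsilon>], rule conjI[OF \<epsilon>], intro allI impI)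
    fix a b assume ab: "a \<in> {0..t}" "b \<in> {0..t}" "a < s0" "s0 < b" "s0 - \<epsilon> < a" "b < s0 + \<epsilon>" and ga: "\<exists>c\<in>A. good_in c0 c t \<gamma>0 a"
    have a: "0 \<le> a" "\<gamma>0 a \<in> cdom c" "dist ?w0 (\<kappa> c (\<gamma>0 a)) < \<rho>" "hE c (\<kappa> c (\<gamma>0 a)) > 0" using a0(2)[of a] ab by (auto simp: \<epsilon>_def)
    have ba: "b - a \<le> \<epsilon>1" "b \<le> t" "a \<le> b" using ab by (auto simp: \<epsilon>_def)
    obtain e where e: "e > 0" "\<And>\<gamma>'. traj t \<gamma>' \<Longrightarrow> \<gamma>' a \<in> cdom c \<Longrightarrow> norm (\<kappa> c (\<gamma>' a) - \<kappa> c (\<gamma>0 a)) < e \<Longrightarrow>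
         dist ?w0 (\<kappa> c (\<gamma>' a)) < \<rho> \<and> hE c (\<kappa> c (\<gamma>' a)) > 0 \<and> (\<exists>s\<in>{a..<b}. \<gamma>' s \<in> Guard)"
      using win2[OF tr(1) a(1) ab(3,4) ba(2,1) a(2-4) s0(3)] by blast
    have G: "good_in c0 c t \<gamma>0 a" using good_in_chart_change[OF _ c(1) tr _ a(2)] ga by blast
    obtain d C N where d: "d > 0" "C > 0" and good: "\<forall>\<gamma> \<gamma>'. starts_near c0 t \<gamma>0 d \<gamma> \<longrightarrow> starts_near c0 t \<gamma>0 d \<gamma>' \<longrightarrow>
       \<gamma> a \<in> cdom c \<and> \<gamma> a \<notin> Guard \<and> (\<forall>r\<in>{0..a}. \<gamma> r \<notin> Graze) \<and> card {r\<in>{0..a}. \<gamma> r \<in> Guard} = N \<and> est c0 c C a \<gamma> \<gamma>'"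
      using G unfolding good_in_def by blast
    note good = good[rule_format]
    have n0: "starts_near c0 t \<gamma>0 d \<gamma>0" using tr d by (simp add: starts_near_def)
    define d' where "d' = min d (e / C)"
    have d': "d' > 0" using d e by (simp add: d'_def)
    let ?K = "C1 * C + C + C1 * C\<^sup>2"
    have K: "?K > 0" using d \<rho> by (simp add: add_pos_pos)
    have "good_in c0 c t \<gamma>0 b" unfolding good_in_def
    proof (rule exI[of _ d'], rule conjI[OF d'], rule exI[of _ ?K], rule conjI[OF K], rule exI[of _ "N + 1"], intro allI impI)
      fix \<gamma> \<gamma>' assume near: "starts_near c0 t \<gamma>0 d' \<gamma>" "starts_near c0 t \<gamma>0 d' \<gamma>'"
      then have nd: "starts_near c0 t \<gamma>0 d \<gamma>" "starts_near c0 t \<gamma>0 d \<gamma>'" by (auto elim: starts_near_mono simp: d'_def)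
      have T: "traj t \<gamma>" "traj t \<gamma>'" using near by (auto simp: starts_near_def)
      have nr: "x a \<in> cdom c \<and> dist ?w0 (\<kappa> c (x a)) < \<rho> \<and> hE c (\<kappa> c (x a)) > 0 \<and> (\<exists>s\<in>{a..<b}. x s \<in> Guard)"
        if x: "starts_near c0 t \<gamma>0 d' x" "starts_near c0 t \<gamma>0 d x" for x
      proof -
        have "est c0 c C a \<gamma>0 x" using good[OF n0 x(2)] by blast
        then have "dist (\<kappa> c (\<gamma>0 a)) (\<kappa> c (x a)) < e"
          by (rule est_dist[OF _ d(2)]) (use x(1) in \<open>auto simp: starts_near_def d'_def\<close>)
        then have "norm (\<kappa> c (x a) - \<kappa> c (\<gamma>0 a)) < e" by (simp add: dist_norm norm_minus_commute)
        moreover have "x a \<in> cdom c" using good[OF x(2) x(2)] by blast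
        moreover have "traj t x" using x by (simp add: starts_near_def)
        ultimately show ?thesis using e(2)[of x] by blast
      qed
      note g1 = good[OF nd] and n1 = nr[OF near(1) nd(1)] and n2 = nr[OF near(2) nd(2)]
      have w: "(\<forall>s\<in>{a..b}. \<gamma> s \<notin> Graze) \<and> \<gamma> b \<in> cdom c \<and> \<gamma> b \<notin> Guard \<and> (\<exists>\<tau>. {s\<in>{a..b}. \<gamma> s \<in> Guard} = {\<tau>}) \<and> window_est c C1 a b \<gamma> \<gamma>'"
        by (rule win[OF T a(1) ba(3,2,1)]) (use n1 n2 in blast)+
      then obtain \<tau> where \<tau>: "{s\<in>{a..b}. \<gamma> s \<in> Guard} = {\<tau>}" by blast
      have U: "{r\<in>{0..b}. \<gamma> r \<in> Guard} = {r\<in>{0..a}. \<gamma> r \<in> Guard} \<union> {s\<in>{a..b}. \<gamma> s \<in> Guard}"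
        using ab by auto
      have D: "{r\<in>{0..a}. \<gamma> r \<in> Guard} \<inter> {s\<in>{a..b}. \<gamma> s \<in> Guard} = {}"
      proof -
        have "r = a" if "r \<in> {0..a}" "r \<in> {a..b}" for r using that by auto
        then show ?thesis using g1 by blast
      qed
      have "{r\<in>{0..a}. \<gamma> r \<in> Guard} \<subseteq> {s\<in>{0..t}. \<gamma> s \<in> Guard}" using ab by auto
      then have fin: "finite {r\<in>{0..a}. \<gamma> r \<in> Guard}" using trajD(3)[OF T(1)] finite_subset by blast
      have fin2: "finite {s\<in>{a..b}. \<gamma> s \<in> Guard}" unfolding \<tau> by simp
      have "card {r\<in>{0..b}. \<gamma> r \<in> Guard} = card {r\<in>{0..a}. \<gamma> r \<in> Guard} + card {s\<in>{a..b}. \<gamma> s \<in> Guard}"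
        unfolding U by (rule card_Un_disjoint[OF fin fin2 D])
      also have "card {r\<in>{0..a}. \<gamma> r \<in> Guard} = N" using g1 by blast
      also have "card {s\<in>{a..b}. \<gamma> s \<in> Guard} = 1" unfolding \<tau> by simp
      finally have "card {r\<in>{0..b}. \<gamma> r \<in> Guard} = N + 1" .
      moreover have "\<forall>r\<in>{0..b}. \<gamma> r \<notin> Graze"
      proof
        fix r assume "r \<in> {0..b}"
        then show "\<gamma> r \<notin> Graze" using g1 w by (cases "r \<le> a") auto
      qed
      moreover have "est c0 c ?K b \<gamma> \<gamma>'"
        by (rule est_compose[OF T a(1) ba(3,2) _ _ d(2) \<rho>(3)]) (use g1 w in auto)
      ultimately show "\<gamma> b \<in> cdom c \<and> \<gamma> b \<notin> Guard \<and> (\<forall>r\<in>{0..b}. \<gamma> r \<notin> Graze) \<and> card {r\<in>{0..b}. \<gamma> r \<in> Guard} = N + 1 \<and> est c0 c ?K b \<gamma> \<gamma>'"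
        using w by blast
    qed
    then show "\<exists>c\<in>A. good_in c0 c t \<gamma>0 b" using c(1) by blast
  qed
qed

lemma good_in_nonguard:
  assumes tr: "traj t \<gamma>0" "\<gamma>0 0 \<in> cdom c0" and G: "good_in c0 c t \<gamma>0 s"
  shows "\<gamma>0 s \<notin> Guard"
proof -
  obtain d where d: "d > 0" "\<forall>\<gamma>. starts_near c0 t \<gamma>0 d \<gamma> \<longrightarrow> \<gamma> s \<notin> Guard"
    using G unfolding good_in_def by blast
  then show ?thesis using tr by (simp add: starts_near_def)
qed

text \<open>Continuation in time: a good time close to the supremum \<open>T\<close> is carried past
  \<open>T\<close>, or to \<open>s\<close> if \<open>T = s\<close>, by one of the two step lemmas.
  An impact at \<open>T\<close> forces \<open>T < s\<close>, since the final state is not in the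
  guard.\<close>

lemma good_nongrazing:
  assumes c0: "c0 \<in> A" and tr: "traj t \<gamma>0" "\<gamma>0 0 \<in> cdom c0" and h0: "h (fst (\<gamma>0 0)) \<noteq> 0"
    and s: "s \<in> {0..t}" "\<gamma>0 s \<notin> Guard" and ng: "\<And>r. r \<in> {0..s} \<Longrightarrow> \<gamma>0 r \<notin> Graze"
  shows "\<exists>c\<in>A. good_in c0 c t \<gamma>0 s"
proof -
  define S where "S = {r\<in>{0..s}. \<exists>c\<in>A. good_in c0 c t \<gamma>0 r}"
  define T where "T = Sup S"
  have S0: "0 \<in> S" using good_in_zero[OF c0 tr h0] c0 s by (auto simp: S_def)
  have bdd: "bdd_above S" unfolding S_def by auto
  have Sle: "r \<le> s" if "r \<in> S" for r using that by (simp add: S_def)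
  have ne: "S \<noteq> {}" using S0 by blast
  have T: "0 \<le> T" "T \<le> s"
    unfolding T_def by (rule cSup_upper[OF S0 bdd], rule cSup_least[OF ne Sle])
  have near: "\<exists>a\<in>S. T - \<epsilon> < a \<and> a \<le> T" if "\<epsilon> > 0" for \<epsilon>
  proof -
    have "T - \<epsilon> < Sup S" using that by (simp add: T_def)
    then obtain a where "a \<in> S" "T - \<epsilon> < a" unfolding less_cSup_iff[OF ne bdd] by blast
    moreover have "a \<le> T" unfolding T_def by (rule cSup_upper[OF calculation(1) bdd])
    ultimately show ?thesis by blast
  qed
  have "T = s \<and> (\<exists>c\<in>A. good_in c0 c t \<gamma>0 s)"
  proof (cases "\<gamma>0 T \<in> Guard")
    case False
    have ngT: "\<gamma>0 T \<notin> Graze" using ng[of T] T by simp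
    have "T \<in> {0..t}" using T s by auto
    from good_step_regular[OF c0 tr this False ngT] obtain \<epsilon> where \<epsilon>: "\<epsilon> > 0"
      "\<And>a b. a \<in> {0..t} \<Longrightarrow> b \<in> {0..t} \<Longrightarrow> a \<le> b \<Longrightarrow> T - \<epsilon> < a \<Longrightarrow> b < T + \<epsilon> \<Longrightarrow> (\<exists>c\<in>A. good_in c0 c t \<gamma>0 a) \<Longrightarrow> (\<exists>c\<in>A. good_in c0 c t \<gamma>0 b)"
      by blast
    obtain a where a: "a \<in> S" "T - \<epsilon> < a" "a \<le> T" using near[OF \<epsilon>(1)] by blast
    define b where "b = min s (T + \<epsilon> / 2)"
    have b: "T \<le> b" "b \<le> s" "b < T + \<epsilon>" using T \<epsilon>(1) by (auto simp: b_def)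
    have gb: "\<exists>c\<in>A. good_in c0 c t \<gamma>0 b" by (rule \<epsilon>(2)[of a]) (use a b T s in \<open>auto simp: S_def\<close>)
    then have "b \<in> S" using b T by (auto simp: S_def)
    then have "b \<le> T" unfolding T_def by (rule cSup_upper[OF _ bdd])
    then have "T = s" "b = s" using b \<epsilon>(1) T by (auto simp: b_def min_def split: if_splits)
    then show ?thesis using gb by simp
  next
    case True
    have "\<gamma>0 0 \<notin> Guard" using Guard_chart[OF c0 tr(2)] h0 guard_in_chart(2)[OF c0 tr(2)] by simp
    then have T0: "0 < T" using True T by (cases "T = 0") auto
    have Ts: "T < s" using True s T by (cases "T = s") auto
    then have "T < t" using s by simp
    from good_step_impact[OF c0 tr T0 this True] obtain \<epsilon> where \<epsilon>: "\<epsilon> > 0"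
      "\<And>a b. a \<in> {0..t} \<Longrightarrow> b \<in> {0..t} \<Longrightarrow> a < T \<Longrightarrow> T < b \<Longrightarrow> T - \<epsilon> < a \<Longrightarrow> b < T + \<epsilon> \<Longrightarrow> (\<exists>c\<in>A. good_in c0 c t \<gamma>0 a) \<Longrightarrow> (\<exists>c\<in>A. good_in c0 c t \<gamma>0 b)"
      by blast
    obtain a where a: "a \<in> S" "T - \<epsilon> < a" "a \<le> T" using near[OF \<epsilon>(1)] by blast
    have "\<gamma>0 a \<notin> Guard" using a(1) good_in_nonguard[OF tr] by (auto simp: S_def)
    then have aT: "a < T" using a(3) True by (cases "a = T") auto
    define b where "b = min s (T + \<epsilon> / 2)"
    have b: "T < b" "b \<le> s" "b < T + \<epsilon>" using Ts \<epsilon>(1) by (auto simp: b_def)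
    have "\<exists>c\<in>A. good_in c0 c t \<gamma>0 b" by (rule \<epsilon>(2)[of a]) (use a aT b T s in \<open>auto simp: S_def\<close>)
    then have "b \<in> S" using b T by (auto simp: S_def)
    then have "b \<le> T" unfolding T_def by (rule cSup_upper[OF _ bdd])
    then show ?thesis using b by simp
  qed
  then show ?thesis by blast
qed

end

section \<open>Density of non-grazing initial states\<close>

text \<open>The system is autonomous. Restarting a trajectory at time \<open>q\<close> makes
  statements about initial states, such as \<open>avoids\<close>, applicable at later times.\<close>

lemma hybrid_trajectory_shift:
  assumes tr: "hybrid_trajectory HS t \<gamma>" and q: "0 \<le> q" "0 \<le> \<tau>" "q + \<tau> \<le> t"
  shows "hybrid_trajectory HS \<tau> (\<lambda>s. \<gamma> (q + s))"
proof -
  note T = tr[unfolded hybrid_trajectory_def]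
  have left: "limitin X (\<lambda>s. \<gamma> (q + s)) l (at_left s)" if "limitin X \<gamma> l (at_left (q + s))" for X l s
  proof -
    have "\<forall>\<^sub>F x in at_left s. Q (q + x)" if "\<forall>\<^sub>F x in at_left (q + s). Q x" for Q
    proof -
      obtain b where b: "b < q + s" "\<And>y. b < y \<Longrightarrow> y < q + s \<Longrightarrow> Q y" using \<open>\<forall>\<^sub>F x in at_left (q + s). Q x\<close> unfolding eventually_at_left_field by blast
      show ?thesis unfolding eventually_at_left_field by (rule exI[of _ "b - q"]) (use b in auto)
    qed
    then show ?thesis using that unfolding limitin_def by blast
  qed
  have right: "limitin X (\<lambda>s. \<gamma> (q + s)) l (at_right s)" if "limitin X \<gamma> l (at_right (q + s))" for X l s
  proof -
    have "\<forall>\<^sub>F x in at_right s. Q (q + x)" if "\<forall>\<^sub>F x in at_right (q + s). Q x" for Q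
    proof -
      obtain b where b: "b > q + s" "\<And>y. q + s < y \<Longrightarrow> y < b \<Longrightarrow> Q y" using \<open>\<forall>\<^sub>F x in at_right (q + s). Q x\<close> unfolding eventually_at_right_field by blast
      show ?thesis unfolding eventually_at_right_field by (rule exI[of _ "b - q"]) (use b in auto)
    qed
    then show ?thesis using that unfolding limitin_def by blast
  qed
  show ?thesis unfolding hybrid_trajectory_def
  proof (intro conjI ballI impI)
    show "0 \<le> \<tau>" by fact
    show "\<gamma> (q + s) \<in> points (state_atlas HS)" if "s \<in> {0..\<tau>}" for s using T that q by auto
    have "(+) q ` {s \<in> {0..\<tau>}. \<gamma> (q + s) \<in> guard HS} \<subseteq> {s \<in> {0..t}. \<gamma> s \<in> guard HS}" using q by auto
    then have "finite ((+) q ` {s \<in> {0..\<tau>}. \<gamma> (q + s) \<in> guard HS})" using T finite_subset by blast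
    then show "finite {s \<in> {0..\<tau>}. \<gamma> (q + s) \<in> guard HS}" by (rule finite_imageD) auto
    show "limitin (atlas_topology (state_atlas HS)) (\<lambda>s. \<gamma> (q + s)) (\<gamma> (q + s)) (at_left s)" if "s \<in> {0<..\<tau>}" for s
      by (rule left) (use T that q in auto)
    show "limitin (atlas_topology (state_atlas HS)) (\<lambda>s. \<gamma> (q + s)) (if \<gamma> (q + s) \<in> guard HS then reset HS (\<gamma> (q + s)) else \<gamma> (q + s)) (at_right s)"
      if s: "s \<in> {0..<\<tau>}" for s
    proof (rule right)
      have "q + s \<in> {0..<t}" using s q by auto
      then show "limitin (atlas_topology (state_atlas HS)) \<gamma> (if \<gamma> (q + s) \<in> guard HS then reset HS (\<gamma> (q + s)) else \<gamma> (q + s)) (at_right (q + s))"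
        using T by blast
    qed
    fix s C assume s: "s \<in> {0..\<tau>}" "\<gamma> (q + s) \<notin> guard HS" "C \<in> state_atlas HS" "\<gamma> (q + s) \<in> fst C"
    have im: "(+) q ` {0..\<tau>} = {q..q + \<tau>}" by simp
    have "q + s \<in> {0..t}" using s q by auto
    then have "(snd C \<circ> \<gamma> has_vector_derivative vfield HS (\<gamma> (q + s)) C) (at (q + s) within {0..t})"
      using T s by blast
    then have "(snd C \<circ> \<gamma> has_vector_derivative vfield HS (\<gamma> (q + s)) C) (at (q + s) within (+) q ` {0..\<tau>})"
      unfolding im by (rule has_vector_derivative_within_subset) (use q in auto)
    moreover have "((+) q has_vector_derivative 1) (at s within {0..\<tau>})"
      by (auto intro!: derivative_eq_intros)
    ultimately have "((snd C \<circ> \<gamma>) \<circ> (+) q has_vector_derivative 1 *\<^sub>R vfield HS (\<gamma> (q + s)) C) (at s within {0..\<tau>})"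
      by (rule vector_diff_chain_within[rotated])
    then show "(snd C \<circ> (\<lambda>s. \<gamma> (q + s)) has_vector_derivative vfield HS (\<gamma> (q + s)) C) (at s within {0..\<tau>})"
      by (simp add: comp_def)
  qed
qed

context impact_system
begin

text \<open>The time \<open>s1\<close> is singled out because the final time of the flow must not be an impact time
  of nearby trajectories.\<close>

definition avoids :: "real \<Rightarrow> real \<Rightarrow> ('q, real^'n) phase set \<Rightarrow> bool" where
  "avoids \<delta> s1 W \<longleftrightarrow> (\<forall>Y. openin (atlas_topology \<B>) Y \<longrightarrow> Y \<noteq> {} \<longrightarrow> Y \<subseteq> W \<longrightarrow>
     (\<exists>z\<in>Y. \<forall>\<tau> \<gamma>. traj \<tau> \<gamma> \<longrightarrow> \<gamma> 0 = z \<longrightarrow> \<tau> \<le> \<delta> \<longrightarrow> (\<forall>s\<in>{0..<\<tau>}. \<gamma> s \<notin> Guard) \<longrightarrow>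
        \<gamma> \<tau> \<notin> Graze \<and> (\<tau> = s1 \<longrightarrow> \<gamma> \<tau> \<notin> Guard)))"

lemma avoids_mono:
  assumes a: "avoids \<delta> s1 W" and le: "\<delta>' \<le> \<delta>"
  shows "avoids \<delta>' s1 W"
  unfolding avoids_def
proof (intro allI impI)
  fix Y assume "openin (atlas_topology \<B>) Y" "Y \<noteq> {}" "Y \<subseteq> W"
  then have "\<exists>z\<in>Y. \<forall>\<tau> \<gamma>. traj \<tau> \<gamma> \<longrightarrow> \<gamma> 0 = z \<longrightarrow> \<tau> \<le> \<delta> \<longrightarrow> (\<forall>s\<in>{0..<\<tau>}. \<gamma> s \<notin> Guard) \<longrightarrow>
        \<gamma> \<tau> \<notin> Graze \<and> (\<tau> = s1 \<longrightarrow> \<gamma> \<tau> \<notin> Guard)"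
    using a unfolding avoids_def by simp
  then obtain z where z: "z \<in> Y" and p: "\<forall>\<tau> \<gamma>. traj \<tau> \<gamma> \<longrightarrow> \<gamma> 0 = z \<longrightarrow> \<tau> \<le> \<delta> \<longrightarrow> (\<forall>s\<in>{0..<\<tau>}. \<gamma> s \<notin> Guard) \<longrightarrow>
        \<gamma> \<tau> \<notin> Graze \<and> (\<tau> = s1 \<longrightarrow> \<gamma> \<tau> \<notin> Guard)" by (elim bexE)
  show "\<exists>z\<in>Y. \<forall>\<tau> \<gamma>. traj \<tau> \<gamma> \<longrightarrow> \<gamma> 0 = z \<longrightarrow> \<tau> \<le> \<delta>' \<longrightarrow> (\<forall>s\<in>{0..<\<tau>}. \<gamma> s \<notin> Guard) \<longrightarrow>
        \<gamma> \<tau> \<notin> Graze \<and> (\<tau> = s1 \<longrightarrow> \<gamma> \<tau> \<notin> Guard)"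
    by (rule bexI[OF _ z], intro allI impI) (rule p[rule_format], use le in auto)
qed

text \<open>Transfers \<open>graze_avoidable\<close> to the manifold. The shortened \<delta> and the
  half ball ensure, through \<open>confine\<close>, that impact-free trajectories from
  \<open>W\<close> are flow lines in the ball of that lemma.\<close>

lemma avoids_exists:
  assumes z0: "z0 \<in> points \<B>" "h (fst z0) = 0"
  shows "\<exists>\<delta>>0. \<exists>W. openin (atlas_topology \<B>) W \<and> z0 \<in> W \<and> (\<forall>s1. avoids \<delta> s1 W)"
proof -
  obtain c where c: "c \<in> A" "z0 \<in> cdom c" using dom_exists[OF z0(1)] by blast
  interpret I: impact_chart "\<Omega> c" "XH c" "hE c" "PE c" "LE c" "ham_chart A g V c" "refl_chart A g h c"
      "{z \<in> \<Omega> c. nE c z \<noteq> 0}" "\<lambda>z. - 2 * PE c z / nE c z" by (rule impact_chart_local[OF c(1)])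
  let ?w0 = "\<kappa> c z0"
  have w0: "?w0 \<in> \<Omega> c" "hE c ?w0 = 0" using \<kappa>_in_\<Omega>[OF c] guard_in_chart(2)[OF c] z0(2) by auto
  obtain \<rho> \<delta>0 where \<rho>: "\<rho> > 0" "\<delta>0 > 0" "cball ?w0 \<rho> \<subseteq> \<Omega> c" and av: "\<forall>Y s1. open Y \<and> Y \<noteq> {} \<and> Y \<subseteq> ball ?w0 \<rho> \<longrightarrow>
     (\<exists>z\<in>Y. \<forall>\<zeta> \<tau>. \<tau> \<le> \<delta>0 \<and> flowline (XH c) 0 \<tau> \<zeta> \<and> \<zeta> ` {0..\<tau>} \<subseteq> cball ?w0 \<rho> \<and> \<zeta> 0 = z \<longrightarrow>
        \<not> (hE c (\<zeta> \<tau>) = 0 \<and> PE c (\<zeta> \<tau>) = 0) \<and> (\<tau> = s1 \<longrightarrow> hE c (\<zeta> \<tau>) \<noteq> 0))"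
    using I.graze_avoidable[OF w0] by - (elim exE conjE, rule that)
  obtain B where b: "I.box (cball ?w0 \<rho>) B" using I.box_exists[OF compact_cball convex_cball \<rho>(3)] by blast
  have B1: "B \<ge> 1" using I.boxD(2)[OF b] .
  define \<delta> where "\<delta> = min \<delta>0 (\<rho> / (4 * B))"
  have \<delta>: "\<delta> > 0" using \<rho> B1 by (simp add: \<delta>_def)
  have B\<delta>: "B * \<tau> < \<rho> / 2" if "\<tau> \<le> \<delta>" for \<tau>
  proof -
    have "B * \<tau> \<le> B * (\<rho> / (4 * B))" using that B1 by (intro mult_left_mono) (auto simp: \<delta>_def)
    also have "\<dots> = \<rho> / 4" using B1 by simp
    finally show ?thesis using \<rho> by simp
  qed
  define W where "W = {z \<in> cdom c. \<kappa> c z \<in> ball ?w0 (\<rho> / 2)}"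
  have oW: "openin (atlas_topology \<B>) W" unfolding W_def by (rule openin_chart_preimage[OF smooth_B chart_in_B[OF c(1)] open_ball])
  have "z0 \<in> W" using c \<rho> by (simp add: W_def)
  moreover have "avoids \<delta> s1 W" for s1
    unfolding avoids_def
  proof (intro allI impI)
    fix Y assume Y: "openin (atlas_topology \<B>) Y" "Y \<noteq> {}" "Y \<subseteq> W"
    let ?Y = "\<kappa> c ` (cdom c \<inter> Y)"
    have oY: "open ?Y" by (rule open_chart_image_of_openin[OF smooth_B Y(1) chart_in_B[OF c(1)]])
    have Yd: "Y \<subseteq> cdom c" using Y(3) by (auto simp: W_def)
    then have "?Y \<noteq> {}" using Y(2) by blast
    moreover have Yb: "?Y \<subseteq> ball ?w0 (\<rho> / 2)" using Y(3) by (auto simp: W_def)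
    then have "?Y \<subseteq> ball ?w0 \<rho>" using \<rho>(1) by (auto dest!: subsetD)
    ultimately have "open ?Y \<and> ?Y \<noteq> {} \<and> ?Y \<subseteq> ball ?w0 \<rho>" using oY by blast
    from mp[OF spec[OF spec[OF av]] this, of s1] have "\<exists>z\<in>?Y. \<forall>\<zeta> \<tau>. \<tau> \<le> \<delta>0 \<and> flowline (XH c) 0 \<tau> \<zeta> \<and> \<zeta> ` {0..\<tau>} \<subseteq> cball ?w0 \<rho> \<and> \<zeta> 0 = z \<longrightarrow>
        \<not> (hE c (\<zeta> \<tau>) = 0 \<and> PE c (\<zeta> \<tau>) = 0) \<and> (\<tau> = s1 \<longrightarrow> hE c (\<zeta> \<tau>) \<noteq> 0)" .
    then obtain z where z: "z \<in> cdom c" "z \<in> Y" and zav: "\<And>\<zeta> \<tau>. \<tau> \<le> \<delta>0 \<Longrightarrow> flowline (XH c) 0 \<tau> \<zeta> \<Longrightarrow> \<zeta> ` {0..\<tau>} \<subseteq> cball ?w0 \<rho> \<Longrightarrow> \<zeta> 0 = \<kappa> c z \<Longrightarrow>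
        \<not> (hE c (\<zeta> \<tau>) = 0 \<and> PE c (\<zeta> \<tau>) = 0) \<and> (\<tau> = s1 \<longrightarrow> hE c (\<zeta> \<tau>) \<noteq> 0)"
      by blast
    have near: "dist ?w0 (\<kappa> c z) < \<rho> / 2" using Y(3) z by (auto simp: W_def)
    have sub: "cball (\<kappa> c z) (\<rho> / 2) \<subseteq> cball ?w0 \<rho>"
    proof
      fix x assume "x \<in> cball (\<kappa> c z) (\<rho> / 2)"
      then show "x \<in> cball ?w0 \<rho>" using dist_triangle[of ?w0 x "\<kappa> c z"] near by auto
    qed
    show "\<exists>z\<in>Y. \<forall>\<tau> \<gamma>. traj \<tau> \<gamma> \<longrightarrow> \<gamma> 0 = z \<longrightarrow> \<tau> \<le> \<delta> \<longrightarrow> (\<forall>s\<in>{0..<\<tau>}. \<gamma> s \<notin> Guard) \<longrightarrow>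
        \<gamma> \<tau> \<notin> Graze \<and> (\<tau> = s1 \<longrightarrow> \<gamma> \<tau> \<notin> Guard)"
    proof (rule bexI[OF _ z(2)], intro allI impI)
      fix \<tau> \<gamma> assume tr: "traj \<tau> \<gamma>" and g0: "\<gamma> 0 = z" and \<tau>: "\<tau> \<le> \<delta>" and ng: "\<forall>s\<in>{0..<\<tau>}. \<gamma> s \<notin> Guard"
      have \<tau>0: "0 \<le> \<tau>" using trajD(1)[OF tr] .
      have "\<exists>\<zeta>. flowline (XH c) 0 \<tau> \<zeta> \<and> \<zeta> 0 = \<kappa> c z \<and> \<zeta> ` {0..\<tau>} \<subseteq> cball (\<kappa> c z) (\<rho> / 2) \<and> \<gamma> \<tau> \<in> cdom c \<and> \<zeta> \<tau> = \<kappa> c (\<gamma> \<tau>)"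
      proof (cases "\<tau> = 0")
        case True
        then show ?thesis using z g0 \<rho>(1) by (intro exI[of _ "\<lambda>_. \<kappa> c z"]) (auto simp: flowline_def)
      next
        case False
        then have \<tau>p: "0 < \<tau>" using \<tau>0 by simp
        have "\<gamma> 0 \<notin> Guard" using ng \<tau>p by simp
        then have p0: "post \<gamma> 0 = z" using g0 by (simp add: post_def)
        have "\<exists>\<zeta>. flowline (XH c) 0 \<tau> \<zeta> \<and> \<zeta> 0 = \<kappa> c z \<and> \<zeta> ` {0..\<tau>} \<subseteq> cball (\<kappa> c z) (\<rho> / 2) \<and> (\<forall>s\<in>{0<..\<tau>}. \<gamma> s \<in> cdom c \<and> \<zeta> s = \<kappa> c (\<gamma> s))"
        proof (rule confine[OF tr c(1) order_refl \<tau>0 order_refl])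
          show "\<gamma> s \<notin> Guard" if "0 < s" "s < \<tau>" for s using ng that by simp
          show "post \<gamma> 0 \<in> cdom c" "\<kappa> c z = \<kappa> c (post \<gamma> 0)" using p0 z by auto
          show "cball (\<kappa> c z) (\<rho> / 2) \<subseteq> \<Omega> c" using sub \<rho>(3) by blast
          show "norm (XH c x) \<le> B" if "x \<in> cball (\<kappa> c z) (\<rho> / 2)" for x using I.boxD(4)[OF b] sub that by blast
          show "B * (\<tau> - 0) < \<rho> / 2" using B\<delta>[OF \<tau>] by simp
        qed (use \<rho> in auto)
        then show ?thesis using \<tau>p by auto
      qed
      then obtain \<zeta> where \<zeta>: "flowline (XH c) 0 \<tau> \<zeta>" "\<zeta> 0 = \<kappa> c z" "\<zeta> ` {0..\<tau>} \<subseteq> cball (\<kappa> c z) (\<rho> / 2)" "\<gamma> \<tau> \<in> cdom c" "\<zeta> \<tau> = \<kappa> c (\<gamma> \<tau>)"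
        by blast
      have "\<not> (hE c (\<zeta> \<tau>) = 0 \<and> PE c (\<zeta> \<tau>) = 0) \<and> (\<tau> = s1 \<longrightarrow> hE c (\<zeta> \<tau>) \<noteq> 0)"
        by (rule zav[OF _ \<zeta>(1) order_trans[OF \<zeta>(3) sub] \<zeta>(2)]) (use \<tau> in \<open>simp add: \<delta>_def\<close>)
      then show "\<gamma> \<tau> \<notin> Graze \<and> (\<tau> = s1 \<longrightarrow> \<gamma> \<tau> \<notin> Guard)"
        unfolding Graze_chart[OF c(1) \<zeta>(4)] Guard_chart[OF c(1) \<zeta>(4)] \<zeta>(5) by blast
    qed
  qed
  ultimately show ?thesis using \<delta> oW by blast
qed

text \<open>The state from which the motion continues has \<open>h \<noteq> 0\<close> or
  \<open>P > 0\<close>, because a reset makes \<open>P\<close> positive; both conditions are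
  open.\<close>

lemma clear_right:
  assumes tr: "traj t \<gamma>" and \<sigma>: "0 \<le> \<sigma>" "\<sigma> < t" "\<gamma> \<sigma> \<notin> Graze"
  shows "\<exists>u>\<sigma>. \<forall>s. \<sigma> < s \<longrightarrow> s < u \<longrightarrow> \<gamma> s \<notin> Graze \<and> \<gamma> s \<notin> Guard"
proof -
  have "\<gamma> \<sigma> \<in> points \<B>" using trajD(2)[OF tr, of \<sigma>] \<sigma> by simp
  then obtain c where c: "c \<in> A" "\<gamma> \<sigma> \<in> cdom c" using dom_exists by blast
  note \<kappa>c = \<kappa>_in_\<Omega>[OF c]
  have p: "post \<gamma> \<sigma> \<in> cdom c \<and> (hE c (\<kappa> c (post \<gamma> \<sigma>)) \<noteq> 0 \<or> PE c (\<kappa> c (post \<gamma> \<sigma>)) > 0)"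
  proof (cases "\<gamma> \<sigma> \<in> Guard")
    case True
    then show ?thesis
      using impact_map_in_chart[OF c] RE_props(4)[OF c(1) \<kappa>c] Guard_chart[OF c] by (simp add: post_def)
  next
    case False
    then show ?thesis using Guard_chart[OF c] Graze_chart[OF c] \<sigma>(3) c(2) by (auto simp: post_def)
  qed
  let ?Y = "(\<Omega> c \<inter> hE c -` (- {0})) \<union> (\<Omega> c \<inter> PE c -` {0<..})"
  have oY: "open ?Y"
    by (intro open_Un continuous_open_preimage open_\<Omega>[OF c(1)] Ck_on_continuous[OF Ck_hE[OF c(1)]] Ck_on_continuous[OF Ck_PE[OF c(1)]]) auto
  have mY: "\<kappa> c (post \<gamma> \<sigma>) \<in> ?Y" using p \<kappa>_in_\<Omega>[OF c(1), of "post \<gamma> \<sigma>"] by auto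
  have "limitin (atlas_topology \<B>) \<gamma> (post \<gamma> \<sigma>) (at_right \<sigma>)"
    using trajD(5)[OF tr \<sigma>(1,2)] unfolding post_def .
  note L = limitin_chartD[OF smooth_B this chart_in_B[OF c(1)] conjunct1[OF p]]
  have "\<forall>\<^sub>F s in at_right \<sigma>. \<kappa> c (\<gamma> s) \<in> ?Y" by (rule topological_tendstoD[OF L(2) oY mY])
  then have "\<forall>\<^sub>F s in at_right \<sigma>. \<gamma> s \<notin> Graze \<and> \<gamma> s \<notin> Guard"
    using L(1)
  proof eventually_elim
    case (elim s)
    then show ?case using Graze_chart[OF c(1) elim(2)] Guard_chart[OF c(1) elim(2)] by auto
  qed
  then show ?thesis unfolding eventually_at_right_field by blast
qed

section \<open>Baire category argument on a chart of initial states\<close>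

context
  fixes t :: real and c0 :: "('q, real^'n) chart" and D :: "((real^'n) \<times> (real^'n)) set"
    and tr :: "(real^'n) \<times> (real^'n) \<Rightarrow> real \<Rightarrow> ('q, real^'n) phase"
  assumes c0: "c0 \<in> A" and D: "open D"
    and tr: "\<And>y. y \<in> D \<Longrightarrow> traj t (tr y)" "\<And>y. y \<in> D \<Longrightarrow> tr y 0 \<in> cdom c0" "\<And>y. y \<in> D \<Longrightarrow> \<kappa> c0 (tr y 0) = y"
    and hD: "\<And>y. y \<in> D \<Longrightarrow> hE c0 y \<noteq> 0"
begin

text \<open>\<open>tr y\<close> is one chosen trajectory from \<open>y\<close>; by
  \<open>stable\<close> the state at time \<open>q\<close> does not depend on the choice when
  \<open>NG y q\<close> holds. The guard is excluded at time \<open>q\<close> because there the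
  state is pre-impact, while neighbours may already have been reset.\<close>

definition NG :: "(real^'n) \<times> (real^'n) \<Rightarrow> real \<Rightarrow> bool" where
  "NG y q \<longleftrightarrow> (\<forall>r\<in>{0..q}. tr y r \<notin> Graze) \<and> tr y q \<notin> Guard"

text \<open>Repackages \<open>good_nongrazing\<close> on a ball of initial states. Uniqueness of the
  state at time \<open>q\<close> is the Lipschitz bound for two trajectories with the same
  start.\<close>

lemma stable:
  assumes y: "y \<in> D" and q: "q \<in> {0..t}" and ng: "NG y q"
  shows "\<exists>c e C. c \<in> A \<and> e > 0 \<and> ball y e \<subseteq> D \<and>
    (\<forall>y'\<in>ball y e. NG y' q \<and> tr y' q \<in> cdom c \<and> card {r\<in>{0..q}. tr y' r \<in> Guard} = card {r\<in>{0..q}. tr y r \<in> Guard}) \<and>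
    (\<forall>y'\<in>ball y e. \<forall>\<gamma>. traj t \<gamma> \<longrightarrow> \<gamma> 0 = tr y' 0 \<longrightarrow> \<gamma> q = tr y' q) \<and>
    (\<forall>y'\<in>ball y e. \<forall>y''\<in>ball y e. est c0 c C q (tr y') (tr y''))"
proof -
  have h0: "h (fst (tr y 0)) \<noteq> 0" using hD[OF y] guard_in_chart(2)[OF c0 tr(2)[OF y]] tr(3)[OF y] by simp
  obtain c where c: "c \<in> A" "good_in c0 c t (tr y) q"
    using good_nongrazing[OF c0 tr(1)[OF y] tr(2)[OF y] h0 q] ng unfolding NG_def by blast
  obtain d C N where d: "d > 0" and good: "\<forall>\<gamma> \<gamma>'. starts_near c0 t (tr y) d \<gamma> \<longrightarrow> starts_near c0 t (tr y) d \<gamma>' \<longrightarrow>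
     \<gamma> q \<in> cdom c \<and> \<gamma> q \<notin> Guard \<and> (\<forall>r\<in>{0..q}. \<gamma> r \<notin> Graze) \<and> card {r\<in>{0..q}. \<gamma> r \<in> Guard} = N \<and> est c0 c C q \<gamma> \<gamma>'"
    using c(2) unfolding good_in_def by blast
  note good = good[rule_format]
  obtain r where r: "r > 0" "ball y r \<subseteq> D" using D y openE by blast
  define e where "e = min d r"
  have e: "e > 0" "ball y e \<subseteq> D" using d r by (auto simp: e_def)
  have sn: "starts_near c0 t (tr y) d (tr y')" if "y' \<in> ball y e" for y'
  proof -
    have "y' \<in> D" using e that by blast
    then show ?thesis using tr(1,2)[of y'] tr(3)[of y'] tr(3)[OF y] that by (simp add: starts_near_def e_def)
  qed
  have yy: "y \<in> ball y e" using e by simp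
  have uq: "\<gamma> q = tr y' q" if y': "y' \<in> ball y e" and \<gamma>: "traj t \<gamma>" "\<gamma> 0 = tr y' 0" for y' \<gamma>
  proof -
    have n: "starts_near c0 t (tr y) d \<gamma>" using sn[OF y'] \<gamma> by (simp add: starts_near_def)
    have "norm (\<kappa> c (\<gamma> q) - \<kappa> c (tr y' q)) \<le> C * norm (\<kappa> c0 (\<gamma> 0) - \<kappa> c0 (tr y' 0))"
      using good[OF sn[OF y'] n] unfolding est_def by blast
    then have "\<kappa> c (\<gamma> q) = \<kappa> c (tr y' q)" using \<gamma>(2) by simp
    then show ?thesis using \<kappa>_inj[OF c(1)] good[OF n n] good[OF sn[OF y'] n] by blast
  qed
  show ?thesis
  proof (intro exI conjI ballI allI impI)
    show "c \<in> A" "e > 0" "ball y e \<subseteq> D" using c e by auto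
    fix y' assume y': "y' \<in> ball y e"
    note g = good[OF sn[OF y'] sn[OF yy]]
    show "NG y' q" "tr y' q \<in> cdom c" using g unfolding NG_def by blast+
    show "card {r\<in>{0..q}. tr y' r \<in> Guard} = card {r\<in>{0..q}. tr y r \<in> Guard}"
      using g good[OF sn[OF yy] sn[OF yy]] by simp
    show "\<gamma> q = tr y' q" if "traj t \<gamma>" "\<gamma> 0 = tr y' 0" for \<gamma> using uq[OF y' that] .
    show "est c0 c C q (tr y') (tr y'')" if "y'' \<in> ball y e" for y'' using good[OF sn[OF y'] sn[OF that]] by blast
  qed
qed

lemma stable_NG:
  assumes y: "y \<in> D" and q: "q \<in> {0..t}" and ng: "NG y q"
  shows "\<exists>e>0. ball y e \<subseteq> D \<and> (\<forall>x\<in>ball y e. NG x q \<and> card {r\<in>{0..q}. tr x r \<in> Guard} = card {r\<in>{0..q}. tr y r \<in> Guard})"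
proof -
  obtain c e C where e: "e > 0" "ball y e \<subseteq> D" and
    st: "\<forall>y'\<in>ball y e. NG y' q \<and> tr y' q \<in> cdom c \<and> card {r\<in>{0..q}. tr y' r \<in> Guard} = card {r\<in>{0..q}. tr y r \<in> Guard}"
    using stable[OF y q ng] by - (elim exE conjE, rule that)
  show ?thesis
  proof (rule exI[of _ e], intro conjI e ballI)
    fix x assume "x \<in> ball y e"
    note n = bspec[OF st this]
    show "NG x q" by (rule conjunct1[OF n])
    show "card {r\<in>{0..q}. tr x r \<in> Guard} = card {r\<in>{0..q}. tr y r \<in> Guard}" by (rule conjunct2[OF conjunct2[OF n]])
  qed
qed

text \<open>Failures within \<open>\<delta>\<close> after the time \<open>q\<close>. Countably many pairs \<open>(q, \<delta>)\<close> account for all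
  initial states that fail before \<open>t\<close>, so that the Baire category theorem applies.\<close>

definition bad_set :: "real \<Rightarrow> real \<Rightarrow> ((real^'n) \<times> (real^'n)) set" where
  "bad_set q \<delta> = {y \<in> D. NG y q \<and> (\<exists>W. openin (atlas_topology \<B>) W \<and> tr y q \<in> W \<and> avoids \<delta> (t - q) W) \<and>
     (\<exists>s. q \<le> s \<and> s \<le> t \<and> s \<le> q + \<delta> \<and> (\<forall>r\<in>{q..<s}. tr y r \<notin> Guard) \<and> (tr y s \<in> Graze \<or> s = t \<and> tr y s \<in> Guard))}"

text \<open>Near \<open>y\<close> the map \<phi> to the coordinates at time \<open>q\<close> is
  continuous and injective, hence open by invariance of domain. So \<open>avoids\<close>, applied at
  time \<open>q\<close>, yields an initial state \<open>y'\<close> near \<open>y\<close> that does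
  not fail within \<delta> after \<open>q\<close>, and stability excludes failure on a whole
  neighbourhood of \<open>y'\<close>.\<close>

lemma bad_set_nowhere_dense:
  assumes q: "0 \<le> q" "q \<le> t" and \<delta>: "\<delta> > 0" and Y: "open Y" "Y \<noteq> {}"
  shows "\<exists>Y'. open Y' \<and> Y' \<noteq> {} \<and> Y' \<subseteq> Y \<and> Y' \<inter> bad_set q \<delta> = {}"
proof (cases "Y \<inter> bad_set q \<delta> = {}")
  case True
  then show ?thesis using Y by blast
next
  case False
  then obtain y where y: "y \<in> Y" "y \<in> bad_set q \<delta>" by blast
  then have yD: "y \<in> D" and ngy: "NG y q" unfolding bad_set_def by auto
  obtain W where W: "openin (atlas_topology \<B>) W" "tr y q \<in> W" "avoids \<delta> (t - q) W" using y(2) unfolding bad_set_def by auto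
  have qt: "q \<in> {0..t}" using q by simp
  obtain c e C where c: "c \<in> A" and e: "e > 0" "ball y e \<subseteq> D" and
    st: "\<forall>y'\<in>ball y e. NG y' q \<and> tr y' q \<in> cdom c \<and> card {r\<in>{0..q}. tr y' r \<in> Guard} = card {r\<in>{0..q}. tr y r \<in> Guard}" and
    es: "\<forall>y'\<in>ball y e. \<forall>y''\<in>ball y e. est c0 c C q (tr y') (tr y'')"
    using stable[OF yD qt ngy] by - (elim exE conjE, rule that)
  note st = bspec[OF st] and es = bspec[OF bspec[OF es]]
  define \<phi> where "\<phi> y' = \<kappa> c (tr y' q)" for y'
  have lip: "norm (\<phi> y'' - \<phi> y') \<le> C * norm (y'' - y')" and inj: "\<phi> y'' = \<phi> y' \<Longrightarrow> y'' = y'"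
    if "y' \<in> ball y e" "y'' \<in> ball y e" for y' y''
  proof -
    have k: "\<kappa> c0 (tr y' 0) = y'" "\<kappa> c0 (tr y'' 0) = y''" using tr(3) that e(2) by blast+
    note E = es[OF that, unfolded est_def k]
    show "norm (\<phi> y'' - \<phi> y') \<le> C * norm (y'' - y')" unfolding \<phi>_def by (rule conjunct1[OF E])
    show "y'' = y'" if "\<phi> y'' = \<phi> y'" using mp[OF conjunct1[OF conjunct2[OF E]]] that unfolding \<phi>_def .
  qed
  have cont: "continuous_on (ball y e) \<phi>"
  proof (rule continuous_onI)
    fix x \<epsilon> :: real and x0 assume x0: "x0 \<in> ball y e" and ep: "\<epsilon> > 0"
    have "dist (\<phi> x') (\<phi> x0) \<le> \<epsilon>" if x': "x' \<in> ball y e" "dist x' x0 < \<epsilon> / (\<bar>C\<bar> + 1)" for x'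
    proof -
      have "norm (\<phi> x' - \<phi> x0) \<le> C * norm (x' - x0)" by (rule lip[OF x0 x'(1)])
      also have "\<dots> \<le> (\<bar>C\<bar> + 1) * norm (x' - x0)" by (intro mult_right_mono) auto
      also have "\<dots> \<le> \<epsilon>" using x'(2) by (simp add: dist_norm field_simps)
      finally show ?thesis by (simp add: dist_norm)
    qed
    then show "\<exists>d>0. \<forall>x'\<in>ball y e. dist x' x0 < d \<longrightarrow> dist (\<phi> x') (\<phi> x0) \<le> \<epsilon>"
      using ep by (intro exI[of _ "\<epsilon> / (\<bar>C\<bar> + 1)"]) auto
  qed
  let ?W = "\<kappa> c ` (cdom c \<inter> W)"
  have oW: "open ?W" by (rule open_chart_image_of_openin[OF smooth_B W(1) chart_in_B[OF c]])
  define U where "U = Y \<inter> (ball y e \<inter> \<phi> -` ?W)"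
  have oU: "open U" unfolding U_def by (intro open_Int Y(1) continuous_open_preimage[OF cont open_ball oW])
  have Ub: "U \<subseteq> ball y e" unfolding U_def by blast
  have yU: "y \<in> U" using y(1) e(1) st[of y] W(2) unfolding U_def \<phi>_def by auto
  have o\<phi>: "open (\<phi> ` U)"
    by (rule invariance_of_domain[OF continuous_on_subset[OF cont Ub] oU inj_onI]) (rule inj, use Ub in blast, use Ub in blast, assumption) 
  define Z where "Z = {z \<in> cdom c. \<kappa> c z \<in> \<phi> ` U}"
  have oZ: "openin (atlas_topology \<B>) Z" unfolding Z_def by (rule openin_chart_preimage[OF smooth_B chart_in_B[OF c] o\<phi>])
  have "tr y q \<in> Z" using st[of y] e(1) yU unfolding Z_def \<phi>_def by auto
  then have Zn: "Z \<noteq> {}" by blast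
  have ZW: "Z \<subseteq> W"
  proof
    fix z assume z: "z \<in> Z"
    then obtain y' where "y' \<in> U" "\<kappa> c z = \<phi> y'" unfolding Z_def by blast
    then obtain x where "x \<in> cdom c" "x \<in> W" "\<kappa> c z = \<kappa> c x" unfolding U_def by auto
    then show "z \<in> W" using \<kappa>_inj[OF c, of z x] z unfolding Z_def by auto
  qed
  from mp[OF mp[OF mp[OF spec[OF W(3)[unfolded avoids_def]] oZ] Zn] ZW]
  obtain z where z: "z \<in> Z" and zav: "\<forall>\<tau> \<gamma>. traj \<tau> \<gamma> \<longrightarrow> \<gamma> 0 = z \<longrightarrow> \<tau> \<le> \<delta> \<longrightarrow> (\<forall>s\<in>{0..<\<tau>}. \<gamma> s \<notin> Guard) \<longrightarrow>
        \<gamma> \<tau> \<notin> Graze \<and> (\<tau> = t - q \<longrightarrow> \<gamma> \<tau> \<notin> Guard)" by (elim bexE)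
  note zav = zav[rule_format]
  obtain y' where y': "y' \<in> U" "\<kappa> c z = \<phi> y'" using z unfolding Z_def by blast
  have y'b: "y' \<in> ball y e" using y' Ub by blast
  have y'D: "y' \<in> D" using y'b e(2) by blast
  have zq: "z = tr y' q" using \<kappa>_inj[OF c, of z "tr y' q"] z y' st[OF y'b] unfolding Z_def \<phi>_def by auto
  have clear: "tr y' s \<notin> Graze \<and> (s = t \<longrightarrow> tr y' s \<notin> Guard)"
    if s: "q \<le> s" "s \<le> t" "s \<le> q + \<delta>" and ng: "\<forall>r\<in>{q..<s}. tr y' r \<notin> Guard" for s
  proof -
    have T: "traj (s - q) (\<lambda>x. tr y' (q + x))" by (rule hybrid_trajectory_shift[OF tr(1)[OF y'D] q(1)]) (use s in auto)
    have "tr y' (q + (s - q)) \<notin> Graze \<and> (s - q = t - q \<longrightarrow> tr y' (q + (s - q)) \<notin> Guard)"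
      by (rule zav[OF T]) (use s ng zq in auto)
    then show ?thesis by simp
  qed
  have ngy': "NG y' q" using st[OF y'b] by blast
  define m where "m = min t (q + \<delta>)"
  have m: "q \<le> m" "m \<le> t" "m \<le> q + \<delta>" using q \<delta> by (auto simp: m_def)
  \<comment> \<open>Without an impact up to \<open>m\<close>, stability at \<open>m\<close> covers
    the whole stretch. Otherwise stability is used at a time \<open>b\<close> shortly after the
    first impact, which suffices because \<open>bad_set\<close> speaks only of failures up to the
    next impact.\<close>
  have "\<exists>e'>0. ball y' e' \<subseteq> D \<and> ball y' e' \<inter> U \<inter> bad_set q \<delta> = {}"
  proof (cases "\<exists>s\<in>{q..m}. tr y' s \<in> Guard")
    case False
    have "NG y' m"
      unfolding NG_def
    proof (intro conjI ballI)
      fix r assume r: "r \<in> {0..m}"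
      show "tr y' r \<notin> Graze"
      proof (cases "r \<le> q")
        case True
        then show ?thesis using ngy' r unfolding NG_def by auto
      next
        case False': False
        then show ?thesis using clear[of r] r m False by auto
      qed
    qed (use False m in auto)
    moreover have "m \<in> {0..t}" using m q by simp
    ultimately obtain e' where e': "e' > 0" "ball y' e' \<subseteq> D"
      "\<forall>x\<in>ball y' e'. NG x m \<and> card {r\<in>{0..m}. tr x r \<in> Guard} = card {r\<in>{0..m}. tr y' r \<in> Guard}"
      using stable_NG[OF y'D, of m] by blast
    have "x \<notin> bad_set q \<delta>" if x: "x \<in> ball y' e'" for x
    proof
      assume "x \<in> bad_set q \<delta>"
      then obtain s where s: "q \<le> s" "s \<le> t" "s \<le> q + \<delta>" "tr x s \<in> Graze \<or> s = t \<and> tr x s \<in> Guard" unfolding bad_set_def by blast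
      have "s \<in> {0..m}" using s q by (simp add: m_def)
      moreover have "s = t \<Longrightarrow> s = m" using s by (simp add: m_def)
      ultimately show False using bspec[OF e'(3) x] s(4) unfolding NG_def by auto
    qed
    then show ?thesis using e' by blast
  next
    case True
    then obtain s1 where s1: "s1 \<in> {q..m}" "tr y' s1 \<in> Guard" by blast
    obtain r1 where r1: "r1 \<in> {q..m}" "tr y' r1 \<in> Guard" "\<forall>s\<in>{q..<r1}. tr y' s \<notin> Guard"
      using first_impact[OF tr(1)[OF y'D] q(1) m(2) s1] by blast
    have r1q: "q < r1" using r1(1,2) ngy' unfolding NG_def by (cases "q = r1") auto
    have cl: "tr y' r1 \<notin> Graze \<and> (r1 = t \<longrightarrow> tr y' r1 \<notin> Guard)" by (rule clear[OF _ _ _ r1(3)]) (use r1(1) m in auto)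
    then have r1t: "r1 < t" using r1(1,2) m by (cases "r1 = t") auto
    obtain u where u: "u > r1" "\<And>s. r1 < s \<Longrightarrow> s < u \<Longrightarrow> tr y' s \<notin> Graze \<and> tr y' s \<notin> Guard"
      using clear_right[OF tr(1)[OF y'D] _ r1t] cl r1q q(1) by auto
    define b where "b = min ((r1 + t) / 2) ((r1 + u) / 2)"
    have b: "r1 < b" "b < t" "b < u" using r1t u(1) by (auto simp: b_def min_def)
    have "NG y' b"
      unfolding NG_def
    proof (intro conjI ballI)
      fix r assume r: "r \<in> {0..b}"
      consider "r \<le> q" | "q < r" "r \<le> r1" | "r1 < r" by linarith
      then show "tr y' r \<notin> Graze"
      proof cases
        case 1
        then show ?thesis using ngy' r unfolding NG_def by auto
      next
        case 2
        then show ?thesis using clear[of r] r1 m by auto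
      next
        case 3
        then show ?thesis using u(2)[of r] r b by auto
      qed
    qed (use u(2)[of b] b in auto)
    moreover have "b \<in> {0..t}" using b r1q q by auto
    ultimately obtain e' where e': "e' > 0" "ball y' e' \<subseteq> D"
      "\<forall>x\<in>ball y' e'. NG x b \<and> card {r\<in>{0..b}. tr x r \<in> Guard} = card {r\<in>{0..b}. tr y' r \<in> Guard}"
      using stable_NG[OF y'D, of b] by blast
    have fin: "finite {r\<in>{0..b}. tr y' r \<in> Guard}"
      by (rule finite_subset[OF _ trajD(3)[OF tr(1)[OF y'D]]]) (use b in auto)
    have "{r\<in>{0..q}. tr y' r \<in> Guard} \<subset> {r\<in>{0..b}. tr y' r \<in> Guard}"
    proof (rule psubsetI)
      show "{r\<in>{0..q}. tr y' r \<in> Guard} \<subseteq> {r\<in>{0..b}. tr y' r \<in> Guard}" using r1q b by auto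
      have "r1 \<in> {r\<in>{0..b}. tr y' r \<in> Guard}" "r1 \<notin> {r\<in>{0..q}. tr y' r \<in> Guard}" using r1(2) r1q b q by auto
      then show "{r\<in>{0..q}. tr y' r \<in> Guard} \<noteq> {r\<in>{0..b}. tr y' r \<in> Guard}" by blast
    qed
    \<comment> \<open>\<open>y'\<close> has more impacts by time \<open>b\<close> than by time
      \<open>q\<close>, and both numbers are locally constant. Hence a neighbour also hits between
      \<open>q\<close> and \<open>b\<close>; a failure would come no later than this hit, where
      \<open>NG\<close> at time \<open>b\<close> rules it out.\<close>
    then have cd: "card {r\<in>{0..q}. tr y' r \<in> Guard} < card {r\<in>{0..b}. tr y' r \<in> Guard}" by (rule psubset_card_mono[OF fin])
    have "x \<notin> bad_set q \<delta>" if x: "x \<in> ball y' e'" "x \<in> U" for x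
    proof
      assume "x \<in> bad_set q \<delta>"
      then obtain s where s: "q \<le> s" "s \<le> t" "\<forall>r\<in>{q..<s}. tr x r \<notin> Guard" "tr x s \<in> Graze \<or> s = t \<and> tr x s \<in> Guard" unfolding bad_set_def by blast
      have "x \<in> ball y e" using x Ub by blast
      then have "card {r\<in>{0..q}. tr x r \<in> Guard} = card {r\<in>{0..q}. tr y' r \<in> Guard}" using st[of x] st[OF y'b] by simp
      then have "{r\<in>{0..b}. tr x r \<in> Guard} \<noteq> {r\<in>{0..q}. tr x r \<in> Guard}" using cd bspec[OF e'(3) x(1)] by auto
      moreover have "{r\<in>{0..b}. tr x r \<in> Guard} = {r\<in>{0..q}. tr x r \<in> Guard}"
        if none: "\<And>r. q < r \<Longrightarrow> r \<le> b \<Longrightarrow> tr x r \<notin> Guard"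
      proof (intro set_eqI iffI)
        fix r assume r: "r \<in> {r\<in>{0..b}. tr x r \<in> Guard}"
        then have "\<not> q < r" using none[of r] by auto
        then show "r \<in> {r\<in>{0..q}. tr x r \<in> Guard}" using r by auto
      qed (use b r1q in auto)
      ultimately obtain r where r: "q < r" "r \<le> b" "tr x r \<in> Guard" by blast
      then have "s \<le> r" using s(3) by force
      then have "s \<in> {0..b}" "s \<noteq> t" using s(1) r b q by auto
      then show False using s(4) bspec[OF e'(3) x(1)] unfolding NG_def by blast
    qed
    then show ?thesis using e' by blast
  qed
  then obtain e' where e': "e' > 0" "ball y' e' \<inter> U \<inter> bad_set q \<delta> = {}" by blast
  show ?thesis
  proof (intro exI conjI)
    show "open (ball y' e' \<inter> U)" using oU by blast
    show "ball y' e' \<inter> U \<noteq> {}" using e'(1) y'(1) by (metis IntI centre_in_ball empty_iff)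
    show "ball y' e' \<inter> U \<subseteq> Y" unfolding U_def by blast
    show "ball y' e' \<inter> U \<inter> bad_set q \<delta> = {}" by (rule e'(2))
  qed
qed

text \<open>Take the first failure \<sigma> and a rational \<open>q\<close> shortly before it: after
  all earlier impacts, closer than \<open>1 / (j + 1)\<close>, and with the state already in the
  neighbourhood provided by \<open>avoids_exists\<close> at \<sigma>.\<close>

lemma bad_set_cover:
  assumes y: "y \<in> D" and bad: "\<not> NG y t"
  shows "\<exists>(q::rat) (j::nat). 0 \<le> real_of_rat q \<and> real_of_rat q \<le> t \<and> y \<in> bad_set (real_of_rat q) (1 / (real j + 1))"
proof -
  note T = tr(1)[OF y]
  have t0: "0 \<le> t" using trajD(1)[OF T] .
  have h0: "hE c0 (\<kappa> c0 (tr y 0)) \<noteq> 0" using hD[OF y] tr(3)[OF y] by simp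
  then have n0: "tr y 0 \<notin> Graze" "tr y 0 \<notin> Guard" using Graze_chart[OF c0 tr(2)[OF y]] Guard_chart[OF c0 tr(2)[OF y]] by auto
  have "\<exists>\<sigma>. 0 < \<sigma> \<and> \<sigma> \<le> t \<and> (tr y \<sigma> \<in> Graze \<or> \<sigma> = t \<and> tr y \<sigma> \<in> Guard) \<and> (\<forall>s\<in>{0..<\<sigma>}. tr y s \<notin> Graze)"
  proof (cases "\<exists>s\<in>{0..t}. tr y s \<in> Graze")
    case True
    define G where "G = {s\<in>{0..t}. tr y s \<in> Graze}"
    have ne: "G \<noteq> {}" using True by (auto simp: G_def)
    have bdd: "bdd_below G" unfolding G_def by auto
    define \<sigma> where "\<sigma> = Inf G"
    have lower: "\<sigma> \<le> s" if "s \<in> G" for s unfolding \<sigma>_def by (rule cInf_lower[OF that bdd])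
    have \<sigma>0: "0 \<le> \<sigma>" unfolding \<sigma>_def by (rule cInf_greatest[OF ne]) (auto simp: G_def)
    have \<sigma>t: "\<sigma> \<le> t" using ne lower by (force simp: G_def)
    \<comment> \<open>The infimum of the grazing times is attained, since by
      \<open>clear_right\<close> no graze follows immediately on a non-grazing time.\<close>
    have "tr y \<sigma> \<in> Graze"
    proof (rule ccontr)
      assume ng: "tr y \<sigma> \<notin> Graze"
      have "\<sigma> < t"
      proof (rule ccontr)
        assume "\<not> \<sigma> < t"
        then have "s = \<sigma>" if "s \<in> G" for s using lower[OF that] that \<sigma>t by (auto simp: G_def)
        then show False using ne ng by (auto simp: G_def)
      qed
      then obtain u where u: "u > \<sigma>" "\<And>s. \<sigma> < s \<Longrightarrow> s < u \<Longrightarrow> tr y s \<notin> Graze" using clear_right[OF T \<sigma>0 _ ng] by blast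
      obtain s where s: "s \<in> G" "s < u" using u(1) ne bdd cInf_less_iff[OF ne bdd] unfolding \<sigma>_def by blast
      then have "s \<noteq> \<sigma>" using ng by (auto simp: G_def)
      then have "\<sigma> < s" using lower[OF s(1)] by simp
      then show False using u(2)[of s] s by (auto simp: G_def)
    qed
    moreover have "tr y s \<notin> Graze" if "s \<in> {0..<\<sigma>}" for s using lower[of s] that \<sigma>t by (auto simp: G_def)
    moreover have "\<sigma> \<noteq> 0" using calculation(1) n0 by auto
    ultimately show ?thesis using \<sigma>0 \<sigma>t by (intro exI[of _ \<sigma>]) auto
  next
    case False
    then have "tr y t \<in> Guard" using bad unfolding NG_def by blast
    moreover have "t \<noteq> 0" using calculation n0 by auto
    ultimately show ?thesis using False t0 by (intro exI[of _ t]) auto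
  qed
  then obtain \<sigma> where \<sigma>: "0 < \<sigma>" "\<sigma> \<le> t" "tr y \<sigma> \<in> Graze \<or> \<sigma> = t \<and> tr y \<sigma> \<in> Guard" "\<forall>s\<in>{0..<\<sigma>}. tr y s \<notin> Graze" by blast
  have zp: "tr y \<sigma> \<in> points \<B>" using trajD(2)[OF T] \<sigma> by simp
  have "h (fst (tr y \<sigma>)) = 0"
    using \<sigma>(3) by (cases "tr y \<sigma>") (auto simp: Graze_def impact_guard_def)
  from avoids_exists[OF zp this] obtain \<delta> W where \<delta>: "\<delta> > 0" and W: "openin (atlas_topology \<B>) W" "tr y \<sigma> \<in> W" "\<And>s1. avoids \<delta> s1 W" by blast
  obtain j :: nat where j: "1 / (real j + 1) < \<delta>" using reals_Archimedean[OF \<delta>] by (auto simp: inverse_eq_divide add.commute)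
  have av: "avoids (1 / (real j + 1)) s1 W" for s1
    by (rule avoids_mono[OF W(3) less_imp_le[OF j]])
  have "limitin (atlas_topology \<B>) (tr y) (tr y \<sigma>) (at_left \<sigma>)" using trajD(4)[OF T \<sigma>(1,2)] .
  then have "\<forall>\<^sub>F s in at_left \<sigma>. tr y s \<in> W" using W unfolding limitin_def by blast
  then obtain a1 where a1: "a1 < \<sigma>" "\<And>s. a1 < s \<Longrightarrow> s < \<sigma> \<Longrightarrow> tr y s \<in> W" unfolding eventually_at_left_field by blast
  let ?F = "{s\<in>{0..t}. tr y s \<in> Guard} \<inter> {..<\<sigma>}"
  have fin: "finite ?F" using trajD(3)[OF T] by blast
  define a0 where "a0 = Max (insert 0 (insert a1 (insert (\<sigma> - 1 / (real j + 1)) ?F)))"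
  have a0: "a0 < \<sigma>" "0 \<le> a0" "a1 \<le> a0" "\<sigma> - 1 / (real j + 1) \<le> a0"
    using fin a1(1) \<sigma>(1) unfolding a0_def by (auto simp del: Max_insert simp: Max_less_iff intro!: Max_ge)
  have ng: "tr y s \<notin> Guard" if "a0 < s" "s < \<sigma>" for s
  proof
    assume "tr y s \<in> Guard"
    then have "s \<le> a0" unfolding a0_def using fin that a0(2) \<sigma>(2) by (intro Max_ge) auto
    then show False using that by simp
  qed
  obtain q where q: "a0 < real_of_rat q" "real_of_rat q < \<sigma>" using of_rat_dense[OF a0(1)] by blast
  have "y \<in> bad_set (real_of_rat q) (1 / (real j + 1))"
    unfolding bad_set_def
  proof (intro CollectI conjI)
    show "y \<in> D" by (rule y)
    show "NG y (real_of_rat q)" unfolding NG_def using \<sigma>(4) ng[OF q] q by auto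
    show "\<exists>W. openin (atlas_topology \<B>) W \<and> tr y (real_of_rat q) \<in> W \<and> avoids (1 / (real j + 1)) (t - real_of_rat q) W"
      using W(1) a1(2)[of "real_of_rat q"] q a0 av by (intro exI[of _ W]) auto
    show "\<exists>s. real_of_rat q \<le> s \<and> s \<le> t \<and> s \<le> real_of_rat q + 1 / (real j + 1) \<and> (\<forall>r\<in>{real_of_rat q..<s}. tr y r \<notin> Guard) \<and> (tr y s \<in> Graze \<or> s = t \<and> tr y s \<in> Guard)"
      by (rule exI[of _ \<sigma>]) (use q a0 \<sigma> ng in auto)
  qed
  moreover have "0 \<le> real_of_rat q" "real_of_rat q \<le> t" using q a0(2) \<sigma>(2) by linarith+
  ultimately show ?thesis by blast
qed

text \<open>The closures of countably many bad sets have empty interior, so by Baire's theorem some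
  state of the open set \<open>D\<close> lies outside all of them.\<close>

lemma nongrazing_dense:
  assumes "D \<noteq> {}"
  shows "\<exists>y\<in>D. NG y t"
proof (rule ccontr)
  assume none: "\<not> ?thesis"
  define I :: "(rat \<times> nat) set" where "I = {(q, j). 0 \<le> real_of_rat q \<and> real_of_rat q \<le> t}"
  define F where "F = (\<lambda>(q, j). - closure (bad_set (real_of_rat q) (1 / (real j + 1)))) ` I"
  have "UNIV \<subseteq> closure (\<Inter>F)"
  proof (rule Baire)
    show "closed (UNIV :: ((real^'n) \<times> (real^'n)) set)" by simp
    show "countable F" unfolding F_def I_def by (intro countable_image countableI_type)
    fix Tt assume "Tt \<in> F"
    then obtain q j where qj: "0 \<le> real_of_rat q" "real_of_rat q \<le> t" and Tt: "Tt = - closure (bad_set (real_of_rat q) (1 / (real j + 1)))"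
      unfolding F_def I_def by auto
    have "interior (closure (bad_set (real_of_rat q) (1 / (real j + 1)))) = {}"
    proof (rule ccontr)
      assume ne: "interior (closure (bad_set (real_of_rat q) (1 / (real j + 1)))) \<noteq> {}"
      have "1 / (real j + 1) > 0" by simp
      from bad_set_nowhere_dense[OF qj this open_interior ne]
      obtain Y' where Y': "open Y'" "Y' \<noteq> {}" "Y' \<subseteq> closure (bad_set (real_of_rat q) (1 / (real j + 1)))" "Y' \<inter> bad_set (real_of_rat q) (1 / (real j + 1)) = {}"
        using interior_subset by blast
      then show False using open_Int_closure_eq_empty[OF Y'(1)] by blast
    qed
    then show "openin (top_of_set UNIV) Tt \<and> UNIV \<subseteq> closure Tt"
      unfolding Tt by (simp add: closure_complement open_Compl)
  qed
  moreover obtain y0 where "y0 \<in> D" using assms by blast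
  ultimately have "y0 \<in> closure (\<Inter>F)" by blast
  then obtain y where y: "y \<in> D" "y \<in> \<Inter>F"
    using open_Int_closure_eq_empty[OF D, of "\<Inter>F"] \<open>y0 \<in> D\<close> by blast
  obtain q :: rat and j :: nat where "0 \<le> real_of_rat q" "real_of_rat q \<le> t" "y \<in> bad_set (real_of_rat q) (1 / (real j + 1))"
    using bad_set_cover[OF y(1)] none y(1) by blast
  moreover from this have "- closure (bad_set (real_of_rat q) (1 / (real j + 1))) \<in> F" unfolding F_def I_def by force
  ultimately show False using y(2) closure_subset by blast
qed

text \<open>The quadratic estimate at every \<open>y'\<close> near \<open>y\<close> makes the action
  \<open>S\<close> differentiable with differential \<open>p_t dq_t - p_0 dq_0\<close>. This
  differential is differentiable at \<open>y\<close> because \<open>f\<close> is twice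
  differentiable, and symmetry of the second derivative of \<open>S\<close> is exactly preservation
  of \<open>omega0\<close>.\<close>

lemma hybrid_flow_symplectic:
  assumes y: "y \<in> D" and ng: "NG y t" and c': "c' \<in> A" and f: "Ck_on 2 D f"
    and F: "\<And>y'. y' \<in> D \<Longrightarrow> hybrid_flow (hamiltonian_impact_system A g V h) t (tr y' 0) \<in> cdom c'"
      "\<And>y'. y' \<in> D \<Longrightarrow> f y' = \<kappa> c' (hybrid_flow (hamiltonian_impact_system A g V h) t (tr y' 0))"
  shows "omega0 (frechet_derivative f (at y) u) (frechet_derivative f (at y) v) = omega0 u v"
proof -
  have t: "t \<in> {0..t}" using trajD(1)[OF tr(1)[OF y]] by simp
  have h0: "h (fst (tr y 0)) \<noteq> 0" using hD[OF y] guard_in_chart(2)[OF c0 tr(2)[OF y]] tr(3)[OF y] by simp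
  obtain c where c: "c \<in> A" "good_in c0 c t (tr y) t"
    using good_nongrazing[OF c0 tr(1)[OF y] tr(2)[OF y] h0 t] ng unfolding NG_def by blast
  obtain e1 where e1: "e1 > 0" "ball y e1 \<subseteq> D" and uq: "\<forall>y'\<in>ball y e1. \<forall>\<gamma>. traj t \<gamma> \<longrightarrow> \<gamma> 0 = tr y' 0 \<longrightarrow> \<gamma> t = tr y' t"
    using stable[OF y t ng] by - (elim exE conjE, rule that)
  have flow: "hybrid_flow (hamiltonian_impact_system A g V h) t (tr y' 0) = tr y' t" if y': "y' \<in> ball y e1" for y'
    unfolding hybrid_flow_def
  proof (rule the_equality)
    have "y' \<in> D" using y' e1(2) by blast
    then show "\<exists>\<gamma>. traj t \<gamma> \<and> \<gamma> 0 = tr y' 0 \<and> \<gamma> t = tr y' t" using tr(1) by blast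
    show "z = tr y' t" if "\<exists>\<gamma>. traj t \<gamma> \<and> \<gamma> 0 = tr y' 0 \<and> \<gamma> t = z" for z
      using that uq y' by blast
  qed
  have fe: "tr y' t \<in> cdom c'" "f y' = \<kappa> c' (tr y' t)" if y': "y' \<in> ball y e1" for y'
  proof -
    have "y' \<in> D" using y' e1(2) by blast
    then show "tr y' t \<in> cdom c'" "f y' = \<kappa> c' (tr y' t)" using F[of y'] flow[OF y'] by simp_all
  qed
  have "y \<in> ball y e1" using e1 by simp
  from good_in_chart_change[OF c(1) c' tr(1)[OF y] tr(2)[OF y] c(2) fe(1)[OF this]]
  have G: "good_in c0 c' t (tr y) t" .
  obtain d C N where d: "d > 0" and good: "\<forall>\<gamma> \<gamma>'. starts_near c0 t (tr y) d \<gamma> \<longrightarrow> starts_near c0 t (tr y) d \<gamma>' \<longrightarrow>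
     \<gamma> t \<in> cdom c' \<and> \<gamma> t \<notin> Guard \<and> (\<forall>r\<in>{0..t}. \<gamma> r \<notin> Graze) \<and> card {r\<in>{0..t}. \<gamma> r \<in> Guard} = N \<and> est c0 c' C t \<gamma> \<gamma>'"
    using G unfolding good_in_def by blast
  define e where "e = min d e1"
  have e: "e > 0" "ball y e \<subseteq> D" "\<And>y'. y' \<in> ball y e \<Longrightarrow> y' \<in> ball y e1" using d e1 by (auto simp: e_def)
  have sn: "starts_near c0 t (tr y) d (tr y')" if y': "y' \<in> ball y e" for y'
  proof -
    have "y' \<in> D" using e(2) y' by blast
    then show ?thesis using tr(1,2)[of y'] tr(3)[of y'] tr(3)[OF y] y' by (simp add: starts_near_def e_def)
  qed
  define S where "S y' = integral {0..t} (\<lambda>s. Lag (tr y' s))" for y'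
  have est: "\<bar>S y'' - S y' - snd (f y') \<bullet> (fst (f y'') - fst (f y')) + snd y' \<bullet> (fst y'' - fst y')\<bar> \<le> C * (norm (y'' - y'))\<^sup>2"
    if y': "y' \<in> ball y e" and y'': "y'' \<in> ball y e" for y' y''
  proof -
    have D': "y' \<in> D" "y'' \<in> D" using e(2) y' y'' by auto
    have "est c0 c' C t (tr y') (tr y'')" using good sn[OF y'] sn[OF y''] by blast
    note E = this[unfolded est_def tr(3)[OF D'(1)] tr(3)[OF D'(2)] fe(2)[OF e(3)[OF y'], symmetric] fe(2)[OF e(3)[OF y''], symmetric]]
    show ?thesis unfolding S_def by (rule conjunct2[OF conjunct2[OF E]])
  qed
  let ?f' = "\<lambda>y. frechet_derivative f (at y)"
  have f2: "Ck_on (Suc (Suc 0)) D f" using f by (simp only: numeral_2_eq_2)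
  note d1 = Ck_on_SucD(1)[OF f2]
  have dS: "(S has_derivative (\<lambda>u. snd (f y') \<bullet> fst (?f' y' u) - snd y' \<bullet> fst u)) (at y')" if y': "y' \<in> ball y e" for y'
  proof -
    have D': "y' \<in> D" using e(2) y' by blast
    \<comment> \<open>\<Phi> has the claimed derivative at \<open>y'\<close>, with the momenta
      frozen there; the estimate says that the increment of \<open>S - \<Phi>\<close> from
      \<open>y'\<close> is quadratically small.\<close>
    define \<Phi> where "\<Phi> x = snd (f y') \<bullet> fst (f x) - snd y' \<bullet> fst x" for x
    have d\<Phi>: "(\<Phi> has_derivative (\<lambda>u. snd (f y') \<bullet> fst (?f' y' u) - snd y' \<bullet> fst u)) (at y')"
      unfolding \<Phi>_def[abs_def]
      by (intro has_derivative_diff has_derivative_inner_right has_derivative_fst d1[OF D'] has_derivative_ident)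
    have "((\<lambda>x. S x - \<Phi> x) has_derivative (\<lambda>_. 0)) (at y')"
      unfolding has_derivative_at_alt
    proof (intro conjI allI impI)
      fix \<epsilon> :: real assume ep: "\<epsilon> > 0"
      obtain r where r: "r > 0" "ball y' r \<subseteq> ball y e" using y' openE[OF open_ball] by blast
      define r' where "r' = min r (\<epsilon> / (\<bar>C\<bar> + 1))"
      have r': "r' > 0" using r ep by (simp add: r'_def)
      show "\<exists>d>0. \<forall>x. norm (x - y') < d \<longrightarrow> norm ((S x - \<Phi> x) - (S y' - \<Phi> y') - 0) \<le> \<epsilon> * norm (x - y')"
      proof (rule exI[of _ r'], rule conjI[OF r'], intro allI impI)
        fix x assume x: "norm (x - y') < r'"
        then have "x \<in> ball y' r" by (simp add: r'_def dist_norm norm_minus_commute)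
        then have xb: "x \<in> ball y e" using r(2) by blast
        have "\<bar>(S x - \<Phi> x) - (S y' - \<Phi> y')\<bar> \<le> C * (norm (x - y'))\<^sup>2"
          using est[OF y' xb] unfolding \<Phi>_def by (simp add: inner_diff_right algebra_simps)
        also have "\<dots> \<le> (\<bar>C\<bar> + 1) * (norm (x - y'))\<^sup>2" by (intro mult_right_mono) auto
        also have "\<dots> = ((\<bar>C\<bar> + 1) * norm (x - y')) * norm (x - y')" by (simp add: power2_eq_square)
        also have "\<dots> \<le> \<epsilon> * norm (x - y')"
        proof (rule mult_right_mono)
          have "norm (x - y') \<le> \<epsilon> / (\<bar>C\<bar> + 1)" using x by (simp add: r'_def)
          then show "(\<bar>C\<bar> + 1) * norm (x - y') \<le> \<epsilon>" by (simp add: field_simps)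
        qed simp
        finally show "norm ((S x - \<Phi> x) - (S y' - \<Phi> y') - 0) \<le> \<epsilon> * norm (x - y')" by simp
      qed
    qed simp
    from has_derivative_add[OF this d\<Phi>] show ?thesis by simp
  qed
  define H where "H u v = frechet_derivative (\<lambda>y. ?f' y u) (at y) v" for u v
  have dH: "((\<lambda>y. ?f' y u) has_derivative H u) (at y)" for u
    unfolding H_def using Ck_on_SucD(1)[OF Ck_on_SucD(2)[OF f2] y] .
  have Hs: "H u v = H v u" for u v unfolding H_def by (rule smooth_on_symmetric[OF D y f])
  have dd: "((\<lambda>y'. snd (f y') \<bullet> fst (?f' y' u) - snd y' \<bullet> fst u) has_derivative
      (\<lambda>v. (snd (f y) \<bullet> fst (H u v) + snd (?f' y v) \<bullet> fst (?f' y u)) - snd v \<bullet> fst u)) (at y)" for u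
    by (intro has_derivative_diff has_derivative_inner has_derivative_inner_left has_derivative_snd has_derivative_fst d1[OF y] dH has_derivative_ident)
  have yb: "y \<in> ball y e" using e(1) by simp
  \<comment> \<open>The terms with second derivatives of \<open>f\<close> agree by
    \<open>Hs\<close>; what remains is the equality of the two values of
    \<open>omega0\<close>.\<close>
  have "(snd (f y) \<bullet> fst (H u v) + snd (?f' y v) \<bullet> fst (?f' y u)) - snd v \<bullet> fst u
      = (snd (f y) \<bullet> fst (H v u) + snd (?f' y u) \<bullet> fst (?f' y v)) - snd u \<bullet> fst v"
    by (rule symmetric_second_derivative[OF open_ball yb dS dd])
  then show ?thesis unfolding omega0_def using Hs[of u v] by (simp add: inner_commute)
qed

lemma symplectic_somewhere:
  assumes "D \<noteq> {}" and c': "c' \<in> A" and f: "Ck_on 2 D f"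
    and F: "\<And>y'. y' \<in> D \<Longrightarrow> hybrid_flow (hamiltonian_impact_system A g V h) t (tr y' 0) \<in> cdom c'"
      "\<And>y'. y' \<in> D \<Longrightarrow> f y' = \<kappa> c' (hybrid_flow (hamiltonian_impact_system A g V h) t (tr y' 0))"
  shows "\<exists>y\<in>D. \<forall>u v. omega0 (frechet_derivative f (at y) u) (frechet_derivative f (at y) v) = omega0 u v"
  using nongrazing_dense[OF assms(1)] hybrid_flow_symplectic[OF _ _ c' f F] by blast

end

end

section \<open>Invariance of the symplectic form and of its powers\<close>

context impact_system
begin

text \<open>If \<open>h\<close> vanished on an open set, so would \<open>dh\<close>, which is
  nonzero on the level set.\<close>

lemma hE_nonzero_nearby:
  assumes c: "c \<in> A" and Y: "open Y" "Y \<subseteq> \<Omega> c" "Y \<noteq> {}"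
  shows "\<exists>y\<in>Y. hE c y \<noteq> 0"
proof (rule ccontr)
  assume none: "\<not> ?thesis"
  obtain y where y: "y \<in> Y" using Y(3) by blast
  have y\<Omega>: "y \<in> \<Omega> c" using y Y(2) by blast
  have z: "hE c x = 0" if "x \<in> Y" for x using none that by blast
  have "(hE c has_derivative (\<lambda>_. 0)) (at y)"
    by (rule has_derivative_transform_within_open[OF has_derivative_const[of 0] Y(1) y]) (simp add: z)
  from frechet_derivative_eqI[OF this]
  have "frechet_derivative (hE c) (at y) (dvec c h (fst y), 0) = 0" by simp
  then show False using hE_derivative[OF c y\<Omega>] nE_pos(2)[OF c y\<Omega> z[OF y]] by simp
qed

text \<open>A failure at \<open>x\<close> for some \<open>u\<close> and \<open>v\<close> would
  persist on a neighbourhood, since the derivative of the flow is continuous. Removing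
  \<open>h = 0\<close> leaves a nonempty open set of failures, against
  \<open>symplectic_somewhere\<close>.\<close>

lemma hybrid_flow_derivative_symplectic:
  assumes sm: "flow_smooth_near (hamiltonian_impact_system A g V h) t x"
  obtains c c' U f where "c \<in> A" "c' \<in> A" "openin (atlas_topology \<B>) U" "x \<in> U" "U \<subseteq> cdom c"
    "hybrid_flow (hamiltonian_impact_system A g V h) t ` U \<subseteq> cdom c'"
    "(\<kappa> c' \<circ> hybrid_flow (hamiltonian_impact_system A g V h) t \<circ> chart_inv (cotangent_chart A c) has_derivative f) (at (\<kappa> c x))"
    "\<And>u v. omega0 (f u) (f v) = omega0 u v"
proof -
  let ?H = "hamiltonian_impact_system A g V h"
  let ?F = "hybrid_flow ?H t"
  have st: "state_atlas ?H = \<B>" by (simp add: hamiltonian_impact_system_def)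
  obtain W where W: "openin (atlas_topology \<B>) W" "x \<in> W" "\<forall>y\<in>W. flow_defined ?H t y" "smooth_map_on \<B> \<B> W ?F"
    using sm unfolding flow_smooth_near_def st by blast
  obtain C C' U where C: "C \<in> \<B>" "C' \<in> \<B>" and U: "openin (atlas_topology \<B>) U" "x \<in> U" "U \<subseteq> W \<inter> fst C" "?F ` U \<subseteq> fst C'"
    and s: "smooth_on (snd C ` U) (snd C' \<circ> ?F \<circ> chart_inv C)"
    using W(2,4) unfolding smooth_map_on_def by blast
  obtain c c' where c: "c \<in> A" "c' \<in> A" and CC: "C = cotangent_chart A c" "C' = cotangent_chart A c'"
    using C by (auto simp: cotangent_atlas_def)
  define f where "f = \<kappa> c' \<circ> ?F \<circ> chart_inv (cotangent_chart A c)"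
  define Y where "Y = \<kappa> c ` U"
  have Uc: "U \<subseteq> cdom c" "U \<subseteq> W" "?F ` U \<subseteq> cdom c'" using U(3,4) CC by auto
  have "cdom c \<inter> U = U" using Uc by blast
  then have oY: "open Y" unfolding Y_def using open_chart_image_of_openin[OF smooth_B U(1) chart_in_B[OF c(1)]] by simp
  have xY: "\<kappa> c x \<in> Y" using U(2) by (simp add: Y_def)
  have Y\<Omega>: "Y \<subseteq> \<Omega> c" unfolding Y_def using \<kappa>_in_\<Omega>[OF c(1)] Uc(1) by blast
  have sf: "smooth_on Y f" using s unfolding CC f_def Y_def .
  let ?f' = "\<lambda>y. frechet_derivative f (at y)"
  have inv: "chart_inv (cotangent_chart A c) y \<in> U \<and> \<kappa> c (chart_inv (cotangent_chart A c) y) = y" if y: "y \<in> Y" for y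
  proof -
    obtain z where z: "z \<in> U" "y = \<kappa> c z" using y unfolding Y_def by blast
    then have "chart_inv (cotangent_chart A c) y = z" using chart_inv_left[OF smooth_B chart_in_B[OF c(1)], of z] Uc(1) by blast
    then show ?thesis using z by simp
  qed
  have sympl: "omega0 (?f' (\<kappa> c x) u) (?f' (\<kappa> c x) v) = omega0 u v" for u v
  proof (rule ccontr)
    assume ne: "\<not> ?thesis"
    define \<phi> where "\<phi> y = omega0 (?f' y u) (?f' y v)" for y
    have cf: "continuous_on Y (\<lambda>y. ?f' y w)" for w
      using Ck_on_continuous[OF smooth_on_Ck[OF smooth_on_deriv[OF sf], of 0]] .
    have "continuous_on Y \<phi>" unfolding \<phi>_def omega0_def by (intro continuous_intros cf)
    then have oY1: "open (Y \<inter> \<phi> -` (- {omega0 u v}))" by (rule continuous_open_preimage[OF _ oY]) auto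
    define Y1 where "Y1 = Y \<inter> \<phi> -` (- {omega0 u v})"
    have "\<kappa> c x \<in> Y1" using xY ne by (simp add: Y1_def \<phi>_def)
    moreover have o1: "open Y1" using oY1 by (simp add: Y1_def)
    moreover have Y1\<Omega>: "Y1 \<subseteq> \<Omega> c" using Y\<Omega> by (auto simp: Y1_def)
    ultimately obtain y1 where y1: "y1 \<in> Y1" "hE c y1 \<noteq> 0" using hE_nonzero_nearby[OF c(1), of Y1] by blast
    define D where "D = Y1 \<inter> (\<Omega> c \<inter> hE c -` (- {0}))"
    have oD: "open D" unfolding D_def
      by (intro open_Int o1 continuous_open_preimage[OF Ck_on_continuous[OF Ck_hE[OF c(1)]] open_\<Omega>[OF c(1)]]) auto
    have "y1 \<in> D" using y1 Y1\<Omega> by (auto simp: D_def)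
    then have Dne: "D \<noteq> {}" by blast
    have DY: "D \<subseteq> Y" unfolding D_def Y1_def by blast
    have "\<exists>\<gamma>. traj t \<gamma> \<and> \<gamma> 0 = chart_inv (cotangent_chart A c) y" if y: "y \<in> D" for y
    proof -
      have "y \<in> Y" using y DY by blast
      then have "flow_defined ?H t (chart_inv (cotangent_chart A c) y)" using W(3) inv Uc(2) by blast
      then show ?thesis unfolding flow_defined_def .
    qed
    then obtain tr where tr: "\<And>y. y \<in> D \<Longrightarrow> traj t (tr y) \<and> tr y 0 = chart_inv (cotangent_chart A c) y" by metis
    have "\<exists>y\<in>D. \<forall>u v. omega0 (?f' y u) (?f' y v) = omega0 u v"
    proof (rule symplectic_somewhere[OF c(1) oD, where tr = tr and t = t and c' = c'])
      fix y assume y: "y \<in> D"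
      then have yY: "y \<in> Y" using DY by blast
      note i = inv[OF yY]
      have t0: "tr y 0 = chart_inv (cotangent_chart A c) y" using tr[OF y] by blast
      show "traj t (tr y)" using tr[OF y] by blast
      show "tr y 0 \<in> cdom c" "\<kappa> c (tr y 0) = y" unfolding t0 using i Uc(1) by auto
      show "hE c y \<noteq> 0" using y by (simp add: D_def)
      show "?F (tr y 0) \<in> cdom c'" unfolding t0 using i Uc(3) by blast
      show "f y = \<kappa> c' (?F (tr y 0))" unfolding t0 f_def by simp
    next
      show "Ck_on 2 D f" by (rule Ck_on_subset[OF smooth_on_Ck[OF sf] DY])
    qed (use Dne c(2) in auto)
    then obtain y where y: "y \<in> D" "omega0 (?f' y u) (?f' y v) = omega0 u v" by blast
    then have "y \<in> Y1" by (simp add: D_def)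
    then show False using y(2) by (simp add: Y1_def \<phi>_def)
  qed
  show ?thesis
    by (rule that[OF c U(1,2) Uc(1,3) smooth_on_has_derivative[OF sf xY, unfolded f_def] sympl[unfolded f_def]])
qed

text \<open>Preservation of \<open>omega0\<close> by the derivative gives equality of the two-forms
  on every reindexed sequence of arguments, and \<open>wedge_power_cong\<close> lifts this to the
  powers.\<close>

lemma hybrid_invariant_symplectic_power:
  "hybrid_invariant (hamiltonian_impact_system A g V h) (\<lambda>z. wedge_power 2 (symplectic_form A z) m)"
  unfolding hybrid_invariant_def
proof (intro allI impI ballI)
  let ?H = "hamiltonian_impact_system A g V h"
  let ?F = "hybrid_flow ?H"
  have st: "state_atlas ?H = \<B>" by (simp add: hamiltonian_impact_system_def)
  fix t x and v :: "nat \<Rightarrow> _"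
  assume x: "x \<notin> guard ?H \<and> flow_smooth_near ?H t x \<and> ?F t x \<notin> guard ?H" and v: "\<forall>i. v i \<in> tangent_space (state_atlas ?H) x"
  from x have "flow_smooth_near ?H t x" by blast
  then obtain c c' U f where c: "c \<in> A" "c' \<in> A" and U: "openin (atlas_topology \<B>) U" "x \<in> U" "U \<subseteq> cdom c"
    and F: "?F t ` U \<subseteq> cdom c'" and f: "(\<kappa> c' \<circ> ?F t \<circ> chart_inv (cotangent_chart A c) has_derivative f) (at (\<kappa> c x))"
    and sy: "\<And>u v. omega0 (f u) (f v) = omega0 u v"
    using hybrid_flow_derivative_symplectic[of t x] by blast
  let ?C = "cotangent_chart A c" and ?C' = "cotangent_chart A c'"
  have vT: "v i \<in> tangent_space \<B> x" for i using v st by simp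
  have xc: "x \<in> cdom c" and Fx: "?F t x \<in> cdom c'" using U F by auto
  note C = chart_in_B[OF c(1)] and C' = chart_in_B[OF c(2)]
  have tm: "tangent_map \<B> \<B> (?F t) x (v i) = coord_vec \<B> ?C' (?F t x) (f (v i ?C))" for i
    by (rule tangent_map_in_chart[OF smooth_B smooth_B C C' U F f vT])
  have "symplectic_form A (?F t x) (\<lambda>i. tangent_map \<B> \<B> (?F t) x (v (p i))) = symplectic_form A x (\<lambda>i. v (p i))" for p :: "nat \<Rightarrow> nat"
    unfolding tm
    using symplectic_form_in_chart[OF A C' Fx, of "\<lambda>i. coord_vec \<B> ?C' (?F t x) (f (v (p i) ?C))"]
      symplectic_form_in_chart[OF A C xc, of "\<lambda>i. v (p i)"]
      coord_vec_in_tangent_space[OF smooth_B C' Fx] coord_vec_component[OF smooth_B C' Fx] vT sy by simp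
  then show "pullback (state_atlas ?H) (state_atlas ?H) (?F t) (\<lambda>z. wedge_power 2 (symplectic_form A z) m) x v
      = wedge_power 2 (symplectic_form A x) m v"
    unfolding pullback_def st by (rule wedge_power_cong[where v = "\<lambda>i. tangent_map \<B> \<B> (?F t) x (v i)" and v' = v])
qed

end

theorem proposition3:
  fixes A :: "('q, real^'n) atlas"
    and g :: "('q, real^'n) metric"
    and V h :: "'q \<Rightarrow> real"
  assumes "smooth_manifold A"
    and "riemannian_metric A g"
    and "smooth_fun A V"
    and "smooth_fun A h"
    and "\<And>q. q \<in> points A \<Longrightarrow> h q = 0 \<Longrightarrow> differential A h q \<noteq> (\<lambda>_. 0)"
  shows "(\<lambda>x. wedge_power 2 (symplectic_form A x) CARD('n))
           \<in> hybrid_invariant_forms (hamiltonian_impact_system A g V h) (2 * CARD('n))"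
proof -
  have A: "smooth_atlas A" and hd: "Hausdorff_space (atlas_topology A)"
    using assms(1) by (auto simp: smooth_manifold_def)
  interpret impact_system A g V h
    by unfold_locales (use A hd assms(2-5) in auto)
  have "state_atlas (hamiltonian_impact_system A g V h) = cotangent_atlas A"
    by (simp add: hamiltonian_impact_system_def)
  then show ?thesis
    using differential_form_symplectic_power[OF A] hybrid_invariant_symplectic_power
    by (simp add: hybrid_invariant_forms_def)
qed

end
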